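(* Let $\mathbb{K}$ be a commutative ring, let $A = \bigoplus_{i \leq 0} A^i$ be a nonpositive central DG $\mathbb{K}$-ring (possibly noncommutative), let $\bar{A} := \operatorname{H}^0(A)$, and let $i_0$ and $j_0$ be integers. Then for all $M \in \mathsf{D}^{\leq i_0}(A^{\mathrm{op}})$ and $N \in \mathsf{D}^{\leq j_0}(A)$ there is a unique isomorphism of $\mathbb{K}$-modules $$\theta^{\mathrm{der}}_{M,N} : \operatorname{H}^{i_0}(M) \otimes_{\bar{A}} \operatorname{H}^{j_0}(N) \xrightarrow{\ \simeq\ } \operatorname{H}^{i_0+j_0}(M \otimes^{\mathrm{L}}_A N)$$ with the following two properties (that is, there is a unique collection of isomorphisms $\theta^{\mathrm{der}}_{M,N}$, indexed by all such pairs $(M,N)$, with these properties): (i) $\theta^{\mathrm{der}}_{M,N}$ is functorial in $M$ and $N$, with respect to morphisms in $\mathsf{D}^{\leq i_0}(A^{\mathrm{op}})$ and in $\mathsf{D}^{\leq j_0}(A)$. (ii) If $M \in \mathsf{C}^{\leq i_0}(A^{\mathrm{op}})$ and $N \in \mathsf{C}^{\leq j_0}(A)$, then $$\operatorname{H}^{i_0+j_0}(\eta^{\mathrm{L}}_{M,N}) \circ \theta^{\mathrm{der}}_{M,N} = \theta_{M,N}$$ as homomorphisms $\operatorname{H}^{i_0}(M) \otimes_{\bar{A}} \operatorname{H}^{j_0}(N) \to \operatorname{H}^{i_0+j_0}(M \otimes_A N)$, where $\theta_{M,N} : \operatorname{H}^{i_0}(M) \otimes_{\bar{A}} \operatorname{H}^{j_0}(N)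 \to \operatorname{H}^{i_0+j_0}(M \otimes_A N)$ is the unique $\mathbb{K}$-module isomorphism such that $\theta_{M,N}([m] \otimes [n]) = [m \otimes n]$ for all $m \in M^{i_0}$ and $n \in N^{j_0}$.
   Context: Gradings are by $\mathbb{Z}$ and cohomological (differentials have degree $+1$). A central DG $\mathbb{K}$-ring is a unital associative DG ring $A$ together with a ring homomorphism from $\mathbb{K}$ to the degree $0$ part of the center of $A$, with image consisting of cocycles; so $A$ is a DG $\mathbb{K}$-algebra in the traditional sense, and it need not be commutative. It is nonpositive if $A^i = 0$ for all $i > 0$. The ring $\bar{A} = \operatorname{H}^0(A)$ is a central $\mathbb{K}$-ring, and there is a canonical DG $\mathbb{K}$-ring homomorphism $A \to \bar{A}$. The cohomologies $\operatorname{H}^i$ of a left (resp. right) DG $A$-module are left (resp. right) $\bar{A}$-modules. $\mathsf{C}(A)$ is the DG category of left DG $A$-modules; right DG $A$-modules are treated as left DG modules over the opposite DG ring $A^{\mathrm{op}}$. For an integer $k$, $\mathsf{C}^{\leq k}(A)$ denotes the DG $A$-modules $N$ concentrated in degrees $\leq k$, i.e. $N = \bigoplus_{i \leq k} N^i$. The derived category of (unbounded) DG $A$-modules is $\mathsf{D}(A)$; it has the same objects as $\mathsf{C}(A)$ and is obtained by inverting quasi-isomorphisms. $\mathsf{D}^{\leq k}(A)$ is the full subcategory of $\mathsf{D}(A)$ on the DG modules $N$ whose cohomology is concentrated in degrees $\leq k$, i.e. $\operatorname{H}^i(N) = 0$ for $i > k$. Similarly for $A^{\mathrm{op}}$ and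 $\mathbb{K}$. The tensor product $M \otimes_A N$ is the DG $\mathbb{K}$-module which is the quotient of $M \otimes_{\mathbb{K}} N$ by the relations $(m \cdot a) \otimes n = m \otimes (a \cdot n)$, with differential $\mathrm{d}(m \otimes n) = \mathrm{d}(m) \otimes n + (-1)^{i}\, m \otimes \mathrm{d}(n)$ for $m \in M^i$. The derived tensor product $(- \otimes^{\mathrm{L}}_A -) : \mathsf{D}(A^{\mathrm{op}}) \times \mathsf{D}(A) \to \mathsf{D}(\mathbb{K})$ is its left derived bifunctor, and $\eta^{\mathrm{L}}_{M,N} : M \otimes^{\mathrm{L}}_A N \to M \otimes_A N$ is the canonical morphism in $\mathsf{D}(\mathbb{K})$ that is part of the left derived functor (functorial with respect to strict homomorphisms in $M$ and $N$, i.e. degree $0$ homomorphisms commuting with the differentials). Concretely, if $\rho : P \to M$ is a K-flat (e.g. semi-free) resolution over $A^{\mathrm{op}}$, then $M \otimes^{\mathrm{L}}_A N \cong P \otimes_A N$ and $\eta^{\mathrm{L}}_{M,N}$ corresponds to $\rho \otimes \operatorname{id}_N : P \otimes_A N \to M \otimes_A N$. If $M \in \mathsf{D}^{\leq i_0}(A^{\mathrm{op}})$ and $N \in \mathsf{D}^{\leq j_0}(A)$ then $M \otimes^{\mathrm{L}}_A N \in \mathsf{D}^{\leq i_0+j_0}(\mathbb{K})$. For $N \in \mathsf{C}^{\leq j_0}(A)$ all elements $n \in N^{j_0}$ are cocycles, and $[n]$ denotes the cohomology class of $n$ in $\operatorname{H}^{j_0}(N)$; similarly for $m \in M^{i_0}$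 with $M \in \mathsf{C}^{\leq i_0}(A^{\mathrm{op}})$, and for elements of degree $i_0+j_0$ of $M \otimes_A N$, which is then concentrated in degrees $\leq i_0 + j_0$. The isomorphism $\theta_{M,N}$ in (ii) is known to exist and to be unique. *)

theory Defs
  imports "HOL-Algebra.Free_Abelian_Groups" "HOL-Algebra.Generated_Groups" "HOL-Algebra.Module"
begin

section \<open>Cochain complexes and their cohomology\<close>

text \<open>
  Graded objects are families indexed by the integers. The homogeneous components are abelian
  groups in the sense of \<^const>\<open>comm_group\<close>, hence written multiplicatively (as in HOL-Homology):
  the operation \<open>mult\<close> of a component is addition, and its \<open>one\<close> is zero.
\<close>

record 'u cochain =
  gr :: "int \<Rightarrow> 'u monoid"
  df :: "int \<Rightarrow> 'u \<Rightarrow> 'u"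

locale cochain_complex =
  fixes M :: "('u, 'z) cochain_scheme"
  assumes gr_comm_group: "comm_group (gr M i)"
    and df_hom: "df M i \<in> hom (gr M i) (gr M (i + 1))"
    and df_df: "x \<in> carrier (gr M i) \<Longrightarrow> df M (i + 1) (df M i x) = \<one>\<^bsub>gr M (i + 1 + 1)\<^esub>"

definition cocycles :: "('u, 'z) cochain_scheme \<Rightarrow> int \<Rightarrow> 'u monoid"
  where "cocycles M i = (gr M i)\<lparr>carrier := kernel (gr M i) (gr M (i + 1)) (df M i)\<rparr>"

definition coboundaries :: "('u, 'z) cochain_scheme \<Rightarrow> int \<Rightarrow> 'u set"
  where "coboundaries M i = df M (i - 1) ` carrier (gr M (i - 1))"

definition coh :: "('u, 'z) cochain_scheme \<Rightarrow> int \<Rightarrow> 'u set monoid"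
  where "coh M i = cocycles M i Mod coboundaries M i"

definition coh_class :: "('u, 'z) cochain_scheme \<Rightarrow> int \<Rightarrow> 'u \<Rightarrow> 'u set"
  where "coh_class M i m = coboundaries M i #>\<^bsub>cocycles M i\<^esub> m"

text \<open>Here and below, maps on cosets are computed on an arbitrarily chosen representative.\<close>

definition coh_map ::
    "('u, 'y) cochain_scheme \<Rightarrow> ('v, 'z) cochain_scheme \<Rightarrow> int \<Rightarrow> (int \<Rightarrow> 'u \<Rightarrow> 'v) \<Rightarrow> 'u set \<Rightarrow> 'v set"
  where "coh_map M N i f = (\<lambda>x\<in>carrier (coh M i). coh_class N i (f i (SOME m. m \<in> x)))"

definition concentrated_le :: "int \<Rightarrow> ('u, 'z) cochain_scheme \<Rightarrow> bool"
  where "concentrated_le k M \<longleftrightarrow> (\<forall>i>k. carrier (gr M i) = {\<one>\<^bsub>gr M i\<^esub>})"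

definition coh_concentrated_le :: "int \<Rightarrow> ('u, 'z) cochain_scheme \<Rightarrow> bool"
  where "coh_concentrated_le k M \<longleftrightarrow> (\<forall>i>k. carrier (coh M i) = {\<one>\<^bsub>coh M i\<^esub>})"

text \<open>\<open>koszul G n x\<close> is $(-1)^n x$ in the abelian group \<open>G\<close>.\<close>

definition koszul :: "'u monoid \<Rightarrow> int \<Rightarrow> 'u \<Rightarrow> 'u"
  where "koszul G n x = (if even n then x else inv\<^bsub>G\<^esub> x)"


section \<open>DG rings and DG modules\<close>

text \<open>\<open>rmul A i j\<close> is the multiplication of the components of degrees \<open>i\<close> and \<open>j\<close>.\<close>

record 'a dg_ring = "'a cochain" +
  rmul :: "int \<Rightarrow> int \<Rightarrow> 'a \<Rightarrow> 'a \<Rightarrow> 'a"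
  rone :: 'a

locale dg_ring = cochain_complex A for A :: "('a, 'z) dg_ring_scheme" +
  assumes rmul_closed:
      "\<lbrakk>a \<in> carrier (gr A i); b \<in> carrier (gr A j)\<rbrakk> \<Longrightarrow> rmul A i j a b \<in> carrier (gr A (i + j))"
    and rmul_add_left:
      "\<lbrakk>a \<in> carrier (gr A i); a' \<in> carrier (gr A i); b \<in> carrier (gr A j)\<rbrakk> \<Longrightarrow>
        rmul A i j (a \<otimes>\<^bsub>gr A i\<^esub> a') b = rmul A i j a b \<otimes>\<^bsub>gr A (i + j)\<^esub> rmul A i j a' b"
    and rmul_add_right:
      "\<lbrakk>a \<in> carrier (gr A i); b \<in> carrier (gr A j); b' \<in> carrier (gr A j)\<rbrakk> \<Longrightarrow>
        rmul A i j a (b \<otimes>\<^bsub>gr A j\<^esub> b') = rmul A i j a b \<otimes>\<^bsub>gr A (i + j)\<^esub> rmul A i j a b'"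
    and rmul_assoc:
      "\<lbrakk>a \<in> carrier (gr A i); b \<in> carrier (gr A j); c \<in> carrier (gr A k)\<rbrakk> \<Longrightarrow>
        rmul A (i + j) k (rmul A i j a b) c = rmul A i (j + k) a (rmul A j k b c)"
    and rone_closed: "rone A \<in> carrier (gr A 0)"
    and rone_left: "a \<in> carrier (gr A i) \<Longrightarrow> rmul A 0 i (rone A) a = a"
    and rone_right: "a \<in> carrier (gr A i) \<Longrightarrow> rmul A i 0 a (rone A) = a"
    and rmul_leibniz:
      "\<lbrakk>a \<in> carrier (gr A i); b \<in> carrier (gr A j)\<rbrakk> \<Longrightarrow>
        df A (i + j) (rmul A i j a b) =
          rmul A (i + 1) j (df A i a) b \<otimes>\<^bsub>gr A (i + j + 1)\<^esub>
          koszul (gr A (i + j + 1)) i (rmul A i (j + 1) a (df A j b))"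

definition op_dg_ring :: "'a dg_ring \<Rightarrow> 'a dg_ring"
  where "op_dg_ring A = A\<lparr>rmul := (\<lambda>i j a b. koszul (gr A (i + j)) (i * j) (rmul A j i b a))\<rparr>"

text \<open>A ring viewed as a DG ring concentrated in degree 0.\<close>

definition dg_of_ring :: "'k ring \<Rightarrow> 'k dg_ring"
  where "dg_of_ring K =
    \<lparr>gr = (\<lambda>i. if i = 0 then add_monoid K else (add_monoid K)\<lparr>carrier := {\<zero>\<^bsub>K\<^esub>}\<rparr>),
     df = (\<lambda>i x. \<zero>\<^bsub>K\<^esub>), rmul = (\<lambda>i j. monoid.mult K), rone = \<one>\<^bsub>K\<^esub>\<rparr>"

text \<open>\<open>s\<close> is the structural homomorphism of a central DG \<open>K\<close>-ring.\<close>

locale central_dg_ring = cring K + A: dg_ring A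
  for K :: "'k ring" (structure) and A :: "'a dg_ring" +
  fixes s :: "'k \<Rightarrow> 'a"
  assumes s_closed: "k \<in> carrier K \<Longrightarrow> s k \<in> carrier (gr A 0)"
    and s_add: "\<lbrakk>k \<in> carrier K; l \<in> carrier K\<rbrakk> \<Longrightarrow> s (k \<oplus> l) = s k \<otimes>\<^bsub>gr A 0\<^esub> s l"
    and s_mult: "\<lbrakk>k \<in> carrier K; l \<in> carrier K\<rbrakk> \<Longrightarrow> s (k \<otimes> l) = rmul A 0 0 (s k) (s l)"
    and s_one: "s \<one> = rone A"
    and s_central:
      "\<lbrakk>k \<in> carrier K; a \<in> carrier (gr A i)\<rbrakk> \<Longrightarrow> rmul A 0 i (s k) a = rmul A i 0 a (s k)"
    and s_cocycle: "k \<in> carrier K \<Longrightarrow> df A 0 (s k) = \<one>\<^bsub>gr A 1\<^esub>"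

record ('a, 'u) dg_module = "'u cochain" +
  act :: "int \<Rightarrow> int \<Rightarrow> 'a \<Rightarrow> 'u \<Rightarrow> 'u"

locale dg_module = cochain_complex M
  for A :: "'a dg_ring" and M :: "('a, 'u) dg_module" +
  assumes act_closed:
      "\<lbrakk>a \<in> carrier (gr A i); m \<in> carrier (gr M j)\<rbrakk> \<Longrightarrow> act M i j a m \<in> carrier (gr M (i + j))"
    and act_add_left:
      "\<lbrakk>a \<in> carrier (gr A i); a' \<in> carrier (gr A i); m \<in> carrier (gr M j)\<rbrakk> \<Longrightarrow>
        act M i j (a \<otimes>\<^bsub>gr A i\<^esub> a') m = act M i j a m \<otimes>\<^bsub>gr M (i + j)\<^esub> act M i j a' m"
    and act_add_right:
      "\<lbrakk>a \<in> carrier (gr A i); m \<in> carrier (gr M j); m' \<in> carrier (gr M j)\<rbrakk> \<Longrightarrow>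
        act M i j a (m \<otimes>\<^bsub>gr M j\<^esub> m') = act M i j a m \<otimes>\<^bsub>gr M (i + j)\<^esub> act M i j a m'"
    and act_assoc:
      "\<lbrakk>a \<in> carrier (gr A i); b \<in> carrier (gr A j); m \<in> carrier (gr M k)\<rbrakk> \<Longrightarrow>
        act M (i + j) k (rmul A i j a b) m = act M i (j + k) a (act M j k b m)"
    and act_one: "m \<in> carrier (gr M i) \<Longrightarrow> act M 0 i (rone A) m = m"
    and act_leibniz:
      "\<lbrakk>a \<in> carrier (gr A i); m \<in> carrier (gr M j)\<rbrakk> \<Longrightarrow>
        df M (i + j) (act M i j a m) =
          act M (i + 1) j (df A i a) m \<otimes>\<^bsub>gr M (i + j + 1)\<^esub>
          koszul (gr M (i + j + 1)) i (act M i (j + 1) a (df M j m))"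

text \<open>
  Right DG \<open>A\<close>-modules are left DG modules over \<open>op_dg_ring A\<close>; \<open>ract M i j m a\<close> is the product
  $m \cdot a$ for $m \in M^i$ and $a \in A^j$, which differs from $a \cdot m$ by the Koszul sign.
\<close>

definition ract :: "('a, 'u) dg_module \<Rightarrow> int \<Rightarrow> int \<Rightarrow> 'u \<Rightarrow> 'a \<Rightarrow> 'u"
  where "ract M i j m a = koszul (gr M (i + j)) (i * j) (act M j i a m)"

text \<open>Strict homomorphisms, normalised to be \<open>undefined\<close> outside the carriers.\<close>

definition strict_homs ::
    "'a dg_ring \<Rightarrow> ('a, 'u) dg_module \<Rightarrow> ('a, 'u) dg_module \<Rightarrow> (int \<Rightarrow> 'u \<Rightarrow> 'u) set"
  where "strict_homs A M N =
    {f. (\<forall>i. f i \<in> hom (gr M i) (gr N i) \<inter> extensional (carrier (gr M i))) \<and>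
        (\<forall>i. \<forall>m\<in>carrier (gr M i). f (i + 1) (df M i m) = df N i (f i m)) \<and>
        (\<forall>i j. \<forall>a\<in>carrier (gr A i). \<forall>m\<in>carrier (gr M j).
           f (i + j) (act M i j a m) = act N i j a (f j m))}"

definition quasi_isos ::
    "'a dg_ring \<Rightarrow> ('a, 'u) dg_module \<Rightarrow> ('a, 'u) dg_module \<Rightarrow> (int \<Rightarrow> 'u \<Rightarrow> 'u) set"
  where "quasi_isos A M N =
    {f \<in> strict_homs A M N. \<forall>i. bij_betw (coh_map M N i f) (carrier (coh M i)) (carrier (coh N i))}"


section \<open>Categories, localization and left derived functors\<close>

text \<open>\<open>Cmp C X Y Z g f\<close> is the composition of $f : X \to Y$ and $g : Y \to Z$.\<close>

record ('o, 'm) category =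
  Ob :: "'o set"
  Mor :: "'o \<Rightarrow> 'o \<Rightarrow> 'm set"
  Idt :: "'o \<Rightarrow> 'm"
  Cmp :: "'o \<Rightarrow> 'o \<Rightarrow> 'o \<Rightarrow> 'm \<Rightarrow> 'm \<Rightarrow> 'm"

definition prod_cat :: "('o, 'm) category \<Rightarrow> ('p, 'n) category \<Rightarrow> ('o \<times> 'p, 'm \<times> 'n) category"
  where "prod_cat C D =
    \<lparr>Ob = Ob C \<times> Ob D,
     Mor = (\<lambda>X Y. Mor C (fst X) (fst Y) \<times> Mor D (snd X) (snd Y)),
     Idt = (\<lambda>X. (Idt C (fst X), Idt D (snd X))),
     Cmp = (\<lambda>X Y Z g f. (Cmp C (fst X) (fst Y) (fst Z) (fst g) (fst f),
                         Cmp D (snd X) (snd Y) (snd Z) (snd g) (snd f)))\<rparr>"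

record ('o, 'm, 'p, 'n) functr =
  fob :: "'o \<Rightarrow> 'p"
  fmor :: "'o \<Rightarrow> 'o \<Rightarrow> 'm \<Rightarrow> 'n"

definition is_functor ::
    "('o, 'm) category \<Rightarrow> ('p, 'n) category \<Rightarrow> ('o, 'm, 'p, 'n) functr \<Rightarrow> bool"
  where "is_functor C D F \<longleftrightarrow>
    (\<forall>X\<in>Ob C. fob F X \<in> Ob D) \<and>
    (\<forall>X\<in>Ob C. \<forall>Y\<in>Ob C. \<forall>f\<in>Mor C X Y. fmor F X Y f \<in> Mor D (fob F X) (fob F Y)) \<and>
    (\<forall>X\<in>Ob C. fmor F X X (Idt C X) = Idt D (fob F X)) \<and>
    (\<forall>X\<in>Ob C. \<forall>Y\<in>Ob C. \<forall>Z\<in>Ob C. \<forall>f\<in>Mor C X Y. \<forall>g\<in>Mor C Y Z.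
       fmor F X Z (Cmp C X Y Z g f) =
         Cmp D (fob F X) (fob F Y) (fob F Z) (fmor F Y Z g) (fmor F X Y f))"

definition comp_functor ::
    "('p, 'n, 'q, 'l) functr \<Rightarrow> ('o, 'm, 'p, 'n) functr \<Rightarrow> ('o, 'm, 'q, 'l) functr"
  where "comp_functor G F =
    \<lparr>fob = (\<lambda>X. fob G (fob F X)), fmor = (\<lambda>X Y f. fmor G (fob F X) (fob F Y) (fmor F X Y f))\<rparr>"

definition prod_functor ::
    "('o, 'm, 'p, 'n) functr \<Rightarrow> ('o', 'm', 'p', 'n') functr \<Rightarrow>
     ('o \<times> 'o', 'm \<times> 'm', 'p \<times> 'p', 'n \<times> 'n') functr"
  where "prod_functor F G =
    \<lparr>fob = (\<lambda>X. (fob F (fst X), fob G (snd X))),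
     fmor = (\<lambda>X Y f. (fmor F (fst X) (fst Y) (fst f), fmor G (snd X) (snd Y) (snd f)))\<rparr>"

definition nat_trans ::
    "('o, 'm) category \<Rightarrow> ('p, 'n) category \<Rightarrow> ('o, 'm, 'p, 'n) functr \<Rightarrow>
     ('o, 'm, 'p, 'n) functr \<Rightarrow> ('o \<Rightarrow> 'n) set"
  where "nat_trans C D F G =
    {\<eta> \<in> \<Pi>\<^sub>E X\<in>Ob C. Mor D (fob F X) (fob G X).
       \<forall>X\<in>Ob C. \<forall>Y\<in>Ob C. \<forall>f\<in>Mor C X Y.
         Cmp D (fob F X) (fob F Y) (fob G Y) (\<eta> Y) (fmor F X Y f) =
         Cmp D (fob F X) (fob G X) (fob G Y) (fmor G X Y f) (\<eta> X)}"

text \<open>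
  The localization of a category at a class \<open>W\<close> of morphisms (\<open>W X Y\<close> is a set of morphisms
  $X \to Y$): morphisms are zigzags modulo the congruence generated by the relations of the
  category and by the invertibility of \<open>W\<close>. The step \<open>Fwd X Y f\<close> is $f : X \to Y$, and
  \<open>Bwd X Y w\<close> is the formal inverse $X \to Y$ of $w : Y \to X$. Steps are listed in the order of
  travel.
\<close>

datatype ('o, 'm) step = Fwd 'o 'o 'm | Bwd 'o 'o 'm

inductive zigzag ::
    "('o, 'm) category \<Rightarrow> ('o \<Rightarrow> 'o \<Rightarrow> 'm set) \<Rightarrow> 'o \<Rightarrow> ('o, 'm) step list \<Rightarrow> 'o \<Rightarrow> bool"
  for C W where
    zz_nil: "X \<in> Ob C \<Longrightarrow> zigzag C W X [] X"
  | zz_fwd: "\<lbrakk>X \<in> Ob C; Y \<in> Ob C; f \<in> Mor C X Y; zigzag C W Y p Z\<rbrakk> \<Longrightarrow>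
      zigzag C W X (Fwd X Y f # p) Z"
  | zz_bwd: "\<lbrakk>X \<in> Ob C; Y \<in> Ob C; w \<in> W Y X; zigzag C W Y p Z\<rbrakk> \<Longrightarrow>
      zigzag C W X (Bwd X Y w # p) Z"

inductive zz_eq ::
    "('o, 'm) category \<Rightarrow> ('o \<Rightarrow> 'o \<Rightarrow> 'm set) \<Rightarrow> 'o \<Rightarrow> 'o \<Rightarrow>
     ('o, 'm) step list \<Rightarrow> ('o, 'm) step list \<Rightarrow> bool"
  for C W where
    zz_refl: "zigzag C W X p Y \<Longrightarrow> zz_eq C W X Y p p"
  | zz_sym: "zz_eq C W X Y p q \<Longrightarrow> zz_eq C W X Y q p"
  | zz_trans: "\<lbrakk>zz_eq C W X Y p q; zz_eq C W X Y q r\<rbrakk> \<Longrightarrow> zz_eq C W X Y p r"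
  | zz_cong: "\<lbrakk>zigzag C W V p X; zz_eq C W X Y q q'; zigzag C W Y r Z\<rbrakk> \<Longrightarrow>
      zz_eq C W V Z (p @ q @ r) (p @ q' @ r)"
  | zz_idt: "X \<in> Ob C \<Longrightarrow> zz_eq C W X X [Fwd X X (Idt C X)] []"
  | zz_cmp: "\<lbrakk>X \<in> Ob C; Y \<in> Ob C; Z \<in> Ob C; f \<in> Mor C X Y; g \<in> Mor C Y Z\<rbrakk> \<Longrightarrow>
      zz_eq C W X Z [Fwd X Y f, Fwd Y Z g] [Fwd X Z (Cmp C X Y Z g f)]"
  | zz_inv: "\<lbrakk>X \<in> Ob C; Y \<in> Ob C; w \<in> W X Y\<rbrakk> \<Longrightarrow> zz_eq C W X X [Fwd X Y w, Bwd Y X w] []"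
  | zz_inv': "\<lbrakk>X \<in> Ob C; Y \<in> Ob C; w \<in> W X Y\<rbrakk> \<Longrightarrow> zz_eq C W Y Y [Bwd Y X w, Fwd X Y w] []"

definition zz_class ::
    "('o, 'm) category \<Rightarrow> ('o \<Rightarrow> 'o \<Rightarrow> 'm set) \<Rightarrow> 'o \<Rightarrow> 'o \<Rightarrow>
     ('o, 'm) step list \<Rightarrow> ('o, 'm) step list set"
  where "zz_class C W X Y p = {q. zz_eq C W X Y p q}"

definition localization ::
    "('o, 'm) category \<Rightarrow> ('o \<Rightarrow> 'o \<Rightarrow> 'm set) \<Rightarrow> ('o, ('o, 'm) step list set) category"
  where "localization C W =
    \<lparr>Ob = Ob C,
     Mor = (\<lambda>X Y. {zz_class C W X Y p | p. zigzag C W X p Y}),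
     Idt = (\<lambda>X. zz_class C W X X []),
     Cmp = (\<lambda>X Y Z \<psi> \<phi>. zz_class C W X Z ((SOME p. p \<in> \<phi>) @ (SOME q. q \<in> \<psi>)))\<rparr>"

definition loc_functor ::
    "('o, 'm) category \<Rightarrow> ('o \<Rightarrow> 'o \<Rightarrow> 'm set) \<Rightarrow> ('o, 'm, 'o, ('o, 'm) step list set) functr"
  where "loc_functor C W = \<lparr>fob = (\<lambda>X. X), fmor = (\<lambda>X Y f. zz_class C W X Y [Fwd X Y f])\<rparr>"

text \<open>
  The pair \<open>(L, \<eta>)\<close>, with $\eta : L \circ Q \to F$, is a left derived functor of
  $F : C \to E$ with respect to the localization functor $Q : C \to D$: every pair
  \<open>(G, \<theta>)\<close> with $\theta : G \circ Q \to F$ factors through \<open>(L, \<eta>)\<close> by a unique $\mu : G \to L$.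
\<close>

definition left_derived ::
    "('o, 'm) category \<Rightarrow> ('p, 'n) category \<Rightarrow> ('q, 'l) category \<Rightarrow>
     ('o, 'm, 'p, 'n) functr \<Rightarrow> ('o, 'm, 'q, 'l) functr \<Rightarrow>
     ('p, 'n, 'q, 'l) functr \<Rightarrow> ('o \<Rightarrow> 'l) \<Rightarrow> bool"
  where "left_derived C D E Q F L \<eta> \<longleftrightarrow>
    is_functor D E L \<and> \<eta> \<in> nat_trans C E (comp_functor L Q) F \<and>
    (\<forall>G \<theta>. is_functor D E G \<and> \<theta> \<in> nat_trans C E (comp_functor G Q) F \<longrightarrow>
      (\<exists>!\<mu>. \<mu> \<in> nat_trans D E G L \<and>
        (\<forall>X\<in>Ob C. \<theta> X =
          Cmp E (fob G (fob Q X)) (fob L (fob Q X)) (fob F X) (\<eta> X) (\<mu> (fob Q X)))))"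


section \<open>The derived category\<close>

text \<open>
  The type \<open>'u\<close> plays the role of a universe: the DG modules considered are those whose
  homogeneous components have carriers in \<open>'u\<close>. If \<open>'u\<close> is infinite and has room for \<open>K\<close> and \<open>A\<close>,
  it contains K-flat resolutions of these DG modules. Localizing the strict category gives the
  same result as localizing its homotopy category, since homotopic homomorphisms become equal
  once quasi-isomorphisms are inverted.
\<close>

definition strict_cat :: "'a dg_ring \<Rightarrow> (('a, 'u) dg_module, int \<Rightarrow> 'u \<Rightarrow> 'u) category"
  where "strict_cat A =
    \<lparr>Ob = {M. dg_module A M},
     Mor = strict_homs A,
     Idt = (\<lambda>M i. \<lambda>m\<in>carrier (gr M i). m),
     Cmp = (\<lambda>M N P g f i. compose (carrier (gr M i)) (g i) (f i))\<rparr>"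

type_synonym ('a, 'u) der_mor = "(('a, 'u) dg_module, int \<Rightarrow> 'u \<Rightarrow> 'u) step list set"

definition der_cat :: "'a dg_ring \<Rightarrow> (('a, 'u) dg_module, ('a, 'u) der_mor) category"
  where "der_cat A = localization (strict_cat A) (quasi_isos A)"

definition der_functor ::
    "'a dg_ring \<Rightarrow> (('a, 'u) dg_module, int \<Rightarrow> 'u \<Rightarrow> 'u, ('a, 'u) dg_module, ('a, 'u) der_mor) functr"
  where "der_functor A = loc_functor (strict_cat A) (quasi_isos A)"

definition strict_le :: "'a dg_ring \<Rightarrow> int \<Rightarrow> ('a, 'u) dg_module set"
  where "strict_le A k = {M \<in> Ob (strict_cat A). concentrated_le k M}"

definition der_le :: "'a dg_ring \<Rightarrow> int \<Rightarrow> ('a, 'u) dg_module set"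
  where "der_le A k = {M \<in> Ob (der_cat A). coh_concentrated_le k M}"

text \<open>Cohomology of a morphism $X \to Y$ of the derived category, first for a zigzag.\<close>

fun zz_coh ::
    "int \<Rightarrow> ('a, 'u) dg_module \<Rightarrow> (('a, 'u) dg_module, int \<Rightarrow> 'u \<Rightarrow> 'u) step list \<Rightarrow> 'u set \<Rightarrow> 'u set"
  where
    "zz_coh i X [] = (\<lambda>x\<in>carrier (coh X i). x)"
  | "zz_coh i X (Fwd X' Y f # p) =
      compose (carrier (coh X i)) (zz_coh i Y p) (coh_map X' Y i f)"
  | "zz_coh i X (Bwd X' Y w # p) =
      compose (carrier (coh X i)) (zz_coh i Y p) (inv_into (carrier (coh Y i)) (coh_map Y X' i w))"

definition der_coh_map :: "int \<Rightarrow> ('a, 'u) dg_module \<Rightarrow> ('a, 'u) der_mor \<Rightarrow> 'u set \<Rightarrow> 'u set"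
  where "der_coh_map i X \<phi> = zz_coh i X (SOME p. p \<in> \<phi>)"


section \<open>Tensor products\<close>

text \<open>
  \<open>pres S R\<close> is the abelian group with generators \<open>S\<close> and relators \<open>R\<close>, and \<open>pres_map S' R' h\<close> is
  the homomorphism into \<open>pres S' R'\<close> that \<open>h\<close> (defined on generators) induces on such a group.
\<close>

definition pres :: "'g set \<Rightarrow> ('g \<Rightarrow>\<^sub>0 int) set \<Rightarrow> ('g \<Rightarrow>\<^sub>0 int) set monoid"
  where "pres S R = free_Abelian_group S Mod generate (free_Abelian_group S) R"

definition pres_class :: "'g set \<Rightarrow> ('g \<Rightarrow>\<^sub>0 int) set \<Rightarrow> ('g \<Rightarrow>\<^sub>0 int) \<Rightarrow> ('g \<Rightarrow>\<^sub>0 int) set"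
  where "pres_class S R c = generate (free_Abelian_group S) R #>\<^bsub>free_Abelian_group S\<^esub> c"

definition pres_map ::
    "'h set \<Rightarrow> ('h \<Rightarrow>\<^sub>0 int) set \<Rightarrow> ('g \<Rightarrow> 'h \<Rightarrow>\<^sub>0 int) \<Rightarrow> ('g \<Rightarrow>\<^sub>0 int) set \<Rightarrow> ('h \<Rightarrow>\<^sub>0 int) set"
  where "pres_map S' R' h x = pres_class S' R' (frag_extend h (SOME c. c \<in> x))"

text \<open>
  The degree \<open>p\<close> component of $M \otimes_A N$, where \<open>M\<close> is a right DG module: the generator
  \<open>(i, m, n)\<close> is $m \otimes n$ with $m \in M^i$ and $n \in N^{p-i}$. Balancedness over \<open>K\<close> is the
  instance $a = s(k)$ of balancedness over \<open>A\<close>.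
\<close>

definition tensor_gens ::
    "('a, 'u) dg_module \<Rightarrow> ('a, 'v) dg_module \<Rightarrow> int \<Rightarrow> (int \<times> 'u \<times> 'v) set"
  where "tensor_gens M N p =
    {(i, m, n). m \<in> carrier (gr M i) \<and> n \<in> carrier (gr N (p - i))}"

definition tensor_rels ::
    "'a dg_ring \<Rightarrow> ('a, 'u) dg_module \<Rightarrow> ('a, 'v) dg_module \<Rightarrow> int \<Rightarrow> (int \<times> 'u \<times> 'v \<Rightarrow>\<^sub>0 int) set"
  where "tensor_rels A M N p =
    {frag_of (i, m \<otimes>\<^bsub>gr M i\<^esub> m', n) - frag_of (i, m, n) - frag_of (i, m', n) | i m m' n.
       m \<in> carrier (gr M i) \<and> m' \<in> carrier (gr M i) \<and> n \<in> carrier (gr N (p - i))} \<union>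
    {frag_of (i, m, n \<otimes>\<^bsub>gr N (p - i)\<^esub> n') - frag_of (i, m, n) - frag_of (i, m, n') | i m n n'.
       m \<in> carrier (gr M i) \<and> n \<in> carrier (gr N (p - i)) \<and> n' \<in> carrier (gr N (p - i))} \<union>
    {frag_of (i + j, ract M i j m a, n) - frag_of (i, m, act N j (p - i - j) a n) | i j m a n.
       m \<in> carrier (gr M i) \<and> a \<in> carrier (gr A j) \<and> n \<in> carrier (gr N (p - i - j))}"

type_synonym ('u, 'v) tensor_elem = "(int \<times> 'u \<times> 'v \<Rightarrow>\<^sub>0 int) set"

definition tensor_dg ::
    "'a dg_ring \<Rightarrow> ('k \<Rightarrow> 'a) \<Rightarrow> ('a, 'u) dg_module \<Rightarrow> ('a, 'v) dg_module \<Rightarrow>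
     ('k, ('u, 'v) tensor_elem) dg_module"
  where "tensor_dg A s M N =
    \<lparr>gr = (\<lambda>p. pres (tensor_gens M N p) (tensor_rels A M N p)),
     df = (\<lambda>p. pres_map (tensor_gens M N (p + 1)) (tensor_rels A M N (p + 1))
       (\<lambda>(i, m, n). frag_of (i + 1, df M i m, n) +
          frag_cmul (if even i then 1 else - 1) (frag_of (i, m, df N (p - i) n)))),
     act = (\<lambda>q p k.
       if q = 0
       then pres_map (tensor_gens M N p) (tensor_rels A M N p)
              (\<lambda>(i, m, n). frag_of (i, act M 0 i (s k) m, n))
       else (\<lambda>x. \<one>\<^bsub>pres (tensor_gens M N (q + p)) (tensor_rels A M N (q + p))\<^esub>))\<rparr>"

definition tensor_class ::
    "'a dg_ring \<Rightarrow> ('a, 'u) dg_module \<Rightarrow> ('a, 'v) dg_module \<Rightarrow> int \<Rightarrow> int \<Rightarrow> 'u \<Rightarrow> 'v \<Rightarrow>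
     ('u, 'v) tensor_elem"
  where "tensor_class A M N i j m n =
    pres_class (tensor_gens M N (i + j)) (tensor_rels A M N (i + j)) (frag_of (i, m, n))"

definition tensor_map ::
    "'a dg_ring \<Rightarrow> ('a, 'u) dg_module \<times> ('a, 'v) dg_module \<Rightarrow>
     ('a, 'u) dg_module \<times> ('a, 'v) dg_module \<Rightarrow> (int \<Rightarrow> 'u \<Rightarrow> 'u) \<times> (int \<Rightarrow> 'v \<Rightarrow> 'v) \<Rightarrow>
     int \<Rightarrow> ('u, 'v) tensor_elem \<Rightarrow> ('u, 'v) tensor_elem"
  where "tensor_map A = (\<lambda>(M, N) (M', N') (f, g) p.
    \<lambda>x\<in>carrier (pres (tensor_gens M N p) (tensor_rels A M N p)).
      pres_map (tensor_gens M' N' p) (tensor_rels A M' N' p)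
        (\<lambda>(i, m, n). frag_of (i, f i m, g (p - i) n)) x)"

text \<open>The bifunctor $- \otimes_A -$ on strict homomorphisms, with values in the derived category
  of \<open>K\<close>.\<close>

definition tensor_functor ::
    "'k ring \<Rightarrow> 'a dg_ring \<Rightarrow> ('k \<Rightarrow> 'a) \<Rightarrow>
     (('a, 'u) dg_module \<times> ('a, 'u) dg_module, (int \<Rightarrow> 'u \<Rightarrow> 'u) \<times> (int \<Rightarrow> 'u \<Rightarrow> 'u),
      ('k, ('u, 'u) tensor_elem) dg_module, ('k, ('u, 'u) tensor_elem) der_mor) functr"
  where "tensor_functor K A s =
    comp_functor (der_functor (dg_of_ring K))
      \<lparr>fob = (\<lambda>(M, N). tensor_dg A s M N), fmor = tensor_map A\<rparr>"

definition left_derived_tensor ::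
    "'k ring \<Rightarrow> 'a dg_ring \<Rightarrow> ('k \<Rightarrow> 'a) \<Rightarrow>
     (('a, 'u) dg_module \<times> ('a, 'u) dg_module, ('a, 'u) der_mor \<times> ('a, 'u) der_mor,
      ('k, ('u, 'u) tensor_elem) dg_module, ('k, ('u, 'u) tensor_elem) der_mor) functr \<Rightarrow>
     (('a, 'u) dg_module \<times> ('a, 'u) dg_module \<Rightarrow> ('k, ('u, 'u) tensor_elem) der_mor) \<Rightarrow> bool"
  where "left_derived_tensor K A s L \<eta> \<longleftrightarrow>
    left_derived
      (prod_cat (strict_cat (op_dg_ring A)) (strict_cat A))
      (prod_cat (der_cat (op_dg_ring A)) (der_cat A))
      (der_cat (dg_of_ring K))
      (prod_functor (der_functor (op_dg_ring A)) (der_functor A))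
      (tensor_functor K A s) L \<eta>"


section \<open>Modules of cohomology\<close>

definition H0_ring :: "'a dg_ring \<Rightarrow> 'a set ring"
  where "H0_ring A =
    \<lparr>carrier = carrier (coh A 0),
     mult = (\<lambda>\<alpha> \<beta>. coh_class A 0 (rmul A 0 0 (SOME a. a \<in> \<alpha>) (SOME b. b \<in> \<beta>))),
     one = coh_class A 0 (rone A),
     zero = \<one>\<^bsub>coh A 0\<^esub>,
     add = monoid.mult (coh A 0)\<rparr>"

definition coh_act :: "('a, 'u) dg_module \<Rightarrow> int \<Rightarrow> 'a set \<Rightarrow> 'u set \<Rightarrow> 'u set"
  where "coh_act N j \<alpha> y = coh_class N j (act N 0 j (SOME a. a \<in> \<alpha>) (SOME n. n \<in> y))"

definition coh_ract :: "('a, 'u) dg_module \<Rightarrow> int \<Rightarrow> 'u set \<Rightarrow> 'a set \<Rightarrow> 'u set"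
  where "coh_ract M i x \<alpha> = coh_class M i (ract M i 0 (SOME m. m \<in> x) (SOME a. a \<in> \<alpha>))"

text \<open>Tensor product over a ring \<open>R\<close> of abelian groups with a right action \<open>ra\<close> and a left
  action \<open>la\<close>.\<close>

definition bal_rels ::
    "'r ring \<Rightarrow> 'x monoid \<Rightarrow> ('x \<Rightarrow> 'r \<Rightarrow> 'x) \<Rightarrow> 'y monoid \<Rightarrow> ('r \<Rightarrow> 'y \<Rightarrow> 'y) \<Rightarrow> ('x \<times> 'y \<Rightarrow>\<^sub>0 int) set"
  where "bal_rels R G ra H la =
    {frag_of (x \<otimes>\<^bsub>G\<^esub> x', y) - frag_of (x, y) - frag_of (x', y) | x x' y.
       x \<in> carrier G \<and> x' \<in> carrier G \<and> y \<in> carrier H} \<union>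
    {frag_of (x, y \<otimes>\<^bsub>H\<^esub> y') - frag_of (x, y) - frag_of (x, y') | x y y'.
       x \<in> carrier G \<and> y \<in> carrier H \<and> y' \<in> carrier H} \<union>
    {frag_of (ra x r, y) - frag_of (x, la r y) | x r y.
       x \<in> carrier G \<and> r \<in> carrier R \<and> y \<in> carrier H}"

text \<open>A \<open>K\<close>-module of the library from an abelian group and a scalar multiplication; the
  multiplicative fields of the record are not part of the structure.\<close>

definition mk_module :: "'x monoid \<Rightarrow> ('k \<Rightarrow> 'x \<Rightarrow> 'x) \<Rightarrow> ('k, 'x) module"
  where "mk_module G sc =
    \<lparr>carrier = carrier G, mult = undefined, one = undefined, zero = \<one>\<^bsub>G\<^esub>, add = monoid.mult G,
     smult = sc\<rparr>"

definition module_isos ::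
    "'k ring \<Rightarrow> ('k, 'x) module \<Rightarrow> ('k, 'y) module \<Rightarrow> ('x \<Rightarrow> 'y) set"
  where "module_isos K X Y =
    {f \<in> carrier X \<rightarrow>\<^sub>E carrier Y. bij_betw f (carrier X) (carrier Y) \<and>
       (\<forall>x\<in>carrier X. \<forall>x'\<in>carrier X. f (x \<oplus>\<^bsub>X\<^esub> x') = f x \<oplus>\<^bsub>Y\<^esub> f x') \<and>
       (\<forall>k\<in>carrier K. \<forall>x\<in>carrier X. f (k \<odot>\<^bsub>X\<^esub> x) = k \<odot>\<^bsub>Y\<^esub> f x)}"

text \<open>The \<open>K\<close>-module $H^p(X)$ of a DG \<open>K\<close>-module.\<close>

definition coh_module :: "('k, 'x) dg_module \<Rightarrow> int \<Rightarrow> ('k, 'x set) module"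
  where "coh_module X p =
    mk_module (coh X p) (\<lambda>k x. coh_class X p (act X 0 p k (SOME c. c \<in> x)))"

text \<open>The \<open>K\<close>-module $H^i(M) \otimes_{\bar A} H^j(N)$.\<close>

definition coh_tensor_gens ::
    "('a, 'u) dg_module \<Rightarrow> ('a, 'v) dg_module \<Rightarrow> int \<Rightarrow> int \<Rightarrow> ('u set \<times> 'v set) set"
  where "coh_tensor_gens M N i j = carrier (coh M i) \<times> carrier (coh N j)"

definition coh_tensor_rels ::
    "'a dg_ring \<Rightarrow> ('a, 'u) dg_module \<Rightarrow> ('a, 'v) dg_module \<Rightarrow> int \<Rightarrow> int \<Rightarrow>
     ('u set \<times> 'v set \<Rightarrow>\<^sub>0 int) set"
  where "coh_tensor_rels A M N i j =
    bal_rels (H0_ring A) (coh M i) (coh_ract M i) (coh N j) (coh_act N j)"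

definition coh_tensor ::
    "'a dg_ring \<Rightarrow> ('k \<Rightarrow> 'a) \<Rightarrow> int \<Rightarrow> int \<Rightarrow> ('a, 'u) dg_module \<Rightarrow> ('a, 'v) dg_module \<Rightarrow>
     ('k, ('u set \<times> 'v set \<Rightarrow>\<^sub>0 int) set) module"
  where "coh_tensor A s i j M N =
    mk_module (pres (coh_tensor_gens M N i j) (coh_tensor_rels A M N i j))
      (\<lambda>k. pres_map (coh_tensor_gens M N i j) (coh_tensor_rels A M N i j)
         (\<lambda>(x, y). frag_of (coh_class M i (act M 0 i (s k) (SOME m. m \<in> x)), y)))"

definition coh_tensor_class ::
    "'a dg_ring \<Rightarrow> int \<Rightarrow> int \<Rightarrow> ('a, 'u) dg_module \<Rightarrow> ('a, 'v) dg_module \<Rightarrow> 'u set \<Rightarrow> 'v set \<Rightarrow>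
     ('u set \<times> 'v set \<Rightarrow>\<^sub>0 int) set"
  where "coh_tensor_class A i j M N x y =
    pres_class (coh_tensor_gens M N i j) (coh_tensor_rels A M N i j) (frag_of (x, y))"

text \<open>For $u : H^i(M) \to H^i(M')$ and $v : H^j(N) \to H^j(N')$, the homomorphism $u \otimes v$.\<close>

definition coh_tensor_map ::
    "'a dg_ring \<Rightarrow> int \<Rightarrow> int \<Rightarrow> ('a, 'u) dg_module \<Rightarrow> ('a, 'v) dg_module \<Rightarrow>
     ('a, 'u) dg_module \<Rightarrow> ('a, 'v) dg_module \<Rightarrow> ('u set \<Rightarrow> 'u set) \<Rightarrow> ('v set \<Rightarrow> 'v set) \<Rightarrow>
     ('u set \<times> 'v set \<Rightarrow>\<^sub>0 int) set \<Rightarrow> ('u set \<times> 'v set \<Rightarrow>\<^sub>0 int) set"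
  where "coh_tensor_map A i j M N M' N' u v =
    (\<lambda>t\<in>carrier (pres (coh_tensor_gens M N i j) (coh_tensor_rels A M N i j)).
       pres_map (coh_tensor_gens M' N' i j) (coh_tensor_rels A M' N' i j)
         (\<lambda>(x, y). frag_of (u x, v y)) t)"

text \<open>The isomorphism $[m] \otimes [n] \mapsto [m \otimes n]$ of the underived tensor product in top
  degree.\<close>

definition theta ::
    "'k ring \<Rightarrow> 'a dg_ring \<Rightarrow> ('k \<Rightarrow> 'a) \<Rightarrow> int \<Rightarrow> int \<Rightarrow> ('a, 'u) dg_module \<Rightarrow> ('a, 'v) dg_module \<Rightarrow>
     ('u set \<times> 'v set \<Rightarrow>\<^sub>0 int) set \<Rightarrow> ('u, 'v) tensor_elem set"
  where "theta K A s i j M N =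
    (THE t. t \<in> module_isos K (coh_tensor A s i j M N) (coh_module (tensor_dg A s M N) (i + j)) \<and>
       (\<forall>m\<in>carrier (gr M i). \<forall>n\<in>carrier (gr N j).
          t (coh_tensor_class A i j M N (coh_class M i m) (coh_class N j n)) =
          coh_class (tensor_dg A s M N) (i + j) (tensor_class A M N i j m n)))"

end

theory Submission
  imports Defs
begin

text \<open>
  Put $p = i_0 + j_0$, let $C$ and $D$ be the products of the two strict and of the two derived
  categories, $Q : C \to D$ the localization and $F = - \otimes_A -$. The only access to $L$ is the
  universal property of $\eta : L \circ Q \to F$, so the isomorphism has to be extracted from it;
  no resolution of a DG \<open>A\<close>-module is constructed.

  For $M$ and $N$ concentrated in degrees $\leq i_0$ and $\leq j_0$, the degree \<open>p\<close> part of
  $M \otimes_A N$ is generated by the products $m \otimes n$ with \<open>m\<close> and \<open>n\<close> in the top degrees,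
  and sending them to $[m] \otimes [n]$ respects the relations and kills the coboundaries. This
  inverts $\theta_{M,N}$ (\<open>Theta_iso\<close>). Everything else follows once $H^p(\eta)$ is known to be
  bijective on such pairs (\<open>Heta_bij\<close>): the derived isomorphism must be
  $H^p(\eta)^{-1} \circ \theta$ there, and every pair with cohomology in degrees $\leq i_0$ and
  $\leq j_0$ is isomorphic in \<open>D\<close> to its truncation.

  The universal property speaks about functors $D \to D(K)$. Enough of them come from functors
  \<open>S\<close> from \<open>D\<close> to sets: the free \<open>K\<close>-module on a set, placed in degree \<open>p\<close>, corepresents in
  $D(K)$ the families of classes in $H^p(Y)$ indexed by that set (\<open>free_corepresents\<close>).
  Transformations from the functor of free modules on the values of \<open>S\<close> are therefore the same as
  natural maps from \<open>S\<close> to $H^p$, and the universal property becomes a statement about cohomology: natural maps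
  $S \circ Q \to H^p F$ lift uniquely along $H^p(\eta)$ to natural maps $S \to H^p L$
  (\<open>coh_lift_exists\<close>, \<open>coh_lift_unique\<close>). It is applied to two functors.

  Surjectivity (\<open>Heta_surj\<close>) comes from $S(M, N) = H^{i_0}(M) \times H^{j_0}(N)$ with the pairing
  $([m], [n]) \mapsto [m \otimes n]$, whose values generate by surjectivity of $\theta$.

  Injectivity comes from the image \<open>eta_kernel\<close> in $H^p L(M, N)$ of the kernel of $H^p(\eta)$ on the
  truncated pair. Its inclusion into $H^p L$ and the zero map have the same composition with
  $H^p(\eta)$, so they are equal by uniqueness of lifts. What has to be checked is that
  \<open>eta_kernel\<close> is a functor on \<open>D\<close> and not only on \<open>C\<close>, that is, stable under inverses of
  quasi-isomorphisms. This holds since on truncated pairs $\theta$ identifies $H^p F$ with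
  $H^{i_0} \otimes H^{j_0}$, which sends quasi-isomorphisms to bijections (\<open>HFm_kernel\<close>).

  The resulting map is natural for strict homomorphisms by construction, and hence for all morphisms
  of \<open>D\<close>, because these are generated by strict ones and inverses of quasi-isomorphisms
  (\<open>DD_induct\<close>). Uniqueness follows from naturality along the inclusion of the truncation and
  injectivity of $H^p(\eta)$ on truncated pairs (\<open>theta_der_unique\<close>).
\<close>

section \<open>Quotients and presentations of abelian groups\<close>

lemma (in comm_group) rcos_eq_iff:
  assumes "subgroup H G" "x \<in> carrier G" "y \<in> carrier G"
  shows "H #> x = H #> y \<longleftrightarrow> x \<otimes> inv y \<in> H"
proof
  assume "H #> x = H #> y"
  then have "x \<in> H #> y"
    using rcos_self[OF assms(2,1)] by simp
  then show "x \<otimes> inv y \<in> H"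
    using subgroup.rcos_module_imp[OF assms(1) is_group assms(3)] by blast
next
  assume "x \<otimes> inv y \<in> H"
  then have "x \<in> H #> y"
    using subgroup.rcos_module_rev[OF assms(1) is_group assms(3) assms(2)] by blast
  then show "H #> x = H #> y"
    using repr_independence[OF _ assms(3,1)] by blast
qed

lemma (in comm_group) rcos_some:
  assumes "subgroup H G" "x \<in> carrier G"
  shows "(SOME m. m \<in> H #> x) \<in> carrier G" "H #> (SOME m. m \<in> H #> x) = H #> x"
proof -
  have *: "(SOME m. m \<in> H #> x) \<in> H #> x"
    using rcos_self[OF assms(2,1)] by (rule someI)
  then show "(SOME m. m \<in> H #> x) \<in> carrier G"
    using r_coset_subset_G[OF subgroup.subset[OF assms(1)] assms(2)] by blast
  show "H #> (SOME m. m \<in> H #> x) = H #> x"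
    using repr_independence[OF * assms(2,1)] by simp
qed

lemma (in comm_group) rcos_hom:
  assumes "subgroup H G"
  shows "(\<lambda>x. H #> x) \<in> hom G (G Mod H)" "comm_group (G Mod H)"
  using normal.r_coset_hom_Mod[OF subgroup_imp_normal[OF assms]] abelian_FactGroup[OF assms] by auto

lemma group_homI [intro]: "group G \<Longrightarrow> group H \<Longrightarrow> h \<in> hom G H \<Longrightarrow> group_hom G H h"
  by (simp add: group_hom_def group_hom_axioms_def)

lemmas comm_group_group = comm_group.axioms(2)

lemma hom_one': "comm_group G \<Longrightarrow> comm_group H \<Longrightarrow> h \<in> hom G H \<Longrightarrow> h \<one>\<^bsub>G\<^esub> = \<one>\<^bsub>H\<^esub>"
  by (meson hom_one comm_group.axioms(2))

lemma hom_inv':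
  "comm_group G \<Longrightarrow> comm_group H \<Longrightarrow> h \<in> hom G H \<Longrightarrow> x \<in> carrier G \<Longrightarrow> h (inv\<^bsub>G\<^esub> x) = inv\<^bsub>H\<^esub> h x"
  by (meson group_hom.hom_inv group_homI comm_group.axioms(2))

lemma hom_mult_fun:
  assumes "comm_group H" "f \<in> hom G H" "g \<in> hom G H" "monoid G"
  shows "(\<lambda>x. f x \<otimes>\<^bsub>H\<^esub> g x) \<in> hom G H"
proof -
  interpret H: comm_group H by fact
  interpret G: monoid G by fact
  show ?thesis
    by (rule homI) (auto simp: hom_in_carrier[OF assms(2)] hom_in_carrier[OF assms(3)]
        hom_mult[OF assms(2)] hom_mult[OF assms(3)] H.m_ac)
qed

lemma hom_inv_fun:
  assumes "comm_group H" "f \<in> hom G H" "monoid G"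
  shows "(\<lambda>x. inv\<^bsub>H\<^esub> f x) \<in> hom G H"
proof -
  interpret H: comm_group H by fact
  interpret G: monoid G by fact
  show ?thesis
    by (rule homI) (auto simp: hom_in_carrier[OF assms(2)] hom_mult[OF assms(2)] H.inv_mult)
qed

lemma hom_one_fun: "comm_group H \<Longrightarrow> (\<lambda>x. \<one>\<^bsub>H\<^esub>) \<in> hom G H"
  by (rule homI) (auto simp: comm_group_def group.is_monoid monoid.one_closed comm_monoid.axioms)

lemma hom_comp: "f \<in> hom G H \<Longrightarrow> g \<in> hom H I \<Longrightarrow> (\<lambda>x. g (f x)) \<in> hom G I"
  using hom_compose[of f G H g I] by (simp add: comp_def)

lemma subgroup_comm_group:
  assumes "comm_group G" "subgroup H G" shows "comm_group (G\<lparr>carrier := H\<rparr>)"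
proof -
  interpret comm_group G by fact
  interpret H: group "G\<lparr>carrier := H\<rparr>" by (rule subgroup.subgroup_is_group[OF assms(2) is_group])
  show ?thesis
    by (rule H.group_comm_groupI) (simp add: m_comm subgroup.mem_carrier[OF assms(2)])
qed

lemma trivial_comm_group:
  assumes "comm_group G" shows "comm_group (G\<lparr>carrier := {\<one>\<^bsub>G\<^esub>}\<rparr>)"
proof -
  interpret comm_group G by fact
  show ?thesis by (rule subgroup_comm_group[OF assms triv_subgroup])
qed

context
  fixes S :: "'g set" and R :: "('g \<Rightarrow>\<^sub>0 int) set"
  assumes R: "R \<subseteq> carrier (free_Abelian_group S)"
begin

private lemma sub: "subgroup (generate (free_Abelian_group S) R) (free_Abelian_group S)"
  by (rule group.generate_is_subgroup[OF group_free_Abelian_group R])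

private lemma cg: "comm_group (free_Abelian_group S)"
  by (rule abelian_free_Abelian_group)

lemma pres_comm_group: "comm_group (pres S R)"
  unfolding pres_def by (rule comm_group.rcos_hom(2)[OF cg sub])

lemma pres_class_hom: "pres_class S R \<in> hom (free_Abelian_group S) (pres S R)"
  using comm_group.rcos_hom(1)[OF cg sub] unfolding pres_def pres_class_def[abs_def] .

lemma pres_class_closed: "Poly_Mapping.keys c \<subseteq> S \<Longrightarrow> pres_class S R c \<in> carrier (pres S R)"
  using hom_in_carrier[OF pres_class_hom] by simp

lemma pres_gen_closed: "g \<in> S \<Longrightarrow> pres_class S R (frag_of g) \<in> carrier (pres S R)"
  by (rule pres_class_closed) simp

lemma pres_class_eq_iff:
  assumes "Poly_Mapping.keys c \<subseteq> S" "Poly_Mapping.keys d \<subseteq> S"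
  shows "pres_class S R c = pres_class S R d \<longleftrightarrow> c - d \<in> generate (free_Abelian_group S) R"
  using comm_group.rcos_eq_iff[OF cg sub, of c d] assms by (simp add: pres_class_def)

lemma one_pres: "\<one>\<^bsub>pres S R\<^esub> = pres_class S R 0"
  using hom_one'[OF cg pres_comm_group pres_class_hom] by simp

lemma pres_class_add:
  assumes "Poly_Mapping.keys c \<subseteq> S" "Poly_Mapping.keys d \<subseteq> S"
  shows "pres_class S R (c + d) = pres_class S R c \<otimes>\<^bsub>pres S R\<^esub> pres_class S R d"
  using hom_mult[OF pres_class_hom, of c d] assms by simp

lemma pres_class_minus:
  assumes "Poly_Mapping.keys c \<subseteq> S"
  shows "pres_class S R (- c) = inv\<^bsub>pres S R\<^esub> pres_class S R c"
  using hom_inv'[OF cg pres_comm_group pres_class_hom, of c] assms by simp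

lemma pres_class_diff:
  assumes "Poly_Mapping.keys c \<subseteq> S" "Poly_Mapping.keys d \<subseteq> S"
  shows "pres_class S R (c - d) = pres_class S R c \<otimes>\<^bsub>pres S R\<^esub> inv\<^bsub>pres S R\<^esub> pres_class S R d"
  using pres_class_add[of c "- d"] pres_class_minus[of d] assms by simp

lemma pres_class_rel:
  assumes "r \<in> R" shows "pres_class S R r = \<one>\<^bsub>pres S R\<^esub>"
proof -
  have "Poly_Mapping.keys r \<subseteq> S" using subsetD[OF R assms] by simp
  then show ?thesis
    using pres_class_eq_iff[of r 0] generate.incl[OF assms] by (simp add: one_pres)
qed

lemma pres_rep:
  assumes "x \<in> carrier (pres S R)"
  shows "Poly_Mapping.keys (SOME c. c \<in> x) \<subseteq> S" "pres_class S R (SOME c. c \<in> x) = x"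
proof -
  obtain c where "c \<in> carrier (free_Abelian_group S)" "x = generate (free_Abelian_group S) R #>\<^bsub>free_Abelian_group S\<^esub> c"
    using assms unfolding pres_def carrier_FactGroup by blast
  then show "Poly_Mapping.keys (SOME c. c \<in> x) \<subseteq> S" "pres_class S R (SOME c. c \<in> x) = x"
    using comm_group.rcos_some[OF cg sub, of c] by (auto simp: pres_class_def)
qed

lemma pres_induct [consumes 1, case_names one mult inv gen]:
  assumes x: "x \<in> carrier (pres S R)"
    and one: "P \<one>\<^bsub>pres S R\<^esub>"
    and mult: "\<And>x y. \<lbrakk>x \<in> carrier (pres S R); y \<in> carrier (pres S R); P x; P y\<rbrakk> \<Longrightarrow> P (x \<otimes>\<^bsub>pres S R\<^esub> y)"
    and inv: "\<And>x. \<lbrakk>x \<in> carrier (pres S R); P x\<rbrakk> \<Longrightarrow> P (inv\<^bsub>pres S R\<^esub> x)"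
    and gen: "\<And>g. g \<in> S \<Longrightarrow> P (pres_class S R (frag_of g))"
  shows "P x"
proof -
  interpret comm_group "pres S R" by (rule pres_comm_group)
  have "P (pres_class S R c)" if "Poly_Mapping.keys c \<subseteq> S" for c
    using that
  proof (rule free_Abelian_group_induct)
    show "P (pres_class S R 0)" using one by (simp add: one_pres)
  next
    fix c d assume cd: "Poly_Mapping.keys c \<subseteq> S" "Poly_Mapping.keys d \<subseteq> S"
      and P: "P (pres_class S R c)" "P (pres_class S R d)"
    show "P (pres_class S R (c - d))"
      unfolding pres_class_diff[OF cd] using cd P by (intro mult inv inv_closed pres_class_closed)
  qed (rule gen)
  from this[OF pres_rep(1)[OF x]] show ?thesis
    by (simp add: pres_rep(2)[OF x])
qed

lemma pres_hom_ext:
  assumes H: "comm_group H" and f: "f \<in> hom (pres S R) H" and g: "g \<in> hom (pres S R) H"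
    and eq: "\<And>s. s \<in> S \<Longrightarrow> f (pres_class S R (frag_of s)) = g (pres_class S R (frag_of s))"
    and x: "x \<in> carrier (pres S R)"
  shows "f x = g x"
  using x
proof (induction x rule: pres_induct)
  case one then show ?case
    using hom_one'[OF pres_comm_group H f] hom_one'[OF pres_comm_group H g] by simp
next
  case (mult x y) then show ?case
    by (simp add: hom_mult[OF f] hom_mult[OF g])
next
  case (inv x) then show ?case
    by (simp add: hom_inv'[OF pres_comm_group H f] hom_inv'[OF pres_comm_group H g])
qed (rule eq)

text \<open>Two representatives of a class differ by an element generated by the relators, so the chosen
  representative does not matter. This controls every map that is defined through \<open>pres_map\<close>.\<close>

lemma pres_hom_factor:
  assumes H: "comm_group H" and f: "f \<in> hom (free_Abelian_group S) H"
    and rel: "\<And>r. r \<in> R \<Longrightarrow> f r = \<one>\<^bsub>H\<^esub>"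
  shows "(\<lambda>x. f (SOME c. c \<in> x)) \<in> hom (pres S R) H"
    and "\<And>c. Poly_Mapping.keys c \<subseteq> S \<Longrightarrow> f (SOME d. d \<in> pres_class S R c) = f c"
proof -
  interpret H: comm_group H by fact
  interpret F: group_hom "free_Abelian_group S" H f
    by (intro group_homI group_free_Abelian_group H.is_group f)
  interpret P: comm_group "pres S R" by (rule pres_comm_group)
  have gen: "f r = \<one>\<^bsub>H\<^esub>" if "r \<in> generate (free_Abelian_group S) R" for r
    using that
  proof induction
    case one show ?case using F.hom_one .
  next
    case (incl h) then show ?case by (rule rel)
  next
    case (inv h) then have "h \<in> carrier (free_Abelian_group S)" using R by blast
    with F.hom_inv[OF this] show ?case using inv by (simp add: rel)
  next
    case (eng a b) then have "a \<in> carrier (free_Abelian_group S)" "b \<in> carrier (free_Abelian_group S)"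
      using group.generate_in_carrier[OF group_free_Abelian_group R] by blast+
    with F.hom_mult[OF this] eng show ?case by simp
  qed
  show eq: "f (SOME d. d \<in> pres_class S R c) = f c" if c: "Poly_Mapping.keys c \<subseteq> S" for c
  proof -
    let ?d = "SOME d. d \<in> pres_class S R c"
    have d: "Poly_Mapping.keys ?d \<subseteq> S" "pres_class S R ?d = pres_class S R c"
      using pres_rep[OF pres_class_closed[OF c]] by auto
    then have "f (?d - c) = \<one>\<^bsub>H\<^esub>"
      using pres_class_eq_iff c gen by blast
    moreover have "f ?d = f (?d - c) \<otimes>\<^bsub>H\<^esub> f c"
    proof -
      have "?d - c \<in> carrier (free_Abelian_group S)" using d c keys_diff[of ?d c] by auto
      from F.hom_mult[OF this, of c] c show ?thesis by simp
    qed
    moreover have "f c \<in> carrier H" using F.hom_closed[of c] c by simp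
    ultimately show ?thesis by simp
  qed
  show "(\<lambda>x. f (SOME c. c \<in> x)) \<in> hom (pres S R) H"
  proof (rule homI)
    fix x y assume x: "x \<in> carrier (pres S R)" and y: "y \<in> carrier (pres S R)"
    let ?c = "SOME c. c \<in> x" and ?d = "SOME c. c \<in> y"
    have "x \<otimes>\<^bsub>pres S R\<^esub> y = pres_class S R (?c + ?d)"
      using pres_class_add[OF pres_rep(1)[OF x] pres_rep(1)[OF y]] pres_rep(2)[OF x] pres_rep(2)[OF y] by simp
    then have "f (SOME c. c \<in> x \<otimes>\<^bsub>pres S R\<^esub> y) = f (?c + ?d)"
      using eq[of "?c + ?d"] keys_add[of ?c ?d] pres_rep(1)[OF x] pres_rep(1)[OF y] by auto
    then show "f (SOME c. c \<in> x \<otimes>\<^bsub>pres S R\<^esub> y) = f ?c \<otimes>\<^bsub>H\<^esub> f ?d"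
      using F.hom_mult[of ?c ?d] pres_rep(1)[OF x] pres_rep(1)[OF y] by simp
  next
    fix x assume "x \<in> carrier (pres S R)"
    then show "f (SOME c. c \<in> x) \<in> carrier H" using F.hom_closed[of "SOME c. c \<in> x"] pres_rep(1) by simp
  qed
qed

text \<open>The relators are tested on an arbitrary homomorphism \<open>f\<close> of the free group with the prescribed
  values, so that the test only uses additivity of \<open>f\<close> and the values on generators.\<close>

lemma pres_lift:
  assumes H: "comm_group H" and h: "\<And>s. s \<in> S \<Longrightarrow> h s \<in> carrier H"
    and rel: "\<And>f r. \<lbrakk>f \<in> hom (free_Abelian_group S) H; \<And>s. s \<in> S \<Longrightarrow> f (frag_of s) = h s; r \<in> R\<rbrakk> \<Longrightarrow> f r = \<one>\<^bsub>H\<^esub>"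
  obtains f where "f \<in> hom (pres S R) H" "\<And>s. s \<in> S \<Longrightarrow> f (pres_class S R (frag_of s)) = h s"
proof -
  obtain f where f: "f \<in> hom (free_Abelian_group S) H" "\<And>s. s \<in> S \<Longrightarrow> f (frag_of s) = h s"
    using comm_group.free_Abelian_group_universal[OF H, of h S] h by blast
  note * = pres_hom_factor[OF H f(1) rel[OF f]]
  show thesis
    by (rule that[OF *(1)]) (simp_all add: *(2) f(2))
qed

end

lemma frag_extend_hom:
  assumes "\<And>s. s \<in> S \<Longrightarrow> Poly_Mapping.keys (h s) \<subseteq> S'"
  shows "frag_extend h \<in> hom (free_Abelian_group S) (free_Abelian_group S')"
proof (rule homI)
  fix c assume "c \<in> carrier (free_Abelian_group S)"
  then show "frag_extend h c \<in> carrier (free_Abelian_group S')"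
    using keys_frag_extend[of h c] assms by auto
qed (simp add: frag_extend_add)

lemma pres_map_hom:
  assumes R: "R \<subseteq> carrier (free_Abelian_group S)" and R': "R' \<subseteq> carrier (free_Abelian_group S')"
    and h: "\<And>s. s \<in> S \<Longrightarrow> Poly_Mapping.keys (h s) \<subseteq> S'"
    and rel: "\<And>r. r \<in> R \<Longrightarrow> pres_class S' R' (frag_extend h r) = \<one>\<^bsub>pres S' R'\<^esub>"
  shows "pres_map S' R' h \<in> hom (pres S R) (pres S' R')"
    and "\<And>c. Poly_Mapping.keys c \<subseteq> S \<Longrightarrow> pres_map S' R' h (pres_class S R c) = pres_class S' R' (frag_extend h c)"
    and "\<And>s. s \<in> S \<Longrightarrow> pres_map S' R' h (pres_class S R (frag_of s)) = pres_class S' R' (h s)"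
proof -
  have "(\<lambda>c. pres_class S' R' (frag_extend h c)) \<in> hom (free_Abelian_group S) (pres S' R')"
    using hom_compose[OF frag_extend_hom[OF h] pres_class_hom[OF R']] by (simp add: comp_def)
  from pres_hom_factor[OF R pres_comm_group[OF R'] this rel]
  show "pres_map S' R' h \<in> hom (pres S R) (pres S' R')"
    and eq: "\<And>c. Poly_Mapping.keys c \<subseteq> S \<Longrightarrow> pres_map S' R' h (pres_class S R c) = pres_class S' R' (frag_extend h c)"
    by (simp_all add: pres_map_def[abs_def])
  show "pres_map S' R' h (pres_class S R (frag_of s)) = pres_class S' R' (h s)" if "s \<in> S" for s
    using eq[of "frag_of s"] that by simp
qed

lemma free_hom_diff:
  assumes "comm_group H" "f \<in> hom (free_Abelian_group S) H" "Poly_Mapping.keys a \<subseteq> S" "Poly_Mapping.keys b \<subseteq> S"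
  shows "f (a - b) = f a \<otimes>\<^bsub>H\<^esub> inv\<^bsub>H\<^esub> f b"
  using hom_mult[OF assms(2), of a "- b"] hom_inv'[OF abelian_free_Abelian_group assms(1,2), of b] assms(3,4) by simp

text \<open>All presentations below have relators of the shapes $a - b$ and $a - b - c$. Killing such a relator
  is an equation between values on generators.\<close>

lemma free_hom_rel2:
  assumes "comm_group H" "f \<in> hom (free_Abelian_group S) H" "a \<in> S" "b \<in> S"
  shows "f (frag_of a - frag_of b) = \<one>\<^bsub>H\<^esub> \<longleftrightarrow> f (frag_of a) = f (frag_of b)"
proof -
  interpret H: comm_group H by fact
  have "f (frag_of a) \<in> carrier H" "f (frag_of b) \<in> carrier H" using assms hom_in_carrier[OF assms(2)] by auto
  then show ?thesis using free_hom_diff[OF assms(1,2), of "frag_of a" "frag_of b"] assms(3,4)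
    by (simp add: H.inv_solve_right')
qed

lemma free_hom_rel3:
  assumes "comm_group H" "f \<in> hom (free_Abelian_group S) H" "a \<in> S" "b \<in> S" "c \<in> S"
  shows "f (frag_of a - frag_of b - frag_of c) = \<one>\<^bsub>H\<^esub> \<longleftrightarrow> f (frag_of a) = f (frag_of b) \<otimes>\<^bsub>H\<^esub> f (frag_of c)"
proof -
  interpret H: comm_group H by fact
  have c: "f (frag_of a) \<in> carrier H" "f (frag_of b) \<in> carrier H" "f (frag_of c) \<in> carrier H"
    using assms hom_in_carrier[OF assms(2)] by auto
  have k: "Poly_Mapping.keys (frag_of a - frag_of b) \<subseteq> S"
    using keys_diff[of "frag_of a" "frag_of b"] assms by auto
  have "f (frag_of a - frag_of b - frag_of c) = f (frag_of a) \<otimes>\<^bsub>H\<^esub> inv\<^bsub>H\<^esub> f (frag_of b) \<otimes>\<^bsub>H\<^esub> inv\<^bsub>H\<^esub> f (frag_of c)"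
    using assms(3-5) k by (simp add: free_hom_diff[OF assms(1,2)])
  also have "\<dots> = f (frag_of a) \<otimes>\<^bsub>H\<^esub> inv\<^bsub>H\<^esub> (f (frag_of b) \<otimes>\<^bsub>H\<^esub> f (frag_of c))"
    using c by (simp add: H.inv_mult H.m_assoc)
  finally show ?thesis
    using c H.inv_solve_right'[of "\<one>\<^bsub>H\<^esub>" "f (frag_of a)" "f (frag_of b) \<otimes>\<^bsub>H\<^esub> f (frag_of c)"] by simp
qed

lemma keys_rel: "a \<in> S \<Longrightarrow> b \<in> S \<Longrightarrow> Poly_Mapping.keys (frag_of a - frag_of b) \<subseteq> S"
  "a \<in> S \<Longrightarrow> b \<in> S \<Longrightarrow> c \<in> S \<Longrightarrow> Poly_Mapping.keys (frag_of a - frag_of b - frag_of c) \<subseteq> S"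
  using keys_diff[of "frag_of a" "frag_of b"] keys_diff[of "frag_of a - frag_of b" "frag_of c"] by auto

section \<open>Cohomology groups\<close>

abbreviation (input) cyc :: "('u, 'z) cochain_scheme \<Rightarrow> int \<Rightarrow> 'u set"
  where "cyc M i \<equiv> carrier (cocycles M i)"

lemma cyc_iff: "m \<in> cyc M i \<longleftrightarrow> m \<in> carrier (gr M i) \<and> df M i m = \<one>\<^bsub>gr M (i + 1)\<^esub>"
  by (simp add: cocycles_def kernel_def)

lemma cycD: "m \<in> cyc M i \<Longrightarrow> m \<in> carrier (gr M i)"
  by (simp add: cyc_iff)

lemma mult_cocycles [simp]: "monoid.mult (cocycles M i) = monoid.mult (gr M i)"
  "one (cocycles M i) = one (gr M i)"
  by (simp_all add: cocycles_def)

context cochain_complex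
begin

lemma gr_group: "group (gr M i)"
  using gr_comm_group by (simp add: comm_group_def)

lemma gr_one [simp]: "\<one>\<^bsub>gr M i\<^esub> \<in> carrier (gr M i)"
  by (simp add: gr_group group.is_monoid monoid.one_closed)

lemma df_closed: "x \<in> carrier (gr M i) \<Longrightarrow> df M i x \<in> carrier (gr M (i + 1))"
  using df_hom by (rule hom_in_carrier)

lemma df_one: "df M i \<one>\<^bsub>gr M i\<^esub> = \<one>\<^bsub>gr M (i + 1)\<^esub>"
  by (rule hom_one'[OF gr_comm_group gr_comm_group df_hom])

lemma df_hom': "df M (i - 1) \<in> hom (gr M (i - 1)) (gr M i)"
  using df_hom[of "i - 1"] by simp

lemma cyc_subgroup: "subgroup (cyc M i) (gr M i)"
proof -
  interpret group_hom "gr M i" "gr M (i + 1)" "df M i"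
    by (intro group_homI gr_group df_hom)
  show ?thesis using subgroup_kernel by (simp add: cocycles_def)
qed

lemma cocycles_comm_group: "comm_group (cocycles M i)"
proof -
  show ?thesis
    using subgroup_comm_group[OF gr_comm_group cyc_subgroup, of i] by (simp add: cocycles_def)
qed

lemma inv_cocycles: "m \<in> cyc M i \<Longrightarrow> inv\<^bsub>cocycles M i\<^esub> m = inv\<^bsub>gr M i\<^esub> m"
  using group.m_inv_consistent[OF gr_group cyc_subgroup] by (simp add: cocycles_def)

lemma coboundary_cyc: "x \<in> carrier (gr M (i - 1)) \<Longrightarrow> df M (i - 1) x \<in> cyc M i"
  using df_closed[of x "i - 1"] df_df[of x "i - 1"] by (simp add: cyc_iff)

lemma coboundaries_subgroup: "subgroup (coboundaries M i) (cocycles M i)"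
proof -
  have "df M (i - 1) \<in> hom (gr M (i - 1)) (cocycles M i)"
    using coboundary_cyc by (auto simp: hom_def hom_mult[OF df_hom'])
  then interpret group_hom "gr M (i - 1)" "cocycles M i" "df M (i - 1)"
    by (intro group_homI gr_group comm_group_group cocycles_comm_group)
  show ?thesis
    unfolding coboundaries_def by (rule img_is_subgroup)
qed

lemma one_cyc [simp]: "\<one>\<^bsub>gr M i\<^esub> \<in> cyc M i"
  using df_one by (simp add: cyc_iff)

lemma mult_cyc: "m \<in> cyc M i \<Longrightarrow> n \<in> cyc M i \<Longrightarrow> m \<otimes>\<^bsub>gr M i\<^esub> n \<in> cyc M i"
  using subgroup.m_closed[OF cyc_subgroup] .

lemma inv_cyc: "m \<in> cyc M i \<Longrightarrow> inv\<^bsub>gr M i\<^esub> m \<in> cyc M i"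
  using subgroup.m_inv_closed[OF cyc_subgroup] .

lemma coh_comm_group: "comm_group (coh M i)"
  unfolding coh_def by (rule comm_group.rcos_hom(2)[OF cocycles_comm_group coboundaries_subgroup])

lemma coh_group: "group (coh M i)"
  using coh_comm_group by (simp add: comm_group_def)

lemma coh_class_hom: "coh_class M i \<in> hom (cocycles M i) (coh M i)"
  using comm_group.rcos_hom(1)[OF cocycles_comm_group coboundaries_subgroup]
  unfolding coh_def coh_class_def[abs_def] .

lemma coh_class_closed: "m \<in> cyc M i \<Longrightarrow> coh_class M i m \<in> carrier (coh M i)"
  by (rule hom_in_carrier[OF coh_class_hom])

lemma coh_class_mult:
  "m \<in> cyc M i \<Longrightarrow> n \<in> cyc M i \<Longrightarrow>
    coh_class M i (m \<otimes>\<^bsub>gr M i\<^esub> n) = coh_class M i m \<otimes>\<^bsub>coh M i\<^esub> coh_class M i n"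
  using hom_mult[OF coh_class_hom] by simp

lemma one_coh: "\<one>\<^bsub>coh M i\<^esub> = coh_class M i \<one>\<^bsub>gr M i\<^esub>"
  using hom_one'[OF cocycles_comm_group coh_comm_group coh_class_hom] by simp

lemma coh_class_inv:
  "m \<in> cyc M i \<Longrightarrow> coh_class M i (inv\<^bsub>gr M i\<^esub> m) = inv\<^bsub>coh M i\<^esub> coh_class M i m"
  using hom_inv'[OF cocycles_comm_group coh_comm_group coh_class_hom] by (simp add: inv_cocycles)

lemma coh_class_eq_iff:
  assumes "m \<in> cyc M i" "n \<in> cyc M i"
  shows "coh_class M i m = coh_class M i n \<longleftrightarrow>
    (\<exists>y\<in>carrier (gr M (i - 1)). m = df M (i - 1) y \<otimes>\<^bsub>gr M i\<^esub> n)"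
proof -
  interpret Z: comm_group "cocycles M i" by (rule cocycles_comm_group)
  have "coh_class M i m = coh_class M i n \<longleftrightarrow> m \<otimes>\<^bsub>cocycles M i\<^esub> inv\<^bsub>cocycles M i\<^esub> n \<in> coboundaries M i"
    using Z.rcos_eq_iff[OF coboundaries_subgroup assms] by (simp add: coh_class_def)
  also have "\<dots> \<longleftrightarrow> (\<exists>y\<in>carrier (gr M (i - 1)). m \<otimes>\<^bsub>cocycles M i\<^esub> inv\<^bsub>cocycles M i\<^esub> n = df M (i - 1) y)"
    by (auto simp: coboundaries_def)
  also have "\<dots> \<longleftrightarrow> (\<exists>y\<in>carrier (gr M (i - 1)). m = df M (i - 1) y \<otimes>\<^bsub>cocycles M i\<^esub> n)"
    using assms coboundary_cyc by (intro bex_cong refl) (metis Z.inv_solve_right)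
  finally show ?thesis by simp
qed

lemma coh_class_eq_one_iff:
  assumes "m \<in> cyc M i"
  shows "coh_class M i m = \<one>\<^bsub>coh M i\<^esub> \<longleftrightarrow> (\<exists>y\<in>carrier (gr M (i - 1)). m = df M (i - 1) y)"
proof -
  interpret Z: comm_group "cocycles M i" by (rule cocycles_comm_group)
  show ?thesis
    unfolding one_coh coh_class_eq_iff[OF assms one_cyc]
    using coboundary_cyc[of _ i] Z.r_one by (intro bex_cong refl) fastforce
qed

lemma coh_rep:
  assumes "x \<in> carrier (coh M i)"
  shows "(SOME m. m \<in> x) \<in> cyc M i" "coh_class M i (SOME m. m \<in> x) = x"
proof -
  obtain m where "m \<in> cyc M i" "x = coh_class M i m"
    using assms unfolding coh_def carrier_FactGroup coh_class_def by blast
  then show "(SOME m. m \<in> x) \<in> cyc M i" "coh_class M i (SOME m. m \<in> x) = x"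
    using comm_group.rcos_some[OF cocycles_comm_group coboundaries_subgroup]
    unfolding coh_class_def by metis+
qed

lemma coh_cases:
  assumes "x \<in> carrier (coh M i)"
  obtains m where "m \<in> cyc M i" "x = coh_class M i m"
  using coh_rep[OF assms] that by metis

lemma coh_lepoll: "carrier (coh M i) \<lesssim> carrier (gr M i)"
  unfolding lepoll_def
proof (intro exI conjI)
  show "inj_on (\<lambda>x. SOME m. m \<in> x) (carrier (coh M i))"
    by (rule inj_onI) (metis coh_rep(2))
qed (auto simp: cycD coh_rep)

end

text \<open>What functoriality of cohomology needs of a strict homomorphism; the two complexes may live over
  different types.\<close>

definition chain_map :: "('u, 'y) cochain_scheme \<Rightarrow> ('v, 'z) cochain_scheme \<Rightarrow> (int \<Rightarrow> 'u \<Rightarrow> 'v) \<Rightarrow> bool"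
  where "chain_map M N f \<longleftrightarrow> (\<forall>i. f i \<in> hom (gr M i) (gr N i)) \<and>
    (\<forall>i. \<forall>m\<in>carrier (gr M i). f (i + 1) (df M i m) = df N i (f i m))"

lemma chain_map_cyc:
  assumes "cochain_complex M" "cochain_complex N" "chain_map M N f" "m \<in> cyc M i"
  shows "f i m \<in> cyc N i"
proof -
  interpret M: cochain_complex M by fact
  interpret N: cochain_complex N by fact
  have h: "\<And>i. f i \<in> hom (gr M i) (gr N i)" using assms(3) by (simp add: chain_map_def)
  have "df N i (f i m) = f (i + 1) (df M i m)" using assms(3) cycD[OF assms(4)] by (simp add: chain_map_def)
  then show ?thesis
    using assms(4) hom_in_carrier[OF h] hom_one'[OF M.gr_comm_group N.gr_comm_group h] by (simp add: cyc_iff)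
qed

lemma chain_map_class_eq:
  assumes "cochain_complex M" "cochain_complex N" "chain_map M N f"
    and "m \<in> cyc M i" "n \<in> cyc M i" "coh_class M i m = coh_class M i n"
  shows "coh_class N i (f i m) = coh_class N i (f i n)"
proof -
  interpret M: cochain_complex M by fact
  interpret N: cochain_complex N by fact
  have h: "\<And>i. f i \<in> hom (gr M i) (gr N i)"
    and c: "\<And>i m. m \<in> carrier (gr M i) \<Longrightarrow> f (i + 1) (df M i m) = df N i (f i m)"
    using assms(3) by (simp_all add: chain_map_def)
  obtain y where y: "y \<in> carrier (gr M (i - 1))" "m = df M (i - 1) y \<otimes>\<^bsub>gr M i\<^esub> n"
    using assms M.coh_class_eq_iff by blast
  have "f i m = df N (i - 1) (f (i - 1) y) \<otimes>\<^bsub>gr N i\<^esub> f i n"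
    using c[OF y(1)] y(2) hom_mult[OF h, of "df M (i - 1) y" i n] M.coboundary_cyc[OF y(1)] assms(5)
    by (simp add: cyc_iff)
  then show ?thesis
    using N.coh_class_eq_iff chain_map_cyc[OF assms(1-3)] assms(4,5) hom_in_carrier[OF h y(1)] by blast
qed

lemma coh_map_class:
  assumes "cochain_complex M" "cochain_complex N" "chain_map M N f" "m \<in> cyc M i"
  shows "coh_map M N i f (coh_class M i m) = coh_class N i (f i m)"
proof -
  interpret M: cochain_complex M by fact
  have c: "coh_class M i m \<in> carrier (coh M i)" using assms(4) by (rule M.coh_class_closed)
  show ?thesis
    using chain_map_class_eq[OF assms(1-3) M.coh_rep(1)[OF c] assms(4) M.coh_rep(2)[OF c]] c
    by (simp add: coh_map_def)
qed

lemma coh_map_hom: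
  assumes "cochain_complex M" "cochain_complex N" "chain_map M N f"
  shows "coh_map M N i f \<in> hom (coh M i) (coh N i)"
proof (rule homI)
  interpret M: cochain_complex M by fact
  interpret N: cochain_complex N by fact
  have h: "f i \<in> hom (gr M i) (gr N i)" using assms(3) by (simp add: chain_map_def)
  note cl = coh_map_class[OF assms] chain_map_cyc[OF assms]
  show "coh_map M N i f x \<in> carrier (coh N i)" if "x \<in> carrier (coh M i)" for x
    using that by (auto elim!: M.coh_cases simp: cl N.coh_class_closed)
  show "coh_map M N i f (x \<otimes>\<^bsub>coh M i\<^esub> y) = coh_map M N i f x \<otimes>\<^bsub>coh N i\<^esub> coh_map M N i f y"
    if xy: "x \<in> carrier (coh M i)" "y \<in> carrier (coh M i)" for x y
  proof -
    obtain m n where m: "m \<in> cyc M i" "x = coh_class M i m" and n: "n \<in> cyc M i" "y = coh_class M i n"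
      using xy M.coh_cases by metis
    then show ?thesis
      by (simp add: cl M.coh_class_mult[symmetric] N.coh_class_mult[symmetric] M.mult_cyc
          hom_mult[OF h] cycD)
  qed
qed

section \<open>Localization of categories\<close>

locale localizable =
  fixes C :: "('o, 'm) category" and W :: "'o \<Rightarrow> 'o \<Rightarrow> 'm set"
  assumes Idt_Mor: "X \<in> Ob C \<Longrightarrow> Idt C X \<in> Mor C X X"
    and Cmp_Mor: "\<lbrakk>X \<in> Ob C; Y \<in> Ob C; Z \<in> Ob C; f \<in> Mor C X Y; g \<in> Mor C Y Z\<rbrakk> \<Longrightarrow>
      Cmp C X Y Z g f \<in> Mor C X Z"
    and W_Mor: "w \<in> W X Y \<Longrightarrow> w \<in> Mor C X Y"
begin

abbreviation (input) "zz \<equiv> zigzag C W"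
abbreviation (input) "cls \<equiv> zz_class C W"
abbreviation (input) "D \<equiv> localization C W"

lemma zz_Ob: "zz X p Y \<Longrightarrow> X \<in> Ob C \<and> Y \<in> Ob C"
  by (induction rule: zigzag.induct) auto

lemma zz_append: "zz X p Y \<Longrightarrow> zz Y q Z \<Longrightarrow> zz X (p @ q) Z"
  by (induction rule: zigzag.induct) (auto intro: zigzag.intros)

lemma zz_Fwd: "\<lbrakk>X \<in> Ob C; Y \<in> Ob C; f \<in> Mor C X Y\<rbrakk> \<Longrightarrow> zz X [Fwd X Y f] Y"
  by (intro zigzag.intros)

lemma zz_Bwd: "\<lbrakk>X \<in> Ob C; Y \<in> Ob C; w \<in> W Y X\<rbrakk> \<Longrightarrow> zz X [Bwd X Y w] Y"
  by (intro zigzag.intros)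

lemma zz_eq_zz: "zz_eq C W X Y p q \<Longrightarrow> zz X p Y \<and> zz X q Y"
proof (induction rule: zz_eq.induct)
  case (zz_cong V p X Y q q' r Z)
  then show ?case by (meson zz_append)
qed (auto intro!: zigzag.intros intro: Idt_Mor Cmp_Mor dest: W_Mor)

lemma cls_eq_iff:
  assumes "zz X p Y"
  shows "cls X Y p = cls X Y q \<longleftrightarrow> zz_eq C W X Y p q"
proof
  assume "cls X Y p = cls X Y q"
  moreover have "p \<in> cls X Y p" using zz_refl[OF assms] by (simp add: zz_class_def)
  ultimately show "zz_eq C W X Y p q" by (auto simp: zz_class_def intro: zz_sym)
qed (auto simp: zz_class_def intro: zz_sym zz_trans)

lemma some_cls:
  assumes "zz X p Y"
  shows "zz_eq C W X Y p (SOME q. q \<in> cls X Y p)" "zz X (SOME q. q \<in> cls X Y p) Y"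
proof -
  have "p \<in> cls X Y p" using zz_refl[OF assms] by (simp add: zz_class_def)
  then have "(SOME q. q \<in> cls X Y p) \<in> cls X Y p" by (rule someI)
  then show "zz_eq C W X Y p (SOME q. q \<in> cls X Y p)" by (simp add: zz_class_def)
  then show "zz X (SOME q. q \<in> cls X Y p) Y" by (simp add: zz_eq_zz)
qed

lemma Ob_loc [simp]: "Ob D = Ob C"
  by (simp add: localization_def)

lemma cls_Mor: "zz X p Y \<Longrightarrow> cls X Y p \<in> Mor D X Y"
  by (auto simp: localization_def)

lemma Mor_loc:
  assumes "\<phi> \<in> Mor D X Y" obtains p where "zz X p Y" "\<phi> = cls X Y p"
  using assms by (auto simp: localization_def)

lemma Mor_Ob: "\<phi> \<in> Mor D X Y \<Longrightarrow> X \<in> Ob C \<and> Y \<in> Ob C"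
  by (metis Mor_loc zz_Ob)

lemma zz_eq_append:
  assumes "zz_eq C W X Y p p'" "zz_eq C W Y Z q q'"
  shows "zz_eq C W X Z (p @ q) (p' @ q')"
proof -
  have z: "zz X p Y" "zz X p' Y" "zz Y q Z" "zz Y q' Z" using assms zz_eq_zz by blast+
  have nil: "zz X [] X" "zz Z [] Z" using z zz_Ob by (auto intro: zigzag.intros)
  have "zz_eq C W X Z (p @ q) (p' @ q)" using zz_cong[OF nil(1) assms(1) z(3)] by simp
  moreover have "zz_eq C W X Z (p' @ q) (p' @ q')" using zz_cong[OF z(2) assms(2) nil(2)] by simp
  ultimately show ?thesis by (rule zz_trans)
qed

lemma Cmp_cls:
  assumes "zz X p Y" "zz Y q Z"
  shows "Cmp D X Y Z (cls Y Z q) (cls X Y p) = cls X Z (p @ q)"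
proof -
  have "cls X Z (p @ q) = cls X Z ((SOME r. r \<in> cls X Y p) @ (SOME r. r \<in> cls Y Z q))"
    using zz_eq_append[OF some_cls(1)[OF assms(1)] some_cls(1)[OF assms(2)]]
      cls_eq_iff[OF zz_append[OF assms]] by blast
  then show ?thesis by (simp add: localization_def)
qed

lemma Idt_loc: "Idt D X = cls X X []"
  by (simp add: localization_def)

lemma Idt_loc_Mor: "X \<in> Ob C \<Longrightarrow> Idt D X \<in> Mor D X X"
  by (simp add: Idt_loc cls_Mor zz_nil)

lemma Cmp_loc_Mor:
  assumes "\<phi> \<in> Mor D X Y" "\<psi> \<in> Mor D Y Z"
  shows "Cmp D X Y Z \<psi> \<phi> \<in> Mor D X Z"
  using assms by (metis Mor_loc Cmp_cls cls_Mor zz_append)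

lemma Cmp_Idt_left:
  assumes "\<phi> \<in> Mor D X Y" shows "Cmp D X Y Y (Idt D Y) \<phi> = \<phi>"
proof -
  obtain p where p: "zz X p Y" "\<phi> = cls X Y p" using assms by (rule Mor_loc)
  have "zz Y [] Y" using zz_Ob[OF p(1)] by (auto intro: zigzag.intros)
  from Cmp_cls[OF p(1) this] show ?thesis by (simp add: p Idt_loc)
qed

lemma Cmp_Idt_right:
  assumes "\<phi> \<in> Mor D X Y" shows "Cmp D X X Y \<phi> (Idt D X) = \<phi>"
proof -
  obtain p where p: "zz X p Y" "\<phi> = cls X Y p" using assms by (rule Mor_loc)
  have "zz X [] X" using zz_Ob[OF p(1)] by (auto intro: zigzag.intros)
  from Cmp_cls[OF this p(1)] show ?thesis by (simp add: p Idt_loc)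
qed

lemma Cmp_assoc:
  assumes "\<phi> \<in> Mor D X Y" "\<psi> \<in> Mor D Y Z" "\<chi> \<in> Mor D Z V"
  shows "Cmp D X Y V (Cmp D Y Z V \<chi> \<psi>) \<phi> = Cmp D X Z V \<chi> (Cmp D X Y Z \<psi> \<phi>)"
proof -
  obtain p q r where "zz X p Y" "\<phi> = cls X Y p" "zz Y q Z" "\<psi> = cls Y Z q" "zz Z r V" "\<chi> = cls Z V r"
    using assms Mor_loc by metis
  then show ?thesis by (simp add: Cmp_cls zz_append)
qed

abbreviation (input) "fwd X Y f \<equiv> cls X Y [Fwd X Y f]"
abbreviation (input) "bwd X Y w \<equiv> cls X Y [Bwd X Y w]"

lemma fwd_Mor: "\<lbrakk>X \<in> Ob C; Y \<in> Ob C; f \<in> Mor C X Y\<rbrakk> \<Longrightarrow> fwd X Y f \<in> Mor D X Y"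
  by (intro cls_Mor zz_Fwd)

lemma bwd_Mor: "\<lbrakk>X \<in> Ob C; Y \<in> Ob C; w \<in> W Y X\<rbrakk> \<Longrightarrow> bwd X Y w \<in> Mor D X Y"
  by (intro cls_Mor zz_Bwd)

lemma fwd_Idt: "X \<in> Ob C \<Longrightarrow> fwd X X (Idt C X) = Idt D X"
  using zz_idt[of X C W] Idt_Mor by (simp add: Idt_loc cls_eq_iff zz_Fwd)

lemma fwd_Cmp:
  assumes "X \<in> Ob C" "Y \<in> Ob C" "Z \<in> Ob C" "f \<in> Mor C X Y" "g \<in> Mor C Y Z"
  shows "fwd X Z (Cmp C X Y Z g f) = Cmp D X Y Z (fwd Y Z g) (fwd X Y f)"
proof -
  have "zz_eq C W X Z [Fwd X Y f, Fwd Y Z g] [Fwd X Z (Cmp C X Y Z g f)]"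
    by (rule zz_cmp) fact+
  then have "cls X Z ([Fwd X Y f] @ [Fwd Y Z g]) = fwd X Z (Cmp C X Y Z g f)"
    using assms cls_eq_iff[OF zz_append[OF zz_Fwd zz_Fwd], of X Y f Z g] by simp
  then show ?thesis
    using assms by (simp add: Cmp_cls zz_Fwd)
qed

lemma bwd_fwd:
  assumes "X \<in> Ob C" "Y \<in> Ob C" "w \<in> W X Y"
  shows "Cmp D X Y X (bwd Y X w) (fwd X Y w) = Idt D X"
    and "Cmp D Y X Y (fwd X Y w) (bwd Y X w) = Idt D Y"
proof -
  have f: "zz X [Fwd X Y w] Y" and b: "zz Y [Bwd Y X w] X"
    using assms W_Mor by (auto intro: zz_Fwd zz_Bwd)
  show "Cmp D X Y X (bwd Y X w) (fwd X Y w) = Idt D X"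
    using zz_inv[of X C Y w W, OF assms] cls_eq_iff[OF zz_append[OF f b]] by (simp add: Cmp_cls[OF f b] Idt_loc)
  show "Cmp D Y X Y (fwd X Y w) (bwd Y X w) = Idt D Y"
    using zz_inv'[of X C Y w W, OF assms] cls_eq_iff[OF zz_append[OF b f]] by (simp add: Cmp_cls[OF b f] Idt_loc)
qed

lemma loc_functor_functor: "is_functor C D (loc_functor C W)"
  by (auto simp: is_functor_def loc_functor_def fwd_Mor fwd_Idt fwd_Cmp)

lemma loc_functor_simps [simp]: "fob (loc_functor C W) X = X" "fmor (loc_functor C W) X Y f = fwd X Y f"
  by (simp_all add: loc_functor_def)

text \<open>After localization a morphism in \<open>W\<close> can be cancelled on the left. Applied to the projection of a
  cylinder, this identifies homotopic homomorphisms.\<close>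

lemma W_cancel:
  assumes ob: "X \<in> Ob C" "Y \<in> Ob C" "Z \<in> Ob C" and f: "f \<in> Mor C X Y" and g: "g \<in> Mor C X Y"
    and w: "w \<in> W Y Z" and eq: "Cmp C X Y Z w f = Cmp C X Y Z w g"
  shows "fwd X Y f = fwd X Y g"
proof -
  have "fwd X Y h = Cmp D X Z Y (bwd Z Y w) (fwd X Z (Cmp C X Y Z w h))" if "h \<in> Mor C X Y" for h
  proof -
    have m: "fwd X Y h \<in> Mor D X Y" "fwd Y Z w \<in> Mor D Y Z" "bwd Z Y w \<in> Mor D Z Y"
      using ob w that W_Mor by (auto intro: fwd_Mor bwd_Mor)
    show ?thesis
      using Cmp_assoc[OF m] bwd_fwd(1)[OF ob(2,3) w] Cmp_Idt_left[OF m(1)]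
        fwd_Cmp[OF ob that W_Mor[OF w]] by simp
  qed
  then show ?thesis using f g eq by metis
qed

text \<open>Induction on a zigzag that peels off its first step.\<close>

lemma loc_induct [consumes 1, case_names Idt fwd bwd]:
  assumes \<phi>: "\<phi> \<in> Mor D X Y"
    and Idt: "\<And>Y. Y \<in> Ob C \<Longrightarrow> P Y Y (Idt D Y)"
    and fwd: "\<And>X Y Z f \<phi>. \<lbrakk>X \<in> Ob C; Y \<in> Ob C; f \<in> Mor C X Y; \<phi> \<in> Mor D Y Z; P Y Z \<phi>\<rbrakk> \<Longrightarrow>
      P X Z (Cmp D X Y Z \<phi> (fwd X Y f))"
    and bwd: "\<And>X Y Z w \<phi>. \<lbrakk>X \<in> Ob C; Y \<in> Ob C; w \<in> W Y X; \<phi> \<in> Mor D Y Z; P Y Z \<phi>\<rbrakk> \<Longrightarrow>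
      P X Z (Cmp D X Y Z \<phi> (bwd X Y w))"
  shows "P X Y \<phi>"
proof -
  obtain p where p: "zz X p Y" "\<phi> = cls X Y p" using \<phi> by (rule Mor_loc)
  have "P X Y (cls X Y p)"
    using p(1)
  proof induction
    case (zz_nil X)
    then show ?case using Idt by (simp add: Idt_loc)
  next
    case (zz_fwd X Y f p Z)
    have "Cmp D X Y Z (cls Y Z p) (fwd X Y f) = cls X Z (Fwd X Y f # p)"
      using Cmp_cls[OF zz_Fwd zz_fwd(4), of X f] zz_fwd by simp
    then show ?case using fwd[of X Y f "cls Y Z p" Z] zz_fwd cls_Mor by simp
  next
    case (zz_bwd X Y w p Z)
    have "Cmp D X Y Z (cls Y Z p) (bwd X Y w) = cls X Z (Bwd X Y w # p)"
      using Cmp_cls[OF zz_Bwd zz_bwd(4), of X w] zz_bwd by simp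
    then show ?case using bwd[of X Y w "cls Y Z p" Z] zz_bwd cls_Mor by simp
  qed
  then show ?thesis by (simp add: p)
qed

end

section \<open>Cohomology on the derived category\<close>

lemma strict_homsD:
  assumes "f \<in> strict_homs B M N"
  shows "f i \<in> hom (gr M i) (gr N i)" "f i \<in> extensional (carrier (gr M i))"
    "m \<in> carrier (gr M i) \<Longrightarrow> f i m \<in> carrier (gr N i)"
    "m \<in> carrier (gr M i) \<Longrightarrow> f (i + 1) (df M i m) = df N i (f i m)"
    "b \<in> carrier (gr B j) \<Longrightarrow> m \<in> carrier (gr M i) \<Longrightarrow> f (j + i) (act M j i b m) = act N j i b (f i m)"
    "chain_map M N f"
  using assms hom_in_carrier[of "f i" "gr M i" "gr N i"] by (auto simp: strict_homs_def chain_map_def)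

lemma dg_module_complex: "dg_module B M \<Longrightarrow> cochain_complex M"
  by (simp add: dg_module_def)

lemma strict_cat_simps [simp]: "M \<in> Ob (strict_cat B) \<longleftrightarrow> dg_module B M"
  "Mor (strict_cat B) = strict_homs B"
  "Idt (strict_cat B) M = (\<lambda>i. \<lambda>m\<in>carrier (gr M i). m)"
  "Cmp (strict_cat B) M N P g f = (\<lambda>i. compose (carrier (gr M i)) (g i) (f i))"
  by (simp_all add: strict_cat_def)

lemma strict_id:
  assumes "dg_module B M" shows "(\<lambda>i. \<lambda>m\<in>carrier (gr M i). m) \<in> strict_homs B M M"
proof -
  interpret dg_module B M by fact
  have "(\<lambda>m\<in>carrier (gr M i). m) \<in> hom (gr M i) (gr M i)" for i
    using gr_group[of i] by (auto simp: hom_def group.is_monoid monoid.m_closed)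
  then show ?thesis by (simp add: strict_homs_def df_closed act_closed)
qed

lemma strict_comp:
  assumes M: "dg_module B M" and f: "f \<in> strict_homs B M N" and g: "g \<in> strict_homs B N P"
  shows "(\<lambda>i. compose (carrier (gr M i)) (g i) (f i)) \<in> strict_homs B M P"
proof -
  interpret M: dg_module B M by fact
  have "compose (carrier (gr M i)) (g i) (f i) \<in> hom (gr M i) (gr P i)" for i
    using strict_homsD(1)[OF f, of i] strict_homsD(1)[OF g, of i] M.gr_group[of i]
    by (auto simp: hom_def compose_def group.is_monoid monoid.m_closed Pi_iff)
  then show ?thesis
    by (auto simp: strict_homs_def compose_eq M.df_closed M.act_closed strict_homsD[OF f] strict_homsD[OF g])
qed

interpretation str: localizable "strict_cat B" "quasi_isos B" for B
  by unfold_locales (auto intro: strict_id strict_comp simp: quasi_isos_def)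

lemma Ob_der [simp]: "M \<in> Ob (der_cat B) \<longleftrightarrow> dg_module B M"
  by (simp add: der_cat_def)

lemma quasi_isosD:
  assumes "w \<in> quasi_isos B M N"
  shows "w \<in> strict_homs B M N" "bij_betw (coh_map M N i w) (carrier (coh M i)) (carrier (coh N i))"
  using assms by (auto simp: quasi_isos_def)

lemma coh_map_comp:
  assumes "dg_module B M" "dg_module B N" "dg_module B P" "f \<in> strict_homs B M N" "g \<in> strict_homs B N P"
    and "x \<in> carrier (coh M i)"
  shows "coh_map M P i (\<lambda>i. compose (carrier (gr M i)) (g i) (f i)) x = coh_map N P i g (coh_map M N i f x)"
proof -
  obtain m where m: "m \<in> cyc M i" "x = coh_class M i m"
    using cochain_complex.coh_cases[OF dg_module_complex[OF assms(1)] assms(6)] by blast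
  note c = dg_module_complex[OF assms(1)] dg_module_complex[OF assms(2)] dg_module_complex[OF assms(3)]
  note h = strict_homsD(6)[OF assms(4)] strict_homsD(6)[OF assms(5)]
    strict_homsD(6)[OF strict_comp[OF assms(1,4,5)]]
  show ?thesis
    using m chain_map_cyc[OF c(1,2) h(1) m(1)]
    by (simp add: coh_map_class[OF c(1,3) h(3)] coh_map_class[OF c(1,2) h(1)]
        coh_map_class[OF c(2,3) h(2)] compose_eq cycD)
qed

lemma coh_map_id:
  assumes "dg_module B M" "x \<in> carrier (coh M i)"
  shows "coh_map M M i (\<lambda>i. \<lambda>m\<in>carrier (gr M i). m) x = x"
proof -
  note c = dg_module_complex[OF assms(1)]
  obtain m where m: "m \<in> cyc M i" "x = coh_class M i m"
    using cochain_complex.coh_cases[OF c assms(2)] by blast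
  show ?thesis
    using m by (simp add: coh_map_class[OF c c strict_homsD(6)[OF strict_id[OF assms(1)]]] cycD)
qed

lemma coh_map_strict_hom:
  assumes "dg_module B M" "dg_module B N" "f \<in> strict_homs B M N"
  shows "coh_map M N i f \<in> hom (coh M i) (coh N i)"
  by (rule coh_map_hom[OF dg_module_complex[OF assms(1)] dg_module_complex[OF assms(2)] strict_homsD(6)[OF assms(3)]])

lemma coh_map_inv_hom:
  assumes "dg_module B M" "dg_module B N" "w \<in> quasi_isos B M N"
  shows "inv_into (carrier (coh M i)) (coh_map M N i w) \<in> hom (coh N i) (coh M i)"
proof -
  have "coh_map M N i w \<in> iso (coh M i) (coh N i)"
    using coh_map_strict_hom[OF assms(1,2)] quasi_isosD[OF assms(3)] by (auto simp: iso_def)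
  then have "inv_into (carrier (coh M i)) (coh_map M N i w) \<in> iso (coh N i) (coh M i)"
    by (rule group.iso_set_sym[OF cochain_complex.coh_group[OF dg_module_complex[OF assms(1)]]])
  then show ?thesis by (simp add: iso_def)
qed

lemma zz_coh_ext: "zz_coh i X p \<in> extensional (carrier (coh X i))"
  by (induction i X p rule: zz_coh.induct) (simp_all only: zz_coh.simps restrict_extensional compose_extensional)

lemma zz_coh_hom:
  assumes "zigzag (strict_cat B) (quasi_isos B) X p Y"
  shows "zz_coh i X p \<in> hom (coh X i) (coh Y i)"
  using assms
proof induction
  case (zz_nil X)
  then have "group (coh X i)" by (simp add: cochain_complex.coh_group dg_module_complex)
  then show ?case by (auto simp: hom_def group.is_monoid monoid.m_closed)
next
  case (zz_fwd X Y f p Z)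
  have g: "group (coh X i)" using zz_fwd(1) by (simp add: cochain_complex.coh_group dg_module_complex)
  have "coh_map X Y i f \<in> hom (coh X i) (coh Y i)" using zz_fwd by (auto intro: coh_map_strict_hom)
  from hom_comp[OF this zz_fwd.IH] show ?case
    using g by (auto simp: hom_def compose_eq group.is_monoid monoid.m_closed)
next
  case (zz_bwd X Y w p Z)
  have g: "group (coh X i)" using zz_bwd(1) by (simp add: cochain_complex.coh_group dg_module_complex)
  have "inv_into (carrier (coh Y i)) (coh_map Y X i w) \<in> hom (coh X i) (coh Y i)"
    using zz_bwd by (auto intro: coh_map_inv_hom)
  from hom_comp[OF this zz_bwd.IH] show ?case
    using g by (auto simp: hom_def compose_eq group.is_monoid monoid.m_closed)
qed

lemma zz_coh_append:
  assumes "zigzag (strict_cat B) (quasi_isos B) X p Y"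
  shows "zz_coh i X (p @ q) = compose (carrier (coh X i)) (zz_coh i Y q) (zz_coh i X p)"
  using assms
proof induction
  case (zz_nil X)
  show ?case
    by (rule extensionalityI[OF zz_coh_ext]) (auto simp: compose_eq)
next
  case (zz_fwd X Y f p Z)
  have "coh_map X Y i f \<in> hom (coh X i) (coh Y i)" using zz_fwd by (auto intro: coh_map_strict_hom)
  then show ?case
    by (intro extensionalityI[OF zz_coh_ext compose_extensional])
      (simp add: compose_eq zz_fwd.IH hom_in_carrier)
next
  case (zz_bwd X Y w p Z)
  have "inv_into (carrier (coh Y i)) (coh_map Y X i w) \<in> hom (coh X i) (coh Y i)"
    using zz_bwd by (auto intro: coh_map_inv_hom)
  then show ?case
    by (intro extensionalityI[OF zz_coh_ext compose_extensional])
      (simp add: compose_eq zz_bwd.IH hom_in_carrier)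
qed

text \<open>Cohomology turns quasi-isomorphisms into bijections, so a zigzag acts on it, and the congruence of
  zigzags is respected generator by generator.\<close>

lemma zz_coh_eq:
  "zz_eq (strict_cat B) (quasi_isos B) X Y p q \<Longrightarrow> zz_coh i X p = zz_coh i X q"
proof (induction rule: zz_eq.induct)
  case (zz_cong V p X Y q q' r Z)
  have q: "zigzag (strict_cat B) (quasi_isos B) X q Y" "zigzag (strict_cat B) (quasi_isos B) X q' Y"
    using str.zz_eq_zz[OF zz_cong(2)] by auto
  show ?case
    by (simp add: zz_coh_append[OF zz_cong(1)] zz_coh_append[OF q(1)] zz_coh_append[OF q(2)] zz_cong.IH)
next
  case (zz_idt X)
  show ?case
    by (rule extensionalityI[OF zz_coh_ext zz_coh_ext])
      (use zz_idt in \<open>auto simp: compose_eq coh_map_id\<close>)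
next
  case (zz_cmp X Y Z f g)
  then have "coh_map X Y i f \<in> hom (coh X i) (coh Y i)" "coh_map Y Z i g \<in> hom (coh Y i) (coh Z i)"
    by (auto intro: coh_map_strict_hom)
  then show ?case
    by (intro extensionalityI[OF zz_coh_ext zz_coh_ext])
      (use zz_cmp in \<open>auto simp: compose_eq coh_map_comp hom_in_carrier\<close>)
next
  case (zz_inv X Y w)
  then have "coh_map X Y i w \<in> hom (coh X i) (coh Y i)"
    by (auto intro: coh_map_strict_hom simp: quasi_isosD)
  then show ?case
    by (intro extensionalityI[OF zz_coh_ext zz_coh_ext])
      (use bij_betw_inv_into_left[OF quasi_isosD(2)[OF zz_inv(3)]] in \<open>auto simp: compose_eq hom_in_carrier\<close>)
next
  case (zz_inv' X Y w)
  then have "inv_into (carrier (coh X i)) (coh_map X Y i w) \<in> hom (coh Y i) (coh X i)"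
    "coh_map X Y i w \<in> hom (coh X i) (coh Y i)"
    by (auto intro: coh_map_strict_hom coh_map_inv_hom simp: quasi_isosD)
  then show ?case
    by (intro extensionalityI[OF zz_coh_ext zz_coh_ext])
      (use bij_betw_inv_into_right[OF quasi_isosD(2)[OF zz_inv'(3)]] in \<open>auto simp: compose_eq hom_in_carrier\<close>)
qed auto

abbreviation (input) "fwd B X Y f \<equiv> zz_class (strict_cat B) (quasi_isos B) X Y [Fwd X Y f]"

lemma der_coh_cls:
  assumes "zigzag (strict_cat B) (quasi_isos B) X p Y"
  shows "der_coh_map i X (zz_class (strict_cat B) (quasi_isos B) X Y p) = zz_coh i X p"
  unfolding der_coh_map_def using zz_coh_eq[OF str.some_cls(1)[OF assms]] by simp

lemma der_coh_hom:
  assumes "\<phi> \<in> Mor (der_cat B) X Y" shows "der_coh_map i X \<phi> \<in> hom (coh X i) (coh Y i)"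
  using assms unfolding der_cat_def by (metis str.Mor_loc der_coh_cls zz_coh_hom)

lemma der_coh_closed:
  "\<phi> \<in> Mor (der_cat B) X Y \<Longrightarrow> x \<in> carrier (coh X i) \<Longrightarrow> der_coh_map i X \<phi> x \<in> carrier (coh Y i)"
  using hom_in_carrier[OF der_coh_hom] .

lemma der_coh_Cmp:
  assumes "\<phi> \<in> Mor (der_cat B) X Y" "\<psi> \<in> Mor (der_cat B) Y Z"
  shows "der_coh_map i X (Cmp (der_cat B) X Y Z \<psi> \<phi>) =
    compose (carrier (coh X i)) (der_coh_map i Y \<psi>) (der_coh_map i X \<phi>)"
proof -
  obtain p q where "zigzag (strict_cat B) (quasi_isos B) X p Y" "zigzag (strict_cat B) (quasi_isos B) Y q Z"
    "\<phi> = zz_class (strict_cat B) (quasi_isos B) X Y p" "\<psi> = zz_class (strict_cat B) (quasi_isos B) Y Z q"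
    using assms unfolding der_cat_def by (metis str.Mor_loc)
  then show ?thesis
    by (simp add: der_cat_def str.Cmp_cls der_coh_cls str.zz_append zz_coh_append)
qed

lemma der_coh_Cmp':
  assumes "\<phi> \<in> Mor (der_cat B) X Y" "\<psi> \<in> Mor (der_cat B) Y Z" "x \<in> carrier (coh X i)"
  shows "der_coh_map i X (Cmp (der_cat B) X Y Z \<psi> \<phi>) x = der_coh_map i Y \<psi> (der_coh_map i X \<phi> x)"
  using assms(3) by (simp add: der_coh_Cmp[OF assms(1,2)] compose_eq)

lemma der_coh_Idt:
  assumes "dg_module B X" shows "der_coh_map i X (Idt (der_cat B) X) = (\<lambda>x\<in>carrier (coh X i). x)"
proof -
  have "zigzag (strict_cat B) (quasi_isos B) X [] X" using assms by (auto intro: zigzag.intros)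
  then show ?thesis by (simp add: der_cat_def str.Idt_loc der_coh_cls)
qed

lemma der_coh_fwd:
  assumes "dg_module B X" "dg_module B Y" "f \<in> strict_homs B X Y" "x \<in> carrier (coh X i)"
  shows "der_coh_map i X (fwd B X Y f) x = coh_map X Y i f x"
proof -
  have "zigzag (strict_cat B) (quasi_isos B) X [Fwd X Y f] Y" using assms by (auto intro: str.zz_Fwd)
  moreover have "coh_map X Y i f x \<in> carrier (coh Y i)"
    using hom_in_carrier[OF coh_map_strict_hom[OF assms(1-3)] assms(4)] .
  ultimately show ?thesis using assms(4) by (simp add: der_coh_cls compose_eq)
qed

lemma der_Mor_dg: "\<phi> \<in> Mor (der_cat B) X Y \<Longrightarrow> dg_module B X \<and> dg_module B Y"
  unfolding der_cat_def using str.Mor_Ob by fastforce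

lemma fwd_der_Mor:
  "dg_module B X \<Longrightarrow> dg_module B Y \<Longrightarrow> f \<in> strict_homs B X Y \<Longrightarrow> fwd B X Y f \<in> Mor (der_cat B) X Y"
  unfolding der_cat_def by (rule str.fwd_Mor) auto

section \<open>The action of cocycles on cohomology\<close>

text \<open>Scalars of \<open>K\<close> and elements of $H^0(A)$ act on cohomology through cocycles of degree 0. Working with
  cocycles instead of classes avoids one choice of representatives.\<close>

definition coh_op :: "('a, 'u) dg_module \<Rightarrow> int \<Rightarrow> 'a \<Rightarrow> 'u set \<Rightarrow> 'u set"
  where "coh_op N j b y = coh_class N j (act N 0 j b (SOME n. n \<in> y))"

locale dg_module_over = dg_module + B: cochain_complex A
begin

lemma act_hom: "a \<in> carrier (gr A i) \<Longrightarrow> act M i j a \<in> hom (gr M j) (gr M (i + j))"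
  by (rule homI) (auto simp: act_closed act_add_right)

lemma act_one_right: "a \<in> carrier (gr A i) \<Longrightarrow> act M i j a \<one>\<^bsub>gr M j\<^esub> = \<one>\<^bsub>gr M (i + j)\<^esub>"
  by (rule hom_one'[OF gr_comm_group gr_comm_group act_hom])

lemma act_one_left: "m \<in> carrier (gr M j) \<Longrightarrow> act M i j \<one>\<^bsub>gr A i\<^esub> m = \<one>\<^bsub>gr M (i + j)\<^esub>"
  by (rule hom_one'[OF B.gr_comm_group gr_comm_group, of "\<lambda>a. act M i j a m"])
    (auto intro!: homI simp: act_closed act_add_left)

lemma df_act_cyc:
  assumes "a \<in> cyc A 0" "m \<in> carrier (gr M j)"
  shows "df M j (act M 0 j a m) = act M 0 (j + 1) a (df M j m)"
proof -
  interpret G: comm_group "gr M (j + 1)" by (rule gr_comm_group)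
  have "act M 0 (j + 1) a (df M j m) \<in> carrier (gr M (j + 1))"
    using act_closed[of a 0 "df M j m" "j + 1"] assms df_closed by (simp add: cyc_iff)
  then show ?thesis
    using act_leibniz[of a 0 m j] assms act_one_left[of m j 1]
    by (simp add: cyc_iff koszul_def add.commute[of 1 j])
qed

lemma act_cyc:
  assumes "a \<in> cyc A 0" "m \<in> cyc M j" shows "act M 0 j a m \<in> cyc M j"
  using df_act_cyc[OF assms(1) cycD[OF assms(2)]] act_closed[of a 0 m j] act_one_right[of a 0 "j + 1"] assms
  by (simp add: cyc_iff)

lemma act_coh_class_eq:
  assumes a: "a \<in> cyc A 0" and m: "m \<in> cyc M j" and n: "n \<in> cyc M j" and eq: "coh_class M j m = coh_class M j n"
  shows "coh_class M j (act M 0 j a m) = coh_class M j (act M 0 j a n)"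
proof -
  obtain y where y: "y \<in> carrier (gr M (j - 1))" "m = df M (j - 1) y \<otimes>\<^bsub>gr M j\<^esub> n"
    using eq coh_class_eq_iff[OF m n] by blast
  have "act M 0 j a m = df M (j - 1) (act M 0 (j - 1) a y) \<otimes>\<^bsub>gr M j\<^esub> act M 0 j a n"
    using df_act_cyc[OF a y(1)] act_add_right[of a 0 "df M (j - 1) y" j n] a n y coboundary_cyc[OF y(1)]
    by (simp add: cyc_iff)
  moreover have "act M 0 (j - 1) a y \<in> carrier (gr M (j - 1))"
    using act_closed[of a 0 y "j - 1"] a y by (simp add: cyc_iff)
  ultimately show ?thesis
    unfolding coh_class_eq_iff[OF act_cyc[OF a m] act_cyc[OF a n]] by blast
qed

lemma coh_op_class:
  assumes "a \<in> cyc A 0" "m \<in> cyc M j"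
  shows "coh_op M j a (coh_class M j m) = coh_class M j (act M 0 j a m)"
  unfolding coh_op_def
  using coh_rep[OF coh_class_closed[OF assms(2)]] assms by (intro act_coh_class_eq) auto

lemma coh_op_closed:
  assumes "a \<in> cyc A 0" "x \<in> carrier (coh M j)" shows "coh_op M j a x \<in> carrier (coh M j)"
  using assms by (auto elim!: coh_cases simp: coh_op_class coh_class_closed act_cyc)

lemma coh_op_hom:
  assumes "a \<in> cyc A 0" shows "coh_op M j a \<in> hom (coh M j) (coh M j)"
proof (rule homI)
  fix x y assume xy: "x \<in> carrier (coh M j)" "y \<in> carrier (coh M j)"
  obtain m n where m: "m \<in> cyc M j" "x = coh_class M j m" and n: "n \<in> cyc M j" "y = coh_class M j n"
    using xy coh_cases by metis
  show "coh_op M j a (x \<otimes>\<^bsub>coh M j\<^esub> y) = coh_op M j a x \<otimes>\<^bsub>coh M j\<^esub> coh_op M j a y"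
    using act_add_right[of a 0 m j n] assms m n
    by (simp add: coh_op_class coh_class_mult[symmetric] mult_cyc act_cyc cycD)
qed (rule coh_op_closed[OF assms])

end

lemma coh_map_op:
  assumes B: "cochain_complex B" and M: "dg_module B M" and N: "dg_module B N"
    and f: "f \<in> strict_homs B M N" and b: "b \<in> cyc B 0" and x: "x \<in> carrier (coh M i)"
  shows "coh_map M N i f (coh_op M i b x) = coh_op N i b (coh_map M N i f x)"
proof -
  interpret M: dg_module_over B M using B M by (simp add: dg_module_over_def)
  interpret N: dg_module_over B N using B N by (simp add: dg_module_over_def)
  obtain m where m: "m \<in> cyc M i" "x = coh_class M i m" using M.coh_cases[OF x] by blast
  note cl = coh_map_class[OF M.cochain_complex_axioms N.cochain_complex_axioms strict_homsD(6)[OF f]]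
    chain_map_cyc[OF M.cochain_complex_axioms N.cochain_complex_axioms strict_homsD(6)[OF f]]
  show ?thesis
    using m strict_homsD(5)[OF f, of b 0 m i] b
    by (simp add: M.coh_op_class N.coh_op_class cl M.act_cyc cycD)
qed

text \<open>Strict homomorphisms are linear on cohomology, and so are the inverses of bijective linear maps.\<close>

lemma der_coh_op:
  assumes B: "cochain_complex B" and \<phi>: "\<phi> \<in> Mor (der_cat B) X Y" and b: "b \<in> cyc B 0" and x: "x \<in> carrier (coh X i)"
  shows "der_coh_map i X \<phi> (coh_op X i b x) = coh_op Y i b (der_coh_map i X \<phi> x)"
proof -
  have op: "coh_op M i b y \<in> carrier (coh M i)" if "dg_module B M" "y \<in> carrier (coh M i)" for M :: "('a, 'b) dg_module" and y
    using dg_module_over.coh_op_closed[of B M b y i] that B b by (simp add: dg_module_over_def)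
  obtain p where p: "zigzag (strict_cat B) (quasi_isos B) X p Y" "\<phi> = zz_class (strict_cat B) (quasi_isos B) X Y p"
    using \<phi> unfolding der_cat_def by (rule str.Mor_loc)
  have "zz_coh i X p (coh_op X i b x) = coh_op Y i b (zz_coh i X p x)"
    using p(1) x
  proof (induction arbitrary: x)
    case (zz_nil X) then show ?case by (simp add: op)
  next
    case (zz_fwd X Y f p Z)
    then have "coh_map X Y i f \<in> hom (coh X i) (coh Y i)" by (auto intro: coh_map_strict_hom)
    with zz_fwd show ?case
      by (simp add: compose_eq op hom_in_carrier coh_map_op[OF B _ _ _ b])
  next
    case (zz_bwd X Y w p Z)
    let ?v = "inv_into (carrier (coh Y i)) (coh_map Y X i w)"
    have v: "?v \<in> hom (coh X i) (coh Y i)" using zz_bwd by (auto intro: coh_map_inv_hom)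
    note bij = quasi_isosD(2)[OF zz_bwd(3), of i]
    have vx: "?v x \<in> carrier (coh Y i)" using hom_in_carrier[OF v zz_bwd.prems] .
    have "coh_map Y X i w (coh_op Y i b (?v x)) = coh_op X i b x"
      using zz_bwd vx by (simp add: coh_map_op[OF B _ _ _ b] quasi_isosD(1) bij_betw_inv_into_right[OF bij])
    then have "?v (coh_op X i b x) = coh_op Y i b (?v x)"
      using bij_betw_inv_into_left[OF bij, of "coh_op Y i b (?v x)"] op vx zz_bwd by auto
    then show ?case using zz_bwd vx by (simp add: compose_eq op)
  qed
  then show ?thesis by (simp add: p der_coh_cls)
qed

section \<open>Free modules over a commutative ring\<close>

locale kmodule = K: cring K + G: comm_group G
  for K :: "'k ring" and G :: "'x monoid" and sc :: "'k \<Rightarrow> 'x \<Rightarrow> 'x" +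
  assumes sc_closed: "\<lbrakk>k \<in> carrier K; x \<in> carrier G\<rbrakk> \<Longrightarrow> sc k x \<in> carrier G"
    and sc_add_right: "\<lbrakk>k \<in> carrier K; x \<in> carrier G; y \<in> carrier G\<rbrakk> \<Longrightarrow> sc k (x \<otimes>\<^bsub>G\<^esub> y) = sc k x \<otimes>\<^bsub>G\<^esub> sc k y"
    and sc_add_left: "\<lbrakk>k \<in> carrier K; l \<in> carrier K; x \<in> carrier G\<rbrakk> \<Longrightarrow> sc (k \<oplus>\<^bsub>K\<^esub> l) x = sc k x \<otimes>\<^bsub>G\<^esub> sc l x"
    and sc_assoc: "\<lbrakk>k \<in> carrier K; l \<in> carrier K; x \<in> carrier G\<rbrakk> \<Longrightarrow> sc (k \<otimes>\<^bsub>K\<^esub> l) x = sc k (sc l x)"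
    and sc_one: "x \<in> carrier G \<Longrightarrow> sc \<one>\<^bsub>K\<^esub> x = x"
begin

lemma sc_hom: "k \<in> carrier K \<Longrightarrow> sc k \<in> hom G G"
  by (rule homI) (auto simp: sc_closed sc_add_right)

lemma sc_unit: "k \<in> carrier K \<Longrightarrow> sc k \<one>\<^bsub>G\<^esub> = \<one>\<^bsub>G\<^esub>"
  using hom_one'[OF G.comm_group_axioms G.comm_group_axioms sc_hom] .

lemma sc_inv: "k \<in> carrier K \<Longrightarrow> x \<in> carrier G \<Longrightarrow> sc k (inv\<^bsub>G\<^esub> x) = inv\<^bsub>G\<^esub> sc k x"
  using hom_inv'[OF G.comm_group_axioms G.comm_group_axioms sc_hom] .

lemma sc_zero:
  assumes "x \<in> carrier G" shows "sc \<zero>\<^bsub>K\<^esub> x = \<one>\<^bsub>G\<^esub>"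
proof -
  have "sc \<zero>\<^bsub>K\<^esub> x = sc \<zero>\<^bsub>K\<^esub> x \<otimes>\<^bsub>G\<^esub> sc \<zero>\<^bsub>K\<^esub> x"
    using sc_add_left[of "\<zero>\<^bsub>K\<^esub>" "\<zero>\<^bsub>K\<^esub>" x] assms by simp
  then show ?thesis using sc_closed[OF K.zero_closed assms] by simp
qed

lemma trivial_kmodule: "kmodule K (G\<lparr>carrier := {\<one>\<^bsub>G\<^esub>}\<rparr>) (\<lambda>k x. \<one>\<^bsub>G\<^esub>)"
proof -
  interpret T: comm_group "G\<lparr>carrier := {\<one>\<^bsub>G\<^esub>}\<rparr>" by (rule trivial_comm_group[OF G.comm_group_axioms])
  show ?thesis by unfold_locales auto
qed

end

definition klinear ::
    "'k ring \<Rightarrow> 'x monoid \<Rightarrow> ('k \<Rightarrow> 'x \<Rightarrow> 'x) \<Rightarrow> 'y monoid \<Rightarrow> ('k \<Rightarrow> 'y \<Rightarrow> 'y) \<Rightarrow> ('x \<Rightarrow> 'y) \<Rightarrow> bool"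
  where "klinear K G sc H sc' f \<longleftrightarrow>
    f \<in> hom G H \<and> (\<forall>k\<in>carrier K. \<forall>x\<in>carrier G. f (sc k x) = sc' k (f x))"

lemma klinearD:
  assumes "klinear K G sc H sc' f"
  shows "f \<in> hom G H" "x \<in> carrier G \<Longrightarrow> f x \<in> carrier H"
    "\<lbrakk>x \<in> carrier G; y \<in> carrier G\<rbrakk> \<Longrightarrow> f (x \<otimes>\<^bsub>G\<^esub> y) = f x \<otimes>\<^bsub>H\<^esub> f y"
    "\<lbrakk>k \<in> carrier K; x \<in> carrier G\<rbrakk> \<Longrightarrow> f (sc k x) = sc' k (f x)"
  using assms by (auto simp: klinear_def hom_in_carrier hom_mult)

lemma klinear_comp:
  "klinear K G sc H sc' f \<Longrightarrow> klinear K H sc' I sc'' g \<Longrightarrow> klinear K G sc I sc'' (\<lambda>x. g (f x))"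
  using hom_comp[of f G H g I] hom_in_carrier[of f G H] by (simp add: klinear_def)

lemma klinear_one: "kmodule K H sc' \<Longrightarrow> klinear K G sc H sc' (\<lambda>x. \<one>\<^bsub>H\<^esub>)"
  by (simp add: klinear_def hom_one_fun kmodule.sc_unit kmodule.axioms)

lemma klinear_id: "kmodule K G sc \<Longrightarrow> klinear K G sc G sc (\<lambda>x. x)"
  by (auto simp: klinear_def hom_def kmodule_def comm_group_def group.is_monoid monoid.m_closed)

lemma klinear_mult:
  assumes "kmodule K G sc" "kmodule K H sc'" "klinear K G sc H sc' f" "klinear K G sc H sc' g"
  shows "klinear K G sc H sc' (\<lambda>x. f x \<otimes>\<^bsub>H\<^esub> g x)"
proof -
  interpret G: kmodule K G sc by fact
  interpret H: kmodule K H sc' by fact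
  show ?thesis
    using assms(3,4) hom_mult_fun[OF H.G.comm_group_axioms, of f G g] G.G.is_monoid hom_in_carrier[of f G H] hom_in_carrier[of g G H]
    by (simp add: klinear_def H.sc_add_right)
qed

lemma klinear_inv:
  assumes "kmodule K G sc" "kmodule K H sc'" "klinear K G sc H sc' f"
  shows "klinear K G sc H sc' (\<lambda>x. inv\<^bsub>H\<^esub> f x)"
proof -
  interpret G: kmodule K G sc by fact
  interpret H: kmodule K H sc' by fact
  show ?thesis
    using assms(3) hom_inv_fun[OF H.G.comm_group_axioms, of f G] G.G.is_monoid hom_in_carrier[of f G H]
    by (simp add: klinear_def H.sc_inv)
qed

text \<open>Maps out of the free module are needed only into modules over its own type \<open>'t\<close>, the universe of the
  target category.\<close>

definition free_on ::
    "'k ring \<Rightarrow> 'e set \<Rightarrow> 't monoid \<Rightarrow> ('k \<Rightarrow> 't \<Rightarrow> 't) \<Rightarrow> ('e \<Rightarrow> 't) \<Rightarrow> bool"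
  where "free_on K X H sc e \<longleftrightarrow> kmodule K H sc \<and> e \<in> X \<rightarrow> carrier H \<and>
    (\<forall>Q (sc' :: 'k \<Rightarrow> 't \<Rightarrow> 't) z. kmodule K Q sc' \<and> z \<in> X \<rightarrow> carrier Q \<longrightarrow>
       (\<exists>f. klinear K H sc Q sc' f \<and> (\<forall>x\<in>X. f (e x) = z x))) \<and>
    (\<forall>Q (sc' :: 'k \<Rightarrow> 't \<Rightarrow> 't) f g. kmodule K Q sc' \<and> klinear K H sc Q sc' f \<and> klinear K H sc Q sc' g \<and>
       (\<forall>x\<in>X. f (e x) = g (e x)) \<longrightarrow> (\<forall>h\<in>carrier H. f h = g h))"

lemma free_onD:
  fixes H :: "'t monoid" and Q :: "'t monoid"
  assumes "free_on K X H sc e"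
  shows "kmodule K H sc" "x \<in> X \<Longrightarrow> e x \<in> carrier H"
    "\<lbrakk>kmodule K Q sc'; \<And>x. x \<in> X \<Longrightarrow> z x \<in> carrier Q\<rbrakk> \<Longrightarrow>
      \<exists>f. klinear K H sc Q sc' f \<and> (\<forall>x\<in>X. f (e x) = z x)"
    "\<lbrakk>kmodule K Q sc'; klinear K H sc Q sc' f; klinear K H sc Q sc' g; \<And>x. x \<in> X \<Longrightarrow> f (e x) = g (e x);
      h \<in> carrier H\<rbrakk> \<Longrightarrow> f h = g h"
proof -
  show "kmodule K H sc" "x \<in> X \<Longrightarrow> e x \<in> carrier H"
    using assms by (auto simp: free_on_def)
  show "\<lbrakk>kmodule K Q sc'; \<And>x. x \<in> X \<Longrightarrow> z x \<in> carrier Q\<rbrakk> \<Longrightarrow>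
      \<exists>f. klinear K H sc Q sc' f \<and> (\<forall>x\<in>X. f (e x) = z x)"
    using assms unfolding free_on_def by blast
  show "\<lbrakk>kmodule K Q sc'; klinear K H sc Q sc' f; klinear K H sc Q sc' g; \<And>x. x \<in> X \<Longrightarrow> f (e x) = g (e x);
      h \<in> carrier H\<rbrakk> \<Longrightarrow> f h = g h"
    using assms unfolding free_on_def by blast
qed

text \<open>Free modules have to fit into the given universe: over an infinite type, free abelian groups,
  products and sums of small sets are small.\<close>

lemma frag_lepoll:
  assumes "infinite (UNIV :: 't set)" "S \<lesssim> (UNIV :: 't set)"
  shows "carrier (free_Abelian_group S) \<lesssim> (UNIV :: 't set)"
proof -
  obtain enc :: "_ \<Rightarrow> 't" where enc: "inj_on enc S" using assms(2) unfolding lepoll_def by blast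
  let ?f = "frag_extend (frag_of \<circ> enc)" and ?g = "frag_extend (frag_of \<circ> inv_into S enc)"
  have "?g (?f c) = c" if "Poly_Mapping.keys c \<subseteq> S" for c
  proof -
    have "?g (?f c) = frag_extend ((frag_of \<circ> inv_into S enc) \<circ> enc) c"
      by (rule frag_extend_compose)
    also have "\<dots> = frag_extend frag_of c"
      using that enc by (intro frag_extend_eq) auto
    finally show ?thesis by (simp add: frag_expansion[symmetric])
  qed
  then have "inj_on ?f (carrier (free_Abelian_group S))"
    by (intro inj_on_inverseI[where g = ?g]) simp
  then have "carrier (free_Abelian_group S) \<lesssim> carrier (free_Abelian_group (UNIV :: 't set))"
    unfolding lepoll_def by (intro exI[of _ ?f]) auto
  also have "\<dots> \<approx> (UNIV :: 't set)"
    by (rule eqpoll_free_Abelian_group_infinite[OF assms(1)])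
  finally show ?thesis .
qed

lemma pres_lepoll:
  assumes "R \<subseteq> carrier (free_Abelian_group S)"
  shows "carrier (pres S R) \<lesssim> carrier (free_Abelian_group S)"
  unfolding lepoll_def
proof (intro exI conjI)
  show "inj_on (\<lambda>x. SOME c. c \<in> x) (carrier (pres S R))"
    by (rule inj_onI) (metis pres_rep(2)[OF assms])
qed (auto simp: pres_rep(1)[OF assms] dest: subsetD)

lemma times_lepoll_infinite:
  assumes "infinite (UNIV :: 't set)" "A \<lesssim> (UNIV :: 't set)" "B \<lesssim> (UNIV :: 't set)"
  shows "A \<times> B \<lesssim> (UNIV :: 't set)"
proof -
  have "A \<times> B \<lesssim> (UNIV :: 't set) \<times> (UNIV :: 't set)" by (rule times_lepoll_mono) fact+
  also have "\<dots> \<lesssim> (UNIV :: 't set)"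
    using card_of_Times_same_infinite[OF assms(1)] by (simp add: eqpoll_iff_card_of_ordIso eqpoll_imp_lepoll)
  finally show ?thesis .
qed

lemma plus_lepoll_infinite:
  assumes "infinite (UNIV :: 't set)" "A \<lesssim> (UNIV :: 't set)" "B \<lesssim> (UNIV :: 't set)"
  shows "A <+> B \<lesssim> (UNIV :: 't set)"
proof -
  have "A <+> B \<lesssim> (UNIV :: 't set) <+> (UNIV :: 't set)" by (rule sum_lepoll_mono) fact+
  also have "\<dots> \<approx> (UNIV :: 't set)"
    unfolding eqpoll_iff_card_of_ordIso
    by (rule card_of_Plus_infinite1[OF assms(1) card_of_mono1[OF subset_refl]])
  finally show ?thesis .
qed

lemma kmodule_transport:
  assumes P: "kmodule K P sc" and enc: "inj_on enc (carrier P)"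
  obtains H sc' where "kmodule K H sc'" "klinear K P sc H sc' enc" "carrier H = enc ` carrier P"
    "klinear K H sc' P sc (inv_into (carrier P) enc)"
proof -
  interpret P: kmodule K P sc by fact
  define dec where "dec = inv_into (carrier P) enc"
  define H where "H = \<lparr>carrier = enc ` carrier P, monoid.mult = (\<lambda>a b. enc (dec a \<otimes>\<^bsub>P\<^esub> dec b)), one = enc \<one>\<^bsub>P\<^esub>\<rparr>"
  have dec [simp]: "x \<in> carrier P \<Longrightarrow> dec (enc x) = x" for x
    unfolding dec_def using enc by simp
  interpret H: comm_group H
  proof (rule comm_groupI)
    fix x assume "x \<in> carrier H"
    then obtain a where a: "a \<in> carrier P" "x = enc a" by (auto simp: H_def)
    then show "\<exists>y\<in>carrier H. y \<otimes>\<^bsub>H\<^esub> x = \<one>\<^bsub>H\<^esub>"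
      by (intro bexI[of _ "enc (inv\<^bsub>P\<^esub> a)"]) (auto simp: H_def)
  qed (auto simp: H_def P.G.m_ac)
  show thesis
  proof
    show "kmodule K H (\<lambda>k x. enc (sc k (dec x)))"
      by unfold_locales
        (auto simp: H_def P.sc_closed P.sc_add_right P.sc_add_left P.sc_assoc P.sc_one)
    show "klinear K P sc H (\<lambda>k x. enc (sc k (dec x))) enc" "carrier H = enc ` carrier P"
      by (auto simp: klinear_def hom_def H_def)
    show "klinear K H (\<lambda>k x. enc (sc k (dec x))) P sc (inv_into (carrier P) enc)"
      unfolding dec_def[symmetric] by (auto simp: klinear_def hom_def H_def P.sc_closed)
  qed
qed

text \<open>The generator \<open>(k, x)\<close> stands for $k x$, so that $(k + l) x = k x + l x$ is the only family of
  relators needed, with \<open>K\<close> acting by $k (l x) = (k l) x$. The elements of the presented module are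
  sets of formal sums; the module is transported into \<open>'t\<close> along an injection.\<close>

lemma free_on_exists:
  fixes K :: "'k ring" and X :: "'e set"
  assumes K: "cring K" and inf: "infinite (UNIV :: 't set)" and cardK: "carrier K \<lesssim> (UNIV :: 't set)"
    and cardX: "X \<lesssim> (UNIV :: 't set)"
  obtains H :: "'t monoid" and sc e where "free_on K X H sc e"
proof -
  interpret K: cring K by fact
  define S where "S = carrier K \<times> X"
  define R where "R = {frag_of (k \<oplus>\<^bsub>K\<^esub> l, x) - frag_of (k, x) - frag_of (l, x) | k l x.
    k \<in> carrier K \<and> l \<in> carrier K \<and> x \<in> X}"
  have SE: thesis if "s \<in> S" "\<And>k x. \<lbrakk>k \<in> carrier K; x \<in> X; s = (k, x)\<rbrakk> \<Longrightarrow> thesis" for s thesis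
    using that by (auto simp: S_def)
  have SI: "(k, x) \<in> S" if "k \<in> carrier K" "x \<in> X" for k x
    using that by (simp add: S_def)
  let ?P = "pres S R" and ?gen = "\<lambda>k x. pres_class S R (frag_of (k, x))"
  have R: "R \<subseteq> carrier (free_Abelian_group S)"
  proof
    fix r assume "r \<in> R"
    then obtain k l x where r: "r = frag_of (k \<oplus>\<^bsub>K\<^esub> l, x) - frag_of (k, x) - frag_of (l, x)"
      "k \<in> carrier K" "l \<in> carrier K" "x \<in> X" by (auto simp: R_def)
    then show "r \<in> carrier (free_Abelian_group S)"
      unfolding carrier_free_Abelian_group_iff r(1) by (intro keys_rel) (simp_all add: S_def)
  qed
  interpret P: comm_group ?P by (rule pres_comm_group[OF R])
  have gen: "?gen k x \<in> carrier ?P" if "k \<in> carrier K" "x \<in> X" for k x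
    using that by (intro pres_gen_closed[OF R]) (simp add: S_def)
  have gen_add: "?gen (k \<oplus>\<^bsub>K\<^esub> l) x = ?gen k x \<otimes>\<^bsub>?P\<^esub> ?gen l x"
    if "k \<in> carrier K" "l \<in> carrier K" "x \<in> X" for k l x
  proof -
    have "frag_of (k \<oplus>\<^bsub>K\<^esub> l, x) - frag_of (k, x) - frag_of (l, x) \<in> R"
      unfolding R_def using that by blast
    from pres_class_rel[OF R this] show ?thesis
      using that by (subst (asm) free_hom_rel3[OF P.comm_group_axioms pres_class_hom[OF R]]) (auto simp: SI)
  qed
  define sc where "sc = (\<lambda>k. pres_map S R (\<lambda>(l, x). frag_of (k \<otimes>\<^bsub>K\<^esub> l, x)))"
  have sc: "sc k \<in> hom ?P ?P" "\<And>l x. l \<in> carrier K \<Longrightarrow> x \<in> X \<Longrightarrow> sc k (?gen l x) = ?gen (k \<otimes>\<^bsub>K\<^esub> l) x"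
    if k: "k \<in> carrier K" for k
  proof -
    have 1: "Poly_Mapping.keys ((\<lambda>(l, x). frag_of (k \<otimes>\<^bsub>K\<^esub> l, x)) s) \<subseteq> S" if "s \<in> S" for s
      using that k by (auto simp: S_def)
    have 2: "pres_class S R (frag_extend (\<lambda>(l, x). frag_of (k \<otimes>\<^bsub>K\<^esub> l, x)) r) = \<one>\<^bsub>?P\<^esub>" if r: "r \<in> R" for r
    proof -
      obtain l l' x where "r = frag_of (l \<oplus>\<^bsub>K\<^esub> l', x) - frag_of (l, x) - frag_of (l', x)"
        "l \<in> carrier K" "l' \<in> carrier K" "x \<in> X" using r by (auto simp: R_def)
      then have "frag_extend (\<lambda>(l, x). frag_of (k \<otimes>\<^bsub>K\<^esub> l, x)) r \<in> R"
        using k by (auto simp: R_def frag_extend_diff K.r_distr)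
      then show ?thesis by (rule pres_class_rel[OF R])
    qed
    note pm = pres_map_hom[OF R R 1 2]
    show "sc k \<in> hom ?P ?P" using pm(1) by (simp add: sc_def)
    show "\<And>l x. l \<in> carrier K \<Longrightarrow> x \<in> X \<Longrightarrow> sc k (?gen l x) = ?gen (k \<otimes>\<^bsub>K\<^esub> l) x"
      using pm(3) by (simp add: sc_def S_def)
  qed
  have PK: "kmodule K ?P sc"
  proof unfold_locales
    fix k l x assume kl: "k \<in> carrier K" "l \<in> carrier K" and x: "x \<in> carrier ?P"
    show "sc (k \<oplus>\<^bsub>K\<^esub> l) x = sc k x \<otimes>\<^bsub>?P\<^esub> sc l x"
      by (rule pres_hom_ext[OF R P.comm_group_axioms sc(1) hom_mult_fun[OF P.comm_group_axioms sc(1) sc(1) P.is_monoid] _ x])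
        (use kl in \<open>auto elim!: SE simp: sc gen_add K.l_distr\<close>)
    show "sc (k \<otimes>\<^bsub>K\<^esub> l) x = sc k (sc l x)"
      by (rule pres_hom_ext[OF R P.comm_group_axioms sc(1) hom_comp[OF sc(1) sc(1)] _ x])
        (use kl in \<open>auto elim!: SE simp: sc K.m_assoc\<close>)
  next
    fix x assume x: "x \<in> carrier ?P"
    have id: "(\<lambda>x. x) \<in> hom ?P ?P" by (auto simp: hom_def)
    show "sc \<one>\<^bsub>K\<^esub> x = x"
      by (rule pres_hom_ext[OF R P.comm_group_axioms sc(1)[OF K.one_closed] id _ x]) (auto elim!: SE simp: sc)
  qed (auto simp: hom_in_carrier[OF sc(1)] hom_mult[OF sc(1)])
  have lift: "\<exists>f. klinear K ?P sc Q sc' f \<and> (\<forall>x\<in>X. f (?gen \<one>\<^bsub>K\<^esub> x) = z x)"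
    if Q: "kmodule K Q sc'" and z: "z \<in> X \<rightarrow> carrier Q" for Q :: "'t monoid" and sc' z
  proof -
    interpret Q: kmodule K Q sc' by fact
    have zc: "x \<in> X \<Longrightarrow> z x \<in> carrier Q" for x using z by blast
    obtain f where f: "f \<in> hom ?P Q" "\<And>s. s \<in> S \<Longrightarrow> f (pres_class S R (frag_of s)) = (\<lambda>(k, x). sc' k (z x)) s"
    proof (rule pres_lift[OF R Q.G.comm_group_axioms, of "\<lambda>(k, x). sc' k (z x)"])
      show "(\<lambda>(k, x). sc' k (z x)) s \<in> carrier Q" if "s \<in> S" for s
        using that zc by (auto simp: S_def Q.sc_closed)
    next
      fix f r assume f: "f \<in> hom (free_Abelian_group S) Q" "\<And>s. s \<in> S \<Longrightarrow> f (frag_of s) = (\<lambda>(k, x). sc' k (z x)) s"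
        and "r \<in> R"
      then obtain k l x where r: "r = frag_of (k \<oplus>\<^bsub>K\<^esub> l, x) - frag_of (k, x) - frag_of (l, x)"
        and kl: "k \<in> carrier K" "l \<in> carrier K" "x \<in> X" by (auto simp: R_def)
      show "f r = \<one>\<^bsub>Q\<^esub>"
        unfolding r by (subst free_hom_rel3[OF Q.G.comm_group_axioms f(1)])
          (use kl zc in \<open>simp_all add: f(2) SI Q.sc_add_left\<close>)
    qed blast
    have "klinear K ?P sc Q sc' f"
      unfolding klinear_def
    proof (intro conjI ballI)
      fix k x assume k: "k \<in> carrier K" and x: "x \<in> carrier ?P"
      show "f (sc k x) = sc' k (f x)"
        by (rule pres_hom_ext[OF R Q.G.comm_group_axioms hom_comp[OF sc(1) f(1)] hom_comp[OF f(1) Q.sc_hom] _ x])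
          (use k zc in \<open>auto elim!: SE simp: sc f(2) SI Q.sc_assoc\<close>)
    qed (rule f(1))
    moreover have "f (?gen \<one>\<^bsub>K\<^esub> x) = z x" if "x \<in> X" for x
      using that zc by (simp add: f(2) SI Q.sc_one)
    ultimately show ?thesis by blast
  qed
  have uniq: "f h = g h"
    if Q: "kmodule K Q sc'" and f: "klinear K ?P sc Q sc' f" and g: "klinear K ?P sc Q sc' g"
      and eq: "\<And>x. x \<in> X \<Longrightarrow> f (?gen \<one>\<^bsub>K\<^esub> x) = g (?gen \<one>\<^bsub>K\<^esub> x)" and h: "h \<in> carrier ?P"
    for Q :: "'t monoid" and sc' f g h
  proof -
    interpret Q: kmodule K Q sc' by fact
    have "f (?gen k x) = g (?gen k x)" if "k \<in> carrier K" "x \<in> X" for k x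
    proof -
      have "?gen k x = sc k (?gen \<one>\<^bsub>K\<^esub> x)" using that by (simp add: sc)
      then show ?thesis
        using that gen by (simp add: klinearD(4)[OF f] klinearD(4)[OF g] eq)
    qed
    then show ?thesis
      by (intro pres_hom_ext[OF R Q.G.comm_group_axioms klinearD(1)[OF f] klinearD(1)[OF g] _ h]) (auto elim!: SE)
  qed
  have "carrier ?P \<lesssim> (UNIV :: 't set)"
    using lepoll_trans[OF pres_lepoll[OF R] frag_lepoll[OF inf]] times_lepoll_infinite[OF inf cardK cardX]
    by (simp add: S_def)
  then obtain enc :: "_ \<Rightarrow> 't" where enc: "inj_on enc (carrier ?P)" unfolding lepoll_def by blast
  obtain H sc' where H: "kmodule K H sc'" "klinear K ?P sc H sc' enc" "carrier H = enc ` carrier ?P"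
    "klinear K H sc' ?P sc (inv_into (carrier ?P) enc)"
    by (rule kmodule_transport[OF PK enc])
  show thesis
  proof
    show "free_on K X H sc' (\<lambda>x. enc (?gen \<one>\<^bsub>K\<^esub> x))"
      unfolding free_on_def
    proof (intro conjI allI impI ballI)
      show "kmodule K H sc'" by (rule H(1))
      show "(\<lambda>x. enc (?gen \<one>\<^bsub>K\<^esub> x)) \<in> X \<rightarrow> carrier H" using gen by (auto simp: H(3))
    next
      fix Q and sc'' :: "'k \<Rightarrow> 't \<Rightarrow> 't" and z assume "kmodule K Q sc'' \<and> z \<in> X \<rightarrow> carrier Q"
      then obtain f where f: "klinear K ?P sc Q sc'' f" "\<And>x. x \<in> X \<Longrightarrow> f (?gen \<one>\<^bsub>K\<^esub> x) = z x"
        using lift by blast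
      show "\<exists>f. klinear K H sc' Q sc'' f \<and> (\<forall>x\<in>X. f (enc (?gen \<one>\<^bsub>K\<^esub> x)) = z x)"
        using klinear_comp[OF H(4) f(1)] f(2) gen enc by (intro exI conjI) auto
    next
      fix Q and sc'' :: "'k \<Rightarrow> 't \<Rightarrow> 't" and f g h
      assume a: "kmodule K Q sc'' \<and> klinear K H sc' Q sc'' f \<and> klinear K H sc' Q sc'' g \<and>
        (\<forall>x\<in>X. f (enc (?gen \<one>\<^bsub>K\<^esub> x)) = g (enc (?gen \<one>\<^bsub>K\<^esub> x)))" and "h \<in> carrier H"
      then obtain a where "a \<in> carrier ?P" "h = enc a" by (auto simp: H(3))
      then show "f h = g h"
        using uniq[of Q sc'' "\<lambda>x. f (enc x)" "\<lambda>x. g (enc x)" a] a klinear_comp[OF H(2)] by blast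
    qed
  qed
qed

section \<open>Complexes of modules over a commutative ring\<close>

lemma dg_of_ring_simps [simp]:
  "gr (dg_of_ring K) 0 = add_monoid K"
  "i \<noteq> 0 \<Longrightarrow> gr (dg_of_ring K) i = (add_monoid K)\<lparr>carrier := {\<zero>\<^bsub>K\<^esub>}\<rparr>"
  "df (dg_of_ring K) i x = \<zero>\<^bsub>K\<^esub>" "rmul (dg_of_ring K) i j = monoid.mult K" "rone (dg_of_ring K) = \<one>\<^bsub>K\<^esub>"
  "\<one>\<^bsub>gr (dg_of_ring K) i\<^esub> = \<zero>\<^bsub>K\<^esub>"
  by (simp_all add: dg_of_ring_def)

lemma dg_of_ring_complex:
  assumes "cring K" shows "cochain_complex (dg_of_ring K)"
proof -
  interpret K: cring K by fact
  have c: "comm_group (gr (dg_of_ring K) i)" for i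
    using trivial_comm_group[OF K.a_comm_group] K.a_comm_group by (cases "i = 0") auto
  show ?thesis
  proof (intro cochain_complex.intro)
    show "df (dg_of_ring K) i \<in> hom (gr (dg_of_ring K) i) (gr (dg_of_ring K) (i + 1))" for i
    proof -
      have "df (dg_of_ring K) i = (\<lambda>x. \<one>\<^bsub>gr (dg_of_ring K) (i + 1)\<^esub>)" by (rule ext) simp
      then show ?thesis using hom_one_fun[OF c[of "i + 1"], of "gr (dg_of_ring K) i"] by simp
    qed
  qed (use c in simp_all)
qed

lemma ring_elem_cyc: "k \<in> carrier K \<Longrightarrow> k \<in> cyc (dg_of_ring K) 0"
  by (simp add: cyc_iff)

lemma dgk_over: "cring K \<Longrightarrow> dg_module (dg_of_ring K) Y \<Longrightarrow> dg_module_over (dg_of_ring K) Y"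
  by (simp add: dg_module_over_def dg_of_ring_complex)

lemma dgk_kmodule:
  assumes "cring K" "dg_module (dg_of_ring K) Y"
  shows "kmodule K (gr Y i) (act Y 0 i)"
proof -
  interpret K: cring K by fact
  interpret Y: dg_module "dg_of_ring K" Y by fact
  interpret G: comm_group "gr Y i" by (rule Y.gr_comm_group)
  show ?thesis
    by unfold_locales
      (use Y.act_closed[of _ 0 _ i] Y.act_add_right[of _ 0 _ i] Y.act_add_left[of _ 0 _ _ i]
        Y.act_assoc[of _ 0 _ 0 _ i] Y.act_one[of _ i] in simp_all)
qed

lemma dgk_df_klinear:
  assumes "cring K" "dg_module (dg_of_ring K) Y"
  shows "klinear K (gr Y i) (act Y 0 i) (gr Y (i + 1)) (act Y 0 (i + 1)) (df Y i)"
proof -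
  interpret Y: dg_module_over "dg_of_ring K" Y using assms by (rule dgk_over)
  show ?thesis by (simp add: klinear_def Y.df_hom Y.df_act_cyc ring_elem_cyc)
qed

lemma strict_klinear:
  assumes "f \<in> strict_homs (dg_of_ring K) X Y"
  shows "klinear K (gr X i) (act X 0 i) (gr Y i) (act Y 0 i) (f i)"
  using strict_homsD(5)[OF assms, of _ 0 _ i] by (simp add: klinear_def strict_homsD(1)[OF assms])

text \<open>A DG module over \<open>K\<close> is a complex of \<open>K\<close>-modules: the elements of \<open>dg_of_ring K\<close> in a nonzero
  degree are zero and can only act as zero.\<close>

definition dgk :: "(int \<Rightarrow> 't monoid) \<Rightarrow> (int \<Rightarrow> 't \<Rightarrow> 't) \<Rightarrow> (int \<Rightarrow> 'k \<Rightarrow> 't \<Rightarrow> 't) \<Rightarrow> ('k, 't) dg_module"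
  where "dgk G d sc = \<lparr>gr = G, df = d, act = (\<lambda>q i k x. if q = 0 then sc i k x else \<one>\<^bsub>G (q + i)\<^esub>)\<rparr>"

lemma dgk_simps [simp]: "gr (dgk G d sc) = G" "df (dgk G d sc) = d"
  "act (dgk G d sc) 0 i = sc i" "q \<noteq> 0 \<Longrightarrow> act (dgk G d sc) q i k x = \<one>\<^bsub>G (q + i)\<^esub>"
  by (auto simp: dgk_def)

lemma dgk_dg_module:
  assumes "cring K" and G: "\<And>i. kmodule K (G i) (sc i)"
    and d: "\<And>i. klinear K (G i) (sc i) (G (i + 1)) (sc (i + 1)) (d i)"
    and dd: "\<And>i x. x \<in> carrier (G i) \<Longrightarrow> d (i + 1) (d i x) = \<one>\<^bsub>G (i + 1 + 1)\<^esub>"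
  shows "dg_module (dg_of_ring K) (dgk G d sc)"
proof -
  interpret K: cring K by fact
  interpret M: kmodule K "G i" "sc i" for i by (rule G)
  have cg: "comm_group (G i)" for i by (rule M.G.comm_group_axioms)
  have d1: "d i \<one>\<^bsub>G i\<^esub> = \<one>\<^bsub>G (i + 1)\<^esub>" for i by (rule hom_one'[OF cg cg klinearD(1)[OF d]])
  have kos: "koszul (G i) n \<one>\<^bsub>G i\<^esub> = \<one>\<^bsub>G i\<^esub>" for i n by (simp add: koszul_def)
  have car: "a \<in> carrier (gr (dg_of_ring K) i) \<longleftrightarrow> (if i = 0 then a \<in> carrier K else a = \<zero>\<^bsub>K\<^esub>)" for a i
    by (cases "i = 0") auto
  let ?M = "dgk G d sc"
  show ?thesis
  proof (intro dg_module.intro cochain_complex.intro dg_module_axioms.intro)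
    show "comm_group (gr ?M i)" "df ?M i \<in> hom (gr ?M i) (gr ?M (i + 1))" for i
      using cg klinearD(1)[OF d] by auto
    show "df ?M (i + 1) (df ?M i x) = \<one>\<^bsub>gr ?M (i + 1 + 1)\<^esub>" if "x \<in> carrier (gr ?M i)" for x i
      using dd that by simp
  next
    fix a i m j assume a: "a \<in> carrier (gr (dg_of_ring K) i)" and m: "m \<in> carrier (gr ?M j)"
    show "act ?M i j a m \<in> carrier (gr ?M (i + j))"
      using a m by (cases "i = 0") (auto simp: M.sc_closed)
    show "act ?M i j (a \<otimes>\<^bsub>gr (dg_of_ring K) i\<^esub> a') m = act ?M i j a m \<otimes>\<^bsub>gr ?M (i + j)\<^esub> act ?M i j a' m"
      if "a' \<in> carrier (gr (dg_of_ring K) i)" for a'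
      using a m that by (cases "i = 0") (auto simp: M.sc_add_left)
    show "act ?M i j a (m \<otimes>\<^bsub>gr ?M j\<^esub> m') = act ?M i j a m \<otimes>\<^bsub>gr ?M (i + j)\<^esub> act ?M i j a m'"
      if "m' \<in> carrier (gr ?M j)" for m'
      using a m that by (cases "i = 0") (auto simp: M.sc_add_right)
    show "df ?M (i + j) (act ?M i j a m) = act ?M (i + 1) j (df (dg_of_ring K) i a) m \<otimes>\<^bsub>gr ?M (i + j + 1)\<^esub>
        koszul (gr ?M (i + j + 1)) i (act ?M i (j + 1) a (df ?M j m))"
    proof (cases "i = 0")
      case True
      then show ?thesis using a m klinearD(2)[OF d[of j], of m] klinearD(4)[OF d[of j], of a m] by (simp add: koszul_def add.commute[of 1 j] M.sc_closed)
    next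
      case False
      have "act ?M (i + 1) j \<zero>\<^bsub>K\<^esub> m = \<one>\<^bsub>G (i + j + 1)\<^esub>"
      proof (cases "i + 1 = 0")
        case True
        then have i: "i = - 1" by simp
        show ?thesis using m by (simp add: i M.sc_zero)
      next
        case False
        then show ?thesis by (simp add: add_ac)
      qed
      then show ?thesis using False by (simp add: d1 kos add_ac)
    qed
  next
    fix a i b j m k assume a: "a \<in> carrier (gr (dg_of_ring K) i)" and b: "b \<in> carrier (gr (dg_of_ring K) j)"
      and m: "m \<in> carrier (gr ?M k)"
    show "act ?M (i + j) k (rmul (dg_of_ring K) i j a b) m = act ?M i (j + k) a (act ?M j k b m)"
    proof (cases "i = 0 \<or> j = 0")
      case True
      then show ?thesis using a b m by (cases "i = 0"; cases "j = 0") (auto simp: M.sc_assoc M.sc_unit)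
    next
      case False
      then have ab: "a = \<zero>\<^bsub>K\<^esub>" "b = \<zero>\<^bsub>K\<^esub>" using a b by (auto simp: car)
      show ?thesis
      proof (cases "i + j = 0")
        case True
        then have j: "j = - i" by simp
        show ?thesis using False m by (simp add: ab M.sc_zero j)
      next
        case i: False
        then show ?thesis using False by (simp add: add.assoc)
      qed
    qed
  next
    show "act ?M 0 i (rone (dg_of_ring K)) m = m" if "m \<in> carrier (gr ?M i)" for m i
      using that by (simp add: M.sc_one)
  qed
qed

lemma klinear_strict:
  assumes K: "cring K" and X: "dg_module (dg_of_ring K) (dgk G d sc)" and Y: "dg_module (dg_of_ring K) Y"
    and f: "\<And>i. klinear K (G i) (sc i) (gr Y i) (act Y 0 i) (f i)"
    and c: "\<And>i x. x \<in> carrier (G i) \<Longrightarrow> f (i + 1) (d i x) = df Y i (f i x)"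
  shows "(\<lambda>i. restrict (f i) (carrier (G i))) \<in> strict_homs (dg_of_ring K) (dgk G d sc) Y"
proof -
  interpret X: dg_module_over "dg_of_ring K" "dgk G d sc" using K X by (rule dgk_over)
  interpret Y: dg_module_over "dg_of_ring K" Y using K Y by (rule dgk_over)
  note [simp] = X.df_closed[simplified] X.act_closed[simplified]
  have one: "\<one>\<^bsub>G i\<^esub> \<in> carrier (G i)" for i using X.gr_one by simp
  have mc: "x \<otimes>\<^bsub>G i\<^esub> y \<in> carrier (G i)" if "x \<in> carrier (G i)" "y \<in> carrier (G i)" for x y i
    using X.gr_group[of i] that by (simp add: group.is_monoid monoid.m_closed)
  have "restrict (f (j + i)) (carrier (G (j + i))) (act (dgk G d sc) j i k m) =
      act Y j i k (restrict (f i) (carrier (G i)) m)"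
    if k: "k \<in> carrier (gr (dg_of_ring K) j)" and m: "m \<in> carrier (G i)" for k j i m
  proof (cases "j = 0")
    case True
    then show ?thesis
      using k m klinearD(4)[OF f] X.act_closed[of k 0 m i] by simp
  next
    case False
    then have k0: "k = \<one>\<^bsub>gr (dg_of_ring K) j\<^esub>" using k by simp
    have "f (j + i) \<one>\<^bsub>G (j + i)\<^esub> = \<one>\<^bsub>gr Y (j + i)\<^esub>"
      using hom_one'[OF X.gr_comm_group Y.gr_comm_group, of "f (j + i)" "j + i" "j + i"] klinearD(1)[OF f] by simp
    moreover have "act Y j i k (f i m) = \<one>\<^bsub>gr Y (j + i)\<^esub>"
      unfolding k0 by (rule Y.act_one_left[OF klinearD(2)[OF f m]])
    ultimately show ?thesis using False m one by simp
  qed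
  moreover have "restrict (f i) (carrier (G i)) \<in> hom (G i) (gr Y i)" for i
    using klinearD(2,3)[OF f] mc by (auto intro!: homI)
  moreover have "restrict (f (i + 1)) (carrier (G (i + 1))) (d i m) = df Y i (restrict (f i) (carrier (G i)) m)"
    if "m \<in> carrier (G i)" for i m
    using X.df_closed[of m i] that by (simp add: c)
  ultimately show ?thesis by (simp add: strict_homs_def)
qed

text \<open>The complex \<open>H' \<longrightarrow> H\<close> in degrees \<open>p - 1\<close> and \<open>p\<close>.\<close>

definition two_gr :: "int \<Rightarrow> 't monoid \<Rightarrow> 't monoid \<Rightarrow> int \<Rightarrow> 't monoid"
  where "two_gr p H' H i = (if i = p then H else if i = p - 1 then H' else H\<lparr>carrier := {\<one>\<^bsub>H\<^esub>}\<rparr>)"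

definition two_term ::
    "int \<Rightarrow> 't monoid \<Rightarrow> ('k \<Rightarrow> 't \<Rightarrow> 't) \<Rightarrow> 't monoid \<Rightarrow> ('k \<Rightarrow> 't \<Rightarrow> 't) \<Rightarrow> ('t \<Rightarrow> 't) \<Rightarrow> ('k, 't) dg_module"
  where "two_term p H' sc' H sc d =
    dgk (two_gr p H' H) (\<lambda>i x. if i = p - 1 then d x else \<one>\<^bsub>two_gr p H' H (i + 1)\<^esub>)
      (\<lambda>i. if i = p then sc else if i = p - 1 then sc' else (\<lambda>k x. \<one>\<^bsub>H\<^esub>))"

lemma two_gr_simps [simp]: "two_gr p H' H p = H" "two_gr p H' H (p - 1) = H'"
  "i \<noteq> p \<Longrightarrow> i \<noteq> p - 1 \<Longrightarrow> two_gr p H' H i = H\<lparr>carrier := {\<one>\<^bsub>H\<^esub>}\<rparr>"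
  by (auto simp: two_gr_def)

lemma two_term_simps [simp]: "gr (two_term p H' sc' H sc d) = two_gr p H' H"
  "df (two_term p H' sc' H sc d) (p - 1) = d"
  "i \<noteq> p - 1 \<Longrightarrow> df (two_term p H' sc' H sc d) i x = \<one>\<^bsub>two_gr p H' H (i + 1)\<^esub>"
  by (auto simp: two_term_def)

lemma two_term_dg_module:
  assumes K: "cring K" and H': "kmodule K H' sc'" and H: "kmodule K H sc" and d: "klinear K H' sc' H sc d"
  shows "dg_module (dg_of_ring K) (two_term p H' sc' H sc d)"
  unfolding two_term_def
proof (rule dgk_dg_module[OF K])
  let ?G = "two_gr p H' H" and ?sc = "\<lambda>i. if i = p then sc else if i = p - 1 then sc' else (\<lambda>k x. \<one>\<^bsub>H\<^esub>)"
  show G: "kmodule K (?G i) (?sc i)" for i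
    using H' H kmodule.trivial_kmodule[OF H] by (simp add: two_gr_def)
  have one: "klinear K G' s (?G i) (?sc i) (\<lambda>x. \<one>\<^bsub>?G i\<^esub>)" for i s and G' :: "'b monoid"
    by (rule klinear_one[OF G])
  let ?d = "\<lambda>i x. if i = p - 1 then d x else \<one>\<^bsub>?G (i + 1)\<^esub>"
  show "klinear K (?G i) (?sc i) (?G (i + 1)) (?sc (i + 1)) (?d i)" for i
  proof (cases "i = p - 1")
    case True then show ?thesis using d by simp
  next
    case False then show ?thesis using one[of "?G i" "?sc i" "i + 1"] by simp
  qed
  show "?d (i + 1) (?d i x) = \<one>\<^bsub>?G (i + 1 + 1)\<^esub>" if "x \<in> carrier (?G i)" for i x
  proof (cases "i + 1 = p - 1")
    case True
    have "d \<one>\<^bsub>H'\<^esub> = \<one>\<^bsub>H\<^esub>"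
      using H' H d by (intro hom_one'[OF _ _ klinearD(1)[OF d]]) (auto simp: kmodule_def)
    moreover have "i = p - 2" using True by simp
    ultimately show ?thesis by simp
  qed simp
qed

lemma two_term_strict:
  assumes K: "cring K" and H': "kmodule K H' sc'" and H: "kmodule K H sc" and d: "klinear K H' sc' H sc d"
    and Y: "dg_module (dg_of_ring K) Y"
    and f': "klinear K H' sc' (gr Y (p - 1)) (act Y 0 (p - 1)) f'" and f: "klinear K H sc (gr Y p) (act Y 0 p) f"
    and c: "\<And>x. x \<in> carrier H' \<Longrightarrow> f (d x) = df Y (p - 1) (f' x)"
    and z: "\<And>x. x \<in> carrier H \<Longrightarrow> df Y p (f x) = \<one>\<^bsub>gr Y (p + 1)\<^esub>"
  obtains g where "g \<in> strict_homs (dg_of_ring K) (two_term p H' sc' H sc d) Y"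
    "\<And>x. x \<in> carrier H' \<Longrightarrow> g (p - 1) x = f' x" "\<And>x. x \<in> carrier H \<Longrightarrow> g p x = f x"
proof -
  interpret Y: dg_module "dg_of_ring K" Y by fact
  let ?G = "two_gr p H' H" and ?sc = "\<lambda>i. if i = p then sc else if i = p - 1 then sc' else (\<lambda>k x. \<one>\<^bsub>H\<^esub>)"
  let ?d = "\<lambda>i x. if i = p - 1 then d x else \<one>\<^bsub>?G (i + 1)\<^esub>"
  let ?f = "\<lambda>i. if i = p then f else if i = p - 1 then f' else (\<lambda>x. \<one>\<^bsub>gr Y i\<^esub>)"
  have lin: "klinear K (?G i) (?sc i) (gr Y i) (act Y 0 i) (?f i)" for i
    using f f' klinear_one[OF dgk_kmodule[OF K Y, of i], of "H\<lparr>carrier := {\<one>\<^bsub>H\<^esub>}\<rparr>" "\<lambda>k x. \<one>\<^bsub>H\<^esub>"]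
    by (simp add: two_gr_def)
  have G: "comm_group (?G i)" for i
    using H' H trivial_comm_group[of H] by (simp add: two_gr_def kmodule_def)
  have one: "?f i \<one>\<^bsub>?G i\<^esub> = \<one>\<^bsub>gr Y i\<^esub>" for i
    by (rule hom_one'[OF G Y.gr_comm_group klinearD(1)[OF lin]])
  have "(\<lambda>i. restrict (?f i) (carrier (?G i))) \<in> strict_homs (dg_of_ring K) (two_term p H' sc' H sc d) Y"
    unfolding two_term_def
  proof (rule klinear_strict[OF K two_term_dg_module[OF K H' H d, unfolded two_term_def] Y lin])
    fix i x assume x: "x \<in> carrier (?G i)"
    consider "i = p - 1" | "i = p" | "i \<noteq> p" "i \<noteq> p - 1" by blast
    then show "?f (i + 1) (?d i x) = df Y i (?f i x)"
    proof cases
      case 1 then show ?thesis using c x by simp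
    next
      case 2 then show ?thesis using z x one[of "p + 1"] by simp
    next
      case 3 then show ?thesis using one[of "i + 1"] Y.df_one[of i] by simp
    qed
  qed
  then show thesis by (rule that) auto
qed

section \<open>Free DG modules corepresent cohomology\<close>

lemma coh_map_bijI:
  assumes M: "cochain_complex M" and N: "cochain_complex N" and f: "chain_map M N f"
    and inj: "\<And>m y. \<lbrakk>m \<in> cyc M i; y \<in> carrier (gr N (i - 1)); f i m = df N (i - 1) y\<rbrakk> \<Longrightarrow>
      \<exists>y\<in>carrier (gr M (i - 1)). m = df M (i - 1) y"
    and surj: "\<And>n. n \<in> cyc N i \<Longrightarrow> \<exists>m\<in>cyc M i. coh_class N i n = coh_class N i (f i m)"
  shows "bij_betw (coh_map M N i f) (carrier (coh M i)) (carrier (coh N i))"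
proof -
  interpret M: cochain_complex M by fact
  interpret N: cochain_complex N by fact
  interpret h: group_hom "coh M i" "coh N i" "coh_map M N i f"
    by (intro group_homI M.coh_group N.coh_group coh_map_hom[OF M N f])
  note cl = coh_map_class[OF M N f] chain_map_cyc[OF M N f]
  have "inj_on (coh_map M N i f) (carrier (coh M i))"
  proof (subst h.inj_on_one_iff, intro allI impI)
    fix x assume x: "x \<in> carrier (coh M i)" "coh_map M N i f x = \<one>\<^bsub>coh N i\<^esub>"
    obtain m where m: "m \<in> cyc M i" "x = coh_class M i m" using M.coh_cases[OF x(1)] by blast
    then have "coh_class N i (f i m) = \<one>\<^bsub>coh N i\<^esub>" using x(2) cl by simp
    then show "x = \<one>\<^bsub>coh M i\<^esub>"
      using inj m cl by (auto simp: N.coh_class_eq_one_iff M.coh_class_eq_one_iff)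
  qed
  moreover have "carrier (coh N i) \<subseteq> coh_map M N i f ` carrier (coh M i)"
  proof
    fix y assume "y \<in> carrier (coh N i)"
    then obtain n where "n \<in> cyc N i" "y = coh_class N i n" by (rule N.coh_cases)
    then obtain m where "m \<in> cyc M i" "y = coh_map M N i f (coh_class M i m)" using surj cl by metis
    then show "y \<in> coh_map M N i f ` carrier (coh M i)" using M.coh_class_closed by blast
  qed
  ultimately show ?thesis by (auto simp: bij_betw_def h.hom_closed)
qed

text \<open>A module placed in degree \<open>p\<close>, as a two-term complex whose other term is zero. This makes it fit
  with the cylinder in the proof of \<open>free_homotopy\<close>.\<close>

abbreviation (input) "free_dg p H sc \<equiv> two_term p (H\<lparr>carrier := {\<one>\<^bsub>H\<^esub>}\<rparr>) (\<lambda>k x. \<one>\<^bsub>H\<^esub>) H sc (\<lambda>x. \<one>\<^bsub>H\<^esub>)"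

lemma free_dg_module:
  assumes "cring K" "kmodule K H sc" shows "dg_module (dg_of_ring K) (free_dg p H sc)"
  using two_term_dg_module[OF assms(1) kmodule.trivial_kmodule[OF assms(2)] assms(2) klinear_one[OF assms(2)]] .

lemma act_two_term [simp]: "act (two_term p H' sc' H sc d) 0 p = sc"
  by (simp add: two_term_def)

lemma free_strict_ext:
  assumes K: "cring K" and F: "free_on K X H sc e" and Y: "dg_module (dg_of_ring K) Y"
    and f: "f \<in> strict_homs (dg_of_ring K) (free_dg p H sc) Y" and g: "g \<in> strict_homs (dg_of_ring K) (free_dg p H sc) Y"
    and eq: "\<And>x. x \<in> X \<Longrightarrow> f p (e x) = g p (e x)"
  shows "f = g"
proof
  fix i
  interpret Y: dg_module "dg_of_ring K" Y by fact
  interpret M: dg_module "dg_of_ring K" "free_dg p H sc" by (rule free_dg_module[OF K free_onD(1)[OF F]])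
  show "f i = g i"
  proof (rule extensionalityI[OF strict_homsD(2)[OF f] strict_homsD(2)[OF g]])
    fix x assume x: "x \<in> carrier (gr (free_dg p H sc) i)"
    show "f i x = g i x"
    proof (cases "i = p")
      case True
      then show ?thesis
        using free_onD(4)[OF F dgk_kmodule[OF K Y, of p], of "f p" "g p" x] eq
          strict_klinear[OF f, of p] strict_klinear[OF g, of p] x
        by simp
    next
      case False
      then have x1: "x = \<one>\<^bsub>gr (free_dg p H sc) i\<^esub>" using x by (cases "i = p - 1") auto
      show ?thesis
        unfolding x1 using hom_one'[OF M.gr_comm_group Y.gr_comm_group strict_homsD(1)[OF f]]
          hom_one'[OF M.gr_comm_group Y.gr_comm_group strict_homsD(1)[OF g]] by simp
    qed
  qed
qed

lemma free_strict_exists: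
  assumes K: "cring K" and F: "free_on K X H sc e" and Y: "dg_module (dg_of_ring K) Y"
    and z: "\<And>x. x \<in> X \<Longrightarrow> z x \<in> cyc Y p"
  obtains f where "f \<in> strict_homs (dg_of_ring K) (free_dg p H sc) Y" "\<And>x. x \<in> X \<Longrightarrow> f p (e x) = z x"
proof -
  interpret Y: dg_module "dg_of_ring K" Y by fact
  note H = free_onD(1)[OF F] and T = kmodule.trivial_kmodule[OF free_onD(1)[OF F]]
  have kY: "kmodule K (gr Y i) (act Y 0 i)" for i by (rule dgk_kmodule[OF K Y])
  obtain f where f: "klinear K H sc (gr Y p) (act Y 0 p) f" "\<And>x. x \<in> X \<Longrightarrow> f (e x) = z x"
  proof -
    have "\<exists>f. klinear K H sc (gr Y p) (act Y 0 p) f \<and> (\<forall>x\<in>X. f (e x) = z x)"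
      by (rule free_onD(3)[OF F kY]) (rule cycD[OF z])
    then show ?thesis using that by blast
  qed
  have df: "df Y p (f h) = \<one>\<^bsub>gr Y (p + 1)\<^esub>" if "h \<in> carrier H" for h
    by (rule free_onD(4)[OF F kY[of "p + 1"] klinear_comp[OF f(1) dgk_df_klinear[OF K Y, of p]] klinear_one[OF kY[of "p + 1"]] _ that])
      (use z f(2) in \<open>simp add: cyc_iff\<close>)
  have f1: "f \<one>\<^bsub>H\<^esub> = \<one>\<^bsub>gr Y p\<^esub>"
    using H by (intro hom_one'[OF _ Y.gr_comm_group klinearD(1)[OF f(1)]]) (simp add: kmodule_def)
  have c: "f \<one>\<^bsub>H\<^esub> = df Y (p - 1) \<one>\<^bsub>gr Y (p - 1)\<^esub>" using f1 Y.df_one[of "p - 1"] by simp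
  obtain g where "g \<in> strict_homs (dg_of_ring K) (free_dg p H sc) Y" "\<And>x. x \<in> carrier H \<Longrightarrow> g p x = f x"
  proof (rule two_term_strict[of K "H\<lparr>carrier := {\<one>\<^bsub>H\<^esub>}\<rparr>" "\<lambda>k x. \<one>\<^bsub>H\<^esub>" H sc "\<lambda>x. \<one>\<^bsub>H\<^esub>" Y p
        "\<lambda>x. \<one>\<^bsub>gr Y (p - 1)\<^esub>" f])
  qed (use K T H klinear_one[OF H] Y klinear_one[OF kY[of "p - 1"]] f(1) c df in blast)+
  then show thesis using that f(2) free_onD(2)[OF F] by metis
qed

text \<open>Two homomorphisms \<open>f\<close>, \<open>g\<close> from the free module on \<open>X\<close> that agree on cohomology are homotopic: choose
  $y_x$ with $f(e_x) = d y_x + g(e_x)$. The cylinder is the complex from the free module on \<open>X\<close>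
  to the free module on \<open>X <+> X\<close>, in degrees $p - 1$ and $p$, that sends $e_x$ to the difference
  of the right and the left copy of $e_x$. Its projection \<open>P\<close> to the free module on \<open>X\<close> is a
  quasi-isomorphism with the two sections \<open>A\<close> (right) and \<open>B\<close> (left), which are thus equal in the
  derived category. The elements $y_x$ define a homomorphism \<open>Q\<close> from the cylinder with
  $Q A = f$ and $Q B = g$.\<close>

lemma free_homotopy:
  fixes K :: "'k ring" and H H2 :: "'t monoid"
  assumes K: "cring K" and F: "free_on K X H sc e" and F2: "free_on K (X <+> X) H2 sc2 e2"
    and Y: "dg_module (dg_of_ring K) Y"
    and f: "f \<in> strict_homs (dg_of_ring K) (free_dg p H sc) Y" and g: "g \<in> strict_homs (dg_of_ring K) (free_dg p H sc) Y"
    and eq: "\<And>x. x \<in> X \<Longrightarrow> coh_class Y p (f p (e x)) = coh_class Y p (g p (e x))"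
  shows "fwd (dg_of_ring K) (free_dg p H sc) Y f = fwd (dg_of_ring K) (free_dg p H sc) Y g"
proof -
  let ?B = "dg_of_ring K" and ?F = "free_dg p H sc"
  interpret Y: dg_module ?B Y by fact
  note H = free_onD(1)[OF F] and H2 = free_onD(1)[OF F2]
  interpret H: kmodule K H sc by (rule H)
  interpret H2: kmodule K H2 sc2 by (rule H2)
  have kY: "kmodule K (gr Y i) (act Y 0 i)" for i by (rule dgk_kmodule[OF K Y])
  have dg: "dg_module ?B ?F" by (rule free_dg_module[OF K H])
  interpret F: dg_module ?B ?F by (rule dg)
  have ec: "x \<in> X \<Longrightarrow> e x \<in> carrier H" for x by (rule free_onD(2)[OF F])
  have e2c: "x \<in> X \<Longrightarrow> e2 (Inl x) \<in> carrier H2" "x \<in> X \<Longrightarrow> e2 (Inr x) \<in> carrier H2" for x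
    by (rule free_onD(2)[OF F2], blast)+
  have Fcyc: "h \<in> cyc ?F p" if "h \<in> carrier H" for h using that by (simp add: cyc_iff)
  have Y1: "f p (e x) \<in> cyc Y p" "g p (e x) \<in> cyc Y p" if "x \<in> X" for x
    using that chain_map_cyc[OF F.cochain_complex_axioms Y.cochain_complex_axioms strict_homsD(6)[OF f] Fcyc]
      chain_map_cyc[OF F.cochain_complex_axioms Y.cochain_complex_axioms strict_homsD(6)[OF g] Fcyc] ec by auto
  have "\<forall>x\<in>X. \<exists>y\<in>carrier (gr Y (p - 1)). f p (e x) = df Y (p - 1) y \<otimes>\<^bsub>gr Y p\<^esub> g p (e x)"
    using eq Y.coh_class_eq_iff[OF Y1] by blast
  then obtain y where y: "\<And>x. x \<in> X \<Longrightarrow> y x \<in> carrier (gr Y (p - 1))"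
    "\<And>x. x \<in> X \<Longrightarrow> f p (e x) = df Y (p - 1) (y x) \<otimes>\<^bsub>gr Y p\<^esub> g p (e x)" by metis
  \<comment> \<open>the structure maps of the cylinder: the two ends, the projection, and a contraction\<close>
  obtain a where a: "klinear K H sc H2 sc2 a" "\<And>x. x \<in> X \<Longrightarrow> a (e x) = e2 (Inr x)"
    using free_onD(3)[OF F H2, of "\<lambda>x. e2 (Inr x)"] e2c by blast
  obtain b where b: "klinear K H sc H2 sc2 b" "\<And>x. x \<in> X \<Longrightarrow> b (e x) = e2 (Inl x)"
    using free_onD(3)[OF F H2, of "\<lambda>x. e2 (Inl x)"] e2c by blast
  obtain pr where pr: "klinear K H2 sc2 H sc pr" "\<And>x. x \<in> X \<Longrightarrow> pr (e2 (Inl x)) = e x"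
    "\<And>x. x \<in> X \<Longrightarrow> pr (e2 (Inr x)) = e x"
    using free_onD(3)[OF F2 H, of "\<lambda>s. case s of Inl x \<Rightarrow> e x | Inr x \<Rightarrow> e x"] ec
    by (fastforce split: sum.splits)
  obtain r where r: "klinear K H2 sc2 H sc r" "\<And>x. x \<in> X \<Longrightarrow> r (e2 (Inl x)) = \<one>\<^bsub>H\<^esub>"
    "\<And>x. x \<in> X \<Longrightarrow> r (e2 (Inr x)) = e x"
    using free_onD(3)[OF F2 H, of "\<lambda>s. case s of Inl x \<Rightarrow> \<one>\<^bsub>H\<^esub> | Inr x \<Rightarrow> e x"] ec
    by (fastforce split: sum.splits)
  obtain Phi where Phi: "klinear K H2 sc2 (gr Y p) (act Y 0 p) Phi" "\<And>x. x \<in> X \<Longrightarrow> Phi (e2 (Inl x)) = g p (e x)"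
    "\<And>x. x \<in> X \<Longrightarrow> Phi (e2 (Inr x)) = f p (e x)"
    using free_onD(3)[OF F2 kY[of p], of "\<lambda>s. case s of Inl x \<Rightarrow> g p (e x) | Inr x \<Rightarrow> f p (e x)"] cycD[OF Y1(1)] cycD[OF Y1(2)]
    by (fastforce split: sum.splits)
  obtain s where s: "klinear K H sc (gr Y (p - 1)) (act Y 0 (p - 1)) s" "\<And>x. x \<in> X \<Longrightarrow> s (e x) = y x"
    using free_onD(3)[OF F kY[of "p - 1"], of y] y(1) by blast
  define d where "d = (\<lambda>h. a h \<otimes>\<^bsub>H2\<^esub> inv\<^bsub>H2\<^esub> b h)"
  have d: "klinear K H sc H2 sc2 d"
    unfolding d_def by (rule klinear_mult[OF H H2 a(1) klinear_inv[OF H H2 b(1)]])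
  have hom: "h (u \<otimes>\<^bsub>H2\<^esub> inv\<^bsub>H2\<^esub> v) = h u \<otimes>\<^bsub>G\<^esub> inv\<^bsub>G\<^esub> h v"
    if "klinear K H2 sc2 G s' h" "kmodule K G s'" "u \<in> carrier H2" "v \<in> carrier H2" for h u v G and s' :: "'k \<Rightarrow> 't \<Rightarrow> 't"
    using that klinearD(3)[OF that(1)] hom_inv'[OF H2.G.comm_group_axioms _ klinearD(1)[OF that(1)]]
    by (simp add: kmodule_def)
  have rd: "r (d h) = h" if "h \<in> carrier H" for h
    by (rule free_onD(4)[OF F H klinear_comp[OF d r(1)] klinear_id[OF H] _ that])
      (simp add: d_def hom[OF r(1) H] a b r e2c ec)
  have prd: "pr (d h) = \<one>\<^bsub>H\<^esub>" if "h \<in> carrier H" for h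
    by (rule free_onD(4)[OF F H klinear_comp[OF d pr(1)] klinear_one[OF H] _ that])
      (simp add: d_def hom[OF pr(1) H] a b pr e2c ec)
  have dr: "c = d (r c) \<otimes>\<^bsub>H2\<^esub> b (pr c)" if "c \<in> carrier H2" for c
  proof (rule free_onD(4)[OF F2 H2 klinear_id[OF H2]
        klinear_mult[OF H2 H2 klinear_comp[OF r(1) d] klinear_comp[OF pr(1) b(1)]] _ that])
    fix x assume "x \<in> X <+> X"
    have d1: "d \<one>\<^bsub>H\<^esub> = \<one>\<^bsub>H2\<^esub>" by (rule hom_one'[OF H.G.comm_group_axioms H2.G.comm_group_axioms klinearD(1)[OF d]])
    show "e2 x = d (r (e2 x)) \<otimes>\<^bsub>H2\<^esub> b (pr (e2 x))"
      using \<open>x \<in> X <+> X\<close> by (auto simp: r pr b d1 e2c) (simp add: d_def a b e2c H2.G.m_assoc)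
  qed
  have Phid: "Phi (d h) = df Y (p - 1) (s h)" if "h \<in> carrier H" for h
  proof (rule free_onD(4)[OF F kY[of p] klinear_comp[OF d Phi(1)] _ _ that])
    show "klinear K H sc (gr Y p) (act Y 0 p) (\<lambda>h. df Y (p - 1) (s h))"
      using klinear_comp[OF s(1) dgk_df_klinear[OF K Y, of "p - 1"]] by simp
    fix x assume x: "x \<in> X"
    interpret G: comm_group "gr Y p" by (rule Y.gr_comm_group)
    show "Phi (d (e x)) = df Y (p - 1) (s (e x))"
      using x y Y1 Y.df_closed[OF y(1)[OF x]]
      by (simp add: d_def hom[OF Phi(1) kY[of p]] a b Phi s e2c G.inv_solve_right' cycD)
  qed
  let ?C = "two_term p H sc H2 sc2 d"
  have dgC: "dg_module ?B ?C" by (rule two_term_dg_module[OF K H H2 d])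
  interpret C: dg_module ?B ?C by (rule dgC)
  obtain A where A: "A \<in> strict_homs ?B ?F ?C" "\<And>x. x \<in> X \<Longrightarrow> A p (e x) = e2 (Inr x)"
    by (rule free_strict_exists[OF K F dgC, of "\<lambda>x. e2 (Inr x)" p]) (auto simp: cyc_iff e2c)
  obtain B where B: "B \<in> strict_homs ?B ?F ?C" "\<And>x. x \<in> X \<Longrightarrow> B p (e x) = e2 (Inl x)"
    by (rule free_strict_exists[OF K F dgC, of "\<lambda>x. e2 (Inl x)" p]) (auto simp: cyc_iff e2c)
  obtain P where P: "P \<in> strict_homs ?B ?C ?F" "\<And>c. c \<in> carrier H2 \<Longrightarrow> P p c = pr c"
    by (rule two_term_strict[OF K H H2 d dg, of p "\<lambda>x. \<one>\<^bsub>H\<^esub>" pr])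
      (use pr(1) klinear_one[OF dgk_kmodule[OF K dg, of "p - 1"]] prd in auto)
  obtain Q where Q: "Q \<in> strict_homs ?B ?C Y" "\<And>c. c \<in> carrier H2 \<Longrightarrow> Q p c = Phi c"
  proof (rule two_term_strict[OF K H H2 d Y s(1) Phi(1) Phid])
    show "df Y p (Phi c) = \<one>\<^bsub>gr Y (p + 1)\<^esub>" if "c \<in> carrier H2" for c
      by (rule free_onD(4)[OF F2 kY[of "p + 1"] klinear_comp[OF Phi(1) dgk_df_klinear[OF K Y, of p]] klinear_one[OF kY[of "p + 1"]] _ that])
        (use Y1 in \<open>auto simp: cyc_iff Phi\<close>)
  qed auto
  have Pq: "P \<in> quasi_isos ?B ?C ?F"
  proof -
    have "bij_betw (coh_map ?C ?F i P) (carrier (coh ?C i)) (carrier (coh ?F i))" for i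
    proof (rule coh_map_bijI[OF C.cochain_complex_axioms F.cochain_complex_axioms strict_homsD(6)[OF P(1)]])
      fix m z assume m: "m \<in> cyc ?C i" and z: "z \<in> carrier (gr ?F (i - 1))" and eq: "P i m = df ?F (i - 1) z"
      show "\<exists>y\<in>carrier (gr ?C (i - 1)). m = df ?C (i - 1) y"
      proof (cases "i = p")
        case True
        then have mc: "m \<in> carrier H2" and "pr m = \<one>\<^bsub>H\<^esub>" using m eq P(2) by (auto simp: cyc_iff)
        moreover have "b \<one>\<^bsub>H\<^esub> = \<one>\<^bsub>H2\<^esub>" by (rule hom_one'[OF H.G.comm_group_axioms H2.G.comm_group_axioms klinearD(1)[OF b(1)]])
        moreover have "r m \<in> carrier H" "d (r m) \<in> carrier H2" using klinearD(2)[OF r(1)] klinearD(2)[OF d] mc by auto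
        ultimately show ?thesis using dr[OF mc] True by auto
      next
        case False
        have "m = \<one>\<^bsub>gr ?C i\<^esub>"
        proof (cases "i = p - 1")
          case True
          then have "m \<in> carrier H" "d m = \<one>\<^bsub>H2\<^esub>" using m by (auto simp: cyc_iff)
          moreover have "r \<one>\<^bsub>H2\<^esub> = \<one>\<^bsub>H\<^esub>" by (rule hom_one'[OF H2.G.comm_group_axioms H.G.comm_group_axioms klinearD(1)[OF r(1)]])
          ultimately show ?thesis using rd[of m] True by simp
        qed (use m False in \<open>simp add: cyc_iff\<close>)
        then show ?thesis using C.df_one[of "i - 1"] C.gr_one[of "i - 1"] by (intro bexI[of _ "\<one>\<^bsub>gr ?C (i - 1)\<^esub>"]) simp_all
      qed
    next
      fix n assume n: "n \<in> cyc ?F i"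
      show "\<exists>m\<in>cyc ?C i. coh_class ?F i n = coh_class ?F i (P i m)"
      proof (cases "i = p")
        case True
        then have nc: "n \<in> carrier H" using n by (simp add: cyc_iff)
        have "pr (b n) = n"
          by (rule free_onD(4)[OF F H klinear_comp[OF b(1) pr(1)] klinear_id[OF H] _ nc]) (simp add: b pr)
        then show ?thesis
          using nc klinearD(2)[OF b(1)] True by (intro bexI[of _ "b n"]) (auto simp: P(2) cyc_iff)
      next
        case False
        then have "n = \<one>\<^bsub>gr ?F i\<^esub>" using n by (cases "i = p - 1") (auto simp: cyc_iff)
        then show ?thesis
          using hom_one'[OF C.gr_comm_group F.gr_comm_group strict_homsD(1)[OF P(1)], of i]
          by (intro bexI[of _ "\<one>\<^bsub>gr ?C i\<^esub>"]) (simp_all del: two_term_simps)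
      qed
    qed
    then show ?thesis using P(1) by (simp add: quasi_isos_def)
  qed
  let ?S = "strict_cat ?B"
  have cF: "e x \<in> carrier (gr ?F p)" if "x \<in> X" for x using ec that by simp
  have "Cmp ?S ?F ?C ?F P A = Cmp ?S ?F ?C ?F P B"
    unfolding strict_cat_simps
    by (rule free_strict_ext[OF K F dg strict_comp[OF dg A(1) P(1)] strict_comp[OF dg B(1) P(1)]])
      (simp add: compose_eq A B P(2) e2c ec pr)
  then have AB: "fwd ?B ?F ?C A = fwd ?B ?F ?C B"
    by (intro str.W_cancel[OF _ _ _ _ _ Pq]) (use A B dg dgC in auto)
  have fA: "f = Cmp ?S ?F ?C Y Q A" unfolding strict_cat_simps
    by (rule free_strict_ext[OF K F Y f strict_comp[OF dg A(1) Q(1)]])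
      (simp add: compose_eq A Q(2) e2c ec Phi)
  have gB: "g = Cmp ?S ?F ?C Y Q B" unfolding strict_cat_simps
    by (rule free_strict_ext[OF K F Y g strict_comp[OF dg B(1) Q(1)]])
      (simp add: compose_eq B Q(2) e2c ec Phi)
  show ?thesis
    using str.fwd_Cmp[of ?F ?B ?C Y A Q] str.fwd_Cmp[of ?F ?B ?C Y B Q] A B Q dg dgC Y AB
    unfolding fA[symmetric] gB[symmetric] by simp
qed

text \<open>\<open>F\<close> with the classes \<open>e x\<close> corepresents, on the derived category of \<open>K\<close>, the functor of \<open>X\<close>-indexed
  families of classes in $H^p$.\<close>

definition corepresents ::
    "'k ring \<Rightarrow> int \<Rightarrow> 'e set \<Rightarrow> ('k, 't) dg_module \<Rightarrow> ('e \<Rightarrow> 't set) \<Rightarrow> bool"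
  where "corepresents K p X F e \<longleftrightarrow>
    dg_module (dg_of_ring K) F \<and> (\<forall>x\<in>X. e x \<in> carrier (coh F p)) \<and>
    (\<forall>Y z. dg_module (dg_of_ring K) Y \<and> (\<forall>x\<in>X. z x \<in> carrier (coh Y p)) \<longrightarrow>
      (\<exists>\<phi>\<in>Mor (der_cat (dg_of_ring K)) F Y. \<forall>x\<in>X. der_coh_map p F \<phi> (e x) = z x)) \<and>
    (\<forall>Y \<phi> \<psi>. \<phi> \<in> Mor (der_cat (dg_of_ring K)) F Y \<and> \<psi> \<in> Mor (der_cat (dg_of_ring K)) F Y \<and>
      (\<forall>x\<in>X. der_coh_map p F \<phi> (e x) = der_coh_map p F \<psi> (e x)) \<longrightarrow> \<phi> = \<psi>)"

text \<open>Morphisms of the derived category out of a free module are strict: along a formal inverse of \<open>w\<close>, the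
  images of the generators lift through \<open>w\<close> up to coboundaries, and \<open>free_homotopy\<close> makes the
  coboundaries irrelevant.\<close>

lemma free_lift_roof:
  fixes K :: "'k ring" and H H2 :: "'t monoid"
  assumes K: "cring K" and F: "free_on K X H sc e" and F2: "free_on K (X <+> X) H2 sc2 e2"
    and \<phi>: "\<phi> \<in> Mor (der_cat (dg_of_ring K)) Y Z"
    and f: "f \<in> strict_homs (dg_of_ring K) (free_dg p H sc) Y"
  shows "\<exists>g\<in>strict_homs (dg_of_ring K) (free_dg p H sc) Z.
    Cmp (der_cat (dg_of_ring K)) (free_dg p H sc) Y Z \<phi> (fwd (dg_of_ring K) (free_dg p H sc) Y f) =
    fwd (dg_of_ring K) (free_dg p H sc) Z g"
  using \<phi> f unfolding der_cat_def
proof (induction arbitrary: f rule: str.loc_induct)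
  let ?B = "dg_of_ring K" and ?F = "free_dg p H sc"
  let ?D = "localization (strict_cat ?B) (quasi_isos ?B)"
  have dgF: "dg_module ?B ?F" by (rule free_dg_module[OF K free_onD(1)[OF F]])
  interpret F: dg_module ?B ?F by (rule dgF)
  have ec: "e x \<in> cyc ?F p" if "x \<in> X" for x using free_onD(2)[OF F that] by (simp add: cyc_iff)
  have fM: "fwd ?B U V h \<in> Mor ?D U V" if "dg_module ?B U" "dg_module ?B V" "h \<in> strict_homs ?B U V" for U V h
    using fwd_der_Mor[OF that] by (simp add: der_cat_def)
  {
    case (Idt Y)
    then show ?case using str.Cmp_Idt_left[OF fM[OF dgF _ Idt(2)]] by auto
  next
    case (fwd Y Y' Z h \<phi>)
    have Y: "dg_module ?B Y" "dg_module ?B Y'" and h: "h \<in> strict_homs ?B Y Y'" using fwd by auto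
    let ?g = "\<lambda>i. compose (carrier (gr ?F i)) (h i) (f i)"
    have g: "?g \<in> strict_homs ?B ?F Y'" by (rule strict_comp[OF dgF fwd.prems h])
    have "Cmp ?D ?F Y Z (Cmp ?D Y Y' Z \<phi> (fwd ?B Y Y' h)) (fwd ?B ?F Y f) =
        Cmp ?D ?F Y' Z \<phi> (Cmp ?D ?F Y Y' (fwd ?B Y Y' h) (fwd ?B ?F Y f))"
      by (rule str.Cmp_assoc[OF fM[OF dgF Y(1) fwd.prems] fM[OF Y h] fwd(4)])
    also have "Cmp ?D ?F Y Y' (fwd ?B Y Y' h) (fwd ?B ?F Y f) = fwd ?B ?F Y' ?g"
      using str.fwd_Cmp[of ?F ?B Y Y' f h] dgF Y fwd.prems h by simp
    finally show ?case using fwd.IH[OF g] by simp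
  next
    case (bwd Y Y' Z w \<phi>)
    have Y: "dg_module ?B Y" "dg_module ?B Y'" and w: "w \<in> quasi_isos ?B Y' Y" using bwd by auto
    interpret Y: dg_module ?B Y by fact
    interpret Y': dg_module ?B Y' by fact
    note ws = quasi_isosD(1)[OF w] and wb = quasi_isosD(2)[OF w, of p]
    note wc = coh_map_class[OF Y'.cochain_complex_axioms Y.cochain_complex_axioms strict_homsD(6)[OF ws]]
    \<comment> \<open>lift the generators through the quasi-isomorphism, up to coboundaries\<close>
    have "\<exists>z\<in>cyc Y' p. coh_class Y p (w p z) = coh_class Y p (f p (e x))" if x: "x \<in> X" for x
    proof -
      have "coh_class Y p (f p (e x)) \<in> carrier (coh Y p)"
        by (intro Y.coh_class_closed chain_map_cyc[OF F.cochain_complex_axioms Y.cochain_complex_axioms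
              strict_homsD(6)[OF bwd.prems]] ec x)
      then obtain y where "y \<in> carrier (coh Y' p)" "coh_map Y' Y p w y = coh_class Y p (f p (e x))"
        using wb unfolding bij_betw_def by (metis imageE)
      then show ?thesis using Y'.coh_cases wc by metis
    qed
    then obtain z where z: "\<And>x. x \<in> X \<Longrightarrow> z x \<in> cyc Y' p"
      "\<And>x. x \<in> X \<Longrightarrow> coh_class Y p (w p (z x)) = coh_class Y p (f p (e x))" by metis
    obtain g where g: "g \<in> strict_homs ?B ?F Y'" "\<And>x. x \<in> X \<Longrightarrow> g p (e x) = z x"
      using free_strict_exists[OF K F Y(2), of z p] z(1) by metis
    let ?wg = "\<lambda>i. compose (carrier (gr ?F i)) (w i) (g i)"
    have wg: "?wg \<in> strict_homs ?B ?F Y" by (rule strict_comp[OF dgF g(1) ws])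
    have eq: "fwd ?B ?F Y f = fwd ?B ?F Y ?wg"
      by (rule free_homotopy[OF K F F2 Y(1) bwd.prems wg])
        (simp add: compose_eq free_onD(2)[OF F] z(2) g(2))
    also have "\<dots> = Cmp ?D ?F Y' Y (fwd ?B Y' Y w) (fwd ?B ?F Y' g)"
      using str.fwd_Cmp[of ?F ?B Y' Y g w] dgF Y g(1) ws by simp
    finally have fw: "fwd ?B ?F Y f = Cmp ?D ?F Y' Y (fwd ?B Y' Y w) (fwd ?B ?F Y' g)" .
    let ?b = "zz_class (strict_cat ?B) (quasi_isos ?B) Y Y' [Bwd Y Y' w]"
    have b: "?b \<in> Mor ?D Y Y'" using w Y by (intro str.bwd_Mor) auto
    note gM = fM[OF dgF Y(2) g(1)] and wM = fM[OF Y(2) Y(1) ws] and fM' = fM[OF dgF Y(1) bwd.prems]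
    have bf: "Cmp ?D ?F Y Y' ?b (fwd ?B ?F Y f) = fwd ?B ?F Y' g"
      unfolding fw str.Cmp_assoc[OF gM wM b, symmetric]
      using str.bwd_fwd(1)[of Y' ?B Y w] Y w str.Cmp_Idt_left[OF gM] by simp
    have "Cmp ?D ?F Y Z (Cmp ?D Y Y' Z \<phi> ?b) (fwd ?B ?F Y f) = Cmp ?D ?F Y' Z \<phi> (fwd ?B ?F Y' g)"
      unfolding str.Cmp_assoc[OF fM' b bwd(4)] bf ..
    then show ?case using bwd.IH[OF g(1)] by simp
  }
qed

lemma free_corepresents:
  fixes K :: "'k ring" and X :: "'e set"
  assumes K: "cring K" and inf: "infinite (UNIV :: 't set)" and cardK: "carrier K \<lesssim> (UNIV :: 't set)"
    and cardX: "X \<lesssim> (UNIV :: 't set)"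
  shows "\<exists>(F :: ('k, 't) dg_module) e. corepresents K p X F e"
proof -
  obtain H :: "'t monoid" and sc e where F: "free_on K X H sc e"
    by (rule free_on_exists[OF K inf cardK cardX])
  obtain H2 :: "'t monoid" and sc2 e2 where F2: "free_on K (X <+> X) H2 sc2 e2"
    by (rule free_on_exists[OF K inf cardK plus_lepoll_infinite[OF inf cardX cardX]])
  let ?B = "dg_of_ring K" and ?F = "free_dg p H sc"
  let ?e = "\<lambda>x. coh_class ?F p (e x)"
  have dgF: "dg_module ?B ?F" by (rule free_dg_module[OF K free_onD(1)[OF F]])
  interpret F: dg_module ?B ?F by (rule dgF)
  have ec: "e x \<in> cyc ?F p" if "x \<in> X" for x using free_onD(2)[OF F that] by (simp add: cyc_iff)
  have coh: "der_coh_map p ?F (fwd ?B ?F Y g) (?e x) = coh_class Y p (g p (e x))"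
    if "dg_module ?B Y" "g \<in> strict_homs ?B ?F Y" "x \<in> X" for Y g x
    using that der_coh_fwd[OF dgF that(1,2) F.coh_class_closed[OF ec]]
      coh_map_class[OF F.cochain_complex_axioms dg_module_complex[OF that(1)] strict_homsD(6)[OF that(2)] ec] by simp
  have strict: "\<exists>g\<in>strict_homs ?B ?F Y. \<phi> = fwd ?B ?F Y g" if \<phi>: "\<phi> \<in> Mor (der_cat ?B) ?F Y" for \<phi> Y
  proof -
    have "fwd ?B ?F ?F (\<lambda>i. \<lambda>m\<in>carrier (gr ?F i). m) = Idt (der_cat ?B) ?F"
      using str.fwd_Idt[of ?F ?B] dgF by (simp add: der_cat_def)
    moreover have "Cmp (der_cat ?B) ?F ?F Y \<phi> (Idt (der_cat ?B) ?F) = \<phi>"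
      using str.Cmp_Idt_right \<phi> by (simp add: der_cat_def)
    ultimately show ?thesis using free_lift_roof[OF K F F2 \<phi> strict_id[OF dgF]] by simp
  qed
  have "corepresents K p X ?F ?e"
    unfolding corepresents_def
  proof (intro conjI allI impI ballI)
    show "dg_module ?B ?F" by (rule dgF)
    show "?e x \<in> carrier (coh ?F p)" if "x \<in> X" for x by (rule F.coh_class_closed[OF ec[OF that]])
  next
    fix Y :: "('k, 't) dg_module" and z assume a: "dg_module ?B Y \<and> (\<forall>x\<in>X. z x \<in> carrier (coh Y p))"
    then interpret Y: dg_module ?B Y by simp
    obtain f where f: "f \<in> strict_homs ?B ?F Y" "\<And>x. x \<in> X \<Longrightarrow> f p (e x) = (SOME m. m \<in> z x)"
      using free_strict_exists[OF K F Y.dg_module_axioms, of "\<lambda>x. SOME m. m \<in> z x" p] Y.coh_rep(1) a by metis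
    show "\<exists>\<phi>\<in>Mor (der_cat ?B) ?F Y. \<forall>x\<in>X. der_coh_map p ?F \<phi> (?e x) = z x"
      using f a fwd_der_Mor[OF dgF _ f(1)] by (intro bexI[of _ "fwd ?B ?F Y f"]) (auto simp: coh Y.coh_rep(2))
  next
    fix Y \<phi> \<psi> assume a: "\<phi> \<in> Mor (der_cat ?B) ?F Y \<and> \<psi> \<in> Mor (der_cat ?B) ?F Y \<and>
      (\<forall>x\<in>X. der_coh_map p ?F \<phi> (?e x) = der_coh_map p ?F \<psi> (?e x))"
    then obtain f g where f: "f \<in> strict_homs ?B ?F Y" "\<phi> = fwd ?B ?F Y f"
      and g: "g \<in> strict_homs ?B ?F Y" "\<psi> = fwd ?B ?F Y g" using strict by meson
    have Y: "dg_module ?B Y" using a der_Mor_dg by blast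
    show "\<phi> = \<psi>"
      unfolding f g by (rule free_homotopy[OF K F F2 Y f(1) g(1)]) (use a f g coh[OF Y] in auto)
  qed
  then show ?thesis by blast
qed

section \<open>The cohomology of a left derived functor\<close>

definition set_functor ::
    "('p, 'n) category \<Rightarrow> ('p \<Rightarrow> 'e set) \<Rightarrow> ('p \<Rightarrow> 'p \<Rightarrow> 'n \<Rightarrow> 'e \<Rightarrow> 'e) \<Rightarrow> bool"
  where "set_functor D S Sm \<longleftrightarrow>
    (\<forall>X\<in>Ob D. \<forall>Y\<in>Ob D. \<forall>f\<in>Mor D X Y. Sm X Y f \<in> S X \<rightarrow> S Y) \<and>
    (\<forall>X\<in>Ob D. \<forall>x\<in>S X. Sm X X (Idt D X) x = x) \<and>
    (\<forall>X\<in>Ob D. \<forall>Y\<in>Ob D. \<forall>Z\<in>Ob D. \<forall>f\<in>Mor D X Y. \<forall>g\<in>Mor D Y Z. \<forall>x\<in>S X.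
      Sm X Z (Cmp D X Y Z g f) x = Sm Y Z g (Sm X Y f x))"

text \<open>Uniqueness in the corepresenting property makes the free modules on the values of \<open>S\<close> into a
  functor.\<close>

lemma free_functor_exists:
  fixes K :: "'k ring" and S :: "'p \<Rightarrow> 'e set"
  assumes K: "cring K" and inf: "infinite (UNIV :: 't set)" and cardK: "carrier K \<lesssim> (UNIV :: 't set)"
    and S: "set_functor D S Sm" and cardS: "\<And>X. X \<in> Ob D \<Longrightarrow> S X \<lesssim> (UNIV :: 't set)"
  obtains G :: "('p, 'n, ('k, 't) dg_module, ('k, 't) der_mor) functr" and e
  where "is_functor D (der_cat (dg_of_ring K)) G"
    "\<And>X. X \<in> Ob D \<Longrightarrow> corepresents K p (S X) (fob G X) (e X)"
    "\<And>X Y f x. \<lbrakk>X \<in> Ob D; Y \<in> Ob D; f \<in> Mor D X Y; x \<in> S X\<rbrakk> \<Longrightarrow>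
      der_coh_map p (fob G X) (fmor G X Y f) (e X x) = e Y (Sm X Y f x)"
proof -
  let ?E = "der_cat (dg_of_ring K) :: (('k, 't) dg_module, ('k, 't) der_mor) category"
  have "\<forall>X. \<exists>(F :: ('k, 't) dg_module) e. X \<in> Ob D \<longrightarrow> corepresents K p (S X) F e"
    using free_corepresents[OF K inf cardK cardS] by blast
  then obtain Fr :: "'p \<Rightarrow> ('k, 't) dg_module" and e
    where rep: "\<And>X. X \<in> Ob D \<Longrightarrow> corepresents K p (S X) (Fr X) (e X)" by metis
  define Gm where "Gm X Y f = (SOME \<phi>. \<phi> \<in> Mor ?E (Fr X) (Fr Y) \<and>
    (\<forall>x\<in>S X. der_coh_map p (Fr X) \<phi> (e X x) = e Y (Sm X Y f x)))" for X Y f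
  define G where "G = \<lparr>fob = Fr, fmor = Gm\<rparr>"
  have dg: "dg_module (dg_of_ring K) (Fr X)" if "X \<in> Ob D" for X using rep[OF that] by (simp add: corepresents_def)
  have ec: "e X x \<in> carrier (coh (Fr X) p)" if "X \<in> Ob D" "x \<in> S X" for X x
    using rep[OF that(1)] that(2) by (simp add: corepresents_def)
  have Sm: "Sm X Y f x \<in> S Y" if "X \<in> Ob D" "Y \<in> Ob D" "f \<in> Mor D X Y" "x \<in> S X" for X Y f x
    using S that unfolding set_functor_def by blast
  have Gm: "Gm X Y f \<in> Mor ?E (Fr X) (Fr Y)" "x \<in> S X \<Longrightarrow> der_coh_map p (Fr X) (Gm X Y f) (e X x) = e Y (Sm X Y f x)"
    if "X \<in> Ob D" "Y \<in> Ob D" "f \<in> Mor D X Y" for X Y f x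
  proof -
    have z: "\<forall>x\<in>S X. e Y (Sm X Y f x) \<in> carrier (coh (Fr Y) p)" using ec Sm that by blast
    have "\<exists>\<phi>\<in>Mor ?E (Fr X) (Fr Y). \<forall>x\<in>S X. der_coh_map p (Fr X) \<phi> (e X x) = e Y (Sm X Y f x)"
      using conjunct1[OF conjunct2[OF conjunct2[OF rep[OF that(1), unfolded corepresents_def]]],
        rule_format, OF conjI[OF dg[OF that(2)] z]] .
    then have "\<exists>\<phi>. \<phi> \<in> Mor ?E (Fr X) (Fr Y) \<and> (\<forall>x\<in>S X. der_coh_map p (Fr X) \<phi> (e X x) = e Y (Sm X Y f x))"
      by blast
    from someI_ex[OF this]
    show "Gm X Y f \<in> Mor ?E (Fr X) (Fr Y)" "x \<in> S X \<Longrightarrow> der_coh_map p (Fr X) (Gm X Y f) (e X x) = e Y (Sm X Y f x)"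
      unfolding Gm_def by blast+
  qed
  have ext: "\<phi> = \<psi>" if "X \<in> Ob D" "\<phi> \<in> Mor ?E (Fr X) Y" "\<psi> \<in> Mor ?E (Fr X) Y"
    "\<And>x. x \<in> S X \<Longrightarrow> der_coh_map p (Fr X) \<phi> (e X x) = der_coh_map p (Fr X) \<psi> (e X x)" for X Y \<phi> \<psi>
    using conjunct2[OF conjunct2[OF conjunct2[OF rep[OF that(1), unfolded corepresents_def]]], rule_format, of \<phi> Y \<psi>] that
    by blast
  have EC: "Cmp ?E U V W \<psi> \<phi> \<in> Mor ?E U W" if "\<phi> \<in> Mor ?E U V" "\<psi> \<in> Mor ?E V W" for U V W \<phi> \<psi>
    using that unfolding der_cat_def by (rule str.Cmp_loc_Mor)
  have "is_functor D ?E G"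
    unfolding is_functor_def G_def functr.simps
  proof (intro conjI ballI)
    show "Fr X \<in> Ob ?E" if "X \<in> Ob D" for X using dg[OF that] by simp
    show "Gm X Y f \<in> Mor ?E (Fr X) (Fr Y)" if "X \<in> Ob D" "Y \<in> Ob D" "f \<in> Mor D X Y" for X Y f
      using Gm(1) that .
  next
    fix X assume X: "X \<in> Ob D"
    show "Gm X X (Idt D X) = Idt ?E (Fr X)"
    proof -
      have id: "Idt ?E (Fr X) \<in> Mor ?E (Fr X) (Fr X)" unfolding der_cat_def
        using dg[OF X] by (intro str.Idt_loc_Mor) simp
      have "Gm X X (Idt D X) \<in> Mor ?E (Fr X) (Fr X) \<and>
        (\<forall>x\<in>S X. der_coh_map p (Fr X) (Gm X X (Idt D X)) (e X x) = e X (Sm X X (Idt D X) x))"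
        unfolding Gm_def
        by (rule someI[of _ "Idt ?E (Fr X)"])
          (use id X S in \<open>simp add: der_coh_Idt[OF dg[OF X]] ec set_functor_def\<close>)
      then show ?thesis
        by (intro ext[OF X _ id]) (use X S in \<open>auto simp: der_coh_Idt[OF dg[OF X]] ec set_functor_def\<close>)
    qed
  next
    fix X Y Z f g assume XYZ: "X \<in> Ob D" "Y \<in> Ob D" "Z \<in> Ob D" and f: "f \<in> Mor D X Y" and g: "g \<in> Mor D Y Z"
    note Gf = Gm[OF XYZ(1,2) f] and Gg = Gm[OF XYZ(2,3) g]
    have c: "Cmp ?E (Fr X) (Fr Y) (Fr Z) (Gm Y Z g) (Gm X Y f) \<in> Mor ?E (Fr X) (Fr Z)"
      by (rule EC[OF Gf(1) Gg(1)])
    have cx: "der_coh_map p (Fr X) (Cmp ?E (Fr X) (Fr Y) (Fr Z) (Gm Y Z g) (Gm X Y f)) (e X x) =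
        e Z (Sm X Z (Cmp D X Y Z g f) x)" if x: "x \<in> S X" for x
    proof -
      have "Sm X Z (Cmp D X Y Z g f) x = Sm Y Z g (Sm X Y f x)"
        using S XYZ f g x unfolding set_functor_def by blast
      then show ?thesis
        using der_coh_Cmp'[OF Gf(1) Gg(1) ec[OF XYZ(1) x]] Gf(2)[OF x] Gg(2)[OF Sm[OF XYZ(1,2) f x]] by simp
    qed
    have "Gm X Z (Cmp D X Y Z g f) \<in> Mor ?E (Fr X) (Fr Z) \<and>
        (\<forall>x\<in>S X. der_coh_map p (Fr X) (Gm X Z (Cmp D X Y Z g f)) (e X x) = e Z (Sm X Z (Cmp D X Y Z g f) x))"
      unfolding Gm_def[of X Z] by (rule someI) (use c cx in blast)
    then show "Gm X Z (Cmp D X Y Z g f) = Cmp ?E (Fr X) (Fr Y) (Fr Z) (Gm Y Z g) (Gm X Y f)"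
      using cx by (intro ext[OF XYZ(1) _ c]) auto
  qed
  then show thesis
    by (rule that[of G e]) (use rep Gm in \<open>auto simp: G_def\<close>)
qed

text \<open>The functors \<open>Q\<close> and \<open>F\<close> are arbitrary here: what follows uses only the universal property and
  free modules in the target category.\<close>

locale derived_functor =
  fixes K :: "'k ring" and C :: "('o, 'm) category" and D :: "('p, 'n) category"
    and Q :: "('o, 'm, 'p, 'n) functr" and F :: "('o, 'm, ('k, 't) dg_module, ('k, 't) der_mor) functr"
    and L :: "('p, 'n, ('k, 't) dg_module, ('k, 't) der_mor) functr" and \<eta>
  assumes K: "cring K" and inf: "infinite (UNIV :: 't set)" and cardK: "carrier K \<lesssim> (UNIV :: 't set)"
    and Q: "is_functor C D Q"
    and F_Mor: "\<lbrakk>X \<in> Ob C; Y \<in> Ob C; f \<in> Mor C X Y\<rbrakk> \<Longrightarrow>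
      fmor F X Y f \<in> Mor (der_cat (dg_of_ring K)) (fob F X) (fob F Y)"
    and derived: "left_derived C D (der_cat (dg_of_ring K)) Q F L \<eta>"
begin

abbreviation (input) "E \<equiv> der_cat (dg_of_ring K)"

abbreviation (input) "HL p X \<equiv> carrier (coh (fob L X) p)"

lemma L: "is_functor D E L" and eta: "\<eta> \<in> nat_trans C E (comp_functor L Q) F"
  and universal: "\<lbrakk>is_functor D E G; t \<in> nat_trans C E (comp_functor G Q) F\<rbrakk> \<Longrightarrow>
    \<exists>!\<mu>. \<mu> \<in> nat_trans D E G L \<and>
      (\<forall>X\<in>Ob C. t X = Cmp E (fob G (fob Q X)) (fob L (fob Q X)) (fob F X) (\<eta> X) (\<mu> (fob Q X)))"
  using derived unfolding left_derived_def by blast+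

lemma Q_Ob: "X \<in> Ob C \<Longrightarrow> fob Q X \<in> Ob D"
  and Q_Mor: "\<lbrakk>X \<in> Ob C; Y \<in> Ob C; f \<in> Mor C X Y\<rbrakk> \<Longrightarrow> fmor Q X Y f \<in> Mor D (fob Q X) (fob Q Y)"
  using Q unfolding is_functor_def by blast+

lemma L_Ob: "X \<in> Ob D \<Longrightarrow> dg_module (dg_of_ring K) (fob L X)"
  and L_Mor: "\<lbrakk>X \<in> Ob D; Y \<in> Ob D; f \<in> Mor D X Y\<rbrakk> \<Longrightarrow> fmor L X Y f \<in> Mor E (fob L X) (fob L Y)"
  and L_Idt: "X \<in> Ob D \<Longrightarrow> fmor L X X (Idt D X) = Idt E (fob L X)"
  and L_Cmp: "\<lbrakk>X \<in> Ob D; Y \<in> Ob D; Z \<in> Ob D; f \<in> Mor D X Y; g \<in> Mor D Y Z\<rbrakk> \<Longrightarrow>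
    fmor L X Z (Cmp D X Y Z g f) = Cmp E (fob L X) (fob L Y) (fob L Z) (fmor L Y Z g) (fmor L X Y f)"
  using L unfolding is_functor_def by (simp_all add: Ob_der[symmetric] del: Ob_der)

lemma eta_Mor: "X \<in> Ob C \<Longrightarrow> \<eta> X \<in> Mor E (fob L (fob Q X)) (fob F X)"
  using eta by (auto simp: nat_trans_def comp_functor_def PiE_def)

lemma F_Ob: "X \<in> Ob C \<Longrightarrow> dg_module (dg_of_ring K) (fob F X)"
  using der_Mor_dg[OF eta_Mor] by blast

definition HLm :: "int \<Rightarrow> 'p \<Rightarrow> 'p \<Rightarrow> 'n \<Rightarrow> 't set \<Rightarrow> 't set"
  where "HLm p X Y f = der_coh_map p (fob L X) (fmor L X Y f)"

definition Heta :: "int \<Rightarrow> 'o \<Rightarrow> 't set \<Rightarrow> 't set"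
  where "Heta p X = der_coh_map p (fob L (fob Q X)) (\<eta> X)"

definition HFm :: "int \<Rightarrow> 'o \<Rightarrow> 'o \<Rightarrow> 'm \<Rightarrow> 't set \<Rightarrow> 't set"
  where "HFm p X Y f = der_coh_map p (fob F X) (fmor F X Y f)"

lemma HLm_closed: "\<lbrakk>X \<in> Ob D; Y \<in> Ob D; f \<in> Mor D X Y; y \<in> HL p X\<rbrakk> \<Longrightarrow> HLm p X Y f y \<in> HL p Y"
  unfolding HLm_def by (rule der_coh_closed[OF L_Mor])

lemma HLm_Idt: "X \<in> Ob D \<Longrightarrow> y \<in> HL p X \<Longrightarrow> HLm p X X (Idt D X) y = y"
  by (simp add: HLm_def L_Idt der_coh_Idt[OF L_Ob])

lemma HLm_Cmp:
  "\<lbrakk>X \<in> Ob D; Y \<in> Ob D; Z \<in> Ob D; f \<in> Mor D X Y; g \<in> Mor D Y Z; y \<in> HL p X\<rbrakk> \<Longrightarrow>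
    HLm p X Z (Cmp D X Y Z g f) y = HLm p Y Z g (HLm p X Y f y)"
  by (simp add: HLm_def L_Cmp der_coh_Cmp'[OF L_Mor L_Mor])

lemma Heta_closed: "X \<in> Ob C \<Longrightarrow> y \<in> HL p (fob Q X) \<Longrightarrow> Heta p X y \<in> carrier (coh (fob F X) p)"
  unfolding Heta_def by (rule der_coh_closed[OF eta_Mor])

lemma Heta_nat:
  assumes "X \<in> Ob C" "Y \<in> Ob C" "f \<in> Mor C X Y" "y \<in> HL p (fob Q X)"
  shows "Heta p Y (HLm p (fob Q X) (fob Q Y) (fmor Q X Y f) y) = HFm p X Y f (Heta p X y)"
proof -
  have "Cmp E (fob L (fob Q X)) (fob L (fob Q Y)) (fob F Y) (\<eta> Y) (fmor L (fob Q X) (fob Q Y) (fmor Q X Y f)) =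
      Cmp E (fob L (fob Q X)) (fob F X) (fob F Y) (fmor F X Y f) (\<eta> X)"
    using eta assms(1-3) by (simp add: nat_trans_def comp_functor_def)
  then show ?thesis
    unfolding HLm_def Heta_def HFm_def
    using der_coh_Cmp'[OF L_Mor[OF Q_Ob[OF assms(1)] Q_Ob[OF assms(2)] Q_Mor[OF assms(1-3)]] eta_Mor[OF assms(2)] assms(4)]
      der_coh_Cmp'[OF eta_Mor[OF assms(1)] F_Mor[OF assms(1-3)] assms(4)] by simp
qed

lemma corep_exists:
  assumes "corepresents K p S U e" "dg_module (dg_of_ring K) Y" "\<And>x. x \<in> S \<Longrightarrow> z x \<in> carrier (coh Y p)"
  obtains \<phi> where "\<phi> \<in> Mor E U Y" "\<And>x. x \<in> S \<Longrightarrow> der_coh_map p U \<phi> (e x) = z x"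
proof -
  have "\<forall>x\<in>S. z x \<in> carrier (coh Y p)" using assms(3) by blast
  then have "\<exists>\<phi>\<in>Mor E U Y. \<forall>x\<in>S. der_coh_map p U \<phi> (e x) = z x"
    using conjunct1[OF conjunct2[OF conjunct2[OF assms(1)[unfolded corepresents_def]]], rule_format, OF conjI[OF assms(2)]]
    by simp
  then show thesis using that by blast
qed

lemma corep_ext:
  assumes "corepresents K p S U e" "\<phi> \<in> Mor E U Y" "\<psi> \<in> Mor E U Y"
    "\<And>x. x \<in> S \<Longrightarrow> der_coh_map p U \<phi> (e x) = der_coh_map p U \<psi> (e x)"
  shows "\<phi> = \<psi>"
  using conjunct2[OF conjunct2[OF conjunct2[OF assms(1)[unfolded corepresents_def]]], rule_format, of \<phi> Y \<psi>] assms(2-4)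
  by simp

lemma corep_closed: "corepresents K p S U e \<Longrightarrow> x \<in> S \<Longrightarrow> e x \<in> carrier (coh U p)"
  by (simp add: corepresents_def)

lemma E_Cmp: "\<phi> \<in> Mor E U V \<Longrightarrow> \<psi> \<in> Mor E V W \<Longrightarrow> Cmp E U V W \<psi> \<phi> \<in> Mor E U W"
  unfolding der_cat_def by (rule str.Cmp_loc_Mor)

text \<open>The Yoneda lemma for corepresenting objects: a natural map into cohomology is a natural
  transformation out of the functor of free modules.\<close>

lemma nat_trans_from_free:
  fixes p :: int
  assumes G: "is_functor C' E G" and rep: "\<And>X. X \<in> Ob C' \<Longrightarrow> corepresents K p (S X) (fob G X) (e X)"
    and Gm: "\<And>X Y f x. \<lbrakk>X \<in> Ob C'; Y \<in> Ob C'; f \<in> Mor C' X Y; x \<in> S X\<rbrakk> \<Longrightarrow>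
      Sm X Y f x \<in> S Y \<and> der_coh_map p (fob G X) (fmor G X Y f) (e X x) = e Y (Sm X Y f x)"
    and F': "\<And>X. X \<in> Ob C' \<Longrightarrow> dg_module (dg_of_ring K) (fob F' X)"
      "\<And>X Y f. \<lbrakk>X \<in> Ob C'; Y \<in> Ob C'; f \<in> Mor C' X Y\<rbrakk> \<Longrightarrow> fmor F' X Y f \<in> Mor E (fob F' X) (fob F' Y)"
    and t: "\<And>X x. \<lbrakk>X \<in> Ob C'; x \<in> S X\<rbrakk> \<Longrightarrow> t X x \<in> carrier (coh (fob F' X) p)"
      "\<And>X Y f x. \<lbrakk>X \<in> Ob C'; Y \<in> Ob C'; f \<in> Mor C' X Y; x \<in> S X\<rbrakk> \<Longrightarrow>
        t Y (Sm X Y f x) = der_coh_map p (fob F' X) (fmor F' X Y f) (t X x)"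
  obtains \<mu> where "\<mu> \<in> nat_trans C' E G F'"
    "\<And>X x. \<lbrakk>X \<in> Ob C'; x \<in> S X\<rbrakk> \<Longrightarrow> der_coh_map p (fob G X) (\<mu> X) (e X x) = t X x"
proof -
  have "\<exists>\<phi>. X \<in> Ob C' \<longrightarrow> \<phi> \<in> Mor E (fob G X) (fob F' X) \<and> (\<forall>x\<in>S X. der_coh_map p (fob G X) \<phi> (e X x) = t X x)" for X
  proof (cases "X \<in> Ob C'")
    case True
    obtain \<phi> where "\<phi> \<in> Mor E (fob G X) (fob F' X)" "\<And>x. x \<in> S X \<Longrightarrow> der_coh_map p (fob G X) \<phi> (e X x) = t X x"
      by (rule corep_exists[OF rep[OF True] F'(1)[OF True] t(1)[OF True]]) (assumption | rule that)+
    then show ?thesis by blast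
  qed simp
  then obtain \<mu> where \<mu>: "\<And>X. X \<in> Ob C' \<Longrightarrow> \<mu> X \<in> Mor E (fob G X) (fob F' X)"
    "\<And>X x. X \<in> Ob C' \<Longrightarrow> x \<in> S X \<Longrightarrow> der_coh_map p (fob G X) (\<mu> X) (e X x) = t X x" by metis
  have "restrict \<mu> (Ob C') \<in> nat_trans C' E G F'"
    unfolding nat_trans_def
  proof (intro CollectI conjI ballI)
    show "restrict \<mu> (Ob C') \<in> (\<Pi>\<^sub>E X\<in>Ob C'. Mor E (fob G X) (fob F' X))" using \<mu> by auto
    fix X Y f assume XY: "X \<in> Ob C'" "Y \<in> Ob C'" and f: "f \<in> Mor C' X Y"
    have gm: "fmor G X Y f \<in> Mor E (fob G X) (fob G Y)" using G XY f unfolding is_functor_def by blast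
    have "Cmp E (fob G X) (fob G Y) (fob F' Y) (\<mu> Y) (fmor G X Y f) =
        Cmp E (fob G X) (fob F' X) (fob F' Y) (fmor F' X Y f) (\<mu> X)"
    proof (rule corep_ext[OF rep[OF XY(1)] E_Cmp[OF gm \<mu>(1)[OF XY(2)]] E_Cmp[OF \<mu>(1)[OF XY(1)] F'(2)[OF XY f]]])
      fix x assume x: "x \<in> S X"
      note ex = corep_closed[OF rep[OF XY(1)] x]
      show "der_coh_map p (fob G X) (Cmp E (fob G X) (fob G Y) (fob F' Y) (\<mu> Y) (fmor G X Y f)) (e X x) =
        der_coh_map p (fob G X) (Cmp E (fob G X) (fob F' X) (fob F' Y) (fmor F' X Y f) (\<mu> X)) (e X x)"
        using Gm[OF XY f x] \<mu>(2)[OF XY(1) x] \<mu>(2)[OF XY(2)] t(2)[OF XY f x]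
        by (simp add: der_coh_Cmp'[OF gm \<mu>(1)[OF XY(2)] ex] der_coh_Cmp'[OF \<mu>(1)[OF XY(1)] F'(2)[OF XY f] ex])
    qed
    then show "Cmp E (fob G X) (fob G Y) (fob F' Y) (restrict \<mu> (Ob C') Y) (fmor G X Y f) =
        Cmp E (fob G X) (fob F' X) (fob F' Y) (fmor F' X Y f) (restrict \<mu> (Ob C') X)"
      using XY by simp
  qed
  then show thesis by (rule that) (use \<mu>(2) in auto)
qed

lemma comp_functor_functor:
  assumes "is_functor D E G" shows "is_functor C E (comp_functor G Q)"
  using assms Q unfolding is_functor_def comp_functor_def by simp

text \<open>The natural map \<open>t\<close> is a transformation from the functor of free modules, composed with \<open>Q\<close>, to \<open>F\<close>;
  its factorization through \<open>\<eta>\<close> sends the generator \<open>x\<close> to the class looked for.\<close>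

lemma coh_lift_exists:
  fixes S :: "'p \<Rightarrow> 'e set"
  assumes S: "set_functor D S Sm" and cardS: "\<And>X. X \<in> Ob D \<Longrightarrow> S X \<lesssim> (UNIV :: 't set)"
    and t: "\<And>X x. \<lbrakk>X \<in> Ob C; x \<in> S (fob Q X)\<rbrakk> \<Longrightarrow> t X x \<in> carrier (coh (fob F X) p)"
      "\<And>X Y f x. \<lbrakk>X \<in> Ob C; Y \<in> Ob C; f \<in> Mor C X Y; x \<in> S (fob Q X)\<rbrakk> \<Longrightarrow>
        t Y (Sm (fob Q X) (fob Q Y) (fmor Q X Y f) x) = HFm p X Y f (t X x)"
    and X: "X \<in> Ob C" "x \<in> S (fob Q X)"
  shows "\<exists>y\<in>HL p (fob Q X). Heta p X y = t X x"
proof -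
  obtain G :: "('p, 'n, ('k, 't) dg_module, ('k, 't) der_mor) functr" and e where G: "is_functor D E G"
    and rep: "\<And>X. X \<in> Ob D \<Longrightarrow> corepresents K p (S X) (fob G X) (e X)"
    and Gm: "\<And>X Y f x. \<lbrakk>X \<in> Ob D; Y \<in> Ob D; f \<in> Mor D X Y; x \<in> S X\<rbrakk> \<Longrightarrow>
      der_coh_map p (fob G X) (fmor G X Y f) (e X x) = e Y (Sm X Y f x)"
    by (rule free_functor_exists[OF K inf cardK S cardS, where p = p]) (assumption | rule that)+
  have Sm: "Sm X Y f x \<in> S Y" if "X \<in> Ob D" "Y \<in> Ob D" "f \<in> Mor D X Y" "x \<in> S X" for X Y f x
    using S that unfolding set_functor_def by blast
  obtain \<tau> where \<tau>: "\<tau> \<in> nat_trans C E (comp_functor G Q) F"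
    "\<And>X x. \<lbrakk>X \<in> Ob C; x \<in> S (fob Q X)\<rbrakk> \<Longrightarrow> der_coh_map p (fob G (fob Q X)) (\<tau> X) (e (fob Q X) x) = t X x"
  proof (rule nat_trans_from_free[OF comp_functor_functor[OF G], of p "\<lambda>X. S (fob Q X)" "\<lambda>X. e (fob Q X)"
        "\<lambda>X Y f. Sm (fob Q X) (fob Q Y) (fmor Q X Y f)" F t])
  qed (use rep Gm Sm Q_Ob Q_Mor F_Ob F_Mor t in \<open>simp_all add: comp_functor_def HFm_def\<close>)
  obtain \<mu> where \<mu>: "\<mu> \<in> nat_trans D E G L"
    "\<And>X. X \<in> Ob C \<Longrightarrow> \<tau> X = Cmp E (fob G (fob Q X)) (fob L (fob Q X)) (fob F X) (\<eta> X) (\<mu> (fob Q X))"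
    using universal[OF G \<tau>(1)] by blast
  have \<mu>M: "\<mu> (fob Q X) \<in> Mor E (fob G (fob Q X)) (fob L (fob Q X))"
    using \<mu>(1) Q_Ob[OF X(1)] by (auto simp: nat_trans_def PiE_def)
  note ex = corep_closed[OF rep[OF Q_Ob[OF X(1)]] X(2)]
  show ?thesis
    using \<tau>(2)[OF X] der_coh_closed[OF \<mu>M ex]
    by (intro bexI[of _ "der_coh_map p (fob G (fob Q X)) (\<mu> (fob Q X)) (e (fob Q X) x)"])
      (simp_all add: \<mu>(2)[OF X(1)] der_coh_Cmp'[OF \<mu>M eta_Mor[OF X(1)] ex] Heta_def)
qed

text \<open>Both lifts correspond to transformations from the functor of free modules to \<open>L\<close> that have the same
  composition with \<open>\<eta>\<close>, and the universal property allows only one.\<close>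

lemma coh_lift_unique:
  fixes S :: "'p \<Rightarrow> 'e set"
  assumes S: "set_functor D S Sm" and cardS: "\<And>X. X \<in> Ob D \<Longrightarrow> S X \<lesssim> (UNIV :: 't set)"
    and z: "\<And>X x. \<lbrakk>X \<in> Ob D; x \<in> S X\<rbrakk> \<Longrightarrow> z X x \<in> HL p X"
      "\<And>X Y f x. \<lbrakk>X \<in> Ob D; Y \<in> Ob D; f \<in> Mor D X Y; x \<in> S X\<rbrakk> \<Longrightarrow> z Y (Sm X Y f x) = HLm p X Y f (z X x)"
    and z': "\<And>X x. \<lbrakk>X \<in> Ob D; x \<in> S X\<rbrakk> \<Longrightarrow> z' X x \<in> HL p X"
      "\<And>X Y f x. \<lbrakk>X \<in> Ob D; Y \<in> Ob D; f \<in> Mor D X Y; x \<in> S X\<rbrakk> \<Longrightarrow> z' Y (Sm X Y f x) = HLm p X Y f (z' X x)"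
    and eq: "\<And>X x. \<lbrakk>X \<in> Ob C; x \<in> S (fob Q X)\<rbrakk> \<Longrightarrow> Heta p X (z (fob Q X) x) = Heta p X (z' (fob Q X) x)"
    and X: "X \<in> Ob D" "x \<in> S X"
  shows "z X x = z' X x"
proof -
  obtain G :: "('p, 'n, ('k, 't) dg_module, ('k, 't) der_mor) functr" and e where G: "is_functor D E G"
    and rep: "\<And>X. X \<in> Ob D \<Longrightarrow> corepresents K p (S X) (fob G X) (e X)"
    and Gm: "\<And>X Y f x. \<lbrakk>X \<in> Ob D; Y \<in> Ob D; f \<in> Mor D X Y; x \<in> S X\<rbrakk> \<Longrightarrow>
      der_coh_map p (fob G X) (fmor G X Y f) (e X x) = e Y (Sm X Y f x)"
    by (rule free_functor_exists[OF K inf cardK S cardS, where p = p]) (assumption | rule that)+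
  have Sm: "Sm X Y f x \<in> S Y" if "X \<in> Ob D" "Y \<in> Ob D" "f \<in> Mor D X Y" "x \<in> S X" for X Y f x
    using S that unfolding set_functor_def by blast
  have lift: "\<exists>\<mu>. \<mu> \<in> nat_trans D E G L \<and>
      (\<forall>X\<in>Ob D. \<forall>x\<in>S X. der_coh_map p (fob G X) (\<mu> X) (e X x) = z X x)"
    if zL: "\<And>X x. \<lbrakk>X \<in> Ob D; x \<in> S X\<rbrakk> \<Longrightarrow> z X x \<in> HL p X"
      "\<And>X Y f x. \<lbrakk>X \<in> Ob D; Y \<in> Ob D; f \<in> Mor D X Y; x \<in> S X\<rbrakk> \<Longrightarrow> z Y (Sm X Y f x) = HLm p X Y f (z X x)" for z
  proof -
    obtain \<mu> where "\<mu> \<in> nat_trans D E G L"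
      "\<And>X x. \<lbrakk>X \<in> Ob D; x \<in> S X\<rbrakk> \<Longrightarrow> der_coh_map p (fob G X) (\<mu> X) (e X x) = z X x"
      by (rule nat_trans_from_free[OF G, of p S e Sm L z])
        (use rep Gm Sm L_Ob L_Mor zL in \<open>simp_all add: HLm_def\<close>)
    then show ?thesis by blast
  qed
  obtain \<mu> where \<mu>: "\<mu> \<in> nat_trans D E G L"
    "\<And>X x. \<lbrakk>X \<in> Ob D; x \<in> S X\<rbrakk> \<Longrightarrow> der_coh_map p (fob G X) (\<mu> X) (e X x) = z X x" using lift[OF z] by blast
  obtain \<mu>' where \<mu>': "\<mu>' \<in> nat_trans D E G L"
    "\<And>X x. \<lbrakk>X \<in> Ob D; x \<in> S X\<rbrakk> \<Longrightarrow> der_coh_map p (fob G X) (\<mu>' X) (e X x) = z' X x" using lift[OF z'] by blast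
  have M: "\<mu> X \<in> Mor E (fob G X) (fob L X)" "\<mu>' X \<in> Mor E (fob G X) (fob L X)" if "X \<in> Ob D" for X
    using \<mu>(1) \<mu>'(1) that by (auto simp: nat_trans_def PiE_def)
  let ?c = "\<lambda>\<nu> X. Cmp E (fob G (fob Q X)) (fob L (fob Q X)) (fob F X) (\<eta> X) (\<nu> (fob Q X))"
  have c: "der_coh_map p (fob G (fob Q X)) (?c \<nu> X) (e (fob Q X) x) = Heta p X (der_coh_map p (fob G (fob Q X)) (\<nu> (fob Q X)) (e (fob Q X) x))"
    if "X \<in> Ob C" "x \<in> S (fob Q X)" "\<nu> (fob Q X) \<in> Mor E (fob G (fob Q X)) (fob L (fob Q X))" for \<nu> X x
    unfolding Heta_def by (rule der_coh_Cmp'[OF that(3) eta_Mor[OF that(1)] corep_closed[OF rep[OF Q_Ob[OF that(1)]] that(2)]])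
  have same: "?c \<mu> X = ?c \<mu>' X" if X: "X \<in> Ob C" for X
    by (rule corep_ext[OF rep[OF Q_Ob[OF X]] E_Cmp[OF M(1)[OF Q_Ob[OF X]] eta_Mor[OF X]] E_Cmp[OF M(2)[OF Q_Ob[OF X]] eta_Mor[OF X]]])
      (simp add: c X M Q_Ob \<mu>(2) \<mu>'(2) eq)
  obtain \<tau> where \<tau>: "\<tau> \<in> nat_trans C E (comp_functor G Q) F"
    "\<And>X x. \<lbrakk>X \<in> Ob C; x \<in> S (fob Q X)\<rbrakk> \<Longrightarrow>
      der_coh_map p (fob G (fob Q X)) (\<tau> X) (e (fob Q X) x) = Heta p X (z (fob Q X) x)"
  proof (rule nat_trans_from_free[OF comp_functor_functor[OF G], of p "\<lambda>X. S (fob Q X)" "\<lambda>X. e (fob Q X)"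
        "\<lambda>X Y f. Sm (fob Q X) (fob Q Y) (fmor Q X Y f)" F "\<lambda>X x. Heta p X (z (fob Q X) x)"])
  qed (use rep Gm Sm Q_Ob Q_Mor F_Ob F_Mor z Heta_closed Heta_nat in \<open>simp_all add: comp_functor_def HFm_def[symmetric]\<close>)
  have \<tau>M: "\<tau> X \<in> Mor E (fob G (fob Q X)) (fob F X)" if "X \<in> Ob C" for X
    using \<tau>(1) that by (auto simp: nat_trans_def PiE_def comp_functor_def)
  have \<tau>c: "\<tau> X = ?c \<mu> X" if X: "X \<in> Ob C" for X
    by (rule corep_ext[OF rep[OF Q_Ob[OF X]] \<tau>M[OF X] E_Cmp[OF M(1)[OF Q_Ob[OF X]] eta_Mor[OF X]]])
      (simp add: c X M Q_Ob \<mu>(2) \<tau>(2))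
  obtain \<nu> where uni: "\<And>m. m \<in> nat_trans D E G L \<and> (\<forall>X\<in>Ob C. \<tau> X = ?c m X) \<Longrightarrow> m = \<nu>"
    using universal[OF G \<tau>(1)] by (elim ex1E) blast
  have "\<mu> = \<mu>'"
    using uni[of \<mu>] uni[of \<mu>'] \<mu>(1) \<mu>'(1) \<tau>c same by simp
  then show ?thesis using \<mu>(2)[OF X] \<mu>'(2)[OF X] by simp
qed

end

section \<open>Truncation\<close>

text \<open>In degree \<open>k\<close> only the cocycles are kept, so that the cohomology in degrees \<open>\<le> k\<close> is unchanged.\<close>

definition trunc_set :: "int \<Rightarrow> ('a, 'u) dg_module \<Rightarrow> int \<Rightarrow> 'u set"
  where "trunc_set k M i =
    (if i < k then carrier (gr M i) else if i = k then cyc M k else {\<one>\<^bsub>gr M i\<^esub>})"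

definition trunc :: "int \<Rightarrow> ('a, 'u) dg_module \<Rightarrow> ('a, 'u) dg_module"
  where "trunc k M = M\<lparr>gr := (\<lambda>i. (gr M i)\<lparr>carrier := trunc_set k M i\<rparr>)\<rparr>"

definition trunc_inc :: "int \<Rightarrow> ('a, 'u) dg_module \<Rightarrow> int \<Rightarrow> 'u \<Rightarrow> 'u"
  where "trunc_inc k M i = (\<lambda>m\<in>trunc_set k M i. m)"

definition trunc_map :: "int \<Rightarrow> ('a, 'u) dg_module \<Rightarrow> (int \<Rightarrow> 'u \<Rightarrow> 'u) \<Rightarrow> int \<Rightarrow> 'u \<Rightarrow> 'u"
  where "trunc_map k M f i = restrict (f i) (trunc_set k M i)"

lemma trunc_simps [simp]: "carrier (gr (trunc k M) i) = trunc_set k M i" "\<one>\<^bsub>gr (trunc k M) i\<^esub> = \<one>\<^bsub>gr M i\<^esub>"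
  "monoid.mult (gr (trunc k M) i) = monoid.mult (gr M i)" "df (trunc k M) = df M" "act (trunc k M) = act M"
  by (simp_all add: trunc_def)

lemma coh_trivial:
  assumes "cochain_complex M" "cyc M i = {\<one>\<^bsub>gr M i\<^esub>}"
  shows "carrier (coh M i) = {\<one>\<^bsub>coh M i\<^esub>}"
proof -
  interpret cochain_complex M by fact
  have "carrier (coh M i) \<subseteq> {\<one>\<^bsub>coh M i\<^esub>}"
    using assms(2) by (auto elim!: coh_cases simp: one_coh)
  moreover have "\<one>\<^bsub>coh M i\<^esub> \<in> carrier (coh M i)"
    using coh_class_closed[OF one_cyc] by (simp add: one_coh)
  ultimately show ?thesis by auto
qed

lemma trivial_bij:
  assumes "comm_group G" "comm_group H" "f \<in> hom G H" "carrier G = {\<one>\<^bsub>G\<^esub>}" "carrier H = {\<one>\<^bsub>H\<^esub>}"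
  shows "bij_betw f (carrier G) (carrier H)"
  using assms hom_one'[OF assms(1-3)] by (simp add: bij_betw_def)

locale truncatable = dg_module_over B M for B :: "'a dg_ring" and M :: "('a, 'u) dg_module" +
  assumes nonpos: "concentrated_le 0 B"
begin

lemma B_pos: "i > 0 \<Longrightarrow> b \<in> carrier (gr B i) \<Longrightarrow> b = \<one>\<^bsub>gr B i\<^esub>"
  using nonpos by (auto simp: concentrated_le_def)

lemma B_cyc: "b \<in> carrier (gr B 0) \<Longrightarrow> b \<in> cyc B 0"
  using B_pos[of 1 "df B 0 b"] B.df_closed[of b 0] by (simp add: cyc_iff)

lemma trunc_subgroup: "subgroup (trunc_set k M i) (gr M i)"
  using cyc_subgroup[of k] group.subgroup_self[OF gr_group, of i] group.triv_subgroup[OF gr_group, of i]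
  by (auto simp: trunc_set_def)

lemma trunc_sub: "m \<in> trunc_set k M i \<Longrightarrow> m \<in> carrier (gr M i)"
  using subgroup.subset[OF trunc_subgroup] by blast

lemma trunc_one: "\<one>\<^bsub>gr M i\<^esub> \<in> trunc_set k M i"
  using subgroup.one_closed[OF trunc_subgroup] .

lemma trunc_mult: "m \<in> trunc_set k M i \<Longrightarrow> n \<in> trunc_set k M i \<Longrightarrow> m \<otimes>\<^bsub>gr M i\<^esub> n \<in> trunc_set k M i"
  using subgroup.m_closed[OF trunc_subgroup] .

lemma trunc_df:
  assumes "m \<in> trunc_set k M i" shows "df M i m \<in> trunc_set k M (i + 1)"
proof -
  consider "i + 1 < k" | "i + 1 = k" | "i = k" | "i > k" by linarith
  then show ?thesis
  proof cases
    case 1 then show ?thesis using df_closed[OF trunc_sub[OF assms]] by (simp add: trunc_set_def)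
  next
    case 2
    then have "i = k - 1" by simp
    then show ?thesis using coboundary_cyc[of m k] trunc_sub[OF assms] by (simp add: trunc_set_def)
  next
    case 3 then show ?thesis using assms by (simp add: trunc_set_def cyc_iff)
  next
    case 4 then show ?thesis using assms df_one by (simp add: trunc_set_def)
  qed
qed

text \<open>Nonpositivity of \<open>B\<close> enters here: an element of positive degree could move the truncation out of
  itself, and an element of degree 0 preserves cocycles because it is a cocycle.\<close>

lemma trunc_act:
  assumes b: "b \<in> carrier (gr B i)" and m: "m \<in> trunc_set k M j"
  shows "act M i j b m \<in> trunc_set k M (i + j)"
proof -
  note mc = trunc_sub[OF m]
  consider "i > 0" | "i = 0" "j = k" | "j > k" | "i \<le> 0" "j \<le> k" "i + j < k" by linarith
  then show ?thesis
  proof cases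
    case 1 then show ?thesis using B_pos[OF _ b] act_one_left[OF mc] trunc_one by simp
  next
    case 2 then show ?thesis using act_cyc[OF B_cyc, of b m k] b m by (simp add: trunc_set_def)
  next
    case 3 then show ?thesis using m act_one_right[OF b] trunc_one by (simp add: trunc_set_def)
  next
    case 4 then show ?thesis using act_closed[OF b mc] by (simp add: trunc_set_def)
  qed
qed

lemma trunc_koszul:
  "m \<in> trunc_set k M i \<Longrightarrow> koszul (gr (trunc k M) i) n m = koszul (gr M i) n m"
  using group.m_inv_consistent[OF gr_group trunc_subgroup] by (simp add: koszul_def trunc_def)

lemma trunc_dg_module: "dg_module B (trunc k M)"
proof (intro dg_module.intro cochain_complex.intro dg_module_axioms.intro)
  show "comm_group (gr (trunc k M) i)" for i
    using subgroup_comm_group[OF gr_comm_group trunc_subgroup] by (simp add: trunc_def)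
  show "df (trunc k M) i \<in> hom (gr (trunc k M) i) (gr (trunc k M) (i + 1))" for i
    by (rule homI) (simp_all add: trunc_df hom_mult[OF df_hom] trunc_sub)
  show "df (trunc k M) (i + j) (act (trunc k M) i j a m) =
      act (trunc k M) (i + 1) j (df B i a) m \<otimes>\<^bsub>gr (trunc k M) (i + j + 1)\<^esub>
      koszul (gr (trunc k M) (i + j + 1)) i (act (trunc k M) i (j + 1) a (df (trunc k M) j m))"
    if "a \<in> carrier (gr B i)" "m \<in> carrier (gr (trunc k M) j)" for a i m j
    using that act_leibniz[of a i m j] trunc_act[of a i "df M j m" k "j + 1"]
    by (simp add: trunc_df trunc_koszul trunc_sub add.assoc[symmetric])
qed (simp_all add: df_df trunc_sub trunc_act act_add_left act_add_right act_assoc act_one)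

lemma trunc_concentrated: "concentrated_le k (trunc k M)"
  by (simp add: concentrated_le_def trunc_set_def)

lemma trunc_inc_strict: "trunc_inc k M \<in> strict_homs B (trunc k M) M"
  by (auto simp: strict_homs_def trunc_inc_def hom_def trunc_sub trunc_mult trunc_df trunc_act)

lemma cyc_trunc: "cyc (trunc k M) i = (if i \<le> k then cyc M i else {\<one>\<^bsub>gr M i\<^esub>})"
  using df_one by (auto simp: cyc_iff trunc_set_def split: if_splits)

lemma trunc_complex: "cochain_complex (trunc k M)"
  using trunc_dg_module by (rule dg_module_complex)

lemma coh_trunc_trivial: "i > k \<Longrightarrow> carrier (coh (trunc k M) i) = {\<one>\<^bsub>coh (trunc k M) i\<^esub>}"
  by (rule coh_trivial[OF trunc_complex]) (simp add: cyc_trunc)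

lemma trunc_inc_bij:
  assumes "i \<le> k"
  shows "bij_betw (coh_map (trunc k M) M i (trunc_inc k M)) (carrier (coh (trunc k M) i)) (carrier (coh M i))"
proof (rule coh_map_bijI[OF trunc_complex cochain_complex_axioms strict_homsD(6)[OF trunc_inc_strict]])
  show "\<exists>y\<in>carrier (gr (trunc k M) (i - 1)). m = df (trunc k M) (i - 1) y"
    if "m \<in> cyc (trunc k M) i" "y \<in> carrier (gr M (i - 1))" "trunc_inc k M i m = df M (i - 1) y" for m y
    using that cycD[OF that(1)] assms by (intro bexI[of _ y]) (auto simp: trunc_inc_def trunc_set_def)
  show "\<exists>m\<in>cyc (trunc k M) i. coh_class M i n = coh_class M i (trunc_inc k M i m)" if "n \<in> cyc M i" for n
    using that assms cycD[of n "trunc k M" i] by (intro bexI[of _ n]) (auto simp: trunc_inc_def cyc_trunc)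
qed

lemma trunc_inc_quasi_iso:
  assumes "coh_concentrated_le k M" shows "trunc_inc k M \<in> quasi_isos B (trunc k M) M"
proof -
  have "bij_betw (coh_map (trunc k M) M i (trunc_inc k M)) (carrier (coh (trunc k M) i)) (carrier (coh M i))" for i
  proof (cases "i \<le> k")
    case False
    then show ?thesis
      using assms coh_trunc_trivial
      by (intro trivial_bij cochain_complex.coh_comm_group trunc_complex cochain_complex_axioms
          coh_map_hom strict_homsD(6)[OF trunc_inc_strict]) (auto simp: coh_concentrated_le_def)
  qed (rule trunc_inc_bij)
  then show ?thesis using trunc_inc_strict by (simp add: quasi_isos_def)
qed

end

context
  fixes B :: "'a dg_ring" and M N :: "('a, 'u) dg_module" and f
  assumes M: "truncatable B M" and N: "truncatable B N" and f: "f \<in> strict_homs B M N"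
begin

interpretation M: truncatable B M by (rule M)
interpretation N: truncatable B N by (rule N)

lemma trunc_map_closed: "m \<in> trunc_set k M i \<Longrightarrow> f i m \<in> trunc_set k N i"
  using strict_homsD(3)[OF f] chain_map_cyc[OF M.cochain_complex_axioms N.cochain_complex_axioms strict_homsD(6)[OF f]]
    hom_one'[OF M.gr_comm_group N.gr_comm_group strict_homsD(1)[OF f]]
  by (auto simp: trunc_set_def split: if_splits)

lemma trunc_map_strict: "trunc_map k M f \<in> strict_homs B (trunc k M) (trunc k N)"
  by (auto simp: strict_homs_def trunc_map_def hom_def trunc_map_closed hom_mult[OF strict_homsD(1)[OF f]]
      M.trunc_mult M.trunc_df M.trunc_act M.trunc_sub strict_homsD(4,5)[OF f])

lemma trunc_inc_natural:
  "(\<lambda>i. compose (carrier (gr (trunc k M) i)) (f i) (trunc_inc k M i)) =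
   (\<lambda>i. compose (carrier (gr (trunc k M) i)) (trunc_inc k N i) (trunc_map k M f i))"
  by (rule ext) (auto simp: compose_def trunc_inc_def trunc_map_def trunc_map_closed restrict_def fun_eq_iff)

lemma trunc_map_quasi_iso:
  assumes q: "f \<in> quasi_isos B M N"
  shows "trunc_map k M f \<in> quasi_isos B (trunc k M) (trunc k N)"
proof -
  note tM = M.trunc_dg_module[of k] and tN = N.trunc_dg_module[of k]
  note tf = trunc_map_strict[of k]
  have "bij_betw (coh_map (trunc k M) (trunc k N) i (trunc_map k M f)) (carrier (coh (trunc k M) i)) (carrier (coh (trunc k N) i))"
    (is "bij_betw ?t _ _") for i
  proof (cases "i \<le> k")
    case False
    then show ?thesis
      using M.coh_trunc_trivial N.coh_trunc_trivial
      by (intro trivial_bij cochain_complex.coh_comm_group M.trunc_complex N.trunc_complex coh_map_strict_hom[OF tM tN tf]) auto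
  next
    case True
    let ?M = "carrier (coh (trunc k M) i)"
    note eM = M.trunc_inc_bij[OF True] and eN = N.trunc_inc_bij[OF True]
    have sq: "coh_map (trunc k N) N i (trunc_inc k N) (?t x) = coh_map M N i f (coh_map (trunc k M) M i (trunc_inc k M) x)"
      if "x \<in> ?M" for x
      using that coh_map_comp[OF tM tN N.dg_module_axioms tf N.trunc_inc_strict]
        coh_map_comp[OF tM M.dg_module_axioms N.dg_module_axioms M.trunc_inc_strict f]
      by (simp only: trunc_inc_natural[symmetric])
    have "bij_betw (\<lambda>x. coh_map M N i f (coh_map (trunc k M) M i (trunc_inc k M) x)) ?M (carrier (coh N i))"
      using bij_betw_trans[OF eM quasi_isosD(2)[OF q]] by (simp add: comp_def)
    then have "bij_betw (\<lambda>x. coh_map (trunc k N) N i (trunc_inc k N) (?t x)) ?M (carrier (coh N i))"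
      using sq by (simp cong: bij_betw_cong)
    moreover have "?t ` ?M \<subseteq> carrier (coh (trunc k N) i)"
      using hom_carrier[OF coh_map_strict_hom[OF tM tN tf]] by blast
    ultimately show ?thesis
      using bij_betw_comp_iff2[OF eN, of ?t ?M] by (simp add: comp_def)
  qed
  then show ?thesis using tf by (simp add: quasi_isos_def)
qed

end

section \<open>The tensor product of DG modules\<close>

lemma koszul_closed: "comm_group G \<Longrightarrow> x \<in> carrier G \<Longrightarrow> koszul G n x \<in> carrier G"
  by (simp add: koszul_def comm_group_def group.inv_closed)

lemma koszul_mult:
  assumes "comm_group G" "x \<in> carrier G" "y \<in> carrier G"
  shows "koszul G n (x \<otimes>\<^bsub>G\<^esub> y) = koszul G n x \<otimes>\<^bsub>G\<^esub> koszul G n y"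
proof -
  interpret comm_group G by fact
  show ?thesis using assms by (simp add: koszul_def inv_mult)
qed

lemma koszul_koszul:
  assumes "comm_group G" "x \<in> carrier G"
  shows "koszul G n (koszul G m x) = koszul G (n + m) x"
proof -
  interpret comm_group G by fact
  show ?thesis using assms by (simp add: koszul_def)
qed

lemma koszul_even: "even n = even m \<Longrightarrow> koszul G n x = koszul G m x"
  by (simp add: koszul_def)

lemma koszul_hom:
  "\<lbrakk>comm_group G; comm_group H; f \<in> hom G H; x \<in> carrier G\<rbrakk> \<Longrightarrow> f (koszul G n x) = koszul H n (f x)"
  by (simp add: koszul_def hom_inv')

lemma koszul_one: "comm_group G \<Longrightarrow> koszul G n \<one>\<^bsub>G\<^esub> = \<one>\<^bsub>G\<^esub>"
  by (simp add: koszul_def comm_group_def group.is_monoid monoid.inv_one)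

lemma op_dg_ring_simps [simp]: "gr (op_dg_ring A) = gr A" "df (op_dg_ring A) = df A" "rone (op_dg_ring A) = rone A"
  "rmul (op_dg_ring A) i j a b = koszul (gr A (i + j)) (i * j) (rmul A j i b a)"
  by (simp_all add: op_dg_ring_def)

lemma cyc_op [simp]: "cyc (op_dg_ring A) i = cyc A i"
  by (auto simp: cyc_iff)

lemma op_complex: "cochain_complex A \<Longrightarrow> cochain_complex (op_dg_ring A)"
  by (simp add: cochain_complex_def)

locale tensor_pair = central_dg_ring K A s
  for K :: "'k ring" (structure) and A :: "'a dg_ring" and s :: "'k \<Rightarrow> 'a" +
  fixes M :: "('a, 'u) dg_module" and N :: "('a, 'v) dg_module"
  assumes M_dg: "dg_module (op_dg_ring A) M" and N_dg: "dg_module A N"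
begin

sublocale M: dg_module_over "op_dg_ring A" M
  by (simp add: dg_module_over_def M_dg op_complex A.cochain_complex_axioms)

sublocale N: dg_module_over A N
  by (simp add: dg_module_over_def N_dg A.cochain_complex_axioms)

abbreviation "Tg \<equiv> tensor_gens M N"
abbreviation "Tr \<equiv> tensor_rels A M N"
abbreviation "P p \<equiv> pres (Tg p) (Tr p)"

text \<open>The element $m \otimes n$ of degree \<open>p\<close>, for $m \in M^i$ and $n \in N^{p-i}$.\<close>

abbreviation "T p i m n \<equiv> pres_class (Tg p) (Tr p) (frag_of (i, m, n))"

lemma ract_closed:
  assumes "m \<in> carrier (gr M i)" "a \<in> carrier (gr A j)" shows "ract M i j m a \<in> carrier (gr M (i + j))"
  using M.act_closed[of a j m i] assms by (simp add: ract_def koszul_closed M.gr_comm_group add.commute)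

lemma act_index: "a \<in> carrier (gr A j) \<Longrightarrow> n \<in> carrier (gr N (p - i - j)) \<Longrightarrow> act N j (p - i - j) a n \<in> carrier (gr N (p - i))"
  using N.act_closed[of a j n "p - i - j"] by simp

lemma Tg_iff: "(i, m, n) \<in> Tg p \<longleftrightarrow> m \<in> carrier (gr M i) \<and> n \<in> carrier (gr N (p - i))"
  by (simp add: tensor_gens_def)

lemma Tr_cases:
  assumes "r \<in> Tr p"
  obtains (add1) i m m' n where "r = frag_of (i, m \<otimes>\<^bsub>gr M i\<^esub> m', n) - frag_of (i, m, n) - frag_of (i, m', n)"
      "m \<in> carrier (gr M i)" "m' \<in> carrier (gr M i)" "n \<in> carrier (gr N (p - i))"
    | (add2) i m n n' where "r = frag_of (i, m, n \<otimes>\<^bsub>gr N (p - i)\<^esub> n') - frag_of (i, m, n) - frag_of (i, m, n')"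
      "m \<in> carrier (gr M i)" "n \<in> carrier (gr N (p - i))" "n' \<in> carrier (gr N (p - i))"
    | (bal) i j m a n where "r = frag_of (i + j, ract M i j m a, n) - frag_of (i, m, act N j (p - i - j) a n)"
      "m \<in> carrier (gr M i)" "a \<in> carrier (gr A j)" "n \<in> carrier (gr N (p - i - j))"
  using assms unfolding tensor_rels_def by blast

lemma M_mult [simp]: "m \<in> carrier (gr M i) \<Longrightarrow> m' \<in> carrier (gr M i) \<Longrightarrow> m \<otimes>\<^bsub>gr M i\<^esub> m' \<in> carrier (gr M i)"
  using M.gr_group by (simp add: group.is_monoid monoid.m_closed)

lemma N_mult [simp]: "m \<in> carrier (gr N i) \<Longrightarrow> m' \<in> carrier (gr N i) \<Longrightarrow> m \<otimes>\<^bsub>gr N i\<^esub> m' \<in> carrier (gr N i)"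
  using N.gr_group by (simp add: group.is_monoid monoid.m_closed)

lemma diff_diff_index: "p - (i + j) = p - i - j" for p i j :: int by simp

lemma Tr: "Tr p \<subseteq> carrier (free_Abelian_group (Tg p))"
proof
  fix r assume "r \<in> Tr p"
  then show "r \<in> carrier (free_Abelian_group (Tg p))"
  proof (cases rule: Tr_cases)
    case (add1 i m m' n)
    then show ?thesis unfolding carrier_free_Abelian_group_iff add1(1) by (intro keys_rel) (simp_all add: Tg_iff)
  next
    case (add2 i m n n')
    then show ?thesis unfolding carrier_free_Abelian_group_iff add2(1) by (intro keys_rel) (simp_all add: Tg_iff)
  next
    case (bal i j m a n)
    then show ?thesis unfolding carrier_free_Abelian_group_iff bal(1)
      by (intro keys_rel) (simp_all add: Tg_iff diff_diff_index ract_closed act_index)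
  qed
qed

sublocale P: comm_group "P p" for p
  by (rule pres_comm_group[OF Tr])

lemma rels_kill:
  assumes H: "comm_group H" and f: "f \<in> hom (free_Abelian_group (Tg p)) H"
    and a1: "\<And>i m m' n. \<lbrakk>m \<in> carrier (gr M i); m' \<in> carrier (gr M i); n \<in> carrier (gr N (p - i))\<rbrakk> \<Longrightarrow>
      f (frag_of (i, m \<otimes>\<^bsub>gr M i\<^esub> m', n)) = f (frag_of (i, m, n)) \<otimes>\<^bsub>H\<^esub> f (frag_of (i, m', n))"
    and a2: "\<And>i m n n'. \<lbrakk>m \<in> carrier (gr M i); n \<in> carrier (gr N (p - i)); n' \<in> carrier (gr N (p - i))\<rbrakk> \<Longrightarrow>
      f (frag_of (i, m, n \<otimes>\<^bsub>gr N (p - i)\<^esub> n')) = f (frag_of (i, m, n)) \<otimes>\<^bsub>H\<^esub> f (frag_of (i, m, n'))"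
    and b: "\<And>i j m a n. \<lbrakk>m \<in> carrier (gr M i); a \<in> carrier (gr A j); n \<in> carrier (gr N (p - i - j))\<rbrakk> \<Longrightarrow>
      f (frag_of (i + j, ract M i j m a, n)) = f (frag_of (i, m, act N j (p - i - j) a n))"
    and r: "r \<in> Tr p"
  shows "f r = \<one>\<^bsub>H\<^esub>"
  using r
proof (cases rule: Tr_cases)
  case (add1 i m m' n)
  then show ?thesis unfolding add1(1) by (subst free_hom_rel3[OF H f]) (auto simp: Tg_iff a1)
next
  case (add2 i m n n')
  then show ?thesis unfolding add2(1) by (subst free_hom_rel3[OF H f]) (auto simp: Tg_iff a2)
next
  case (bal i j m a n)
  then show ?thesis unfolding bal(1)
    by (subst free_hom_rel2[OF H f]) (auto simp: Tg_iff diff_diff_index b ract_closed act_index)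
qed

lemma T_closed: "m \<in> carrier (gr M i) \<Longrightarrow> n \<in> carrier (gr N (p - i)) \<Longrightarrow> T p i m n \<in> carrier (P p)"
  by (rule pres_gen_closed[OF Tr]) (simp add: Tg_iff)

lemma T_add1:
  assumes "m \<in> carrier (gr M i)" "m' \<in> carrier (gr M i)" "n \<in> carrier (gr N (p - i))"
  shows "T p i (m \<otimes>\<^bsub>gr M i\<^esub> m') n = T p i m n \<otimes>\<^bsub>P p\<^esub> T p i m' n"
proof -
  have "frag_of (i, m \<otimes>\<^bsub>gr M i\<^esub> m', n) - frag_of (i, m, n) - frag_of (i, m', n) \<in> Tr p"
    unfolding tensor_rels_def using assms by blast
  from pres_class_rel[OF Tr this] show ?thesis
    using assms by (subst (asm) free_hom_rel3[OF P.comm_group_axioms pres_class_hom[OF Tr]]) (auto simp: Tg_iff)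
qed

lemma T_add2:
  assumes "m \<in> carrier (gr M i)" "n \<in> carrier (gr N (p - i))" "n' \<in> carrier (gr N (p - i))"
  shows "T p i m (n \<otimes>\<^bsub>gr N (p - i)\<^esub> n') = T p i m n \<otimes>\<^bsub>P p\<^esub> T p i m n'"
proof -
  have "frag_of (i, m, n \<otimes>\<^bsub>gr N (p - i)\<^esub> n') - frag_of (i, m, n) - frag_of (i, m, n') \<in> Tr p"
    unfolding tensor_rels_def using assms by blast
  from pres_class_rel[OF Tr this] show ?thesis
    using assms by (subst (asm) free_hom_rel3[OF P.comm_group_axioms pres_class_hom[OF Tr]]) (auto simp: Tg_iff)
qed

lemma T_bal:
  assumes "m \<in> carrier (gr M i)" "a \<in> carrier (gr A j)" "n \<in> carrier (gr N (p - i - j))"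
  shows "T p (i + j) (ract M i j m a) n = T p i m (act N j (p - i - j) a n)"
proof -
  have "frag_of (i + j, ract M i j m a, n) - frag_of (i, m, act N j (p - i - j) a n) \<in> Tr p"
    unfolding tensor_rels_def using assms by blast
  from pres_class_rel[OF Tr this] show ?thesis
    using assms by (subst (asm) free_hom_rel2[OF P.comm_group_axioms pres_class_hom[OF Tr]])
      (auto simp: Tg_iff diff_diff_index ract_closed act_index)
qed

lemma T_hom1: "n \<in> carrier (gr N (p - i)) \<Longrightarrow> (\<lambda>m. T p i m n) \<in> hom (gr M i) (P p)"
  by (rule homI) (auto simp: T_closed T_add1)

lemma T_hom2: "m \<in> carrier (gr M i) \<Longrightarrow> (\<lambda>n. T p i m n) \<in> hom (gr N (p - i)) (P p)" for m
  by (rule homI) (auto simp: T_closed T_add2)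

lemma T_one1: "n \<in> carrier (gr N (p - i)) \<Longrightarrow> T p i \<one>\<^bsub>gr M i\<^esub> n = \<one>\<^bsub>P p\<^esub>"
  using hom_one'[OF M.gr_comm_group P.comm_group_axioms T_hom1] .

lemma T_one2: "m \<in> carrier (gr M i) \<Longrightarrow> T p i m \<one>\<^bsub>gr N (p - i)\<^esub> = \<one>\<^bsub>P p\<^esub>"
  using hom_one'[OF N.gr_comm_group P.comm_group_axioms T_hom2] .

lemma T_koszul1: "m \<in> carrier (gr M i) \<Longrightarrow> n \<in> carrier (gr N (p - i)) \<Longrightarrow>
    T p i (koszul (gr M i) k m) n = koszul (P p) k (T p i m n)"
  using koszul_hom[OF M.gr_comm_group P.comm_group_axioms T_hom1] .

lemma T_koszul2: "m \<in> carrier (gr M i) \<Longrightarrow> n \<in> carrier (gr N (p - i)) \<Longrightarrow>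
    T p i m (koszul (gr N (p - i)) k n) = koszul (P p) k (T p i m n)"
  using koszul_hom[OF N.gr_comm_group P.comm_group_axioms T_hom2] .

lemma P_hom_ext:
  assumes "comm_group H" "f \<in> hom (P p) H" "g \<in> hom (P p) H"
    and "\<And>i m n. \<lbrakk>m \<in> carrier (gr M i); n \<in> carrier (gr N (p - i))\<rbrakk> \<Longrightarrow> f (T p i m n) = g (T p i m n)"
    and "x \<in> carrier (P p)"
  shows "f x = g x"
  by (rule pres_hom_ext[OF Tr assms(1-3) _ assms(5)]) (use assms(4) in \<open>auto simp: tensor_gens_def\<close>)

lemma tensor_pres_map:
  fixes S' R' and h :: "int \<times> 'u \<times> 'v \<Rightarrow> 'g \<Rightarrow>\<^sub>0 int"
  assumes R': "R' \<subseteq> carrier (free_Abelian_group S')"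
    and h: "\<And>i m n. \<lbrakk>m \<in> carrier (gr M i); n \<in> carrier (gr N (p - i))\<rbrakk> \<Longrightarrow> Poly_Mapping.keys (h (i, m, n)) \<subseteq> S'"
    and a1: "\<And>i m m' n. \<lbrakk>m \<in> carrier (gr M i); m' \<in> carrier (gr M i); n \<in> carrier (gr N (p - i))\<rbrakk> \<Longrightarrow>
      pres_class S' R' (h (i, m \<otimes>\<^bsub>gr M i\<^esub> m', n)) =
      pres_class S' R' (h (i, m, n)) \<otimes>\<^bsub>pres S' R'\<^esub> pres_class S' R' (h (i, m', n))"
    and a2: "\<And>i m n n'. \<lbrakk>m \<in> carrier (gr M i); n \<in> carrier (gr N (p - i)); n' \<in> carrier (gr N (p - i))\<rbrakk> \<Longrightarrow>
      pres_class S' R' (h (i, m, n \<otimes>\<^bsub>gr N (p - i)\<^esub> n')) =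
      pres_class S' R' (h (i, m, n)) \<otimes>\<^bsub>pres S' R'\<^esub> pres_class S' R' (h (i, m, n'))"
    and b: "\<And>i j m a n. \<lbrakk>m \<in> carrier (gr M i); a \<in> carrier (gr A j); n \<in> carrier (gr N (p - i - j))\<rbrakk> \<Longrightarrow>
      pres_class S' R' (h (i + j, ract M i j m a, n)) = pres_class S' R' (h (i, m, act N j (p - i - j) a n))"
  shows "pres_map S' R' h \<in> hom (P p) (pres S' R') \<and>
    (\<forall>i m n. m \<in> carrier (gr M i) \<longrightarrow> n \<in> carrier (gr N (p - i)) \<longrightarrow>
      pres_map S' R' h (T p i m n) = pres_class S' R' (h (i, m, n)))"
proof -
  have h': "Poly_Mapping.keys (h g) \<subseteq> S'" if "g \<in> Tg p" for g
    using that h by (cases g) (simp add: Tg_iff)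
  have fh: "(\<lambda>c. pres_class S' R' (frag_extend h c)) \<in> hom (free_Abelian_group (Tg p)) (pres S' R')"
    using hom_comp[OF frag_extend_hom[OF h'] pres_class_hom[OF R']] .
  have rel: "pres_class S' R' (frag_extend h r) = \<one>\<^bsub>pres S' R'\<^esub>" if "r \<in> Tr p" for r
    by (rule rels_kill[OF pres_comm_group[OF R'] fh _ _ _ that]) (simp_all add: a1 a2 b)
  note pm = pres_map_hom[OF Tr[of p] R' h' rel]
  show ?thesis using pm(1,3) by (simp add: Tg_iff)
qed

text \<open>The Leibniz rule of the left module over the opposite ring, after the sign $(-1)^{ij}$ in
  $m \cdot a = (-1)^{ij} a \cdot m$ is moved through the differential.\<close>

lemma ract_leibniz:
  assumes m: "m \<in> carrier (gr M i)" and a: "a \<in> carrier (gr A j)"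
  shows "df M (i + j) (ract M i j m a) =
    ract M (i + 1) j (df M i m) a \<otimes>\<^bsub>gr M (i + j + 1)\<^esub>
    koszul (gr M (i + j + 1)) i (ract M i (j + 1) m (df A j a))"
proof -
  let ?G = "gr M (i + j + 1)"
  interpret G: comm_group ?G by (rule M.gr_comm_group)
  have e: "j + i = i + j" "j + 1 + i = i + j + 1" "j + (i + 1) = i + j + 1" "i + 1 + j = i + j + 1"
    "i + (j + 1) = i + j + 1" by simp_all
  let ?x = "act M (j + 1) i (df A j a) m" and ?y = "act M j (i + 1) a (df M i m)"
  have x: "?x \<in> carrier ?G"
    using M.act_closed[of "df A j a" "j + 1" m i] A.df_closed[OF a] m by (simp add: e)
  have y: "?y \<in> carrier ?G"
    using M.act_closed[of a j "df M i m" "i + 1"] M.df_closed[OF m] a by (simp add: e)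
  have am: "act M j i a m \<in> carrier (gr M (i + j))" using M.act_closed[of a j m i] a m by (simp add: e)
  have "df M (i + j) (ract M i j m a) = koszul ?G (i * j) (df M (i + j) (act M j i a m))"
    unfolding ract_def by (rule koszul_hom[OF M.gr_comm_group M.gr_comm_group M.df_hom am])
  also have "df M (i + j) (act M j i a m) = ?x \<otimes>\<^bsub>?G\<^esub> koszul ?G j ?y"
    using M.act_leibniz[of a j m i] a m by (simp add: e)
  also have "koszul ?G (i * j) (?x \<otimes>\<^bsub>?G\<^esub> koszul ?G j ?y) = koszul ?G (i * j) ?x \<otimes>\<^bsub>?G\<^esub> koszul ?G (i * j + j) ?y"
    using x y by (simp add: koszul_mult koszul_koszul koszul_closed G.comm_group_axioms)
  also have "\<dots> = koszul ?G (i * j + j) ?y \<otimes>\<^bsub>?G\<^esub> koszul ?G (i * j) ?x"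
    using x y by (simp add: G.m_comm koszul_closed G.comm_group_axioms)
  also have "koszul ?G (i * j + j) ?y = ract M (i + 1) j (df M i m) a"
    by (simp add: ract_def e algebra_simps)
  also have "koszul ?G (i * j) ?x = koszul ?G i (ract M i (j + 1) m (df A j a))"
    unfolding ract_def e koszul_koszul[OF G.comm_group_axioms x] by (rule koszul_even) (simp add: algebra_simps)
  finally show ?thesis .
qed

abbreviation "X \<equiv> tensor_dg A s M N"

lemma gr_X [simp]: "gr X p = P p"
  by (simp add: tensor_dg_def)

text \<open>The formula respects balancedness because $m a \otimes n$ and $m \otimes a n$ both have the
  differential
  $dm \otimes a n + (-1)^i m \otimes (da) n + (-1)^{i+j} m \otimes a (dn)$.\<close>

lemma df_X:
  shows "df X p \<in> hom (P p) (P (p + 1))"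
    and "\<And>i m n. \<lbrakk>m \<in> carrier (gr M i); n \<in> carrier (gr N (p - i))\<rbrakk> \<Longrightarrow>
      df X p (T p i m n) = T (p + 1) (i + 1) (df M i m) n \<otimes>\<^bsub>P (p + 1)\<^esub> koszul (P (p + 1)) i (T (p + 1) i m (df N (p - i) n))"
proof -
  let ?q = "p + 1" and ?P = "P (p + 1)"
  let ?h = "\<lambda>(i, m, n). frag_of (i + 1, df M i m, n) +
    frag_cmul (if even i then 1 else - 1) (frag_of (i, m, df N (p - i) n))"
  have e: "?q - (i + 1) = p - i" and e': "?q - i = p - i + 1" for i by simp_all
  have dn: "df N (p - i) n \<in> carrier (gr N (?q - i))" if "n \<in> carrier (gr N (p - i))" for i n
    using N.df_closed[OF that] by (simp only: e')
  have dn': "n \<in> carrier (gr N (?q - (i + 1)))" if "n \<in> carrier (gr N (p - i))" for i n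
    using that by (simp only: e)
  note cl = T_closed[where p = ?q]
  have keys: "Poly_Mapping.keys (?h (i, m, n)) \<subseteq> Tg ?q"
    if "m \<in> carrier (gr M i)" "n \<in> carrier (gr N (p - i))" for i m n
  proof -
    have "Poly_Mapping.keys (?h (i, m, n)) \<subseteq> {(i + 1, df M i m, n), (i, m, df N (p - i) n)}"
      using keys_add[of "frag_of (i + 1, df M i m, n)" "frag_cmul (if even i then 1 else - 1) (frag_of (i, m, df N (p - i) n))"]
        keys_cmul[of "if even i then 1 else - 1" "frag_of (i, m, df N (p - i) n)"] by (auto split: if_splits)
    moreover have "(i + 1, df M i m, n) \<in> Tg ?q" "(i, m, df N (p - i) n) \<in> Tg ?q"
      using that dn dn' M.df_closed[OF that(1)] by (simp_all add: Tg_iff)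
    ultimately show ?thesis by blast
  qed
  have h: "pres_class (Tg ?q) (Tr ?q) (?h (i, m, n)) =
      T ?q (i + 1) (df M i m) n \<otimes>\<^bsub>?P\<^esub> koszul ?P i (T ?q i m (df N (p - i) n))"
    if "m \<in> carrier (gr M i)" "n \<in> carrier (gr N (p - i))" for i m n
  proof -
    have g: "(i + 1, df M i m, n) \<in> Tg ?q" "(i, m, df N (p - i) n) \<in> Tg ?q"
      using that dn dn' M.df_closed[OF that(1)] by (simp_all add: Tg_iff)
    then show ?thesis
      using pres_class_add[OF Tr, of "frag_of (i + 1, df M i m, n)" ?q "frag_of (i, m, df N (p - i) n)"]
        pres_class_diff[OF Tr, of "frag_of (i + 1, df M i m, n)" ?q "frag_of (i, m, df N (p - i) n)"]
      by (simp add: koszul_def)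
  qed
  have c1: "T ?q (i + 1) (df M i m) n \<in> carrier ?P" if "m \<in> carrier (gr M i)" "n \<in> carrier (gr N (p - i))" for i m n
    using that by (intro cl M.df_closed dn')
  have c2: "T ?q i m (df N (p - i) n) \<in> carrier ?P" if "m \<in> carrier (gr M i)" "n \<in> carrier (gr N (p - i))" for i m n
    using that by (intro cl dn)
  have shuffle: "(x \<otimes>\<^bsub>?P\<^esub> x') \<otimes>\<^bsub>?P\<^esub> koszul ?P i (y \<otimes>\<^bsub>?P\<^esub> y') = (x \<otimes>\<^bsub>?P\<^esub> koszul ?P i y) \<otimes>\<^bsub>?P\<^esub> (x' \<otimes>\<^bsub>?P\<^esub> koszul ?P i y')"
    if "x \<in> carrier ?P" "x' \<in> carrier ?P" "y \<in> carrier ?P" "y' \<in> carrier ?P" for x x' y y' i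
    using that by (simp add: koszul_mult koszul_closed P.comm_group_axioms P.m_ac)
  have pm: "pres_map (Tg ?q) (Tr ?q) ?h \<in> hom (P p) ?P \<and>
    (\<forall>i m n. m \<in> carrier (gr M i) \<longrightarrow> n \<in> carrier (gr N (p - i)) \<longrightarrow>
      pres_map (Tg ?q) (Tr ?q) ?h (T p i m n) = pres_class (Tg ?q) (Tr ?q) (?h (i, m, n)))"
  proof (rule tensor_pres_map[where S' = "Tg ?q" and R' = "Tr ?q" and p = p and h = ?h, OF Tr keys])
    fix i m m' n assume m: "m \<in> carrier (gr M i)" "m' \<in> carrier (gr M i)" and n: "n \<in> carrier (gr N (p - i))"
    show "pres_class (Tg ?q) (Tr ?q) (?h (i, m \<otimes>\<^bsub>gr M i\<^esub> m', n)) =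
      pres_class (Tg ?q) (Tr ?q) (?h (i, m, n)) \<otimes>\<^bsub>?P\<^esub> pres_class (Tg ?q) (Tr ?q) (?h (i, m', n))"
      unfolding h[OF m(1) n] h[OF m(2) n] h[OF M_mult[OF m] n] hom_mult[OF M.df_hom m]
        T_add1[OF M.df_closed[OF m(1)] M.df_closed[OF m(2)] dn'[OF n]] T_add1[OF m dn[OF n]]
      by (rule shuffle) (use m n in \<open>auto intro: c1 c2\<close>)
  next
    fix i m n n' assume m: "m \<in> carrier (gr M i)" and n: "n \<in> carrier (gr N (p - i))" "n' \<in> carrier (gr N (p - i))"
    have 1: "T ?q (i + 1) (df M i m) (n \<otimes>\<^bsub>gr N (p - i)\<^esub> n') =
        T ?q (i + 1) (df M i m) n \<otimes>\<^bsub>?P\<^esub> T ?q (i + 1) (df M i m) n'"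
      using T_add2[OF M.df_closed[OF m] dn'[OF n(1)] dn'[OF n(2)]] by (simp only: e)
    have 2: "T ?q i m (df N (p - i) n \<otimes>\<^bsub>gr N (p - i + 1)\<^esub> df N (p - i) n') =
        T ?q i m (df N (p - i) n) \<otimes>\<^bsub>?P\<^esub> T ?q i m (df N (p - i) n')"
      using T_add2[OF m dn[OF n(1)] dn[OF n(2)]] by (simp only: e')
    show "pres_class (Tg ?q) (Tr ?q) (?h (i, m, n \<otimes>\<^bsub>gr N (p - i)\<^esub> n')) =
      pres_class (Tg ?q) (Tr ?q) (?h (i, m, n)) \<otimes>\<^bsub>?P\<^esub> pres_class (Tg ?q) (Tr ?q) (?h (i, m, n'))"
      unfolding h[OF m n(1)] h[OF m n(2)] h[OF m N_mult[OF n]] hom_mult[OF N.df_hom n] 1 2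
      by (rule shuffle) (use m n in \<open>auto intro: c1 c2\<close>)
  next
    fix i j m a n assume m: "m \<in> carrier (gr M i)" and a: "a \<in> carrier (gr A j)" and n: "n \<in> carrier (gr N (p - i - j))"
    let ?l = "p - i - j"
    have f: "p - (i + j) = ?l" "?q - i - j = ?l + 1" "?q - (i + 1) - j = ?l" "?q - i - (j + 1) = ?l" "p - i + 1 - (j + 1) = ?l" "p - i + 1 - j = ?l + 1"
      "j + 1 + ?l = p - i + 1" "j + (?l + 1) = p - i + 1" "?q - i = p - i + 1" "i + 1 + j = i + j + 1" "i + (j + 1) = i + j + 1"
      "?q - (i + j + 1) = ?l" "j + ?l = p - i" "j + ?l + 1 = p - i + 1" by simp_all
    have dm: "df M i m \<in> carrier (gr M (i + 1))" by (rule M.df_closed[OF m])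
    have da: "df A j a \<in> carrier (gr A (j + 1))" by (rule A.df_closed[OF a])
    have dnl: "df N ?l n \<in> carrier (gr N (?l + 1))" by (rule N.df_closed[OF n])
    \<comment> \<open>the three terms of the common differential, up to sign\<close>
    let ?u = "T ?q (i + 1) (df M i m) (act N j ?l a n)"
    let ?v = "T ?q i m (act N (j + 1) ?l (df A j a) n)"
    let ?w = "T ?q i m (act N j (?l + 1) a (df N ?l n))"
    have an: "act N j ?l a n \<in> carrier (gr N (p - i))" using N.act_closed[OF a n] by (simp only: f)
    have dan: "act N (j + 1) ?l (df A j a) n \<in> carrier (gr N (?q - i))" using N.act_closed[OF da n] by (simp only: f)
    have adn: "act N j (?l + 1) a (df N ?l n) \<in> carrier (gr N (?q - i))" using N.act_closed[OF a dnl] by (simp only: f)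
    have uvw: "?u \<in> carrier ?P" "?v \<in> carrier ?P" "?w \<in> carrier ?P"
      using c1[OF m an] cl[OF m dan] cl[OF m adn] by auto
    have u: "T ?q (i + j + 1) (ract M (i + 1) j (df M i m) a) n = ?u"
      using T_bal[of "df M i m" "i + 1" a j n ?q] dm a n by (simp only: f)
    have v: "T ?q (i + j + 1) (ract M i (j + 1) m (df A j a)) n = ?v"
      using T_bal[of m i "df A j a" "j + 1" n ?q] m da n by (simp only: f)
    have w: "T ?q (i + j) (ract M i j m a) (df N ?l n) = ?w"
      using T_bal[of m i a j "df N ?l n" ?q] m a dnl by (simp only: f)
    have r1: "ract M (i + 1) j (df M i m) a \<in> carrier (gr M (i + j + 1))"
      using ract_closed[OF dm a] by (simp only: f)
    have r2: "ract M i (j + 1) m (df A j a) \<in> carrier (gr M (i + j + 1))"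
      using ract_closed[OF m da] by (simp only: f)
    have n': "n \<in> carrier (gr N (?q - (i + j + 1)))" using n by (simp only: f)
    have "pres_class (Tg ?q) (Tr ?q) (?h (i + j, ract M i j m a, n)) =
        T ?q (i + j + 1) (df M (i + j) (ract M i j m a)) n \<otimes>\<^bsub>?P\<^esub> koszul ?P (i + j) ?w"
      using h[OF ract_closed[OF m a], of n] n w by (simp only: f)
    also have "T ?q (i + j + 1) (df M (i + j) (ract M i j m a)) n = ?u \<otimes>\<^bsub>?P\<^esub> koszul ?P i ?v"
      unfolding ract_leibniz[OF m a] T_add1[OF r1 koszul_closed[OF M.gr_comm_group r2] n'] T_koszul1[OF r2 n'] u v ..
    finally have L: "pres_class (Tg ?q) (Tr ?q) (?h (i + j, ract M i j m a, n)) =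
        ?u \<otimes>\<^bsub>?P\<^esub> koszul ?P i ?v \<otimes>\<^bsub>?P\<^esub> koszul ?P (i + j) ?w" .
    have lei: "df N (p - i) (act N j ?l a n) = act N (j + 1) ?l (df A j a) n \<otimes>\<^bsub>gr N (?q - i)\<^esub>
        koszul (gr N (?q - i)) j (act N j (?l + 1) a (df N ?l n))"
      using N.act_leibniz[OF a n] by (simp only: f)
    have "T ?q i m (df N (p - i) (act N j ?l a n)) = ?v \<otimes>\<^bsub>?P\<^esub> koszul ?P j ?w"
      unfolding lei T_add2[OF m dan koszul_closed[OF N.gr_comm_group adn]] T_koszul2[OF m adn] ..
    then have R: "pres_class (Tg ?q) (Tr ?q) (?h (i, m, act N j ?l a n)) =
        ?u \<otimes>\<^bsub>?P\<^esub> koszul ?P i (?v \<otimes>\<^bsub>?P\<^esub> koszul ?P j ?w)"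
      using h[OF m an] by simp
    show "pres_class (Tg ?q) (Tr ?q) (?h (i + j, ract M i j m a, n)) = pres_class (Tg ?q) (Tr ?q) (?h (i, m, act N j ?l a n))"
      unfolding L R using uvw
      by (simp add: koszul_mult koszul_koszul koszul_closed P.comm_group_axioms P.m_assoc)
  qed
  have d: "df X p = pres_map (Tg ?q) (Tr ?q) ?h" by (simp add: tensor_dg_def)
  show "df X p \<in> hom (P p) ?P" using pm by (simp only: d)
  show "\<And>i m n. \<lbrakk>m \<in> carrier (gr M i); n \<in> carrier (gr N (p - i))\<rbrakk> \<Longrightarrow>
      df X p (T p i m n) = T (p + 1) (i + 1) (df M i m) n \<otimes>\<^bsub>P (p + 1)\<^esub> koszul (P (p + 1)) i (T (p + 1) i m (df N (p - i) n))"
    using pm h by (simp only: d)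
qed

text \<open>Scalars commute with the right action by centrality, so they act on the tensor product through its
  left factor.\<close>

lemma s_act_ract:
  assumes k: "k \<in> carrier K" and m: "m \<in> carrier (gr M i)" and a: "a \<in> carrier (gr A j)"
  shows "act M 0 (i + j) (s k) (ract M i j m a) = ract M i j (act M 0 i (s k) m) a"
proof -
  have e: "j + i = i + j" by simp
  have am: "act M j i a m \<in> carrier (gr M (i + j))" using M.act_closed[of a j m i] a m by (simp add: e)
  have sk: "s k \<in> carrier (gr (op_dg_ring A) 0)" using s_closed[OF k] by simp
  have h: "act M 0 (i + j) (s k) \<in> hom (gr M (i + j)) (gr M (i + j))" using M.act_hom[OF sk, of "i + j"] by simp
  have "act M 0 (i + j) (s k) (ract M i j m a) = koszul (gr M (i + j)) (i * j) (act M 0 (i + j) (s k) (act M j i a m))"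
    unfolding ract_def by (rule koszul_hom[OF M.gr_comm_group M.gr_comm_group h am])
  also have "act M 0 (i + j) (s k) (act M j i a m) = act M j i a (act M 0 i (s k) m)"
    using M.act_assoc[of "s k" 0 a j m i] M.act_assoc[of a j "s k" 0 m i] k m a s_closed[OF k] s_central[OF k a]
    by (simp add: e koszul_def)
  finally show ?thesis by (simp add: ract_def)
qed

lemma act_X:
  assumes k: "k \<in> carrier K"
  shows "act X 0 p k \<in> hom (P p) (P p)"
    and "\<And>i m n. \<lbrakk>m \<in> carrier (gr M i); n \<in> carrier (gr N (p - i))\<rbrakk> \<Longrightarrow>
      act X 0 p k (T p i m n) = T p i (act M 0 i (s k) m) n"
proof -
  let ?h = "\<lambda>(i, m, n). frag_of (i, act M 0 i (s k) m, n)"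
  have sk: "s k \<in> carrier (gr (op_dg_ring A) 0)" using s_closed[OF k] by simp
  have c: "act M 0 i (s k) m \<in> carrier (gr M i)" if "m \<in> carrier (gr M i)" for m i
    using M.act_closed[OF sk that] by simp
  have pm: "pres_map (Tg p) (Tr p) ?h \<in> hom (P p) (P p) \<and>
    (\<forall>i m n. m \<in> carrier (gr M i) \<longrightarrow> n \<in> carrier (gr N (p - i)) \<longrightarrow>
      pres_map (Tg p) (Tr p) ?h (T p i m n) = pres_class (Tg p) (Tr p) (?h (i, m, n)))"
  proof (rule tensor_pres_map[OF Tr])
    fix i m m' n assume m: "m \<in> carrier (gr M i)" "m' \<in> carrier (gr M i)" and n: "n \<in> carrier (gr N (p - i))"
    show "pres_class (Tg p) (Tr p) (?h (i, m \<otimes>\<^bsub>gr M i\<^esub> m', n)) =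
      pres_class (Tg p) (Tr p) (?h (i, m, n)) \<otimes>\<^bsub>P p\<^esub> pres_class (Tg p) (Tr p) (?h (i, m', n))"
      using T_add1[OF c[OF m(1)] c[OF m(2)] n] M.act_add_right[OF sk m] by simp
  qed (simp_all add: Tg_iff c T_add2 s_act_ract[OF k] T_bal)
  have d: "act X 0 p k = pres_map (Tg p) (Tr p) ?h" by (simp add: tensor_dg_def)
  show "act X 0 p k \<in> hom (P p) (P p)" using pm by (simp only: d)
  show "act X 0 p k (T p i m n) = T p i (act M 0 i (s k) m) n"
    if "m \<in> carrier (gr M i)" "n \<in> carrier (gr N (p - i))" for i m n
    using pm that by (simp add: d)
qed

lemma act_X_nonzero: "q \<noteq> 0 \<Longrightarrow> act X q p k x = \<one>\<^bsub>P (q + p)\<^esub>"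
  by (simp add: tensor_dg_def)

end

locale tensor_map_setup = tensor_pair K A s M N + N': tensor_pair K A s M' N'
  for K :: "'k ring" (structure) and A :: "'a dg_ring" and s :: "'k \<Rightarrow> 'a"
    and M M' :: "('a, 'u) dg_module" and N N' :: "('a, 'v) dg_module" +
  fixes f g
  assumes f: "f \<in> strict_homs (op_dg_ring A) M M'" and g: "g \<in> strict_homs A N N'"
begin

lemma f_ract:
  assumes m: "m \<in> carrier (gr M i)" and a: "a \<in> carrier (gr A j)"
  shows "f (i + j) (ract M i j m a) = ract M' i j (f i m) a"
proof -
  have "act M j i a m \<in> carrier (gr M (i + j))" using M.act_closed[of a j m i] a m by (simp add: add.commute)
  then show ?thesis
    using strict_homsD(5)[OF f, of a j m i] a m
    by (simp add: ract_def koszul_hom[OF M.gr_comm_group N'.M.gr_comm_group strict_homsD(1)[OF f]] add.commute)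
qed

abbreviation "fg \<equiv> tensor_map A (M, N) (M', N') (f, g)"

lemma fg:
  shows "fg p \<in> hom (P p) (N'.P p)"
    and "\<And>i m n. \<lbrakk>m \<in> carrier (gr M i); n \<in> carrier (gr N (p - i))\<rbrakk> \<Longrightarrow>
      fg p (T p i m n) = N'.T p i (f i m) (g (p - i) n)"
proof -
  let ?h = "\<lambda>(i, m, n). frag_of (i, f i m, g (p - i) n)"
  note fc = strict_homsD(3)[OF f] and gc = strict_homsD(3)[OF g]
  have pm: "pres_map (N'.Tg p) (N'.Tr p) ?h \<in> hom (P p) (N'.P p) \<and>
    (\<forall>i m n. m \<in> carrier (gr M i) \<longrightarrow> n \<in> carrier (gr N (p - i)) \<longrightarrow>
      pres_map (N'.Tg p) (N'.Tr p) ?h (T p i m n) = pres_class (N'.Tg p) (N'.Tr p) (?h (i, m, n)))"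
  proof (rule tensor_pres_map[OF N'.Tr])
    fix i j m a n assume m: "m \<in> carrier (gr M i)" and a: "a \<in> carrier (gr A j)" and n: "n \<in> carrier (gr N (p - i - j))"
    have "g (p - i) (act N j (p - i - j) a n) = act N' j (p - i - j) a (g (p - i - j) n)"
      using strict_homsD(5)[OF g a n] by simp
    then show "pres_class (N'.Tg p) (N'.Tr p) (?h (i + j, ract M i j m a, n)) =
        pres_class (N'.Tg p) (N'.Tr p) (?h (i, m, act N j (p - i - j) a n))"
      using N'.T_bal[OF fc[OF m] a gc[OF n]] by (simp add: f_ract[OF m a] diff_diff_index)
  qed (simp_all add: N'.Tg_iff fc gc hom_mult[OF strict_homsD(1)[OF f]] hom_mult[OF strict_homsD(1)[OF g]] N'.T_add1 N'.T_add2)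
  have d: "fg p = restrict (pres_map (N'.Tg p) (N'.Tr p) ?h) (carrier (P p))" by (simp add: tensor_map_def)
  show "fg p \<in> hom (P p) (N'.P p)"
    unfolding d using conjunct1[OF pm] by (auto simp: hom_def P.m_closed)
  show "fg p (T p i m n) = N'.T p i (f i m) (g (p - i) n)"
    if "m \<in> carrier (gr M i)" "n \<in> carrier (gr N (p - i))" for i m n
    using pm that by (simp add: d T_closed)
qed

lemma fg_strict: "fg \<in> strict_homs (dg_of_ring K) X N'.X"
proof -
  have ext: "fg p \<in> extensional (carrier (gr X p))" for p by (simp add: tensor_map_def)
  have df: "fg (p + 1) (df X p x) = df N'.X p (fg p x)" if x: "x \<in> carrier (P p)" for p x
  proof (rule P_hom_ext[OF N'.P.comm_group_axioms hom_comp[OF df_X(1) fg(1)] hom_comp[OF fg(1) N'.df_X(1)] _ x])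
    fix i m n assume m: "m \<in> carrier (gr M i)" and n: "n \<in> carrier (gr N (p - i))"
    have e: "p + 1 - (i + 1) = p - i" "p + 1 - i = p - i + 1" by simp_all
    have n': "n \<in> carrier (gr N (p + 1 - (i + 1)))" and dn: "df N (p - i) n \<in> carrier (gr N (p + 1 - i))"
      using n N.df_closed[OF n] by (simp_all only: e)
    note c = T_closed[OF M.df_closed[OF m] n'] T_closed[OF m dn]
    have "fg (p + 1) (df X p (T p i m n)) = N'.T (p + 1) (i + 1) (f (i + 1) (df M i m)) (g (p - i) n) \<otimes>\<^bsub>N'.P (p + 1)\<^esub>
        koszul (N'.P (p + 1)) i (N'.T (p + 1) i (f i m) (g (p - i + 1) (df N (p - i) n)))"
      unfolding df_X(2)[OF m n] hom_mult[OF fg(1) c(1) koszul_closed[OF P.comm_group_axioms c(2)]]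
        koszul_hom[OF P.comm_group_axioms N'.P.comm_group_axioms fg(1) c(2)] fg(2)[OF M.df_closed[OF m] n'] fg(2)[OF m dn] e ..
    also have "\<dots> = df N'.X p (fg p (T p i m n))"
      unfolding fg(2)[OF m n] N'.df_X(2)[OF strict_homsD(3)[OF f m] strict_homsD(3)[OF g n]]
        strict_homsD(4)[OF f m] strict_homsD(4)[OF g n] ..
    finally show "fg (p + 1) (df X p (T p i m n)) = df N'.X p (fg p (T p i m n))" .
  qed
  have act: "fg (q + p) (act X q p k x) = act N'.X q p k (fg p x)"
    if k: "k \<in> carrier (gr (dg_of_ring K) q)" and x: "x \<in> carrier (P p)" for p q k x
  proof (cases "q = 0")
    case True
    then have k': "k \<in> carrier K" using k by simp
    have "fg p (act X 0 p k x) = act N'.X 0 p k (fg p x)"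
    proof (rule P_hom_ext[OF N'.P.comm_group_axioms hom_comp[OF act_X(1)[OF k'] fg(1)] hom_comp[OF fg(1) N'.act_X(1)[OF k']] _ x])
      fix i m n assume m: "m \<in> carrier (gr M i)" and n: "n \<in> carrier (gr N (p - i))"
      have "act M 0 i (s k) m \<in> carrier (gr M i)" "f i (act M 0 i (s k) m) = act M' 0 i (s k) (f i m)"
        using M.act_closed[of "s k" 0 m i] strict_homsD(5)[OF f, of "s k" 0 m i] s_closed[OF k'] m by simp_all
      then show "fg p (act X 0 p k (T p i m n)) = act N'.X 0 p k (fg p (T p i m n))"
        using m n by (simp add: act_X(2)[OF k'] N'.act_X(2)[OF k'] fg(2) strict_homsD(3)[OF f] strict_homsD(3)[OF g])
    qed
    then show ?thesis using True by simp
  next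
    case False
    then show ?thesis
      by (simp add: act_X_nonzero N'.act_X_nonzero hom_one'[OF P.comm_group_axioms N'.P.comm_group_axioms fg(1)])
  qed
  show ?thesis using ext df act fg(1) unfolding strict_homs_def by simp
qed

end

section \<open>The tensor product of cohomology modules\<close>

lemma (in cochain_complex) coh_class_eqI:
  "\<lbrakk>m \<in> cyc M i; n \<in> cyc M i; y \<in> carrier (gr M (i - 1)); m = df M (i - 1) y \<otimes>\<^bsub>gr M i\<^esub> n\<rbrakk> \<Longrightarrow>
    coh_class M i m = coh_class M i n"
  using coh_class_eq_iff by blast

text \<open>Boundaries of the ring act as zero on cohomology, since $(dc) m = d(c m)$ for a cocycle \<open>m\<close>.\<close>

lemma (in dg_module_over) coh_op_cong:
  assumes a: "a \<in> cyc A 0" and b: "b \<in> cyc A 0" and eq: "coh_class A 0 a = coh_class A 0 b"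
    and x: "x \<in> carrier (coh M j)"
  shows "coh_op M j a x = coh_op M j b x"
proof -
  obtain m where m: "m \<in> cyc M j" "x = coh_class M j m" by (rule coh_cases[OF x])
  obtain c where c: "c \<in> carrier (gr A (- 1))" "a = df A (- 1) c \<otimes>\<^bsub>gr A 0\<^esub> b"
    using eq B.coh_class_eq_iff[OF a b] by auto
  interpret G: comm_group "gr M j" by (rule gr_comm_group)
  have mc: "m \<in> carrier (gr M j)" by (rule cycD[OF m(1)])
  have dc: "df A (- 1) c \<in> carrier (gr A 0)" using B.df_closed[OF c(1)] by simp
  have "df M (j - 1) (act M (- 1) j c m) = act M 0 j (df A (- 1) c) m"
    using act_leibniz[OF c(1) mc] act_one_right[OF c(1), of "j + 1"] act_closed[OF dc mc] m(1)
    by (simp add: cyc_iff koszul_def)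
  moreover have "act M 0 j a m = act M 0 j (df A (- 1) c) m \<otimes>\<^bsub>gr M j\<^esub> act M 0 j b m"
    using act_add_left[OF dc cycD[OF b] mc] c(2) by simp
  moreover have "act M (- 1) j c m \<in> carrier (gr M (j - 1))"
    using act_closed[OF c(1) mc] by simp
  ultimately show ?thesis
    using coh_class_eqI[OF act_cyc[OF a m(1)] act_cyc[OF b m(1)], of "act M (- 1) j c m"]
    by (simp add: coh_op_class a b m)
qed

lemma mk_module_simps [simp]: "carrier (mk_module G sc) = carrier G" "add (mk_module G sc) = monoid.mult G"
  "smult (mk_module G sc) = sc"
  by (simp_all add: mk_module_def)

lemma module_isos_iff:
  "f \<in> module_isos K (mk_module G a) (mk_module H b) \<longleftrightarrow>
    f \<in> extensional (carrier G) \<and> klinear K G a H b f \<and> bij_betw f (carrier G) (carrier H)"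
  by (auto simp: module_isos_def klinear_def hom_def PiE_def bij_betw_def)

lemma coh_module_eq: "coh_module X p = mk_module (coh X p) (coh_op X p)"
  unfolding coh_module_def by (rule arg_cong[of _ _ "mk_module (coh X p)"]) (simp add: fun_eq_iff coh_op_def)

context tensor_pair
begin

abbreviation "CG \<equiv> coh_tensor_gens M N"
abbreviation "CR \<equiv> coh_tensor_rels A M N"
abbreviation "CP i j \<equiv> pres (CG i j) (CR i j)"
abbreviation "ct i j \<equiv> coh_tensor_class A i j M N"

lemma coh_ract_op: "coh_ract M i x \<alpha> = coh_op M i (SOME a. a \<in> \<alpha>) x"
  by (simp add: coh_ract_def coh_op_def ract_def koszul_def)

lemma coh_act_op: "coh_act N j \<alpha> y = coh_op N j (SOME a. a \<in> \<alpha>) y"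
  by (simp add: coh_act_def coh_op_def)

lemma M_op_closed: "b \<in> cyc A 0 \<Longrightarrow> x \<in> carrier (coh M i) \<Longrightarrow> coh_op M i b x \<in> carrier (coh M i)"
  using M.coh_op_closed by simp

lemma coh_M_mult: "x \<in> carrier (coh M i) \<Longrightarrow> y \<in> carrier (coh M i) \<Longrightarrow> x \<otimes>\<^bsub>coh M i\<^esub> y \<in> carrier (coh M i)"
  using M.coh_group by (simp add: group.is_monoid monoid.m_closed)

lemma coh_N_mult: "x \<in> carrier (coh N i) \<Longrightarrow> y \<in> carrier (coh N i) \<Longrightarrow> x \<otimes>\<^bsub>coh N i\<^esub> y \<in> carrier (coh N i)"
  using N.coh_group by (simp add: group.is_monoid monoid.m_closed)

text \<open>The relators of the third kind are rewritten with cocycles of \<open>A\<close> in place of classes in $H^0(A)$.\<close>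

lemma CR_cases:
  assumes "r \<in> CR i j"
  obtains (add1) x x' y where "r = frag_of (x \<otimes>\<^bsub>coh M i\<^esub> x', y) - frag_of (x, y) - frag_of (x', y)"
      "x \<in> carrier (coh M i)" "x' \<in> carrier (coh M i)" "y \<in> carrier (coh N j)"
    | (add2) x y y' where "r = frag_of (x, y \<otimes>\<^bsub>coh N j\<^esub> y') - frag_of (x, y) - frag_of (x, y')"
      "x \<in> carrier (coh M i)" "y \<in> carrier (coh N j)" "y' \<in> carrier (coh N j)"
    | (bal) x a y where "r = frag_of (coh_op M i a x, y) - frag_of (x, coh_op N j a y)"
      "x \<in> carrier (coh M i)" "a \<in> cyc A 0" "y \<in> carrier (coh N j)"
proof -
  from assms consider
      x x' y where "r = frag_of (x \<otimes>\<^bsub>coh M i\<^esub> x', y) - frag_of (x, y) - frag_of (x', y)"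
        "x \<in> carrier (coh M i)" "x' \<in> carrier (coh M i)" "y \<in> carrier (coh N j)"
    | x y y' where "r = frag_of (x, y \<otimes>\<^bsub>coh N j\<^esub> y') - frag_of (x, y) - frag_of (x, y')"
        "x \<in> carrier (coh M i)" "y \<in> carrier (coh N j)" "y' \<in> carrier (coh N j)"
    | x \<alpha> y where "r = frag_of (coh_ract M i x \<alpha>, y) - frag_of (x, coh_act N j \<alpha> y)"
        "x \<in> carrier (coh M i)" "\<alpha> \<in> carrier (coh A 0)" "y \<in> carrier (coh N j)"
    unfolding coh_tensor_rels_def bal_rels_def H0_ring_def by (auto; blast)
  then show thesis
  proof cases
    case (3 x \<alpha> y)
    then show thesis using bal[of "SOME a. a \<in> \<alpha>" x y] A.coh_rep(1)[of \<alpha> 0] by (simp add: coh_ract_op coh_act_op)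
  qed (use add1 add2 in blast)+
qed

lemma CG_iff: "(x, y) \<in> CG i j \<longleftrightarrow> x \<in> carrier (coh M i) \<and> y \<in> carrier (coh N j)"
  by (simp add: coh_tensor_gens_def)

lemma CR: "CR i j \<subseteq> carrier (free_Abelian_group (CG i j))"
proof
  fix r assume "r \<in> CR i j"
  then show "r \<in> carrier (free_Abelian_group (CG i j))"
  proof (cases rule: CR_cases)
    case (add1 x x' y)
    then show ?thesis unfolding carrier_free_Abelian_group_iff add1(1)
      by (intro keys_rel) (simp_all add: CG_iff coh_M_mult)
  next
    case (add2 x y y')
    then show ?thesis unfolding carrier_free_Abelian_group_iff add2(1)
      by (intro keys_rel) (simp_all add: CG_iff coh_N_mult)
  next
    case (bal x a y)
    then show ?thesis unfolding carrier_free_Abelian_group_iff bal(1)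
      by (intro keys_rel) (simp_all add: CG_iff M_op_closed N.coh_op_closed)
  qed
qed

sublocale CP: comm_group "CP i j" for i j
  by (rule pres_comm_group[OF CR])

lemma CR_kill:
  assumes H: "comm_group H" and f: "f \<in> hom (free_Abelian_group (CG i j)) H"
    and a1: "\<And>x x' y. \<lbrakk>x \<in> carrier (coh M i); x' \<in> carrier (coh M i); y \<in> carrier (coh N j)\<rbrakk> \<Longrightarrow>
      f (frag_of (x \<otimes>\<^bsub>coh M i\<^esub> x', y)) = f (frag_of (x, y)) \<otimes>\<^bsub>H\<^esub> f (frag_of (x', y))"
    and a2: "\<And>x y y'. \<lbrakk>x \<in> carrier (coh M i); y \<in> carrier (coh N j); y' \<in> carrier (coh N j)\<rbrakk> \<Longrightarrow>
      f (frag_of (x, y \<otimes>\<^bsub>coh N j\<^esub> y')) = f (frag_of (x, y)) \<otimes>\<^bsub>H\<^esub> f (frag_of (x, y'))"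
    and b: "\<And>x a y. \<lbrakk>x \<in> carrier (coh M i); a \<in> cyc A 0; y \<in> carrier (coh N j)\<rbrakk> \<Longrightarrow>
      f (frag_of (coh_op M i a x, y)) = f (frag_of (x, coh_op N j a y))"
    and r: "r \<in> CR i j"
  shows "f r = \<one>\<^bsub>H\<^esub>"
  using r
proof (cases rule: CR_cases)
  case (add1 x x' y)
  then show ?thesis unfolding add1(1) by (subst free_hom_rel3[OF H f]) (auto simp: CG_iff a1 coh_M_mult)
next
  case (add2 x y y')
  then show ?thesis unfolding add2(1) by (subst free_hom_rel3[OF H f]) (auto simp: CG_iff a2 coh_N_mult)
next
  case (bal x a y)
  then show ?thesis unfolding bal(1)
    by (subst free_hom_rel2[OF H f]) (auto simp: CG_iff b M_op_closed N.coh_op_closed)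
qed

lemma ct_closed: "x \<in> carrier (coh M i) \<Longrightarrow> y \<in> carrier (coh N j) \<Longrightarrow> ct i j x y \<in> carrier (CP i j)"
  unfolding coh_tensor_class_def by (rule pres_gen_closed[OF CR]) (simp add: CG_iff)

lemma ct_add1:
  assumes "x \<in> carrier (coh M i)" "x' \<in> carrier (coh M i)" "y \<in> carrier (coh N j)"
  shows "ct i j (x \<otimes>\<^bsub>coh M i\<^esub> x') y = ct i j x y \<otimes>\<^bsub>CP i j\<^esub> ct i j x' y"
proof -
  have "frag_of (x \<otimes>\<^bsub>coh M i\<^esub> x', y) - frag_of (x, y) - frag_of (x', y) \<in> CR i j"
    unfolding coh_tensor_rels_def bal_rels_def using assms by blast
  from pres_class_rel[OF CR this] show ?thesis
    using assms unfolding coh_tensor_class_def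
    by (subst (asm) free_hom_rel3[OF CP.comm_group_axioms pres_class_hom[OF CR]]) (auto simp: CG_iff coh_M_mult)
qed

lemma ct_add2:
  assumes "x \<in> carrier (coh M i)" "y \<in> carrier (coh N j)" "y' \<in> carrier (coh N j)"
  shows "ct i j x (y \<otimes>\<^bsub>coh N j\<^esub> y') = ct i j x y \<otimes>\<^bsub>CP i j\<^esub> ct i j x y'"
proof -
  have "frag_of (x, y \<otimes>\<^bsub>coh N j\<^esub> y') - frag_of (x, y) - frag_of (x, y') \<in> CR i j"
    unfolding coh_tensor_rels_def bal_rels_def using assms by blast
  from pres_class_rel[OF CR this] show ?thesis
    using assms unfolding coh_tensor_class_def
    by (subst (asm) free_hom_rel3[OF CP.comm_group_axioms pres_class_hom[OF CR]]) (auto simp: CG_iff coh_N_mult)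
qed

lemma ct_bal:
  assumes x: "x \<in> carrier (coh M i)" and b: "b \<in> cyc A 0" and y: "y \<in> carrier (coh N j)"
  shows "ct i j (coh_op M i b x) y = ct i j x (coh_op N j b y)"
proof -
  let ?\<alpha> = "coh_class A 0 b" let ?a = "SOME a. a \<in> ?\<alpha>"
  have \<alpha>: "?\<alpha> \<in> carrier (coh A 0)" by (rule A.coh_class_closed[OF b])
  note a = A.coh_rep[OF \<alpha>]
  have "frag_of (coh_ract M i x ?\<alpha>, y) - frag_of (x, coh_act N j ?\<alpha> y) \<in> CR i j"
    unfolding coh_tensor_rels_def bal_rels_def using x y \<alpha> by (simp add: H0_ring_def) blast
  from pres_class_rel[OF CR this] have "ct i j (coh_op M i ?a x) y = ct i j x (coh_op N j ?a y)"
    using x y a M_op_closed N.coh_op_closed unfolding coh_tensor_class_def coh_ract_op coh_act_op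
    by (subst (asm) free_hom_rel2[OF CP.comm_group_axioms pres_class_hom[OF CR]]) (auto simp: CG_iff)
  moreover have "coh_op M i ?a x = coh_op M i b x"
    by (rule M.coh_op_cong[OF _ _ _ x]) (use a b in \<open>simp_all add: coh_class_def coboundaries_def cocycles_def\<close>)
  moreover have "coh_op N j ?a y = coh_op N j b y"
    by (rule N.coh_op_cong[OF a(1) b a(2) y])
  ultimately show ?thesis by simp
qed

lemma CP_hom_ext:
  assumes "comm_group H" "f \<in> hom (CP i j) H" "g \<in> hom (CP i j) H"
    and "\<And>x y. \<lbrakk>x \<in> carrier (coh M i); y \<in> carrier (coh N j)\<rbrakk> \<Longrightarrow> f (ct i j x y) = g (ct i j x y)"
    and "t \<in> carrier (CP i j)"
  shows "f t = g t"
  by (rule pres_hom_ext[OF CR assms(1-3) _ assms(5)]) (use assms(4) in \<open>auto simp: coh_tensor_gens_def coh_tensor_class_def\<close>)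

lemma ct_one1: "y \<in> carrier (coh N j) \<Longrightarrow> ct i j \<one>\<^bsub>coh M i\<^esub> y = \<one>\<^bsub>CP i j\<^esub>"
  by (rule hom_one'[OF M.coh_comm_group CP.comm_group_axioms, of "\<lambda>x. ct i j x y"])
    (auto intro!: homI simp: ct_closed ct_add1)

lemma ct_one2: "x \<in> carrier (coh M i) \<Longrightarrow> ct i j x \<one>\<^bsub>coh N j\<^esub> = \<one>\<^bsub>CP i j\<^esub>"
  by (rule hom_one'[OF N.coh_comm_group CP.comm_group_axioms, of "\<lambda>y. ct i j x y"])
    (auto intro!: homI simp: ct_closed ct_add2)

lemma sk_cyc: "k \<in> carrier K \<Longrightarrow> s k \<in> cyc A 0"
  by (simp add: cyc_iff s_closed s_cocycle)

definition coh_scalar :: "int \<Rightarrow> int \<Rightarrow> 'k \<Rightarrow> ('u set \<times> 'v set \<Rightarrow>\<^sub>0 int) set \<Rightarrow> ('u set \<times> 'v set \<Rightarrow>\<^sub>0 int) set"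
  where "coh_scalar i j k = pres_map (CG i j) (CR i j) (\<lambda>(x, y). frag_of (coh_op M i (s k) x, y))"

lemma coh_tensor_eq: "coh_tensor A s i j M N = mk_module (CP i j) (coh_scalar i j)"
  by (simp add: coh_tensor_def coh_scalar_def[abs_def] coh_op_def)

end

text \<open>Linearity over $H^0(A)$, expressed with cocycles.\<close>

definition coh_linear :: "'a dg_ring \<Rightarrow> int \<Rightarrow> ('a, 'u) dg_module \<Rightarrow> ('a, 'u) dg_module \<Rightarrow> ('u set \<Rightarrow> 'u set) \<Rightarrow> bool"
  where "coh_linear A i M M' u \<longleftrightarrow> u \<in> hom (coh M i) (coh M' i) \<and>
    (\<forall>b\<in>cyc A 0. \<forall>x\<in>carrier (coh M i). u (coh_op M i b x) = coh_op M' i b (u x))"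

lemma coh_linearD:
  assumes "coh_linear A i M M' u"
  shows "u \<in> hom (coh M i) (coh M' i)" "x \<in> carrier (coh M i) \<Longrightarrow> u x \<in> carrier (coh M' i)"
    "b \<in> cyc A 0 \<Longrightarrow> x \<in> carrier (coh M i) \<Longrightarrow> u (coh_op M i b x) = coh_op M' i b (u x)"
  using assms hom_in_carrier[of u "coh M i" "coh M' i"] by (auto simp: coh_linear_def)

lemma der_coh_linear:
  assumes "cochain_complex B" "\<phi> \<in> Mor (der_cat B) X Y"
  shows "coh_linear B i X Y (der_coh_map i X \<phi>)"
  by (simp add: coh_linear_def der_coh_hom[OF assms(2)] der_coh_op[OF assms])

lemma coh_linear_op [simp]: "coh_linear (op_dg_ring A) = coh_linear A"
  by (simp add: coh_linear_def fun_eq_iff)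

context tensor_pair
begin

lemma ops_commute:
  assumes k: "k \<in> carrier K" and a: "a \<in> cyc A 0" and x: "x \<in> carrier (coh M i)"
  shows "coh_op M i (s k) (coh_op M i a x) = coh_op M i a (coh_op M i (s k) x)"
proof -
  obtain m where m: "m \<in> cyc M i" "x = coh_class M i m" by (rule M.coh_cases[OF x])
  have "act M 0 i (s k) (act M 0 i a m) = act M 0 i a (act M 0 i (s k) m)"
    using M.act_assoc[of "s k" 0 a 0 m i] M.act_assoc[of a 0 "s k" 0 m i] s_closed[OF k] a cycD[OF m(1)]
      s_central[OF k cycD[OF a]] cycD[OF a] by (simp add: koszul_def)
  then show ?thesis using m a sk_cyc[OF k] M.act_cyc by (simp add: M.coh_op_class)
qed

lemma coh_tensor_pres_map:
  assumes M'N': "tensor_pair K A s M' N'" and u: "coh_linear A i M M' u" and v: "coh_linear A j N N' v"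
  defines "F \<equiv> pres_map (coh_tensor_gens M' N' i j) (coh_tensor_rels A M' N' i j) (\<lambda>(x, y). frag_of (u x, v y))"
  shows "F \<in> hom (CP i j) (pres (coh_tensor_gens M' N' i j) (coh_tensor_rels A M' N' i j))"
    and "\<And>x y. \<lbrakk>x \<in> carrier (coh M i); y \<in> carrier (coh N j)\<rbrakk> \<Longrightarrow>
      F (ct i j x y) = coh_tensor_class A i j M' N' (u x) (v y)"
proof -
  interpret N': tensor_pair K A s M' N' by fact
  let ?h = "\<lambda>(x, y). frag_of (u x, v y)"
  have h: "Poly_Mapping.keys (?h g) \<subseteq> N'.CG i j" if "g \<in> CG i j" for g
    using that coh_linearD(2)[OF u] coh_linearD(2)[OF v] by (cases g) (simp add: CG_iff N'.CG_iff)
  let ?f = "\<lambda>c. pres_class (N'.CG i j) (N'.CR i j) (frag_extend ?h c)"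
  have fh: "?f \<in> hom (free_Abelian_group (CG i j)) (N'.CP i j)"
    using hom_comp[OF frag_extend_hom[OF h] pres_class_hom[OF N'.CR]] .
  have rel: "?f r = \<one>\<^bsub>N'.CP i j\<^esub>" if "r \<in> CR i j" for r
    by (rule CR_kill[OF N'.CP.comm_group_axioms fh _ _ _ that])
      (simp_all add: coh_tensor_class_def[symmetric] hom_mult[OF coh_linearD(1)[OF u]] hom_mult[OF coh_linearD(1)[OF v]]
        coh_linearD(2,3)[OF u] coh_linearD(2,3)[OF v] N'.ct_add1 N'.ct_add2 N'.ct_bal)
  note pm = pres_map_hom[OF CR[of i j] N'.CR[of i j] h rel]
  show "F \<in> hom (CP i j) (N'.CP i j)" unfolding F_def by (rule pm(1))
  show "F (ct i j x y) = N'.ct i j (u x) (v y)" if "x \<in> carrier (coh M i)" "y \<in> carrier (coh N j)" for x y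
    using pm(3)[of "(x, y)"] that by (simp add: F_def coh_tensor_class_def CG_iff)
qed

lemma coh_scalar:
  assumes k: "k \<in> carrier K"
  shows "coh_scalar i j k \<in> hom (CP i j) (CP i j)"
    and "\<And>x y. \<lbrakk>x \<in> carrier (coh M i); y \<in> carrier (coh N j)\<rbrakk> \<Longrightarrow>
      coh_scalar i j k (ct i j x y) = ct i j (coh_op M i (s k) x) y"
proof -
  have u: "coh_linear A i M M (coh_op M i (s k))"
    using M.coh_op_hom[of "s k" i] sk_cyc[OF k] by (simp add: coh_linear_def ops_commute[OF k])
  have v: "coh_linear A j N N (\<lambda>y. y)"
    by (simp add: coh_linear_def hom_def Pi_def)
  note pm = coh_tensor_pres_map[OF tensor_pair_axioms u v]
  show "coh_scalar i j k \<in> hom (CP i j) (CP i j)" unfolding coh_scalar_def by (rule pm(1))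
  show "coh_scalar i j k (ct i j x y) = ct i j (coh_op M i (s k) x) y"
    if "x \<in> carrier (coh M i)" "y \<in> carrier (coh N j)" for x y
    unfolding coh_scalar_def by (rule pm(2)[OF that])
qed

lemma coh_tensor_map:
  assumes M'N': "tensor_pair K A s M' N'" and u: "coh_linear A i M M' u" and v: "coh_linear A j N N' v"
  defines "F \<equiv> coh_tensor_map A i j M N M' N' u v"
  shows "klinear K (CP i j) (coh_scalar i j) (tensor_pair.CP A M' N' i j) (tensor_pair.coh_scalar A s M' N' i j) F"
    and "\<And>x y. \<lbrakk>x \<in> carrier (coh M i); y \<in> carrier (coh N j)\<rbrakk> \<Longrightarrow>
      F (ct i j x y) = coh_tensor_class A i j M' N' (u x) (v y)"
    and "F \<in> extensional (carrier (CP i j))"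
proof -
  interpret N': tensor_pair K A s M' N' by fact
  note pm = coh_tensor_pres_map[OF M'N' u v]
  have F: "F t = pres_map (N'.CG i j) (N'.CR i j) (\<lambda>(x, y). frag_of (u x, v y)) t" if "t \<in> carrier (CP i j)" for t
    using that by (simp add: F_def coh_tensor_map_def)
  have hom: "F \<in> hom (CP i j) (N'.CP i j)"
    using pm(1) by (auto simp: hom_def F CP.m_closed)
  show ct: "F (ct i j x y) = N'.ct i j (u x) (v y)" if "x \<in> carrier (coh M i)" "y \<in> carrier (coh N j)" for x y
    using pm(2)[OF that] F[OF ct_closed[OF that]] by simp
  show "F \<in> extensional (carrier (CP i j))" by (simp add: F_def coh_tensor_map_def)
  have "F (coh_scalar i j k t) = N'.coh_scalar i j k (F t)" if k: "k \<in> carrier K" and t: "t \<in> carrier (CP i j)" for k t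
    by (rule CP_hom_ext[OF N'.CP.comm_group_axioms hom_comp[OF coh_scalar(1)[OF k] hom] hom_comp[OF hom N'.coh_scalar(1)[OF k]] _ t])
      (simp add: coh_scalar(2)[OF k] N'.coh_scalar(2)[OF k] ct M_op_closed sk_cyc[OF k] coh_linearD(2,3)[OF u] coh_linearD(2)[OF v])
  then show "klinear K (CP i j) (coh_scalar i j) (N'.CP i j) (N'.coh_scalar i j) F"
    using hom by (simp add: klinear_def)
qed

end

section \<open>The top cohomology of the underived tensor product\<close>

locale tensor_coh = tensor_pair K A s M N
  for K :: "'k ring" (structure) and A :: "'a dg_ring" and s :: "'k \<Rightarrow> 'a"
    and M :: "('a, 'u) dg_module" and N :: "('a, 'v) dg_module" +
  assumes X_dg: "dg_module (dg_of_ring K) X"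
begin

sublocale X: dg_module_over "dg_of_ring K" X
  by (rule dgk_over[OF is_cring X_dg])

lemma N_idx: "n \<in> cyc N j \<Longrightarrow> n \<in> carrier (gr N (i + j - i))" for i j :: int
  by (simp add: cycD)

lemma T_cyc:
  assumes m: "m \<in> cyc M i" and n: "n \<in> cyc N j"
  shows "T (i + j) i m n \<in> cyc X (i + j)"
proof -
  have e: "i + j + 1 - (i + 1) = j" "i + j + 1 - i = j + 1" "i + j - i = j" by simp_all
  have "df X (i + j) (T (i + j) i m n) = \<one>\<^bsub>P (i + j + 1)\<^esub>"
    using df_X(2)[OF cycD[OF m] N_idx[OF n, of i]] T_one1[of n "i + j + 1" "i + 1"] T_one2[of m i "i + j + 1"] m n
    by (simp add: cyc_iff e koszul_one P.comm_group_axioms)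
  then show ?thesis using T_closed[OF cycD[OF m] N_idx[OF n, of i]] by (simp add: cyc_iff)
qed

text \<open>$dy \otimes n = d(y \otimes n)$ for a cocycle \<open>n\<close>.\<close>

lemma T_class1:
  assumes m: "m \<in> cyc M i" "m' \<in> cyc M i" and n: "n \<in> cyc N j" and eq: "coh_class M i m = coh_class M i m'"
  shows "coh_class X (i + j) (T (i + j) i m n) = coh_class X (i + j) (T (i + j) i m' n)"
proof -
  obtain y where y: "y \<in> carrier (gr M (i - 1))" "m = df M (i - 1) y \<otimes>\<^bsub>gr M i\<^esub> m'"
    using eq M.coh_class_eq_iff[OF m] by blast
  have e: "i + j - 1 - (i - 1) = j" "i + j - i = j" "i + j - 1 + 1 = i + j" "i - 1 + 1 = i" by simp_all
  have dy: "df M (i - 1) y \<in> carrier (gr M i)" using M.df_closed[OF y(1)] by simp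
  have n': "n \<in> carrier (gr N (i + j - 1 - (i - 1)))" using n by (simp add: e cycD)
  have "i + j - (i - 1) = j + 1" by simp
  then have o: "T (i + j) (i - 1) y \<one>\<^bsub>gr N (j + 1)\<^esub> = \<one>\<^bsub>P (i + j)\<^esub>"
    using T_one2[OF y(1), of "i + j"] by (simp only:)
  have "df X (i + j - 1) (T (i + j - 1) (i - 1) y n) = T (i + j) i (df M (i - 1) y) n"
    using df_X(2)[OF y(1) n'] n T_closed[OF dy, of n "i + j"] o
    by (simp add: e cyc_iff koszul_one P.comm_group_axioms)
  moreover have "T (i + j) i m n = T (i + j) i (df M (i - 1) y) n \<otimes>\<^bsub>P (i + j)\<^esub> T (i + j) i m' n"
    using T_add1[OF dy cycD[OF m(2)] N_idx[OF n, of i]] y(2) by simp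
  ultimately show ?thesis
    using X.coh_class_eqI[OF T_cyc[OF m(1) n] T_cyc[OF m(2) n], of "T (i + j - 1) (i - 1) y n"] T_closed[OF y(1) n'] by simp
qed

text \<open>$m \otimes dz = (-1)^i d(m \otimes z)$ for a cocycle \<open>m\<close>.\<close>

lemma T_class2:
  assumes m: "m \<in> cyc M i" and n: "n \<in> cyc N j" "n' \<in> cyc N j" and eq: "coh_class N j n = coh_class N j n'"
  shows "coh_class X (i + j) (T (i + j) i m n) = coh_class X (i + j) (T (i + j) i m n')"
proof -
  obtain z where z: "z \<in> carrier (gr N (j - 1))" "n = df N (j - 1) z \<otimes>\<^bsub>gr N j\<^esub> n'"
    using eq N.coh_class_eq_iff[OF n] by blast
  have e: "i + j - 1 - i = j - 1" "i + j - i = j" "i + j - 1 + 1 = i + j" "i + j - (i + 1) = j - 1" by simp_all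
  have dz: "df N (j - 1) z \<in> carrier (gr N (i + j - i))" using N.df_closed[OF z(1)] by simp
  have z': "z \<in> carrier (gr N (i + j - 1 - i))" "z \<in> carrier (gr N (i + j - (i + 1)))" using z(1) by (simp_all add: e)
  note mc = cycD[OF m]
  let ?w = "koszul (P (i + j - 1)) i (T (i + j - 1) i m z)"
  have w: "?w \<in> carrier (P (i + j - 1))" by (intro koszul_closed P.comm_group_axioms T_closed mc z')
  have "df X (i + j - 1) ?w = koszul (P (i + j)) i (df X (i + j - 1) (T (i + j - 1) i m z))"
    using koszul_hom[OF P.comm_group_axioms P.comm_group_axioms df_X(1) T_closed[OF mc z'(1)]] by (simp add: e)
  also have "df X (i + j - 1) (T (i + j - 1) i m z) = koszul (P (i + j)) i (T (i + j) i m (df N (j - 1) z))"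
    using df_X(2)[OF mc z'(1)] T_one1[OF z'(2)] m T_closed[OF mc dz] by (simp add: e cyc_iff koszul_closed P.comm_group_axioms)
  also have "koszul (P (i + j)) i \<dots> = T (i + j) i m (df N (j - 1) z)"
    unfolding koszul_koszul[OF P.comm_group_axioms T_closed[OF mc dz]] by (simp add: koszul_def)
  finally have "df X (i + j - 1) ?w = T (i + j) i m (df N (j - 1) z)" .
  moreover have "T (i + j) i m n = T (i + j) i m (df N (j - 1) z) \<otimes>\<^bsub>P (i + j)\<^esub> T (i + j) i m n'"
    using T_add2[OF mc dz N_idx[OF n(2)]] z(2) by simp
  ultimately show ?thesis
    using X.coh_class_eqI[OF T_cyc[OF m n(1)] T_cyc[OF m n(2)], of ?w] w by simp
qed

text \<open>The pairing $([m], [n]) \mapsto [m \otimes n]$.\<close>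

definition pair :: "int \<Rightarrow> int \<Rightarrow> 'u set \<Rightarrow> 'v set \<Rightarrow> ('u, 'v) tensor_elem set"
  where "pair i j x y = coh_class X (i + j) (T (i + j) i (SOME m. m \<in> x) (SOME n. n \<in> y))"

lemma pair_class:
  assumes m: "m \<in> cyc M i" and n: "n \<in> cyc N j"
  shows "pair i j (coh_class M i m) (coh_class N j n) = coh_class X (i + j) (T (i + j) i m n)"
proof -
  note rm = M.coh_rep[OF M.coh_class_closed[OF m]] and rn = N.coh_rep[OF N.coh_class_closed[OF n]]
  show ?thesis
    unfolding pair_def T_class1[OF rm(1) m rn(1) rm(2)] T_class2[OF m rn(1) n rn(2)] ..
qed

lemma pair_cases:
  assumes "x \<in> carrier (coh M i)" "y \<in> carrier (coh N j)"
  obtains m n where "m \<in> cyc M i" "n \<in> cyc N j" "x = coh_class M i m" "y = coh_class N j n"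
  using M.coh_cases[OF assms(1)] N.coh_cases[OF assms(2)] by metis

lemma pair_closed: "x \<in> carrier (coh M i) \<Longrightarrow> y \<in> carrier (coh N j) \<Longrightarrow> pair i j x y \<in> carrier (coh X (i + j))"
  by (erule (1) pair_cases) (simp add: pair_class X.coh_class_closed T_cyc)

lemma pair_add1:
  assumes "x \<in> carrier (coh M i)" "x' \<in> carrier (coh M i)" "y \<in> carrier (coh N j)"
  shows "pair i j (x \<otimes>\<^bsub>coh M i\<^esub> x') y = pair i j x y \<otimes>\<^bsub>coh X (i + j)\<^esub> pair i j x' y"
proof -
  obtain m n where m: "m \<in> cyc M i" "n \<in> cyc N j" "x = coh_class M i m" "y = coh_class N j n"
    by (rule pair_cases[OF assms(1,3)])
  obtain m' where m': "m' \<in> cyc M i" "x' = coh_class M i m'" by (rule M.coh_cases[OF assms(2)])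
  have "T (i + j) i (m \<otimes>\<^bsub>gr M i\<^esub> m') n = T (i + j) i m n \<otimes>\<^bsub>gr X (i + j)\<^esub> T (i + j) i m' n"
    using T_add1[OF cycD[OF m(1)] cycD[OF m'(1)] N_idx[OF m(2)]] by simp
  then show ?thesis
    using m m' by (simp only: M.coh_class_mult[symmetric] pair_class M.mult_cyc X.coh_class_mult T_cyc)
qed

lemma pair_add2:
  assumes "x \<in> carrier (coh M i)" "y \<in> carrier (coh N j)" "y' \<in> carrier (coh N j)"
  shows "pair i j x (y \<otimes>\<^bsub>coh N j\<^esub> y') = pair i j x y \<otimes>\<^bsub>coh X (i + j)\<^esub> pair i j x y'"
proof -
  obtain m n where m: "m \<in> cyc M i" "n \<in> cyc N j" "x = coh_class M i m" "y = coh_class N j n"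
    by (rule pair_cases[OF assms(1,2)])
  obtain n' where n': "n' \<in> cyc N j" "y' = coh_class N j n'" by (rule N.coh_cases[OF assms(3)])
  have "T (i + j) i m (n \<otimes>\<^bsub>gr N j\<^esub> n') = T (i + j) i m n \<otimes>\<^bsub>gr X (i + j)\<^esub> T (i + j) i m n'"
    using T_add2[OF cycD[OF m(1)] N_idx[OF m(2)] N_idx[OF n'(1)]] by simp
  then show ?thesis
    using m n' by (simp only: N.coh_class_mult[symmetric] pair_class N.mult_cyc X.coh_class_mult T_cyc)
qed

lemma pair_bal:
  assumes "x \<in> carrier (coh M i)" "b \<in> cyc A 0" "y \<in> carrier (coh N j)"
  shows "pair i j (coh_op M i b x) y = pair i j x (coh_op N j b y)"
proof -
  obtain m n where m: "m \<in> cyc M i" "n \<in> cyc N j" "x = coh_class M i m" "y = coh_class N j n"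
    by (rule pair_cases[OF assms(1,3)])
  have "T (i + j) i (act M 0 i b m) n = T (i + j) i m (act N 0 j b n)"
    using T_bal[of m i b 0 n "i + j"] m cycD[OF assms(2)] by (simp add: ract_def koszul_def cycD)
  then show ?thesis
    using m assms(2) M.act_cyc[of b m i] N.act_cyc[of b n j] by (simp add: M.coh_op_class N.coh_op_class pair_class)
qed

lemma pair_scalar:
  assumes k: "k \<in> carrier K" and x: "x \<in> carrier (coh M i)" and y: "y \<in> carrier (coh N j)"
  shows "pair i j (coh_op M i (s k) x) y = coh_op X (i + j) k (pair i j x y)"
proof -
  obtain m n where m: "m \<in> cyc M i" "n \<in> cyc N j" "x = coh_class M i m" "y = coh_class N j n"
    by (rule pair_cases[OF x y])
  show ?thesis
    using m sk_cyc[OF k] M.act_cyc[of "s k" m i] act_X(2)[OF k cycD[OF m(1)] N_idx[OF m(2), of i]]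
    by (simp add: M.coh_op_class pair_class X.coh_op_class ring_elem_cyc[OF k] T_cyc)
qed

lemma Theta_exists:
  obtains t where "klinear K (CP i j) (coh_scalar i j) (coh X (i + j)) (coh_op X (i + j)) t"
    "\<And>x y. \<lbrakk>x \<in> carrier (coh M i); y \<in> carrier (coh N j)\<rbrakk> \<Longrightarrow> t (ct i j x y) = pair i j x y"
proof -
  obtain t where t: "t \<in> hom (CP i j) (coh X (i + j))"
    "\<And>g. g \<in> CG i j \<Longrightarrow> t (pres_class (CG i j) (CR i j) (frag_of g)) = (\<lambda>(x, y). pair i j x y) g"
  proof (rule pres_lift[OF CR[of i j] X.coh_comm_group[of "i + j"], of "\<lambda>(x, y). pair i j x y"])
    show "(\<lambda>(x, y). pair i j x y) g \<in> carrier (coh X (i + j))" if "g \<in> CG i j" for g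
      using that by (auto simp: coh_tensor_gens_def pair_closed)
    fix f r assume f: "f \<in> hom (free_Abelian_group (CG i j)) (coh X (i + j))"
      "\<And>g. g \<in> CG i j \<Longrightarrow> f (frag_of g) = (\<lambda>(x, y). pair i j x y) g" and r: "r \<in> CR i j"
    show "f r = \<one>\<^bsub>coh X (i + j)\<^esub>"
      by (rule CR_kill[OF X.coh_comm_group f(1) _ _ _ r])
        (simp_all add: f(2) CG_iff pair_add1 pair_add2 pair_bal coh_M_mult coh_N_mult M_op_closed N.coh_op_closed)
  qed blast
  have ct: "t (ct i j x y) = pair i j x y" if "x \<in> carrier (coh M i)" "y \<in> carrier (coh N j)" for x y
    using t(2)[of "(x, y)"] that by (simp add: CG_iff coh_tensor_class_def)
  have "t (coh_scalar i j k c) = coh_op X (i + j) k (t c)" if k: "k \<in> carrier K" and c: "c \<in> carrier (CP i j)" for k c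
    by (rule CP_hom_ext[OF X.coh_comm_group hom_comp[OF coh_scalar(1)[OF k] t(1)]
          hom_comp[OF t(1) X.coh_op_hom[OF ring_elem_cyc[OF k]]] _ c])
      (simp add: coh_scalar(2)[OF k] ct M_op_closed sk_cyc[OF k] pair_scalar[OF k])
  then show thesis using t(1) ct by (intro that[of t]) (auto simp: klinear_def)
qed

lemma pair_nat:
  assumes M'N': "tensor_coh K A s M' N'" and f: "f \<in> strict_homs (op_dg_ring A) M M'" and g: "g \<in> strict_homs A N N'"
    and x: "x \<in> carrier (coh M i)" and y: "y \<in> carrier (coh N j)"
  shows "coh_map X (tensor_dg A s M' N') (i + j) (tensor_map A (M, N) (M', N') (f, g)) (pair i j x y) =
    tensor_coh.pair A s M' N' i j (coh_map M M' i f x) (coh_map N N' j g y)"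
proof -
  interpret N': tensor_coh K A s M' N' by fact
  interpret h: tensor_map_setup K A s M M' N N' f g
    by (intro tensor_map_setup.intro tensor_map_setup_axioms.intro tensor_pair_axioms N'.tensor_pair_axioms f g)
  obtain m n where m: "m \<in> cyc M i" "n \<in> cyc N j" "x = coh_class M i m" "y = coh_class N j n"
    by (rule pair_cases[OF x y])
  note fM = coh_map_class[OF M.cochain_complex_axioms N'.M.cochain_complex_axioms strict_homsD(6)[OF f] m(1)]
    chain_map_cyc[OF M.cochain_complex_axioms N'.M.cochain_complex_axioms strict_homsD(6)[OF f] m(1)]
  note gN = coh_map_class[OF N.cochain_complex_axioms N'.N.cochain_complex_axioms strict_homsD(6)[OF g] m(2)]
    chain_map_cyc[OF N.cochain_complex_axioms N'.N.cochain_complex_axioms strict_homsD(6)[OF g] m(2)]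
  have "h.fg (i + j) (T (i + j) i m n) = N'.T (i + j) i (f i m) (g j n)"
    using h.fg(2)[OF cycD[OF m(1)] N_idx[OF m(2), of i]] by simp
  then show ?thesis
    using fM(2) gN(2)
    by (simp add: m(3,4) pair_class[OF m(1,2)] N'.pair_class fM(1) gN(1)
        coh_map_class[OF X.cochain_complex_axioms N'.X.cochain_complex_axioms strict_homsD(6)[OF h.fg_strict] T_cyc[OF m(1,2)]])
qed

end

locale tensor_top = tensor_coh K A s M N
  for K :: "'k ring" (structure) and A :: "'a dg_ring" and s :: "'k \<Rightarrow> 'a"
    and M :: "('a, 'u) dg_module" and N :: "('a, 'v) dg_module" +
  fixes i0 j0 :: int
  assumes nonpos: "concentrated_le 0 A" and M_top: "concentrated_le i0 M" and N_top: "concentrated_le j0 N"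
begin

lemma A_pos: "i > 0 \<Longrightarrow> a \<in> carrier (gr A i) \<Longrightarrow> a = \<one>\<^bsub>gr A i\<^esub>"
  using nonpos by (auto simp: concentrated_le_def)

lemma A_cyc: "a \<in> carrier (gr A 0) \<Longrightarrow> a \<in> cyc A 0"
  using A_pos[of 1 "df A 0 a"] A.df_closed[of a 0] by (simp add: cyc_iff)

lemma M_pos: "i > i0 \<Longrightarrow> m \<in> carrier (gr M i) \<Longrightarrow> m = \<one>\<^bsub>gr M i\<^esub>"
  using M_top by (auto simp: concentrated_le_def)

lemma N_pos: "j > j0 \<Longrightarrow> n \<in> carrier (gr N j) \<Longrightarrow> n = \<one>\<^bsub>gr N j\<^esub>"
  using N_top by (auto simp: concentrated_le_def)

lemma M_cyc: "m \<in> carrier (gr M i0) \<Longrightarrow> m \<in> cyc M i0"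
  using M_pos[of "i0 + 1" "df M i0 m"] M.df_closed[of m i0] by (simp add: cyc_iff)

lemma N_cyc: "n \<in> carrier (gr N j0) \<Longrightarrow> n \<in> cyc N j0"
  using N_pos[of "j0 + 1" "df N j0 n"] N.df_closed[of n j0] by (simp add: cyc_iff)

lemma ract_one: "a \<in> carrier (gr A j) \<Longrightarrow> ract M i j \<one>\<^bsub>gr M i\<^esub> a = \<one>\<^bsub>gr M (i + j)\<^esub>"
  using M.act_one_right[of a j i] by (simp add: ract_def koszul_one M.gr_comm_group add.commute)

lemma ract_one': "m \<in> carrier (gr M i) \<Longrightarrow> ract M i j m \<one>\<^bsub>gr A j\<^esub> = \<one>\<^bsub>gr M (i + j)\<^esub>"
  using M.act_one_left[of m i j] by (simp add: ract_def koszul_one M.gr_comm_group add.commute)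

abbreviation (input) "pp \<equiv> i0 + j0"

text \<open>The inverse of \<open>theta\<close> on the generators of the top component. A generator $m \otimes n$ with
  \<open>m\<close> not in degree \<open>i0\<close> is zero, since \<open>m\<close> or \<open>n\<close> has degree above the top.\<close>

definition psi0 :: "int \<times> 'u \<times> 'v \<Rightarrow> ('u set \<times> 'v set \<Rightarrow>\<^sub>0 int) set"
  where "psi0 = (\<lambda>(i, m, n). if i = i0 then ct i0 j0 (coh_class M i0 m) (coh_class N j0 n) else \<one>\<^bsub>CP i0 j0\<^esub>)"

text \<open>Balancedness over an element of degree 0 is balancedness over its class in $H^0(A)$. Over an
  element of another degree both sides vanish: either it has positive degree and is zero, or it has
  negative degree and the remaining factors cannot both have degree at most the top.\<close>

lemma psi_exists:
  obtains \<psi> where "\<psi> \<in> hom (P pp) (CP i0 j0)"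
    "\<And>i m n. \<lbrakk>m \<in> carrier (gr M i); n \<in> carrier (gr N (pp - i))\<rbrakk> \<Longrightarrow> \<psi> (T pp i m n) = psi0 (i, m, n)"
proof -
  note Mc = M.coh_class_closed[OF M_cyc] and Nc = N.coh_class_closed[OF N_cyc]
  obtain \<psi> where \<psi>: "\<psi> \<in> hom (P pp) (CP i0 j0)"
    "\<And>g. g \<in> Tg pp \<Longrightarrow> \<psi> (pres_class (Tg pp) (Tr pp) (frag_of g)) = psi0 g"
  proof (rule pres_lift[OF Tr[of pp] CP.comm_group_axioms[of i0 j0], of psi0])
    show "psi0 g \<in> carrier (CP i0 j0)" if "g \<in> Tg pp" for g
      using that by (auto simp: tensor_gens_def psi0_def ct_closed Mc Nc)
    fix f r assume f: "f \<in> hom (free_Abelian_group (Tg pp)) (CP i0 j0)"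
      "\<And>g. g \<in> Tg pp \<Longrightarrow> f (frag_of g) = psi0 g" and r: "r \<in> Tr pp"
    show "f r = \<one>\<^bsub>CP i0 j0\<^esub>"
    proof (rule rels_kill[OF CP.comm_group_axioms f(1) _ _ _ r])
      fix i m m' n assume m: "m \<in> carrier (gr M i)" "m' \<in> carrier (gr M i)" and n: "n \<in> carrier (gr N (pp - i))"
      then show "f (frag_of (i, m \<otimes>\<^bsub>gr M i\<^esub> m', n)) = f (frag_of (i, m, n)) \<otimes>\<^bsub>CP i0 j0\<^esub> f (frag_of (i, m', n))"
        by (auto simp: f(2) Tg_iff psi0_def M.coh_class_mult M_cyc ct_add1 Mc Nc)
    next
      fix i m n n' assume m: "m \<in> carrier (gr M i)" and n: "n \<in> carrier (gr N (pp - i))" "n' \<in> carrier (gr N (pp - i))"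
      then show "f (frag_of (i, m, n \<otimes>\<^bsub>gr N (pp - i)\<^esub> n')) = f (frag_of (i, m, n)) \<otimes>\<^bsub>CP i0 j0\<^esub> f (frag_of (i, m, n'))"
        by (auto simp: f(2) Tg_iff psi0_def N.coh_class_mult N_cyc ct_add2 Mc Nc)
    next
      fix i j m a n assume m: "m \<in> carrier (gr M i)" and a: "a \<in> carrier (gr A j)" and n: "n \<in> carrier (gr N (pp - i - j))"
      have "psi0 (i + j, ract M i j m a, n) = psi0 (i, m, act N j (pp - i - j) a n)"
      proof (cases "j = 0")
        case True
        show ?thesis
        proof (cases "i = i0")
          case i: True
          have ac: "a \<in> cyc A 0" using a A_cyc True by simp
          have mc: "m \<in> cyc M i0" and nc: "n \<in> cyc N j0" using m n i True by (simp_all add: M_cyc N_cyc)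
          show ?thesis
            using ct_bal[OF M.coh_class_closed[OF mc] ac N.coh_class_closed[OF nc]] ac mc nc
            by (simp add: True i psi0_def ract_def koszul_def M.coh_op_class N.coh_op_class)
        qed (simp add: psi0_def True)
      next
        case False
        have one: "psi0 (i0, \<one>\<^bsub>gr M i0\<^esub>, n) = \<one>\<^bsub>CP i0 j0\<^esub>" if "n \<in> carrier (gr N j0)" for n
          using that by (simp add: psi0_def M.one_coh[symmetric] ct_one1 Nc)
        have one': "psi0 (i0, m, \<one>\<^bsub>gr N j0\<^esub>) = \<one>\<^bsub>CP i0 j0\<^esub>" if "m \<in> carrier (gr M i0)" for m
          using that by (simp add: psi0_def N.one_coh[symmetric] ct_one2 Mc)
        have "psi0 (i + j, ract M i j m a, n) = \<one>\<^bsub>CP i0 j0\<^esub>"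
        proof (cases "i + j = i0")
          case True
          have "ract M i j m a = \<one>\<^bsub>gr M (i + j)\<^esub>"
          proof (cases "j > 0")
            case True then show ?thesis using A_pos[OF _ a] ract_one'[OF m] by simp
          next
            case f: False
            then have "i > i0" using False True by simp
            then show ?thesis using M_pos[OF _ m] ract_one[OF a] by simp
          qed
          moreover have "n \<in> carrier (gr N j0)"
          proof -
            have "pp - i - j = j0" using True by linarith
            then show ?thesis using n by (simp only:)
          qed
          ultimately show ?thesis using one by (simp add: True)
        qed (simp add: psi0_def)
        moreover have "psi0 (i, m, act N j (pp - i - j) a n) = \<one>\<^bsub>CP i0 j0\<^esub>"
        proof (cases "i = i0")
          case True
          have e: "pp - i - j = j0 - j" using True by simp
          have n': "n \<in> carrier (gr N (j0 - j))" using n by (simp only: e)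
          have "act N j (j0 - j) a n = \<one>\<^bsub>gr N (j + (j0 - j))\<^esub>"
          proof (cases "j > 0")
            case True then show ?thesis using A_pos[OF _ a] N.act_one_left[OF n', of j] by simp
          next
            case f: False
            then have "j0 - j > j0" using False by simp
            then show ?thesis using N_pos[OF _ n'] N.act_one_right[OF a, of "j0 - j"] by simp
          qed
          then have "act N j (pp - i - j) a n = \<one>\<^bsub>gr N j0\<^esub>" by (simp add: e)
          then show ?thesis using one' m True by simp
        qed (simp add: psi0_def)
        ultimately show ?thesis by simp
      qed
      then show "f (frag_of (i + j, ract M i j m a, n)) = f (frag_of (i, m, act N j (pp - i - j) a n))"
        using m a n by (simp add: f(2) Tg_iff diff_diff_index ract_closed act_index)
    qed
  qed blast
  show thesis
    by (rule that[OF \<psi>(1)]) (simp add: \<psi>(2) Tg_iff)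
qed

lemma T_top:
  assumes m: "m \<in> carrier (gr M i)" and n: "n \<in> carrier (gr N (pp - i))"
  shows "i \<noteq> i0 \<Longrightarrow> T pp i m n = \<one>\<^bsub>P pp\<^esub>"
proof -
  assume "i \<noteq> i0"
  then consider "i > i0" | "pp - i > j0" by linarith
  then show ?thesis
  proof cases
    case 1 then show ?thesis using M_pos[OF _ m] T_one1[OF n] by simp
  next
    case 2 then show ?thesis using N_pos[OF _ n] T_one2[OF m, of pp] by simp
  qed
qed

lemma X_cyc:
  assumes "z \<in> carrier (P pp)" shows "z \<in> cyc X pp"
  using assms
proof (induction z rule: pres_induct[OF Tr, consumes 1, case_names one mult inv gen])
  case one then show ?case using X.one_cyc[of pp] by simp
next
  case (mult x y) then show ?case using X.mult_cyc[of x pp y] by simp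
next
  case (inv x) then show ?case using X.inv_cyc[of x pp] by simp
next
  case (gen g)
  then obtain i m n where g: "g = (i, m, n)" and m: "m \<in> carrier (gr M i)" "n \<in> carrier (gr N (pp - i))"
    by (auto simp: tensor_gens_def)
  show ?case
  proof (cases "i = i0")
    case True then show ?thesis using T_cyc[OF M_cyc N_cyc] m g by simp
  next
    case False then show ?thesis using T_top[OF m] X.one_cyc[of pp] g by simp
  qed
qed

text \<open>Surjectivity holds because the top component is generated by products of elements of top degree,
  which are cocycles. For injectivity, \<open>psi0\<close> extends to a map that kills coboundaries and recovers an
  element of the tensor product of cohomologies from a cocycle representing its image.\<close>

lemma Theta_iso:
  assumes t: "t \<in> hom (CP i0 j0) (coh X pp)"
    and ct: "\<And>x y. \<lbrakk>x \<in> carrier (coh M i0); y \<in> carrier (coh N j0)\<rbrakk> \<Longrightarrow> t (ct i0 j0 x y) = pair i0 j0 x y"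
  shows "bij_betw t (carrier (CP i0 j0)) (carrier (coh X pp))"
proof -
  obtain \<psi> where \<psi>: "\<psi> \<in> hom (P pp) (CP i0 j0)"
    "\<And>i m n. \<lbrakk>m \<in> carrier (gr M i); n \<in> carrier (gr N (pp - i))\<rbrakk> \<Longrightarrow> \<psi> (T pp i m n) = psi0 (i, m, n)"
    by (rule psi_exists) blast
  note t1 = hom_one'[OF CP.comm_group_axioms X.coh_comm_group t] and ti = hom_inv'[OF CP.comm_group_axioms X.coh_comm_group t]
  interpret t: group_hom "CP i0 j0" "coh X pp" t
    by (intro group_homI CP.is_group X.coh_group t)
  have "\<exists>c\<in>carrier (CP i0 j0). t c = coh_class X pp z" if "z \<in> carrier (P pp)" for z
    using that
  proof (induction z rule: pres_induct[OF Tr, consumes 1, case_names one mult inv gen])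
    case one then show ?case using t1 X.one_coh[of pp] by (intro bexI[of _ "\<one>\<^bsub>CP i0 j0\<^esub>"]) simp_all
  next
    case (mult x y)
    then obtain c d where "c \<in> carrier (CP i0 j0)" "t c = coh_class X pp x" "d \<in> carrier (CP i0 j0)" "t d = coh_class X pp y" by blast
    then show ?case using mult X.coh_class_mult[OF X_cyc X_cyc, of x y]
      by (intro bexI[of _ "c \<otimes>\<^bsub>CP i0 j0\<^esub> d"]) simp_all
  next
    case (inv x)
    then obtain c where "c \<in> carrier (CP i0 j0)" "t c = coh_class X pp x" by blast
    then show ?case using inv X.coh_class_inv[OF X_cyc, of x] by (intro bexI[of _ "inv\<^bsub>CP i0 j0\<^esub> c"]) simp_all
  next
    case (gen g)
    then obtain i m n where g: "g = (i, m, n)" and m: "m \<in> carrier (gr M i)" "n \<in> carrier (gr N (pp - i))"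
      by (auto simp: tensor_gens_def)
    show ?case
    proof (cases "i = i0")
      case True
      then have mn: "m \<in> cyc M i0" "n \<in> cyc N j0" using m by (simp_all add: M_cyc N_cyc)
      then show ?thesis
        using True g M.coh_class_closed N.coh_class_closed
        by (intro bexI[of _ "ct i0 j0 (coh_class M i0 m) (coh_class N j0 n)"]) (simp_all add: ct pair_class ct_closed)
    next
      case False then show ?thesis
        using T_top[OF m] t1 X.one_coh[of pp] g by (intro bexI[of _ "\<one>\<^bsub>CP i0 j0\<^esub>"]) simp_all
    qed
  qed
  then have surj: "carrier (coh X pp) \<subseteq> t ` carrier (CP i0 j0)"
    using cycD[of _ X pp] by (auto elim!: X.coh_cases) (metis gr_X imageI)
  have lift_back: "\<exists>z\<in>carrier (P pp). t c = coh_class X pp z \<and> \<psi> z = c" if "c \<in> carrier (CP i0 j0)" for c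
    using that
  proof (induction c rule: pres_induct[OF CR, consumes 1, case_names one mult inv gen])
    case one then show ?case
      using t1 X.one_coh[of pp] hom_one'[OF P.comm_group_axioms CP.comm_group_axioms \<psi>(1)]
      by (intro bexI[of _ "\<one>\<^bsub>P pp\<^esub>"]) simp_all
  next
    case (mult c d)
    then obtain x y where "x \<in> carrier (P pp)" "t c = coh_class X pp x" "\<psi> x = c"
      "y \<in> carrier (P pp)" "t d = coh_class X pp y" "\<psi> y = d" by blast
    then show ?case using mult X.coh_class_mult[OF X_cyc X_cyc, of x y]
      by (intro bexI[of _ "x \<otimes>\<^bsub>P pp\<^esub> y"]) (simp_all add: hom_mult[OF \<psi>(1)])
  next
    case (inv c)
    then obtain x where "x \<in> carrier (P pp)" "t c = coh_class X pp x" "\<psi> x = c" by blast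
    then show ?case using inv X.coh_class_inv[OF X_cyc, of x]
      by (intro bexI[of _ "inv\<^bsub>P pp\<^esub> x"]) (simp_all add: hom_inv'[OF P.comm_group_axioms CP.comm_group_axioms \<psi>(1)])
  next
    case (gen g)
    then obtain x y where g: "g = (x, y)" and xy: "x \<in> carrier (coh M i0)" "y \<in> carrier (coh N j0)"
      by (auto simp: coh_tensor_gens_def)
    obtain m n where m: "m \<in> cyc M i0" "n \<in> cyc N j0" "x = coh_class M i0 m" "y = coh_class N j0 n"
      by (rule pair_cases[OF xy])
    have "t (ct i0 j0 x y) = coh_class X pp (T pp i0 m n)" using ct[OF xy] pair_class[OF m(1,2)] m(3,4) by simp
    moreover have "\<psi> (T pp i0 m n) = ct i0 j0 x y"
      using \<psi>(2)[OF cycD[OF m(1)] N_idx[OF m(2)]] by (simp add: psi0_def m)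
    ultimately show ?case
      using T_closed[OF cycD[OF m(1)] N_idx[OF m(2)]] by (intro bexI[of _ "T pp i0 m n"]) (simp_all add: g coh_tensor_class_def)
  qed
  have \<psi>d: "\<psi> (df X (pp - 1) w) = \<one>\<^bsub>CP i0 j0\<^esub>" if w: "w \<in> carrier (P (pp - 1))" for w
  proof -
    have d: "df X (pp - 1) \<in> hom (P (pp - 1)) (P pp)" using df_X(1)[of "pp - 1"] by simp
    show ?thesis
    proof (rule P_hom_ext[OF CP.comm_group_axioms hom_comp[OF d \<psi>(1)] hom_one_fun[OF CP.comm_group_axioms] _ w])
      fix i m n assume m: "m \<in> carrier (gr M i)" and n: "n \<in> carrier (gr N (pp - 1 - i))"
      have e: "pp - (i + 1) = pp - 1 - i" "pp - i = pp - 1 - i + 1" "pp - 1 + 1 = pp" by simp_all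
      have n': "n \<in> carrier (gr N (pp - (i + 1)))" and dn: "df N (pp - 1 - i) n \<in> carrier (gr N (pp - i))"
        using n N.df_closed[OF n] by (simp_all only: e)
      note dm = M.df_closed[OF m]
      have 1: "\<psi> (T pp (i + 1) (df M i m) n) = \<one>\<^bsub>CP i0 j0\<^esub>"
      proof (cases "i + 1 = i0")
        case True
        then have i: "i = i0 - 1" by simp
        have "coh_class M i0 (df M i m) = \<one>\<^bsub>coh M i0\<^esub>"
          using M.coh_class_eq_one_iff[OF M.coboundary_cyc, of m i0] m i by auto
        then show ?thesis using n' \<psi>(2)[OF dm n'] True by (simp add: psi0_def ct_one1 N.coh_class_closed N_cyc)
      qed (simp add: \<psi>(2)[OF dm n'] psi0_def)
      have 2: "\<psi> (T pp i m (df N (pp - 1 - i) n)) = \<one>\<^bsub>CP i0 j0\<^esub>"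
      proof (cases "i = i0")
        case True
        have e': "pp - 1 - i = j0 - 1" using True by simp
        have nj: "n \<in> carrier (gr N (j0 - 1))" using n by (simp only: e')
        have "coh_class N j0 (df N (pp - 1 - i) n) = \<one>\<^bsub>coh N j0\<^esub>"
          using N.coh_class_eq_one_iff[OF N.coboundary_cyc[OF nj]] nj unfolding e' by auto
        then show ?thesis using m \<psi>(2)[OF m dn] True by (simp add: psi0_def ct_one2 M.coh_class_closed M_cyc)
      qed (simp add: \<psi>(2)[OF m dn] psi0_def)
      have "df X (pp - 1) (T (pp - 1) i m n) = T pp (i + 1) (df M i m) n \<otimes>\<^bsub>P pp\<^esub> koszul (P pp) i (T pp i m (df N (pp - 1 - i) n))"
        using df_X(2)[OF m n] by (simp only: e)
      then show "\<psi> (df X (pp - 1) (T (pp - 1) i m n)) = \<one>\<^bsub>CP i0 j0\<^esub>"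
        using T_closed[OF dm n'] T_closed[OF m dn]
        by (simp add: hom_mult[OF \<psi>(1)] koszul_closed[OF P.comm_group_axioms]
            koszul_hom[OF P.comm_group_axioms CP.comm_group_axioms \<psi>(1)] 1 2 koszul_one CP.comm_group_axioms)
    qed
  qed
  have "inj_on t (carrier (CP i0 j0))"
  proof (subst t.inj_on_one_iff, intro allI impI)
    fix c assume c: "c \<in> carrier (CP i0 j0)" "t c = \<one>\<^bsub>coh X pp\<^esub>"
    obtain z where z: "z \<in> carrier (P pp)" "t c = coh_class X pp z" "\<psi> z = c" using lift_back[OF c(1)] by blast
    then obtain w where "w \<in> carrier (P (pp - 1))" "z = df X (pp - 1) w"
      using c(2) X.coh_class_eq_one_iff[OF X_cyc[OF z(1)]] by auto
    then show "c = \<one>\<^bsub>CP i0 j0\<^esub>" using \<psi>d z(3) by simp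
  qed
  then show ?thesis using surj t.hom_closed by (auto simp: bij_betw_def)
qed

abbreviation (input) "th \<equiv> theta K A s i0 j0 M N"

text \<open>\<open>theta\<close> is a definite description, so its properties require existence and uniqueness of the map
  that it describes.\<close>

lemma theta_spec:
  shows "th \<in> extensional (carrier (CP i0 j0))"
    and "klinear K (CP i0 j0) (coh_scalar i0 j0) (coh X pp) (coh_op X pp) th"
    and "bij_betw th (carrier (CP i0 j0)) (carrier (coh X pp))"
    and "\<And>x y. \<lbrakk>x \<in> carrier (coh M i0); y \<in> carrier (coh N j0)\<rbrakk> \<Longrightarrow> th (ct i0 j0 x y) = pair i0 j0 x y"
proof -
  obtain t where t: "klinear K (CP i0 j0) (coh_scalar i0 j0) (coh X pp) (coh_op X pp) t"
    "\<And>x y. \<lbrakk>x \<in> carrier (coh M i0); y \<in> carrier (coh N j0)\<rbrakk> \<Longrightarrow> t (ct i0 j0 x y) = pair i0 j0 x y"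
    by (rule Theta_exists) blast
  let ?t = "restrict t (carrier (CP i0 j0))"
  let ?Q = "\<lambda>t. t \<in> module_isos K (coh_tensor A s i0 j0 M N) (coh_module X pp) \<and>
    (\<forall>m\<in>carrier (gr M i0). \<forall>n\<in>carrier (gr N j0).
      t (ct i0 j0 (coh_class M i0 m) (coh_class N j0 n)) = coh_class X pp (tensor_class A M N i0 j0 m n))"
  have lin: "klinear K (CP i0 j0) (coh_scalar i0 j0) (coh X pp) (coh_op X pp) ?t"
    using klinearD[OF t(1)] by (auto simp: klinear_def hom_def CP.m_closed hom_in_carrier[OF coh_scalar(1)])
  have bij: "bij_betw ?t (carrier (CP i0 j0)) (carrier (coh X pp))"
    using Theta_iso[OF klinearD(1)[OF t(1)] t(2)] by (simp cong: bij_betw_cong)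
  have Q: "?Q ?t"
    using lin bij t(2) by (simp add: coh_tensor_eq coh_module_eq module_isos_iff ct_closed M.coh_class_closed N.coh_class_closed
        M_cyc N_cyc pair_class tensor_class_def)
  have uniq: "t' = ?t" if "?Q t'" for t'
  proof (rule extensionalityI[of _ "carrier (CP i0 j0)"])
    show "t' \<in> extensional (carrier (CP i0 j0))" "?t \<in> extensional (carrier (CP i0 j0))"
      using that by (auto simp: coh_tensor_eq coh_module_eq module_isos_iff)
    have h: "t' \<in> hom (CP i0 j0) (coh X pp)"
      using that klinearD(1) by (auto simp: coh_tensor_eq coh_module_eq module_isos_iff)
    show "t' c = ?t c" if c: "c \<in> carrier (CP i0 j0)" for c
    proof (rule CP_hom_ext[OF X.coh_comm_group h klinearD(1)[OF lin] _ c])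
      fix x y assume xy: "x \<in> carrier (coh M i0)" "y \<in> carrier (coh N j0)"
      obtain m n where "m \<in> cyc M i0" "n \<in> cyc N j0" "x = coh_class M i0 m" "y = coh_class N j0 n"
        by (rule pair_cases[OF xy])
      then show "t' (ct i0 j0 x y) = ?t (ct i0 j0 x y)"
        using \<open>?Q t'\<close> Q by (simp add: cycD)
    qed
  qed
  have th: "th = ?t" unfolding theta_def by (rule the_equality, rule Q, rule uniq)
  show "th \<in> extensional (carrier (CP i0 j0))"
    "klinear K (CP i0 j0) (coh_scalar i0 j0) (coh X pp) (coh_op X pp) th"
    "bij_betw th (carrier (CP i0 j0)) (carrier (coh X pp))"
    "\<And>x y. \<lbrakk>x \<in> carrier (coh M i0); y \<in> carrier (coh N j0)\<rbrakk> \<Longrightarrow> th (ct i0 j0 x y) = pair i0 j0 x y"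
    unfolding th using lin bij t(2) by (simp_all add: ct_closed)
qed

end

section \<open>The derived tensor product in top degree\<close>

lemma Ob_prod_cat: "X \<in> Ob (prod_cat C D) \<longleftrightarrow> fst X \<in> Ob C \<and> snd X \<in> Ob D"
  by (auto simp: prod_cat_def mem_Times_iff)

lemma prod_cat_simps [simp]:
  "f \<in> Mor (prod_cat C D) X Y \<longleftrightarrow> fst f \<in> Mor C (fst X) (fst Y) \<and> snd f \<in> Mor D (snd X) (snd Y)"
  "Idt (prod_cat C D) X = (Idt C (fst X), Idt D (snd X))"
  "Cmp (prod_cat C D) X Y Z g f = (Cmp C (fst X) (fst Y) (fst Z) (fst g) (fst f), Cmp D (snd X) (snd Y) (snd Z) (snd g) (snd f))"
  by (auto simp: prod_cat_def mem_Times_iff)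

lemma prod_functor_functor:
  assumes "is_functor C C' F" "is_functor D D' G"
  shows "is_functor (prod_cat C D) (prod_cat C' D') (prod_functor F G)"
  using assms unfolding is_functor_def by (auto simp: prod_functor_def Ob_prod_cat)

lemma klinear_inv_into:
  assumes G: "kmodule K G a" and H: "comm_group H" and f: "klinear K G a H b f"
    and bij: "bij_betw f (carrier G) (carrier H)"
  shows "klinear K H b G a (inv_into (carrier G) f)"
proof -
  interpret G: kmodule K G a by fact
  interpret H: comm_group H by fact
  let ?g = "inv_into (carrier G) f"
  have g: "?g y \<in> carrier G" "f (?g y) = y" if "y \<in> carrier H" for y
    using bij_betw_inv_into[OF bij] bij_betw_inv_into_right[OF bij that] that by (auto simp: bij_betw_def)
  have gf: "?g (f x) = x" if "x \<in> carrier G" for x using bij_betw_inv_into_left[OF bij that] .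
  have "?g (y \<otimes>\<^bsub>H\<^esub> z) = ?g y \<otimes>\<^bsub>G\<^esub> ?g z" if "y \<in> carrier H" "z \<in> carrier H" for y z
    using gf[of "?g y \<otimes>\<^bsub>G\<^esub> ?g z"] klinearD(3)[OF f g(1)[OF that(1)] g(1)[OF that(2)]] g that by simp
  moreover have "?g (b k y) = a k (?g y)" if "k \<in> carrier K" "y \<in> carrier H" for k y
    using gf[of "a k (?g y)"] klinearD(4)[OF f that(1) g(1)[OF that(2)]] g that G.sc_closed by simp
  ultimately show ?thesis using g(1) by (auto simp: klinear_def intro!: homI)
qed

lemma coh_kmodule:
  assumes "cring K" "dg_module (dg_of_ring K) Y" shows "kmodule K (coh Y i) (coh_op Y i)"
proof -
  interpret cring K by fact
  interpret Y: dg_module_over "dg_of_ring K" Y by (rule dgk_over[OF assms])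
  interpret G: comm_group "coh Y i" by (rule Y.coh_comm_group)
  interpret k: kmodule K "gr Y i" "act Y 0 i" by (rule dgk_kmodule[OF assms])
  note c = ring_elem_cyc
  show ?thesis
  proof unfold_locales
    show "coh_op Y i k x \<in> carrier (coh Y i)" if "k \<in> carrier K" "x \<in> carrier (coh Y i)" for k x
      using Y.coh_op_closed[OF c[OF that(1)] that(2)] .
    show "coh_op Y i k (x \<otimes>\<^bsub>coh Y i\<^esub> y) = coh_op Y i k x \<otimes>\<^bsub>coh Y i\<^esub> coh_op Y i k y"
      if "k \<in> carrier K" "x \<in> carrier (coh Y i)" "y \<in> carrier (coh Y i)" for k x y
      using hom_mult[OF Y.coh_op_hom[OF c[OF that(1)]] that(2,3)] .
  next
    fix k l x assume kl: "k \<in> carrier K" "l \<in> carrier K" and x: "x \<in> carrier (coh Y i)"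
    obtain m where m: "m \<in> cyc Y i" "x = coh_class Y i m" by (rule Y.coh_cases[OF x])
    note cl = Y.act_cyc[OF c[OF kl(1)] m(1)] Y.act_cyc[OF c[OF kl(2)] m(1)]
    show "coh_op Y i (k \<oplus>\<^bsub>K\<^esub> l) x = coh_op Y i k x \<otimes>\<^bsub>coh Y i\<^esub> coh_op Y i l x"
      using kl m(1) by (simp add: m(2) Y.coh_op_class c k.sc_add_left cycD Y.coh_class_mult[OF cl])
    show "coh_op Y i (k \<otimes>\<^bsub>K\<^esub> l) x = coh_op Y i k (coh_op Y i l x)"
      using kl m(1) cl by (simp add: m(2) Y.coh_op_class c k.sc_assoc cycD)
  next
    fix x assume x: "x \<in> carrier (coh Y i)"
    obtain m where m: "m \<in> cyc Y i" "x = coh_class Y i m" by (rule Y.coh_cases[OF x])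
    show "coh_op Y i \<one>\<^bsub>K\<^esub> x = x" using m(1) by (simp add: m(2) Y.coh_op_class c k.sc_one cycD)
  qed
qed

lemma coh_linear_inv:
  assumes M: "dg_module_over B M" and M': "dg_module_over B M'" and u: "coh_linear B i M M' u"
    and bij: "bij_betw u (carrier (coh M i)) (carrier (coh M' i))"
  shows "coh_linear B i M' M (inv_into (carrier (coh M i)) u)"
proof -
  interpret M: dg_module_over B M by fact
  interpret M': dg_module_over B M' by fact
  let ?v = "inv_into (carrier (coh M i)) u"
  have "?v \<in> iso (coh M' i) (coh M i)"
    by (rule group.iso_set_sym[OF M.coh_group]) (use coh_linearD(1)[OF u] bij in \<open>simp add: iso_def\<close>)
  moreover have "?v (coh_op M' i b y) = coh_op M i b (?v y)" if b: "b \<in> cyc B 0" and y: "y \<in> carrier (coh M' i)" for b y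
  proof -
    have vy: "?v y \<in> carrier (coh M i)" "u (?v y) = y"
      using bij_betw_inv_into[OF bij] bij_betw_inv_into_right[OF bij y] y by (auto simp: bij_betw_def)
    have "u (coh_op M i b (?v y)) = coh_op M' i b y" using coh_linearD(3)[OF u b vy(1)] vy(2) by simp
    then show ?thesis using bij_betw_inv_into_left[OF bij M.coh_op_closed[OF b vy(1)]] by simp
  qed
  ultimately show ?thesis by (simp add: coh_linear_def iso_def)
qed

lemma (in tensor_pair) coh_tensor_map_bij:
  assumes M'N': "tensor_pair K A s M' N'" and u: "coh_linear A i M M' u" and v: "coh_linear A j N N' v"
    and bu: "bij_betw u (carrier (coh M i)) (carrier (coh M' i))" and bv: "bij_betw v (carrier (coh N j)) (carrier (coh N' j))"
  shows "bij_betw (coh_tensor_map A i j M N M' N' u v) (carrier (CP i j))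
    (carrier (pres (coh_tensor_gens M' N' i j) (coh_tensor_rels A M' N' i j)))"
proof -
  interpret N': tensor_pair K A s M' N' by fact
  let ?u = "inv_into (carrier (coh M i)) u" and ?v = "inv_into (carrier (coh N j)) v"
  have u': "coh_linear A i M' M ?u"
    using coh_linear_inv[OF M.dg_module_over_axioms N'.M.dg_module_over_axioms, of i u] u bu by simp
  have v': "coh_linear A j N' N ?v"
    by (rule coh_linear_inv[OF N.dg_module_over_axioms N'.N.dg_module_over_axioms v bv])
  note F = coh_tensor_map[OF M'N' u v] and G = N'.coh_tensor_map[OF tensor_pair_axioms u' v']
  let ?F = "coh_tensor_map A i j M N M' N' u v" and ?G = "coh_tensor_map A i j M' N' M N ?u ?v"
  have id: "(\<lambda>t. t) \<in> hom H H" for H :: "'x monoid" by (auto simp: hom_def)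
  have GF: "?G (?F t) = t" if "t \<in> carrier (CP i j)" for t
    by (rule CP_hom_ext[OF CP.comm_group_axioms hom_comp[OF klinearD(1)[OF F(1)] klinearD(1)[OF G(1)]] id _ that])
      (simp add: F(2) G(2) coh_linearD(2)[OF u] coh_linearD(2)[OF v] bij_betw_inv_into_left[OF bu] bij_betw_inv_into_left[OF bv])
  have FG: "?F (?G t) = t" if "t \<in> carrier (N'.CP i j)" for t
    by (rule N'.CP_hom_ext[OF N'.CP.comm_group_axioms hom_comp[OF klinearD(1)[OF G(1)] klinearD(1)[OF F(1)]] id _ that])
      (simp add: F(2) G(2) coh_linearD(2)[OF u'] coh_linearD(2)[OF v'] bij_betw_inv_into_right[OF bu] bij_betw_inv_into_right[OF bv])
  show ?thesis
    by (rule bij_betw_byWitness[where f' = ?G]) (use GF FG klinearD(2)[OF F(1)] klinearD(2)[OF G(1)] in auto)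
qed

locale derived_tensor = central_dg_ring K A s
  for K :: "'k ring" (structure) and A :: "'a dg_ring" and s :: "'k \<Rightarrow> 'a" +
  fixes i0 j0 :: int
    and L :: "(('a, 'u) dg_module \<times> ('a, 'u) dg_module, ('a, 'u) der_mor \<times> ('a, 'u) der_mor,
               ('k, ('u, 'u) tensor_elem) dg_module, ('k, ('u, 'u) tensor_elem) der_mor) functr"
    and \<eta> :: "('a, 'u) dg_module \<times> ('a, 'u) dg_module \<Rightarrow> ('k, ('u, 'u) tensor_elem) der_mor"
  assumes nonpos: "concentrated_le 0 A"
    and inf_u: "infinite (UNIV :: 'u set)"
    and card_K: "carrier K \<lesssim> (UNIV :: 'u set)"
    and ldt: "left_derived_tensor K A s L \<eta>"
begin

abbreviation "Aop \<equiv> op_dg_ring A"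
abbreviation "CC \<equiv> prod_cat (strict_cat Aop) (strict_cat A) ::
  (('a, 'u) dg_module \<times> ('a, 'u) dg_module, (int \<Rightarrow> 'u \<Rightarrow> 'u) \<times> (int \<Rightarrow> 'u \<Rightarrow> 'u)) category"
abbreviation "DD \<equiv> prod_cat (der_cat Aop) (der_cat A) ::
  (('a, 'u) dg_module \<times> ('a, 'u) dg_module, ('a, 'u) der_mor \<times> ('a, 'u) der_mor) category"
abbreviation "QQ \<equiv> prod_functor (der_functor Aop) (der_functor A)"
abbreviation "FF \<equiv> tensor_functor K A s"
abbreviation "pp \<equiv> i0 + j0"

definition obj :: "('a, 'u) dg_module \<times> ('a, 'u) dg_module \<Rightarrow> bool"
  where "obj X \<longleftrightarrow> dg_module Aop (fst X) \<and> dg_module A (snd X)"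

definition top_obj :: "('a, 'u) dg_module \<times> ('a, 'u) dg_module \<Rightarrow> bool"
  where "top_obj X \<longleftrightarrow> obj X \<and> concentrated_le i0 (fst X) \<and> concentrated_le j0 (snd X)"

lemma Ob_CC [simp]: "X \<in> Ob CC \<longleftrightarrow> obj X" and Ob_DD [simp]: "X \<in> Ob DD \<longleftrightarrow> obj X"
  by (simp_all add: obj_def Ob_prod_cat)

lemma Mor_CC [simp]: "f \<in> Mor CC X Y \<longleftrightarrow> fst f \<in> strict_homs Aop (fst X) (fst Y) \<and> snd f \<in> strict_homs A (snd X) (snd Y)"
  by simp

lemma fob_QQ [simp]: "fob QQ X = X"
  by (simp add: prod_functor_def der_functor_def)

abbreviation "Qf \<equiv> fmor QQ"

lemma Qf: "Qf X Y f = (fwd Aop (fst X) (fst Y) (fst f), fwd A (snd X) (snd Y) (snd f))"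
  by (simp add: prod_functor_def der_functor_def)

lemma fob_FF [simp]: "fob FF X = tensor_dg A s (fst X) (snd X)"
  by (simp add: tensor_functor_def comp_functor_def der_functor_def split_beta)

lemma fmor_FF: "fmor FF X Y f = fwd (dg_of_ring K) (fob FF X) (fob FF Y) (tensor_map A X Y f)"
  by (simp add: tensor_functor_def comp_functor_def der_functor_def split_beta)

lemma derived: "left_derived CC DD (der_cat (dg_of_ring K)) QQ FF L \<eta>"
  using ldt by (simp add: left_derived_tensor_def)

text \<open>The component of \<open>\<eta>\<close> at \<open>X\<close> is a morphism of the derived category of \<open>K\<close>, so its target is an
  object of that category.\<close>

lemma tensor_dg_module:
  assumes "obj X" shows "dg_module (dg_of_ring K) (tensor_dg A s (fst X) (snd X))"
proof -
  have "\<eta> \<in> nat_trans CC (der_cat (dg_of_ring K)) (comp_functor L QQ) FF"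
    using derived by (simp add: left_derived_def)
  then have "\<eta> X \<in> Mor (der_cat (dg_of_ring K)) (fob (comp_functor L QQ) X) (fob FF X)"
    using assms by (auto simp: nat_trans_def PiE_def obj_def)
  then show ?thesis using der_Mor_dg by fastforce
qed

lemma pairI: "obj X \<Longrightarrow> tensor_pair K A s (fst X) (snd X)"
  by (intro tensor_pair.intro tensor_pair_axioms.intro central_dg_ring_axioms) (simp_all add: obj_def)

lemma cohI: "obj X \<Longrightarrow> tensor_coh K A s (fst X) (snd X)"
  by (intro tensor_coh.intro tensor_coh_axioms.intro pairI tensor_dg_module)

lemma topI: "top_obj X \<Longrightarrow> tensor_top K A s (fst X) (snd X) i0 j0"
  by (intro tensor_top.intro tensor_top_axioms.intro cohI nonpos) (simp_all add: top_obj_def)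

lemma tensor_map_strict:
  assumes "obj X" "obj Y" "f \<in> Mor CC X Y"
  shows "tensor_map A X Y f \<in> strict_homs (dg_of_ring K) (fob FF X) (fob FF Y)"
proof -
  interpret tensor_map_setup K A s "fst X" "fst Y" "snd X" "snd Y" "fst f" "snd f"
    by (intro tensor_map_setup.intro tensor_map_setup_axioms.intro pairI assms(1,2)) (use assms(3) in auto)
  show ?thesis using fg_strict by simp
qed

lemma inj_u: "(UNIV :: 'u set) \<lesssim> (UNIV :: ('u, 'u) tensor_elem set)"
  unfolding lepoll_def by (intro exI[of _ "\<lambda>u. {frag_of (0, u, u)}"]) (auto simp: inj_on_def frag_of_eq)

lemma inf_t: "infinite (UNIV :: ('u, 'u) tensor_elem set)"
  using inf_u inj_u lepoll_def finite_surj[of "UNIV :: ('u, 'u) tensor_elem set"]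
  by (meson infinite_le_lepoll lepoll_trans)

lemma QQ_functor: "is_functor CC DD QQ"
  by (intro prod_functor_functor str.loc_functor_functor[folded der_cat_def der_functor_def])

sublocale df: derived_functor K CC DD QQ FF L \<eta>
proof (rule derived_functor.intro)
  show "cring K" by (rule is_cring)
  show "infinite (UNIV :: ('u, 'u) tensor_elem set)" by (rule inf_t)
  show "carrier K \<lesssim> (UNIV :: ('u, 'u) tensor_elem set)" by (rule lepoll_trans[OF card_K inj_u])
  show "is_functor CC DD QQ" by (rule QQ_functor)
  show "fmor FF X Y f \<in> Mor (der_cat (dg_of_ring K)) (fob FF X) (fob FF Y)"
    if "X \<in> Ob CC" "Y \<in> Ob CC" "f \<in> Mor CC X Y" for X Y f
    unfolding fmor_FF
    by (rule fwd_der_Mor) (use that tensor_dg_module tensor_map_strict in \<open>simp_all only: Ob_CC fob_FF\<close>)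
  show "left_derived CC DD (der_cat (dg_of_ring K)) QQ FF L \<eta>" by (rule derived)
qed

abbreviation "HL X \<equiv> carrier (coh (fob L X) pp)"
abbreviation "HF X \<equiv> carrier (coh (fob FF X) pp)"
abbreviation "CT X \<equiv> pres (coh_tensor_gens (fst X) (snd X) i0 j0) (coh_tensor_rels A (fst X) (snd X) i0 j0)"
abbreviation "CS X \<equiv> tensor_pair.coh_scalar A s (fst X) (snd X) i0 j0"
abbreviation "HLm \<equiv> df.HLm pp"
abbreviation "HFm \<equiv> df.HFm pp"
abbreviation "Heta \<equiv> df.Heta pp"
abbreviation "Th X \<equiv> theta K A s i0 j0 (fst X) (snd X)"

text \<open>The bifunctor $H^{i_0} \otimes H^{j_0}$ on morphisms of the derived categories.\<close>

definition CTm where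
  "CTm X Y \<phi> = coh_tensor_map A i0 j0 (fst X) (snd X) (fst Y) (snd Y)
    (der_coh_map i0 (fst X) (fst \<phi>)) (der_coh_map j0 (snd X) (snd \<phi>))"

lemma Mor_DD: "\<phi> \<in> Mor DD X Y \<Longrightarrow> obj X \<and> obj Y"
  using der_Mor_dg[of "fst \<phi>"] der_Mor_dg[of "snd \<phi>"] by (auto simp: obj_def)

lemma Qf_Mor: "\<lbrakk>obj X; obj Y; f \<in> Mor CC X Y\<rbrakk> \<Longrightarrow> Qf X Y f \<in> Mor DD X Y"
  using df.Q_Mor[of X Y f] by (simp only: Ob_CC fob_QQ)

lemma Qf_Cmp: "\<lbrakk>obj X; obj Y; obj Z; f \<in> Mor CC X Y; g \<in> Mor CC Y Z\<rbrakk> \<Longrightarrow>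
    Qf X Z (Cmp CC X Y Z g f) = Cmp DD X Y Z (Qf Y Z g) (Qf X Y f)"
  using QQ_functor unfolding is_functor_def fob_QQ Ball_def Ob_CC by blast

lemma cc_A: "cochain_complex A" and cc_Aop: "cochain_complex Aop"
  by (simp_all add: A.cochain_complex_axioms op_complex)

lemma coh_lin:
  assumes "\<phi> \<in> Mor DD X Y"
  shows "coh_linear A i (fst X) (fst Y) (der_coh_map i (fst X) (fst \<phi>))"
    "coh_linear A j (snd X) (snd Y) (der_coh_map j (snd X) (snd \<phi>))"
  using der_coh_linear[OF cc_Aop, of "fst \<phi>" "fst X" "fst Y" i] der_coh_linear[OF cc_A, of "snd \<phi>" "snd X" "snd Y" j] assms
  by simp_all

lemma CTm_linear:
  assumes "\<phi> \<in> Mor DD X Y" shows "klinear K (CT X) (CS X) (CT Y) (CS Y) (CTm X Y \<phi>)"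
  unfolding CTm_def using Mor_DD[OF assms]
  by (intro tensor_pair.coh_tensor_map(1) pairI coh_lin[OF assms]) auto

lemma CTm_closed: "\<phi> \<in> Mor DD X Y \<Longrightarrow> t \<in> carrier (CT X) \<Longrightarrow> CTm X Y \<phi> t \<in> carrier (CT Y)"
  using klinearD(2)[OF CTm_linear] .

lemma CTm_class:
  assumes "\<phi> \<in> Mor DD X Y" "x \<in> carrier (coh (fst X) i0)" "y \<in> carrier (coh (snd X) j0)"
  shows "CTm X Y \<phi> (coh_tensor_class A i0 j0 (fst X) (snd X) x y) =
    coh_tensor_class A i0 j0 (fst Y) (snd Y) (der_coh_map i0 (fst X) (fst \<phi>) x) (der_coh_map j0 (snd X) (snd \<phi>) y)"
  unfolding CTm_def using Mor_DD[OF assms(1)]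
  by (intro tensor_pair.coh_tensor_map(2)[where K = K and s = s] pairI coh_lin[OF assms(1)] assms(2,3)) auto

lemma CT_group: "obj X \<Longrightarrow> comm_group (CT X)"
  by (rule pres_comm_group[OF tensor_pair.CR[OF pairI]])

lemma CT_ext:
  assumes "obj X" "comm_group H" "f \<in> hom (CT X) H" "g \<in> hom (CT X) H"
    and "\<And>x y. \<lbrakk>x \<in> carrier (coh (fst X) i0); y \<in> carrier (coh (snd X) j0)\<rbrakk> \<Longrightarrow>
      f (coh_tensor_class A i0 j0 (fst X) (snd X) x y) = g (coh_tensor_class A i0 j0 (fst X) (snd X) x y)"
    and "t \<in> carrier (CT X)"
  shows "f t = g t"
  by (rule tensor_pair.CP_hom_ext[OF pairI[OF assms(1)] assms(2-6)])

lemma CTm_Cmp: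
  assumes \<phi>: "\<phi> \<in> Mor DD X Y" and \<psi>: "\<psi> \<in> Mor DD Y Z" and t: "t \<in> carrier (CT X)"
  shows "CTm X Z (Cmp DD X Y Z \<psi> \<phi>) t = CTm Y Z \<psi> (CTm X Y \<phi> t)"
proof -
  have c: "Cmp DD X Y Z \<psi> \<phi> \<in> Mor DD X Z"
    using \<phi> \<psi> by (auto simp: der_cat_def intro: str.Cmp_loc_Mor)
  note ob = Mor_DD[OF \<phi>] Mor_DD[OF \<psi>]
  show ?thesis
  proof (rule CT_ext[OF _ CT_group klinearD(1)[OF CTm_linear[OF c]]
        hom_comp[OF klinearD(1)[OF CTm_linear[OF \<phi>]] klinearD(1)[OF CTm_linear[OF \<psi>]]] _ t])
    fix x y assume xy: "x \<in> carrier (coh (fst X) i0)" "y \<in> carrier (coh (snd X) j0)"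
    show "CTm X Z (Cmp DD X Y Z \<psi> \<phi>) (coh_tensor_class A i0 j0 (fst X) (snd X) x y) =
        CTm Y Z \<psi> (CTm X Y \<phi> (coh_tensor_class A i0 j0 (fst X) (snd X) x y))"
      unfolding CTm_class[OF c xy] CTm_class[OF \<phi> xy]
      using CTm_class[OF \<psi> coh_linearD(2)[OF coh_lin(1)[OF \<phi>] xy(1)] coh_linearD(2)[OF coh_lin(2)[OF \<phi>] xy(2)]]
        der_coh_Cmp'[of "fst \<phi>" Aop "fst X" "fst Y" "fst \<psi>" "fst Z" x i0] der_coh_Cmp'[of "snd \<phi>" A "snd X" "snd Y" "snd \<psi>" "snd Z" y j0]
        \<phi> \<psi> xy by simp
  qed (use ob in auto)
qed

lemma CTm_Idt:
  assumes X: "obj X" and t: "t \<in> carrier (CT X)"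
  shows "CTm X X (Idt DD X) t = t"
proof -
  have c: "Idt DD X \<in> Mor DD X X"
    using X by (auto simp: obj_def der_cat_def intro!: str.Idt_loc_Mor)
  show ?thesis
  proof (rule CT_ext[OF X CT_group[OF X] klinearD(1)[OF CTm_linear[OF c]] _ _ t])
    show "(\<lambda>t. t) \<in> hom (CT X) (CT X)" by (auto simp: hom_def)
    fix x y assume xy: "x \<in> carrier (coh (fst X) i0)" "y \<in> carrier (coh (snd X) j0)"
    show "CTm X X (Idt DD X) (coh_tensor_class A i0 j0 (fst X) (snd X) x y) = coh_tensor_class A i0 j0 (fst X) (snd X) x y"
      unfolding CTm_class[OF c xy] using X xy by (simp add: der_coh_Idt obj_def)
  qed
qed

definition inverse_pair where
  "inverse_pair X Y \<phi> \<psi> \<longleftrightarrow> \<phi> \<in> Mor DD X Y \<and> \<psi> \<in> Mor DD Y X \<and>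
    Cmp DD X Y X \<psi> \<phi> = Idt DD X \<and> Cmp DD Y X Y \<phi> \<psi> = Idt DD Y"

definition quasi_iso where
  "quasi_iso X Y w \<longleftrightarrow> fst w \<in> quasi_isos Aop (fst X) (fst Y) \<and> snd w \<in> quasi_isos A (snd X) (snd Y)"

lemma quasi_iso_Mor: "quasi_iso X Y w \<Longrightarrow> w \<in> Mor CC X Y"
  by (simp add: quasi_iso_def quasi_isosD)

lemma quasi_iso_inverse:
  assumes "obj X" "obj Y" "quasi_iso X Y w"
  obtains \<psi> where "inverse_pair X Y (Qf X Y w) \<psi>"
proof -
  let ?b = "\<lambda>B X Y w. zz_class (strict_cat B) (quasi_isos B) Y X [Bwd Y X w]"
  let ?\<psi> = "(?b Aop (fst X) (fst Y) (fst w), ?b A (snd X) (snd Y) (snd w))"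
  have dg: "fst X \<in> Ob (strict_cat Aop)" "fst Y \<in> Ob (strict_cat Aop)" "snd X \<in> Ob (strict_cat A)" "snd Y \<in> Ob (strict_cat A)"
    using assms by (auto simp: obj_def)
  have w: "fst w \<in> quasi_isos Aop (fst X) (fst Y)" "snd w \<in> quasi_isos A (snd X) (snd Y)"
    using assms(3) by (auto simp: quasi_iso_def)
  have "inverse_pair X Y (Qf X Y w) ?\<psi>"
    using str.bwd_fwd[OF dg(1,2) w(1)] str.bwd_fwd[OF dg(3,4) w(2)]
      str.bwd_Mor[OF dg(2,1) w(1)] str.bwd_Mor[OF dg(4,3) w(2)] Qf_Mor[OF assms(1,2) quasi_iso_Mor[OF assms(3)]]
    unfolding inverse_pair_def Qf by (simp add: der_cat_def)
  then show thesis by (rule that)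
qed

text \<open>A zigzag in each factor is treated separately, with an identity in the other factor; a general
  morphism is the composition of one of each kind.\<close>

lemma DD_induct [consumes 1, case_names strict comp inverse]:
  assumes \<phi>: "\<phi> \<in> Mor DD X Y"
    and strict: "\<And>X Y f. \<lbrakk>obj X; obj Y; f \<in> Mor CC X Y\<rbrakk> \<Longrightarrow> Pr X Y (Qf X Y f)"
    and Cmp: "\<And>X Y Z \<phi> \<psi>. \<lbrakk>\<phi> \<in> Mor DD X Y; \<psi> \<in> Mor DD Y Z; Pr X Y \<phi>; Pr Y Z \<psi>\<rbrakk> \<Longrightarrow> Pr X Z (Cmp DD X Y Z \<psi> \<phi>)"
    and inv: "\<And>X Y w \<psi>. \<lbrakk>obj X; obj Y; quasi_iso X Y w; inverse_pair X Y (Qf X Y w) \<psi>; Pr X Y (Qf X Y w)\<rbrakk> \<Longrightarrow> Pr Y X \<psi>"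
  shows "Pr X Y \<phi>"
proof -
  have id_q: "(\<lambda>i. \<lambda>m\<in>carrier (gr M i). m) \<in> quasi_isos B M M" if "dg_module B M" for B :: "'a dg_ring" and M :: "('a, 'u) dg_module"
  proof -
    have "bij_betw (coh_map M M i (\<lambda>i. \<lambda>m\<in>carrier (gr M i). m)) (carrier (coh M i)) (carrier (coh M i))" for i
      by (rule bij_betw_byWitness[where f' = "\<lambda>x. x"]) (auto simp: coh_map_id[OF that])
    then show ?thesis using strict_id[OF that] by (simp add: quasi_isos_def)
  qed
  have idD: "Idt (der_cat B) M \<in> Mor (der_cat B) M M" if "dg_module B M" for B :: "'a dg_ring" and M :: "('a, 'u) dg_module"
    using that unfolding der_cat_def by (intro str.Idt_loc_Mor) simp
  have idc: "Cmp (der_cat B) M M M (Idt (der_cat B) M) (Idt (der_cat B) M) = Idt (der_cat B) M"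
    if "dg_module B M" for B :: "'a dg_ring" and M :: "('a, 'u) dg_module"
    using str.Cmp_Idt_left idD[OF that] by (simp add: der_cat_def)
  have idf: "fwd B M M (\<lambda>i. \<lambda>m\<in>carrier (gr M i). m) = Idt (der_cat B) M" if "dg_module B M" for B :: "'a dg_ring" and M :: "('a, 'u) dg_module"
    using str.fwd_Idt[of M B] that by (simp add: der_cat_def)
  let ?i = "\<lambda>M i. \<lambda>m\<in>carrier (gr M i). m"
  have left: "\<forall>N. dg_module A N \<longrightarrow> Pr (M, N) (M', N) (a, Idt (der_cat A) N)"
    if "a \<in> Mor (der_cat Aop) M M'" for a and M M' :: "('a, 'u) dg_module"
    using that unfolding der_cat_def[of Aop]
  proof (induction rule: str.loc_induct)
    case (Idt M)
    show ?case
    proof (intro allI impI)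
      fix N :: "('a, 'u) dg_module" assume N: "dg_module A N"
      show "Pr (M, N) (M, N) (category.Idt (localization (strict_cat Aop) (quasi_isos Aop)) M, category.Idt (der_cat A) N)"
        using strict[of "(M, N)" "(M, N)" "(?i M, ?i N)"] Idt N strict_id[of Aop M] strict_id[of A N]
        by (simp add: obj_def Qf idf) (simp add: der_cat_def)
    qed
  next
    case (fwd M M' M'' f a)
    show ?case
    proof (intro allI impI)
      fix N :: "('a, 'u) dg_module" assume N: "dg_module A N"
      have o: "obj (M, N)" "obj (M', N)" using fwd N by (auto simp: obj_def)
      have f: "(f, ?i N) \<in> Mor CC (M, N) (M', N)" using fwd strict_id[OF N] by simp
      have a: "(a, category.Idt (der_cat A) N) \<in> Mor DD (M', N) (M'', N)" using fwd(4) idD[OF N] by (simp add: der_cat_def)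
      show "Pr (M, N) (M'', N) (category.Cmp (localization (strict_cat Aop) (quasi_isos Aop)) M M' M'' a
          (Submission.fwd Aop M M' f), category.Idt (der_cat A) N)"
        using Cmp[OF Qf_Mor[OF o f] a strict[OF o f]] fwd.IH N by (simp add: Qf idf idc der_cat_def[of Aop])
    qed
  next
    case (bwd M M' M'' w a)
    show ?case
    proof (intro allI impI)
      fix N :: "('a, 'u) dg_module" assume N: "dg_module A N"
      have o: "obj (M, N)" "obj (M', N)" using bwd N by (auto simp: obj_def)
      let ?b = "zz_class (strict_cat Aop) (quasi_isos Aop) M M' [Bwd M M' w]"
      have dg: "M' \<in> Ob (strict_cat Aop)" "M \<in> Ob (strict_cat Aop)" using bwd by auto
      have q: "quasi_iso (M', N) (M, N) (w, ?i N)" using bwd(3) id_q[OF N] by (simp add: quasi_iso_def)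
      have b: "(?b, category.Idt (der_cat A) N) \<in> Mor DD (M, N) (M', N)"
        using str.bwd_Mor[OF dg(2,1) bwd(3)] idD[OF N] by (simp add: der_cat_def)
      have "inverse_pair (M', N) (M, N) (Qf (M', N) (M, N) (w, ?i N)) (?b, category.Idt (der_cat A) N)"
        using b Qf_Mor[OF o(2,1) quasi_iso_Mor[OF q]] str.bwd_fwd[OF dg bwd(3)]
        by (simp add: inverse_pair_def Qf idf N idc) (simp add: der_cat_def)
      from inv[OF o(2,1) q this strict[OF o(2,1) quasi_iso_Mor[OF q]]] have "Pr (M, N) (M', N) (?b, category.Idt (der_cat A) N)" .
      moreover have a: "(a, category.Idt (der_cat A) N) \<in> Mor DD (M', N) (M'', N)" using bwd(4) idD[OF N] by (simp add: der_cat_def)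
      ultimately show "Pr (M, N) (M'', N) (category.Cmp (localization (strict_cat Aop) (quasi_isos Aop)) M M' M'' a ?b, category.Idt (der_cat A) N)"
        using Cmp[OF b a] bwd.IH N by (simp add: idc der_cat_def[of Aop])
    qed
  qed
  have right: "\<forall>M. dg_module Aop M \<longrightarrow> Pr (M, N) (M, N') (Idt (der_cat Aop) M, b)"
    if "b \<in> Mor (der_cat A) N N'" for b and N N' :: "('a, 'u) dg_module"
    using that unfolding der_cat_def[of A]
  proof (induction rule: str.loc_induct)
    case (Idt N)
    show ?case
    proof (intro allI impI)
      fix M :: "('a, 'u) dg_module" assume M: "dg_module Aop M"
      show "Pr (M, N) (M, N) (category.Idt (der_cat Aop) M, category.Idt (localization (strict_cat A) (quasi_isos A)) N)"
        using strict[of "(M, N)" "(M, N)" "(?i M, ?i N)"] Idt M strict_id[of Aop M] strict_id[of A N]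
        by (simp add: obj_def Qf idf) (simp add: der_cat_def)
    qed
  next
    case (fwd N N' N'' f a)
    show ?case
    proof (intro allI impI)
      fix M :: "('a, 'u) dg_module" assume M: "dg_module Aop M"
      have o: "obj (M, N)" "obj (M, N')" using fwd M by (auto simp: obj_def)
      have f: "(?i M, f) \<in> Mor CC (M, N) (M, N')" using fwd strict_id[OF M] by simp
      have a: "(category.Idt (der_cat Aop) M, a) \<in> Mor DD (M, N') (M, N'')" using fwd(4) idD[OF M] by (simp add: der_cat_def)
      show "Pr (M, N) (M, N'') (category.Idt (der_cat Aop) M, category.Cmp (localization (strict_cat A) (quasi_isos A)) N N' N'' a
          (Submission.fwd A N N' f))"
        using Cmp[OF Qf_Mor[OF o f] a strict[OF o f]] fwd.IH M by (simp add: Qf idf idc der_cat_def[of A])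
    qed
  next
    case (bwd N N' N'' w a)
    show ?case
    proof (intro allI impI)
      fix M :: "('a, 'u) dg_module" assume M: "dg_module Aop M"
      have o: "obj (M, N)" "obj (M, N')" using bwd M by (auto simp: obj_def)
      let ?b = "zz_class (strict_cat A) (quasi_isos A) N N' [Bwd N N' w]"
      have dg: "N' \<in> Ob (strict_cat A)" "N \<in> Ob (strict_cat A)" using bwd by auto
      have q: "quasi_iso (M, N') (M, N) (?i M, w)" using bwd(3) id_q[OF M] by (simp add: quasi_iso_def)
      have b: "(category.Idt (der_cat Aop) M, ?b) \<in> Mor DD (M, N) (M, N')"
        using str.bwd_Mor[OF dg(2,1) bwd(3)] idD[OF M] by (simp add: der_cat_def)
      have "inverse_pair (M, N') (M, N) (Qf (M, N') (M, N) (?i M, w)) (category.Idt (der_cat Aop) M, ?b)"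
        using b Qf_Mor[OF o(2,1) quasi_iso_Mor[OF q]] str.bwd_fwd[OF dg bwd(3)]
        by (simp add: inverse_pair_def Qf idf M idc) (simp add: der_cat_def)
      from inv[OF o(2,1) q this strict[OF o(2,1) quasi_iso_Mor[OF q]]] have "Pr (M, N) (M, N') (category.Idt (der_cat Aop) M, ?b)" .
      moreover have a: "(category.Idt (der_cat Aop) M, a) \<in> Mor DD (M, N') (M, N'')" using bwd(4) idD[OF M] by (simp add: der_cat_def)
      ultimately show "Pr (M, N) (M, N'') (category.Idt (der_cat Aop) M, category.Cmp (localization (strict_cat A) (quasi_isos A)) N N' N'' a ?b)"
        using Cmp[OF b a] bwd.IH M by (simp add: idc der_cat_def[of A])
    qed
  qed
  obtain M N M' N' a b where X: "X = (M, N)" and Y: "Y = (M', N')" and ab: "\<phi> = (a, b)" by (metis surj_pair)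
  have o: "dg_module Aop M" "dg_module Aop M'" "dg_module A N" "dg_module A N'" using Mor_DD[OF \<phi>] by (auto simp: X Y obj_def)
  have m: "a \<in> Mor (der_cat Aop) M M'" "b \<in> Mor (der_cat A) N N'" using \<phi> by (auto simp: X Y ab)
  have "Pr (M, N) (M', N') (Cmp DD (M, N) (M', N) (M', N') (Idt (der_cat Aop) M', b) (a, Idt (der_cat A) N))"
    by (rule Cmp) (use m o idD left right in auto)
  then show ?thesis
    using str.Cmp_Idt_left[of a Aop M M'] str.Cmp_Idt_right[of b A N N'] m by (simp add: X Y ab der_cat_def)
qed

subsection \<open>Truncation of pairs\<close>

text \<open>\<open>eps\<close> is the inclusion of the truncated pair, and \<open>taum\<close> the effect of truncation on strict
  morphisms.\<close>

definition tau where "tau X = (trunc i0 (fst X), trunc j0 (snd X))"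

definition eps where "eps X = (trunc_inc i0 (fst X), trunc_inc j0 (snd X))"

definition taum where "taum X f = (trunc_map i0 (fst X) (fst f), trunc_map j0 (snd X) (snd f))"

text \<open>The maps induced by the inclusion of the truncation on the tensor product of cohomologies and on
  the cohomology of \<open>L\<close>.\<close>

abbreviation (input) "Ce X \<equiv> CTm (tau X) X (Qf (tau X) X (eps X))"
abbreviation (input) "Le X \<equiv> HLm (tau X) X (Qf (tau X) X (eps X))"

lemma truncI: "obj X \<Longrightarrow> truncatable Aop (fst X)" "obj X \<Longrightarrow> truncatable A (snd X)"
  using nonpos by (simp_all add: truncatable_def truncatable_axioms_def dg_module_over_def obj_def cc_A cc_Aop concentrated_le_def)

lemma tau_top: "obj X \<Longrightarrow> top_obj (tau X)"
  using truncatable.trunc_dg_module[OF truncI(1)] truncatable.trunc_dg_module[OF truncI(2)]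
    truncatable.trunc_concentrated[OF truncI(1)] truncatable.trunc_concentrated[OF truncI(2)]
  by (simp add: top_obj_def obj_def tau_def)

lemma top_obj_obj: "top_obj X \<Longrightarrow> obj X"
  by (simp add: top_obj_def)

lemma tau_obj: "obj X \<Longrightarrow> obj (tau X)"
  using tau_top top_obj_obj by blast

lemma eps_Mor: "obj X \<Longrightarrow> eps X \<in> Mor CC (tau X) X"
  using truncatable.trunc_inc_strict[OF truncI(1)] truncatable.trunc_inc_strict[OF truncI(2)]
  by (simp add: tau_def eps_def)

lemma taum_Mor: "obj X \<Longrightarrow> obj Y \<Longrightarrow> f \<in> Mor CC X Y \<Longrightarrow> taum X f \<in> Mor CC (tau X) (tau Y)"
  using trunc_map_strict[OF truncI(1) truncI(1)] trunc_map_strict[OF truncI(2) truncI(2)]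
  by (simp add: tau_def taum_def)

lemma eps_natural:
  "obj X \<Longrightarrow> obj Y \<Longrightarrow> f \<in> Mor CC X Y \<Longrightarrow> Cmp CC (tau X) X Y f (eps X) = Cmp CC (tau X) (tau Y) Y (eps Y) (taum X f)"
  using trunc_inc_natural[OF truncI(1) truncI(1)] trunc_inc_natural[OF truncI(2) truncI(2)]
  by (simp add: tau_def eps_def taum_def)

lemma taum_quasi_iso: "obj X \<Longrightarrow> obj Y \<Longrightarrow> quasi_iso X Y f \<Longrightarrow> quasi_iso (tau X) (tau Y) (taum X f)"
  using trunc_map_quasi_iso[OF truncI(1) truncI(1)] trunc_map_quasi_iso[OF truncI(2) truncI(2)]
  by (simp add: tau_def taum_def quasi_iso_def quasi_isosD)

lemma eps_quasi_iso:
  "obj X \<Longrightarrow> coh_concentrated_le i0 (fst X) \<Longrightarrow> coh_concentrated_le j0 (snd X) \<Longrightarrow> quasi_iso (tau X) X (eps X)"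
  using truncatable.trunc_inc_quasi_iso[OF truncI(1)] truncatable.trunc_inc_quasi_iso[OF truncI(2)]
  by (simp add: tau_def eps_def quasi_iso_def)

lemma concentrated_coh:
  assumes "cochain_complex M" "concentrated_le k M" shows "coh_concentrated_le k M"
proof -
  interpret cochain_complex M by fact
  have "cyc M i = {\<one>\<^bsub>gr M i\<^esub>}" if "i > k" for i
    using assms(2) that one_cyc[of i] cycD[of _ M i] by (auto simp: concentrated_le_def)
  then show ?thesis using coh_trivial[OF assms(1)] by (simp add: coh_concentrated_le_def)
qed

lemma top_coh: "top_obj X \<Longrightarrow> coh_concentrated_le i0 (fst X) \<and> coh_concentrated_le j0 (snd X)"
  using concentrated_coh dg_module_complex by (auto simp: top_obj_def obj_def)

lemma eps_top: "top_obj X \<Longrightarrow> quasi_iso (tau X) X (eps X)"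
  using eps_quasi_iso top_coh top_obj_obj by blast

subsection \<open>The maps on cohomology\<close>

lemma L_dg: "obj X \<Longrightarrow> dg_module (dg_of_ring K) (fob L X)"
  using df.L_Ob[of X] by simp

lemma HLm_linear:
  assumes "\<phi> \<in> Mor DD X Y"
  shows "klinear K (coh (fob L X) pp) (coh_op (fob L X) pp) (coh (fob L Y) pp) (coh_op (fob L Y) pp) (HLm X Y \<phi>)"
proof -
  have "fmor L X Y \<phi> \<in> Mor (der_cat (dg_of_ring K)) (fob L X) (fob L Y)"
    using df.L_Mor[of X Y \<phi>] Mor_DD[OF assms] assms by (simp del: prod_cat_simps)
  then show ?thesis
    unfolding klinear_def df.HLm_def using der_coh_hom der_coh_op[OF dg_of_ring_complex[OF is_cring] _ ring_elem_cyc] by blast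
qed

lemma Heta_linear:
  assumes "obj X"
  shows "klinear K (coh (fob L X) pp) (coh_op (fob L X) pp) (coh (fob FF X) pp) (coh_op (fob FF X) pp) (Heta X)"
proof -
  have "\<eta> X \<in> Mor (der_cat (dg_of_ring K)) (fob L X) (fob FF X)"
    using df.eta_Mor[of X] assms by simp
  then show ?thesis
    unfolding klinear_def df.Heta_def fob_QQ using der_coh_hom der_coh_op[OF dg_of_ring_complex[OF is_cring] _ ring_elem_cyc] by blast
qed

lemma HLm_closed: "\<phi> \<in> Mor DD X Y \<Longrightarrow> y \<in> HL X \<Longrightarrow> HLm X Y \<phi> y \<in> HL Y"
  using klinearD(2)[OF HLm_linear] .

lemma Heta_closed: "obj X \<Longrightarrow> y \<in> HL X \<Longrightarrow> Heta X y \<in> HF X"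
  using klinearD(2)[OF Heta_linear] .

lemma HLm_Cmp:
  "\<phi> \<in> Mor DD X Y \<Longrightarrow> \<psi> \<in> Mor DD Y Z \<Longrightarrow> y \<in> HL X \<Longrightarrow> HLm X Z (Cmp DD X Y Z \<psi> \<phi>) y = HLm Y Z \<psi> (HLm X Y \<phi> y)"
  using df.HLm_Cmp[of X Y Z \<phi> \<psi> y pp] Mor_DD[of \<phi> X Y] Mor_DD[of \<psi> Y Z] by (simp del: prod_cat_simps)

lemma HLm_Idt: "obj X \<Longrightarrow> y \<in> HL X \<Longrightarrow> HLm X X (Idt DD X) y = y"
  using df.HLm_Idt[of X y pp] by (simp del: prod_cat_simps)

lemma Heta_natural:
  "\<lbrakk>obj X; obj Y; f \<in> Mor CC X Y; y \<in> HL X\<rbrakk> \<Longrightarrow> Heta Y (HLm X Y (Qf X Y f) y) = HFm X Y f (Heta X y)"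
  using df.Heta_nat[of X Y f y pp] by (simp del: prod_cat_simps)

lemma HLm_inverse:
  "inverse_pair X Y \<phi> \<psi> \<Longrightarrow> y \<in> HL X \<Longrightarrow> HLm Y X \<psi> (HLm X Y \<phi> y) = y"
  using HLm_Cmp[of \<phi> X Y \<psi> X y] HLm_Idt[of X y] Mor_DD[of \<phi> X Y] by (simp add: inverse_pair_def del: prod_cat_simps)

lemma CTm_inverse:
  "inverse_pair X Y \<phi> \<psi> \<Longrightarrow> t \<in> carrier (CT X) \<Longrightarrow> CTm Y X \<psi> (CTm X Y \<phi> t) = t"
  using CTm_Cmp[of \<phi> X Y \<psi> X t] CTm_Idt[of X t] Mor_DD[of \<phi> X Y] by (simp add: inverse_pair_def del: prod_cat_simps)

lemma inverse_pair_sym: "inverse_pair X Y \<phi> \<psi> \<Longrightarrow> inverse_pair Y X \<psi> \<phi>"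
  by (simp add: inverse_pair_def del: prod_cat_simps)

lemma inverse_pair_Mor: "inverse_pair X Y \<phi> \<psi> \<Longrightarrow> \<phi> \<in> Mor DD X Y" "inverse_pair X Y \<phi> \<psi> \<Longrightarrow> \<psi> \<in> Mor DD Y X"
  by (simp_all add: inverse_pair_def del: prod_cat_simps)

lemma HLm_eps_natural:
  assumes "obj X" "obj Y" "f \<in> Mor CC X Y" "y \<in> HL (tau X)"
  shows "HLm X Y (Qf X Y f) (Le X y) =
    Le Y (HLm (tau X) (tau Y) (Qf (tau X) (tau Y) (taum X f)) y)"
proof -
  note o = tau_obj[OF assms(1)] tau_obj[OF assms(2)]
  note e = eps_Mor[OF assms(1)] eps_Mor[OF assms(2)] taum_Mor[OF assms(1-3)]
  show ?thesis
    using HLm_Cmp[OF Qf_Mor[OF o(1) assms(1) e(1)] Qf_Mor[OF assms(1-3)] assms(4)]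
      HLm_Cmp[OF Qf_Mor[OF o(1,2) e(3)] Qf_Mor[OF o(2) assms(2) e(2)] assms(4)]
      Qf_Cmp[OF o(1) assms(1,2) e(1) assms(3)] Qf_Cmp[OF o(1,2) assms(2) e(3,2)] eps_natural[OF assms(1-3)]
    by (simp only:)
qed

lemma CTm_eps_natural:
  assumes "obj X" "obj Y" "f \<in> Mor CC X Y" "t \<in> carrier (CT (tau X))"
  shows "CTm X Y (Qf X Y f) (Ce X t) =
    Ce Y (CTm (tau X) (tau Y) (Qf (tau X) (tau Y) (taum X f)) t)"
proof -
  note o = tau_obj[OF assms(1)] tau_obj[OF assms(2)]
  note e = eps_Mor[OF assms(1)] eps_Mor[OF assms(2)] taum_Mor[OF assms(1-3)]
  show ?thesis
    using CTm_Cmp[OF Qf_Mor[OF o(1) assms(1) e(1)] Qf_Mor[OF assms(1-3)] assms(4)]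
      CTm_Cmp[OF Qf_Mor[OF o(1,2) e(3)] Qf_Mor[OF o(2) assms(2) e(2)] assms(4)]
      Qf_Cmp[OF o(1) assms(1,2) e(1) assms(3)] Qf_Cmp[OF o(1,2) assms(2) e(3,2)] eps_natural[OF assms(1-3)]
    by (simp only:)
qed

lemma HFm_linear:
  assumes "obj X" "obj Y" "f \<in> Mor CC X Y"
  shows "HFm X Y f \<in> hom (coh (fob FF X) pp) (coh (fob FF Y) pp)"
  unfolding df.HFm_def by (rule der_coh_hom[OF df.F_Mor]) (use assms in \<open>simp_all only: Ob_CC\<close>)

lemma HFm_eq:
  assumes "obj X" "obj Y" "f \<in> Mor CC X Y" "z \<in> HF X"
  shows "HFm X Y f z = coh_map (fob FF X) (fob FF Y) pp (tensor_map A X Y f) z"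
  unfolding df.HFm_def fmor_FF
  by (rule der_coh_fwd[OF _ _ tensor_map_strict[OF assms(1-3)] assms(4)]) (use assms tensor_dg_module in auto)

lemma HF_group: "obj X \<Longrightarrow> comm_group (coh (fob FF X) pp)"
  using cochain_complex.coh_comm_group[OF dg_module_complex[OF tensor_dg_module]] by simp

lemma HL_group: "obj X \<Longrightarrow> comm_group (coh (fob L X) pp)"
  using cochain_complex.coh_comm_group[OF dg_module_complex[OF L_dg]] .

lemma Th_spec:
  assumes "top_obj X"
  shows "Th X \<in> extensional (carrier (CT X))"
    "klinear K (CT X) (CS X) (coh (fob FF X) pp) (coh_op (fob FF X) pp) (Th X)"
    "bij_betw (Th X) (carrier (CT X)) (HF X)"
    "\<And>x y. \<lbrakk>x \<in> carrier (coh (fst X) i0); y \<in> carrier (coh (snd X) j0)\<rbrakk> \<Longrightarrow>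
      Th X (coh_tensor_class A i0 j0 (fst X) (snd X) x y) = tensor_coh.pair A s (fst X) (snd X) i0 j0 x y"
  using tensor_top.theta_spec[OF topI[OF assms]] by simp_all

lemma pair_natural:
  assumes X: "obj X" "obj Y" "f \<in> Mor CC X Y"
    and xy: "x \<in> carrier (coh (fst X) i0)" "y \<in> carrier (coh (snd X) j0)"
  shows "HFm X Y f (tensor_coh.pair A s (fst X) (snd X) i0 j0 x y) =
    tensor_coh.pair A s (fst Y) (snd Y) i0 j0 (der_coh_map i0 (fst X) (fst (Qf X Y f)) x) (der_coh_map j0 (snd X) (snd (Qf X Y f)) y)"
proof -
  interpret X: tensor_coh K A s "fst X" "snd X" by (rule cohI[OF X(1)])
  have f: "fst f \<in> strict_homs Aop (fst X) (fst Y)" "snd f \<in> strict_homs A (snd X) (snd Y)" using X(3) by auto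
  have dg: "dg_module Aop (fst X)" "dg_module Aop (fst Y)" "dg_module A (snd X)" "dg_module A (snd Y)"
    using X by (auto simp: obj_def)
  show ?thesis
    using HFm_eq[OF X] X.pair_closed[OF xy] X.pair_nat[OF cohI[OF X(2)] f xy]
    by (simp add: Qf der_coh_fwd[OF dg(1,2) f(1) xy(1)] der_coh_fwd[OF dg(3,4) f(2) xy(2)])
qed

lemma Th_natural:
  assumes X: "top_obj X" and Y: "top_obj Y" and f: "f \<in> Mor CC X Y" and t: "t \<in> carrier (CT X)"
  shows "HFm X Y f (Th X t) = Th Y (CTm X Y (Qf X Y f) t)"
proof -
  note o = top_obj_obj[OF X] top_obj_obj[OF Y]
  note q = Qf_Mor[OF o f]
  show ?thesis
  proof (rule CT_ext[OF o(1) HF_group[OF o(2)] hom_comp[OF klinearD(1)[OF Th_spec(2)[OF X]] HFm_linear[OF o f]]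
        hom_comp[OF klinearD(1)[OF CTm_linear[OF q]] klinearD(1)[OF Th_spec(2)[OF Y]]] _ t])
    fix x y assume xy: "x \<in> carrier (coh (fst X) i0)" "y \<in> carrier (coh (snd X) j0)"
    show "HFm X Y f (Th X (coh_tensor_class A i0 j0 (fst X) (snd X) x y)) =
        Th Y (CTm X Y (Qf X Y f) (coh_tensor_class A i0 j0 (fst X) (snd X) x y))"
      unfolding Th_spec(4)[OF X xy] CTm_class[OF q xy]
        Th_spec(4)[OF Y coh_linearD(2)[OF coh_lin(1)[OF q] xy(1)] coh_linearD(2)[OF coh_lin(2)[OF q] xy(2)]]
      by (rule pair_natural[OF o f xy])
  qed
qed

text \<open>On pairs concentrated in degrees at most \<open>i0\<close> and \<open>j0\<close>, \<open>theta\<close> identifies the top cohomology of the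
  underived tensor product with $H^{i_0} \otimes H^{j_0}$, which turns quasi-isomorphisms into bijections.\<close>

lemma HFm_kernel:
  assumes X: "top_obj X" and Y: "top_obj Y" and w: "quasi_iso X Y w"
    and z: "z \<in> HF X" "HFm X Y w z = \<one>\<^bsub>coh (fob FF Y) pp\<^esub>"
  shows "z = \<one>\<^bsub>coh (fob FF X) pp\<^esub>"
proof -
  note o = top_obj_obj[OF X] top_obj_obj[OF Y] and m = quasi_iso_Mor[OF w]
  obtain \<psi> where inv: "inverse_pair X Y (Qf X Y w) \<psi>" by (rule quasi_iso_inverse[OF o w])
  obtain t where t: "t \<in> carrier (CT X)" "z = Th X t"
    using Th_spec(3)[OF X] z(1) unfolding bij_betw_def by blast
  have c: "CTm X Y (Qf X Y w) t \<in> carrier (CT Y)" by (rule CTm_closed[OF Qf_Mor[OF o m] t(1)])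
  have one: "Th V \<one>\<^bsub>CT V\<^esub> = \<one>\<^bsub>coh (fob FF V) pp\<^esub>" if "top_obj V" for V
    using hom_one'[OF CT_group HF_group klinearD(1)[OF Th_spec(2)]] that top_obj_obj by blast
  have oc: "\<one>\<^bsub>CT Y\<^esub> \<in> carrier (CT Y)"
    using CT_group[OF o(2)] by (simp add: comm_group_def group.is_monoid monoid.one_closed)
  have "Th Y (CTm X Y (Qf X Y w) t) = Th Y \<one>\<^bsub>CT Y\<^esub>"
    using Th_natural[OF X Y m t(1)] z(2) t(2) one[OF Y] by simp
  then have "CTm X Y (Qf X Y w) t = \<one>\<^bsub>CT Y\<^esub>"
    using Th_spec(3)[OF Y] c oc unfolding bij_betw_def inj_on_def by blast
  then have "t = CTm Y X \<psi> \<one>\<^bsub>CT Y\<^esub>" using CTm_inverse[OF inv t(1)] by simp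
  also have "\<dots> = \<one>\<^bsub>CT X\<^esub>"
    by (rule hom_one'[OF CT_group[OF o(2)] CT_group[OF o(1)] klinearD(1)[OF CTm_linear[OF inverse_pair_Mor(2)[OF inv]]]])
  finally show ?thesis using t(2) one[OF X] by simp
qed

subsection \<open>The canonical morphism is bijective in top degree\<close>

lemma coh_card: "dg_module B M \<Longrightarrow> carrier (coh M i) \<lesssim> (UNIV :: 'u set)" for M :: "('a, 'u) dg_module"
  using lepoll_trans[OF cochain_complex.coh_lepoll[OF dg_module_complex] subset_imp_lepoll[OF subset_UNIV]] by blast

text \<open>Pairs of classes form a functor on the product of the derived categories, and $[m \otimes n]$ is
  natural in $[m]$ and $[n]$, so it lifts along \<open>Heta\<close>. These elements generate the target because
  \<open>theta\<close> is surjective.\<close>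

lemma Heta_surj:
  assumes X: "top_obj X" and z: "z \<in> HF X"
  shows "\<exists>y\<in>HL X. Heta X y = z"
proof -
  let ?S = "\<lambda>X. carrier (coh (fst X) i0) \<times> carrier (coh (snd X) j0)"
  let ?Sm = "\<lambda>X Y \<phi>. map_prod (der_coh_map i0 (fst X) (fst \<phi>)) (der_coh_map j0 (snd X) (snd \<phi>))"
  let ?t = "\<lambda>X (x, y). tensor_coh.pair A s (fst X) (snd X) i0 j0 x y"
  have S: "set_functor DD ?S ?Sm"
    unfolding set_functor_def
    by (auto simp: der_coh_closed der_coh_Idt obj_def der_coh_Cmp')
  have cardS: "?S X \<lesssim> (UNIV :: ('u, 'u) tensor_elem set)" if "X \<in> Ob DD" for X
  proof -
    have "?S X \<lesssim> (UNIV :: 'u set)"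
      by (rule times_lepoll_infinite[OF inf_u]) (use that coh_card in \<open>auto simp: obj_def\<close>)
    then show ?thesis by (rule lepoll_trans[OF _ inj_u])
  qed
  have gens: "\<exists>y\<in>HL X. Heta X y = tensor_coh.pair A s (fst X) (snd X) i0 j0 a b"
    if ab: "a \<in> carrier (coh (fst X) i0)" "b \<in> carrier (coh (snd X) j0)" for a b
  proof -
    have "\<exists>y\<in>carrier (coh (fob L (fob QQ X)) pp). Heta X y = ?t X (a, b)"
    proof (rule df.coh_lift_exists[OF S cardS])
      show "?t X x \<in> carrier (coh (fob FF X) pp)" if "X \<in> Ob CC" "x \<in> ?S (fob QQ X)" for X x
        using that tensor_coh.pair_closed[OF cohI] by auto
      show "?t Y (?Sm (fob QQ X) (fob QQ Y) (fmor QQ X Y f) x) = HFm X Y f (?t X x)"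
        if "X \<in> Ob CC" "Y \<in> Ob CC" "f \<in> Mor CC X Y" "x \<in> ?S (fob QQ X)" for X Y f x
        using that pair_natural[of X Y f "fst x" "snd x"] by (cases x) (simp del: prod_cat_simps Mor_CC)
    qed (use X top_obj_obj ab in auto)
    then show ?thesis by simp
  qed
  obtain c where c: "c \<in> carrier (CT X)" "z = Th X c"
    using Th_spec(3)[OF X] z unfolding bij_betw_def by blast
  note o = top_obj_obj[OF X]
  interpret HL: comm_group "coh (fob L X) pp" by (rule HL_group[OF o])
  note e = klinearD(1)[OF Heta_linear[OF o]] and th = klinearD(1)[OF Th_spec(2)[OF X]]
  have "\<exists>y\<in>HL X. Heta X y = Th X c"
    using c(1)
  proof (induction c rule: pres_induct[OF tensor_pair.CR[OF pairI[OF o]], consumes 1, case_names one mult inv gen])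
    case one
    then show ?case
      using hom_one'[OF HL_group[OF o] HF_group[OF o] e] hom_one'[OF CT_group[OF o] HF_group[OF o] th]
      by (intro bexI[of _ "\<one>\<^bsub>coh (fob L X) pp\<^esub>"]) simp_all
  next
    case (mult c d)
    then obtain x y where "x \<in> HL X" "Heta X x = Th X c" "y \<in> HL X" "Heta X y = Th X d" by blast
    then show ?case using hom_mult[OF e] hom_mult[OF th mult(1,2)] by (intro bexI[of _ "x \<otimes>\<^bsub>coh (fob L X) pp\<^esub> y"]) simp_all
  next
    case (inv c)
    then obtain x where "x \<in> HL X" "Heta X x = Th X c" by blast
    then show ?case
      using hom_inv'[OF HL_group[OF o] HF_group[OF o] e] hom_inv'[OF CT_group[OF o] HF_group[OF o] th inv(1)]
      by (intro bexI[of _ "inv\<^bsub>coh (fob L X) pp\<^esub> x"]) simp_all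
  next
    case (gen g)
    then obtain a b where g: "g = (a, b)" "a \<in> carrier (coh (fst X) i0)" "b \<in> carrier (coh (snd X) j0)"
      by (auto simp: coh_tensor_gens_def)
    then show ?case using gens[OF g(2,3)] Th_spec(4)[OF X g(2,3)] by (simp add: coh_tensor_class_def)
  qed
  then show ?thesis using c(2) by simp
qed

text \<open>The kernel of \<open>Heta\<close> on the truncation, moved to \<open>X\<close>. In this form it is a functor on the derived
  categories, although \<open>Heta\<close> is natural for strict homomorphisms only.\<close>

definition eta_kernel where
  "eta_kernel X = {Le X y | y. y \<in> HL (tau X) \<and> Heta (tau X) y = \<one>\<^bsub>coh (fob FF (tau X)) pp\<^esub>}"

lemma eta_kernel_HL: "obj X \<Longrightarrow> x \<in> eta_kernel X \<Longrightarrow> x \<in> HL X"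
  unfolding eta_kernel_def using HLm_closed[OF Qf_Mor[OF tau_obj _ eps_Mor]] by blast

text \<open>For the inverse of a quasi-isomorphism from \<open>X\<close> to \<open>Y\<close>, the class is moved to the truncation of \<open>X\<close> by
  the inverse of the truncated quasi-isomorphism; it stays in the kernel of \<open>Heta\<close> by \<open>HFm_kernel\<close>.\<close>

lemma eta_kernel_stable:
  assumes "\<phi> \<in> Mor DD X Y" shows "\<forall>x\<in>eta_kernel X. HLm X Y \<phi> x \<in> eta_kernel Y"
  using assms
proof (induction rule: DD_induct)
  case (strict X Y f)
  note o = tau_obj[OF strict(1)] tau_obj[OF strict(2)]
  note tf = taum_Mor[OF strict]
  show ?case
  proof
    fix x assume "x \<in> eta_kernel X"
    then obtain y where y: "x = Le X y" "y \<in> HL (tau X)" "Heta (tau X) y = \<one>\<^bsub>coh (fob FF (tau X)) pp\<^esub>"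
      by (auto simp: eta_kernel_def)
    have "Heta (tau Y) (HLm (tau X) (tau Y) (Qf (tau X) (tau Y) (taum X f)) y) = \<one>\<^bsub>coh (fob FF (tau Y)) pp\<^esub>"
      using Heta_natural[OF o tf y(2)] y(3) hom_one'[OF HF_group[OF o(1)] HF_group[OF o(2)] HFm_linear[OF o tf]] by simp
    then show "HLm X Y (Qf X Y f) x \<in> eta_kernel Y"
      using HLm_eps_natural[OF strict y(2)] y(1) HLm_closed[OF Qf_Mor[OF o tf] y(2)] unfolding eta_kernel_def by blast
  qed
next
  case (comp X Y Z \<phi> \<psi>)
  then show ?case using HLm_Cmp[OF comp(1,2)] eta_kernel_HL Mor_DD[OF comp(1)] by auto
next
  case (inverse X Y w \<psi>)
  note o = tau_obj[OF inverse(1)] tau_obj[OF inverse(2)]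
  note m = quasi_iso_Mor[OF inverse(3)]
  note tw = taum_quasi_iso[OF inverse(1,2,3)] and tm = taum_Mor[OF inverse(1,2) m]
  show ?case
  proof
    fix x assume "x \<in> eta_kernel Y"
    then obtain y where y: "x = Le Y y" "y \<in> HL (tau Y)" "Heta (tau Y) y = \<one>\<^bsub>coh (fob FF (tau Y)) pp\<^esub>"
      by (auto simp: eta_kernel_def)
    obtain \<psi>' where inv: "inverse_pair (tau X) (tau Y) (Qf (tau X) (tau Y) (taum X w)) \<psi>'"
      by (rule quasi_iso_inverse[OF o tw])
    let ?y = "HLm (tau Y) (tau X) \<psi>' y"
    have yc: "?y \<in> HL (tau X)" by (rule HLm_closed[OF inverse_pair_Mor(2)[OF inv] y(2)])
    have yy: "HLm (tau X) (tau Y) (Qf (tau X) (tau Y) (taum X w)) ?y = y"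
      by (rule HLm_inverse[OF inverse_pair_sym[OF inv] y(2)])
    have "HFm (tau X) (tau Y) (taum X w) (Heta (tau X) ?y) = \<one>\<^bsub>coh (fob FF (tau Y)) pp\<^esub>"
      using Heta_natural[OF o tm yc] yy y(3) by simp
    then have "Heta (tau X) ?y = \<one>\<^bsub>coh (fob FF (tau X)) pp\<^esub>"
      by (rule HFm_kernel[OF tau_top[OF inverse(1)] tau_top[OF inverse(2)] tw Heta_closed[OF o(1) yc]])
    then have "Le X ?y \<in> eta_kernel X" using yc by (auto simp: eta_kernel_def)
    moreover have "HLm Y X \<psi> x = Le X ?y"
      using HLm_eps_natural[OF inverse(1,2) m yc] yy y(1)
        HLm_inverse[OF inverse(4) HLm_closed[OF Qf_Mor[OF o(1) inverse(1) eps_Mor[OF inverse(1)]] yc]] by simp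
    ultimately show "HLm Y X \<psi> x \<in> eta_kernel X" by simp
  qed
qed

text \<open>The inclusion into the cohomology of \<open>L\<close> and the zero map are natural and agree after \<open>Heta\<close>.\<close>

lemma eta_kernel_trivial:
  assumes X: "obj X" and x: "x \<in> eta_kernel X"
  shows "x = \<one>\<^bsub>coh (fob L X) pp\<^esub>"
proof -
  have one: "\<one>\<^bsub>coh (fob L X) pp\<^esub> \<in> HL X" if "obj X" for X
    using HL_group[OF that] by (simp add: comm_group_def group.is_monoid monoid.one_closed)
  have stable: "HLm X Y f x \<in> eta_kernel Y" if "f \<in> Mor DD X Y" "x \<in> eta_kernel X" for X Y f x
    using eta_kernel_stable[OF that(1)] that(2) by blast
  have S: "set_functor DD eta_kernel HLm"
    unfolding set_functor_def Ob_DD Ball_def using stable HLm_Idt HLm_Cmp eta_kernel_HL by (simp del: prod_cat_simps)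
  have cardS: "eta_kernel X \<lesssim> (UNIV :: ('u, 'u) tensor_elem set)" if "X \<in> Ob DD" for X
  proof -
    have o: "obj X" using that by simp
    have "eta_kernel X \<subseteq> HL X" using eta_kernel_HL[OF o] by blast
    then have "eta_kernel X \<lesssim> HL X" by (rule subset_imp_lepoll)
    also have "HL X \<lesssim> carrier (gr (fob L X) pp)"
      by (rule cochain_complex.coh_lepoll[OF dg_module_complex[OF L_dg[OF o]]])
    also have "\<dots> \<lesssim> (UNIV :: ('u, 'u) tensor_elem set)" by (rule subset_imp_lepoll) simp
    finally show ?thesis .
  qed
  show ?thesis
  proof (rule df.coh_lift_unique[OF S cardS, of "\<lambda>X x. x" pp "\<lambda>X x. \<one>\<^bsub>coh (fob L X) pp\<^esub>"])
    show "\<one>\<^bsub>coh (fob L Y) pp\<^esub> = HLm X Y f \<one>\<^bsub>coh (fob L X) pp\<^esub>"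
      if "X \<in> Ob DD" "Y \<in> Ob DD" "f \<in> Mor DD X Y" for X Y f
      using hom_one'[OF HL_group HL_group klinearD(1)[OF HLm_linear[OF that(3)]]] that(1,2) by simp
    show "Heta X x = Heta X \<one>\<^bsub>coh (fob L (fob QQ X)) pp\<^esub>" if XC: "X \<in> Ob CC" and xb: "x \<in> eta_kernel (fob QQ X)" for X x
    proof -
      have o: "obj X" using XC by simp
      obtain y where y: "x = Le X y" "y \<in> HL (tau X)" "Heta (tau X) y = \<one>\<^bsub>coh (fob FF (tau X)) pp\<^esub>"
        using xb by (auto simp: eta_kernel_def)
      have "Heta X x = \<one>\<^bsub>coh (fob FF X) pp\<^esub>"
        unfolding y(1) Heta_natural[OF tau_obj[OF o] o eps_Mor[OF o] y(2)] y(3)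
        by (rule hom_one'[OF HF_group[OF tau_obj[OF o]] HF_group[OF o] HFm_linear[OF tau_obj[OF o] o eps_Mor[OF o]]])
      moreover have "Heta X \<one>\<^bsub>coh (fob L X) pp\<^esub> = \<one>\<^bsub>coh (fob FF X) pp\<^esub>"
        by (rule hom_one'[OF HL_group[OF o] HF_group[OF o] klinearD(1)[OF Heta_linear[OF o]]])
      ultimately show ?thesis by simp
    qed
  qed (use eta_kernel_HL one X x in \<open>simp_all del: prod_cat_simps\<close>)
qed

text \<open>An element of the kernel comes from the truncation, where it is in the kernel again by
  \<open>HFm_kernel\<close>, so \<open>eta_kernel_trivial\<close> applies.\<close>

lemma Heta_bij:
  assumes X: "top_obj X" shows "bij_betw (Heta X) (HL X) (HF X)"
proof -
  note o = top_obj_obj[OF X]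
  interpret h: group_hom "coh (fob L X) pp" "coh (fob FF X) pp" "Heta X"
    using HL_group[OF o] HF_group[OF o] klinearD(1)[OF Heta_linear[OF o]]
    by (intro group_homI) (auto simp: comm_group_def)
  have "inj_on (Heta X) (HL X)"
  proof (subst h.inj_on_one_iff, intro allI impI)
    fix y assume y: "y \<in> HL X" "Heta X y = \<one>\<^bsub>coh (fob FF X) pp\<^esub>"
    obtain \<psi> where inv: "inverse_pair (tau X) X (Qf (tau X) X (eps X)) \<psi>"
      by (rule quasi_iso_inverse[OF tau_obj[OF o] o eps_top[OF X]])
    let ?y = "HLm X (tau X) \<psi> y"
    have yc: "?y \<in> HL (tau X)" by (rule HLm_closed[OF inverse_pair_Mor(2)[OF inv] y(1)])
    have yy: "Le X ?y = y" by (rule HLm_inverse[OF inverse_pair_sym[OF inv] y(1)])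
    have "HFm (tau X) X (eps X) (Heta (tau X) ?y) = \<one>\<^bsub>coh (fob FF X) pp\<^esub>"
      using Heta_natural[OF tau_obj[OF o] o eps_Mor[OF o] yc] yy y(2) by simp
    then have "Heta (tau X) ?y = \<one>\<^bsub>coh (fob FF (tau X)) pp\<^esub>"
      by (rule HFm_kernel[OF tau_top[OF o] X eps_top[OF X] Heta_closed[OF tau_obj[OF o] yc]])
    then have "y \<in> eta_kernel X" using yc yy unfolding eta_kernel_def by force
    then show "y = \<one>\<^bsub>coh (fob L X) pp\<^esub>" by (rule eta_kernel_trivial[OF o])
  qed
  moreover have "HF X \<subseteq> Heta X ` HL X" using Heta_surj[OF X] by blast
  ultimately show ?thesis using h.hom_closed by (auto simp: bij_betw_def)
qed

section \<open>The derived isomorphism\<close>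

definition theta_lift where "theta_lift X t = inv_into (HL X) (Heta X) (Th X t)"

lemma theta_lift_linear:
  assumes X: "top_obj X"
  shows "klinear K (CT X) (CS X) (coh (fob L X) pp) (coh_op (fob L X) pp) (theta_lift X)"
proof -
  note o = top_obj_obj[OF X]
  show ?thesis
    unfolding theta_lift_def
    by (rule klinear_comp[OF Th_spec(2)[OF X]
          klinear_inv_into[OF coh_kmodule[OF is_cring L_dg[OF o]] HF_group[OF o] Heta_linear[OF o] Heta_bij[OF X]]])
qed

lemma theta_lift_bij:
  assumes X: "top_obj X" shows "bij_betw (theta_lift X) (carrier (CT X)) (HL X)"
  using bij_betw_trans[OF Th_spec(3)[OF X] bij_betw_inv_into[OF Heta_bij[OF X]]]
  by (simp add: theta_lift_def[abs_def] comp_def)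

lemma Heta_theta_lift:
  assumes X: "top_obj X" and t: "t \<in> carrier (CT X)" shows "Heta X (theta_lift X t) = Th X t"
  unfolding theta_lift_def by (rule bij_betw_inv_into_right[OF Heta_bij[OF X]]) (rule klinearD(2)[OF Th_spec(2)[OF X] t])

lemma Heta_inj:
  assumes X: "top_obj X" and "y \<in> HL X" "y' \<in> HL X" "Heta X y = Heta X y'" shows "y = y'"
  using Heta_bij[OF X] assms(2-4) unfolding bij_betw_def inj_on_def by blast

lemma theta_lift_natural:
  assumes X: "top_obj X" and Y: "top_obj Y" and f: "f \<in> Mor CC X Y" and t: "t \<in> carrier (CT X)"
  shows "HLm X Y (Qf X Y f) (theta_lift X t) = theta_lift Y (CTm X Y (Qf X Y f) t)"
proof (rule Heta_inj[OF Y])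
  note o = top_obj_obj[OF X] top_obj_obj[OF Y]
  note q = Qf_Mor[OF o f] and bc = klinearD(2)[OF theta_lift_linear[OF X] t]
  show "HLm X Y (Qf X Y f) (theta_lift X t) \<in> HL Y" by (rule HLm_closed[OF q bc])
  show "theta_lift Y (CTm X Y (Qf X Y f) t) \<in> HL Y" by (rule klinearD(2)[OF theta_lift_linear[OF Y] CTm_closed[OF q t]])
  show "Heta Y (HLm X Y (Qf X Y f) (theta_lift X t)) = Heta Y (theta_lift Y (CTm X Y (Qf X Y f) t))"
    unfolding Heta_natural[OF o f bc] Heta_theta_lift[OF X t] Heta_theta_lift[OF Y CTm_closed[OF q t]]
    by (rule Th_natural[OF X Y f t])
qed

lemma Qe_Mor: "obj X \<Longrightarrow> Qf (tau X) X (eps X) \<in> Mor DD (tau X) X"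
  by (rule Qf_Mor[OF tau_obj _ eps_Mor])

lemma Ce_bij:
  assumes X: "obj X" shows "bij_betw (Ce X) (carrier (CT (tau X))) (carrier (CT X))"
proof -
  let ?q = "Qf (tau X) X (eps X)"
  let ?u = "der_coh_map i0 (fst (tau X)) (fst ?q)" and ?v = "der_coh_map j0 (snd (tau X)) (snd ?q)"
  note o = tau_obj[OF X] and q = Qe_Mor[OF X]
  have dg: "dg_module Aop (fst (tau X))" "dg_module A (snd (tau X))" "dg_module Aop (fst X)" "dg_module A (snd X)"
    using o X by (auto simp: obj_def)
  have e: "trunc_inc i0 (fst X) \<in> strict_homs Aop (fst (tau X)) (fst X)" "trunc_inc j0 (snd X) \<in> strict_homs A (snd (tau X)) (snd X)"
    using eps_Mor[OF X] by (simp_all add: eps_def)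
  have bu: "bij_betw ?u (carrier (coh (fst (tau X)) i0)) (carrier (coh (fst X) i0))"
  proof (subst bij_betw_cong)
    show "?u x = coh_map (fst (tau X)) (fst X) i0 (trunc_inc i0 (fst X)) x" if "x \<in> carrier (coh (fst (tau X)) i0)" for x
      using der_coh_fwd[OF dg(1,3) e(1) that] by (simp add: Qf eps_def)
    show "bij_betw (coh_map (fst (tau X)) (fst X) i0 (trunc_inc i0 (fst X))) (carrier (coh (fst (tau X)) i0)) (carrier (coh (fst X) i0))"
      using truncatable.trunc_inc_bij[OF truncI(1)[OF X], of i0 i0] by (simp add: tau_def)
  qed
  have bv: "bij_betw ?v (carrier (coh (snd (tau X)) j0)) (carrier (coh (snd X) j0))"
  proof (subst bij_betw_cong)
    show "?v x = coh_map (snd (tau X)) (snd X) j0 (trunc_inc j0 (snd X)) x" if "x \<in> carrier (coh (snd (tau X)) j0)" for x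
      using der_coh_fwd[OF dg(2,4) e(2) that] by (simp add: Qf eps_def)
    show "bij_betw (coh_map (snd (tau X)) (snd X) j0 (trunc_inc j0 (snd X))) (carrier (coh (snd (tau X)) j0)) (carrier (coh (snd X) j0))"
      using truncatable.trunc_inc_bij[OF truncI(2)[OF X], of j0 j0] by (simp add: tau_def)
  qed
  show ?thesis
    unfolding CTm_def
    by (rule tensor_pair.coh_tensor_map_bij[OF pairI[OF o] pairI[OF X] coh_lin(1)[OF q] coh_lin(2)[OF q] bu bv])
qed

text \<open>Defined on all pairs of DG modules, so that naturality can be proved by induction on morphisms of
  the derived categories, whose intermediate objects may have cohomology above the top degrees. There it
  need not be bijective.\<close>

definition theta_der where
  "theta_der X t = Le X (theta_lift (tau X) (inv_into (carrier (CT (tau X))) (Ce X) t))"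

lemma theta_der_Ce:
  "obj X \<Longrightarrow> t \<in> carrier (CT (tau X)) \<Longrightarrow> theta_der X (Ce X t) = Le X (theta_lift (tau X) t)"
  by (simp add: theta_der_def bij_betw_inv_into_left[OF Ce_bij])

text \<open>The scalars act through the first factor, where the module laws can be checked on cocycles.\<close>

lemma CT_kmodule: "obj X \<Longrightarrow> kmodule K (CT X) (CS X)"
proof -
  assume X: "obj X"
  interpret X: tensor_pair K A s "fst X" "snd X" by (rule pairI[OF X])
  note cs = X.coh_scalar[where i = i0 and j = j0]
  have op: "coh_op (fst X) i0 (s (k \<oplus> l)) x = coh_op (fst X) i0 (s k) x \<otimes>\<^bsub>coh (fst X) i0\<^esub> coh_op (fst X) i0 (s l) x"
    "coh_op (fst X) i0 (s (k \<otimes> l)) x = coh_op (fst X) i0 (s k) (coh_op (fst X) i0 (s l) x)"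
    "coh_op (fst X) i0 (s \<one>) x = x"
    if k: "k \<in> carrier K" "l \<in> carrier K" and x: "x \<in> carrier (coh (fst X) i0)" for k l x
  proof -
    obtain m where m: "m \<in> cyc (fst X) i0" "x = coh_class (fst X) i0 m" by (rule X.M.coh_cases[OF x])
    have c: "s a \<in> cyc Aop 0" "act (fst X) 0 i0 (s a) m \<in> cyc (fst X) i0" if "a \<in> carrier K" for a
      using X.sk_cyc[OF that] X.M.act_cyc[OF _ m(1), of "s a"] by auto
    show "coh_op (fst X) i0 (s (k \<oplus> l)) x = coh_op (fst X) i0 (s k) x \<otimes>\<^bsub>coh (fst X) i0\<^esub> coh_op (fst X) i0 (s l) x"
    proof -
      have "coh_op (fst X) i0 (s (k \<oplus> l)) x = coh_class (fst X) i0 (act (fst X) 0 i0 (s (k \<oplus> l)) m)"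
        unfolding m(2) by (rule X.M.coh_op_class[OF c(1) m(1)]) (use k in simp)
      also have "act (fst X) 0 i0 (s (k \<oplus> l)) m = act (fst X) 0 i0 (s k) m \<otimes>\<^bsub>gr (fst X) i0\<^esub> act (fst X) 0 i0 (s l) m"
        using X.M.act_add_left[of "s k" 0 "s l" m i0] k m(1) by (simp add: s_add s_closed cycD)
      also have "coh_class (fst X) i0 \<dots> = coh_op (fst X) i0 (s k) x \<otimes>\<^bsub>coh (fst X) i0\<^esub> coh_op (fst X) i0 (s l) x"
        using k m(1) c by (simp add: m(2) X.M.coh_op_class X.M.coh_class_mult[symmetric])
      finally show ?thesis .
    qed
    show "coh_op (fst X) i0 (s (k \<otimes> l)) x = coh_op (fst X) i0 (s k) (coh_op (fst X) i0 (s l) x)"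
    proof -
      have "coh_op (fst X) i0 (s (k \<otimes> l)) x = coh_class (fst X) i0 (act (fst X) 0 i0 (s (k \<otimes> l)) m)"
        unfolding m(2) by (rule X.M.coh_op_class[OF c(1) m(1)]) (use k in simp)
      also have "act (fst X) 0 i0 (s (k \<otimes> l)) m = act (fst X) 0 i0 (s k) (act (fst X) 0 i0 (s l) m)"
      proof -
        have "s (k \<otimes> l) = rmul Aop 0 0 (s k) (s l)"
          using s_mult[OF k] s_central[OF k(1) s_closed[OF k(2)]] by (simp add: koszul_def)
        then show ?thesis using X.M.act_assoc[of "s k" 0 "s l" 0 m i0] k m(1) by (simp add: s_closed cycD)
      qed
      also have "coh_class (fst X) i0 \<dots> = coh_op (fst X) i0 (s k) (coh_op (fst X) i0 (s l) x)"
        using k m(1) c by (simp add: m(2) X.M.coh_op_class)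
      finally show ?thesis .
    qed
    show "coh_op (fst X) i0 (s \<one>) x = x"
      using m(1) c[OF one_closed] X.M.act_one[of m i0] by (simp add: m(2) X.M.coh_op_class s_one cycD)
  qed
  show ?thesis
  proof unfold_locales
    fix k l t assume k: "k \<in> carrier K" "l \<in> carrier K" and t: "t \<in> carrier (CT X)"
    show "CS X (k \<oplus> l) t = CS X k t \<otimes>\<^bsub>CT X\<^esub> CS X l t"
      by (rule X.CP_hom_ext[OF X.CP.comm_group_axioms cs(1) hom_mult_fun[OF X.CP.comm_group_axioms cs(1) cs(1) X.CP.is_monoid] _ t])
        (use k in \<open>simp_all add: cs(2) op X.ct_add1 X.M_op_closed X.sk_cyc\<close>)
    show "CS X (k \<otimes> l) t = CS X k (CS X l t)"
      by (rule X.CP_hom_ext[OF X.CP.comm_group_axioms cs(1) hom_comp[OF cs(1) cs(1)] _ t])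
        (use k in \<open>simp_all add: cs(2) op X.M_op_closed X.sk_cyc\<close>)
  next
    fix t assume t: "t \<in> carrier (CT X)"
    have id: "(\<lambda>t. t) \<in> hom (CT X) (CT X)" by (auto simp: hom_def)
    show "CS X \<one> t = t"
      by (rule X.CP_hom_ext[OF X.CP.comm_group_axioms cs(1)[OF one_closed] id _ t]) (simp_all add: cs(2) op(3)[OF one_closed one_closed])
  qed (auto simp: hom_in_carrier[OF cs(1)] hom_mult[OF cs(1)])
qed

lemma theta_der_linear:
  assumes X: "obj X"
  shows "klinear K (CT X) (CS X) (coh (fob L X) pp) (coh_op (fob L X) pp) (theta_der X)"
  unfolding theta_der_def
  by (rule klinear_comp[OF klinear_comp[OF klinear_inv_into[OF CT_kmodule[OF tau_obj[OF X]] CT_group[OF X]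
          CTm_linear[OF Qe_Mor[OF X]] Ce_bij[OF X]] theta_lift_linear[OF tau_top[OF X]]] HLm_linear[OF Qe_Mor[OF X]]])

lemma Ce_cases:
  assumes "obj X" "t \<in> carrier (CT X)"
  obtains t0 where "t0 \<in> carrier (CT (tau X))" "t = Ce X t0"
  using Ce_bij[OF assms(1)] assms(2) unfolding bij_betw_def by blast

lemma theta_der_bij:
  assumes X: "obj X" and coh: "coh_concentrated_le i0 (fst X)" "coh_concentrated_le j0 (snd X)"
  shows "bij_betw (theta_der X) (carrier (CT X)) (HL X)"
proof -
  obtain \<psi> where inv: "inverse_pair (tau X) X (Qf (tau X) X (eps X)) \<psi>"
    by (rule quasi_iso_inverse[OF tau_obj[OF X] X eps_quasi_iso[OF X coh]])
  have L: "bij_betw (Le X) (HL (tau X)) (HL X)"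
    by (rule bij_betw_byWitness[where f' = "HLm X (tau X) \<psi>"])
      (use HLm_inverse[OF inv] HLm_inverse[OF inverse_pair_sym[OF inv]] HLm_closed[OF inverse_pair_Mor(1)[OF inv]]
        HLm_closed[OF inverse_pair_Mor(2)[OF inv]] in auto)
  show ?thesis
    using bij_betw_trans[OF bij_betw_trans[OF bij_betw_inv_into[OF Ce_bij[OF X]] theta_lift_bij[OF tau_top[OF X]]] L]
    by (simp add: theta_der_def[abs_def] comp_def)
qed

text \<open>Naturality for a morphism implies naturality for its inverse, so strict homomorphisms suffice, and
  for these the truncation is functorial and \<open>theta_lift\<close> natural.\<close>

lemma theta_der_natural:
  assumes "\<phi> \<in> Mor DD X Y"
  shows "\<forall>t\<in>carrier (CT X). HLm X Y \<phi> (theta_der X t) = theta_der Y (CTm X Y \<phi> t)"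
  using assms
proof (induction rule: DD_induct)
  case (strict X Y f)
  note o = tau_obj[OF strict(1)] tau_obj[OF strict(2)] and tf = taum_Mor[OF strict]
  show ?case
  proof
    fix t assume "t \<in> carrier (CT X)"
    then obtain t0 where t0: "t0 \<in> carrier (CT (tau X))" "t = Ce X t0" by (rule Ce_cases[OF strict(1)])
    note q = Qf_Mor[OF o tf]
    have "HLm X Y (Qf X Y f) (theta_der X t) = Le Y (HLm (tau X) (tau Y) (Qf (tau X) (tau Y) (taum X f)) (theta_lift (tau X) t0))"
      unfolding t0(2) theta_der_Ce[OF strict(1) t0(1)]
      by (rule HLm_eps_natural[OF strict klinearD(2)[OF theta_lift_linear[OF tau_top[OF strict(1)]] t0(1)]])
    also have "\<dots> = Le Y (theta_lift (tau Y) (CTm (tau X) (tau Y) (Qf (tau X) (tau Y) (taum X f)) t0))"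
      unfolding theta_lift_natural[OF tau_top[OF strict(1)] tau_top[OF strict(2)] tf t0(1)] ..
    also have "\<dots> = theta_der Y (CTm X Y (Qf X Y f) t)"
      unfolding t0(2) CTm_eps_natural[OF strict t0(1)] theta_der_Ce[OF strict(2) CTm_closed[OF q t0(1)]] ..
    finally show "HLm X Y (Qf X Y f) (theta_der X t) = theta_der Y (CTm X Y (Qf X Y f) t)" .
  qed
next
  case (comp X Y Z \<phi> \<psi>)
  show ?case
  proof
    fix t assume t: "t \<in> carrier (CT X)"
    have c: "theta_der X t \<in> HL X" using klinearD(2)[OF theta_der_linear t] Mor_DD[OF comp(1)] by blast
    show "HLm X Z (Cmp DD X Y Z \<psi> \<phi>) (theta_der X t) = theta_der Z (CTm X Z (Cmp DD X Y Z \<psi> \<phi>) t)"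
      unfolding HLm_Cmp[OF comp(1,2) c] CTm_Cmp[OF comp(1,2) t] using comp(3,4) t CTm_closed[OF comp(1) t] by simp
  qed
next
  case (inverse X Y w \<psi>)
  note m = inverse_pair_Mor[OF inverse(4)]
  show ?case
  proof
    fix t assume t: "t \<in> carrier (CT Y)"
    let ?t = "CTm Y X \<psi> t"
    have tc: "?t \<in> carrier (CT X)" by (rule CTm_closed[OF m(2) t])
    have "theta_der Y t = HLm X Y (Qf X Y w) (theta_der X ?t)"
      using inverse(5) tc CTm_inverse[OF inverse_pair_sym[OF inverse(4)] t] by simp
    then show "HLm Y X \<psi> (theta_der Y t) = theta_der X ?t"
      using HLm_inverse[OF inverse(4) klinearD(2)[OF theta_der_linear[OF inverse(1)] tc]] by simp
  qed
qed

lemma theta_der_theta: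
  assumes X: "top_obj X" and t: "t \<in> carrier (CT X)"
  shows "Heta X (theta_der X t) = Th X t"
proof -
  note o = top_obj_obj[OF X]
  note e = eps_Mor[OF o] and tt = tau_top[OF o]
  obtain t0 where t0: "t0 \<in> carrier (CT (tau X))" "t = Ce X t0" by (rule Ce_cases[OF o t])
  show ?thesis
    unfolding t0(2) theta_der_Ce[OF o t0(1)]
      Heta_natural[OF tau_obj[OF o] o e klinearD(2)[OF theta_lift_linear[OF tt] t0(1)]] Heta_theta_lift[OF tt t0(1)]
    by (rule Th_natural[OF tt X e t0(1)])
qed

text \<open>The inclusion of the truncation is bijective on the tensor product of cohomologies, so naturality
  along it reduces the claim to truncated pairs, where \<open>Heta\<close> is injective.\<close>

lemma theta_der_unique:
  assumes closed: "\<And>X t. \<lbrakk>obj X; coh_concentrated_le i0 (fst X); coh_concentrated_le j0 (snd X); t \<in> carrier (CT X)\<rbrakk> \<Longrightarrow> th X t \<in> HL X"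
    and nat: "\<And>X Y \<phi> t. \<lbrakk>obj X; coh_concentrated_le i0 (fst X); coh_concentrated_le j0 (snd X);
      obj Y; coh_concentrated_le i0 (fst Y); coh_concentrated_le j0 (snd Y); \<phi> \<in> Mor DD X Y; t \<in> carrier (CT X)\<rbrakk> \<Longrightarrow>
      HLm X Y \<phi> (th X t) = th Y (CTm X Y \<phi> t)"
    and theta: "\<And>X t. \<lbrakk>top_obj X; t \<in> carrier (CT X)\<rbrakk> \<Longrightarrow> Heta X (th X t) = Th X t"
    and X: "obj X" "coh_concentrated_le i0 (fst X)" "coh_concentrated_le j0 (snd X)" and t: "t \<in> carrier (CT X)"
  shows "th X t = theta_der X t"
proof -
  note tt = tau_top[OF X(1)] and ot = tau_obj[OF X(1)] and ct = top_coh[OF tau_top[OF X(1)]] and q = Qe_Mor[OF X(1)]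
  obtain t0 where t0: "t0 \<in> carrier (CT (tau X))" "t = Ce X t0" by (rule Ce_cases[OF X(1) t])
  have "th (tau X) t0 = theta_der (tau X) t0"
    by (rule Heta_inj[OF tt]) (use closed[OF ot _ _ t0(1)] ct klinearD(2)[OF theta_der_linear[OF ot] t0(1)]
        theta[OF tt t0(1)] theta_der_theta[OF tt t0(1)] in simp_all)
  then show ?thesis
    using nat[OF ot _ _ X q t0(1)] ct theta_der_natural[OF q] t0 by simp
qed

lemma coh_tensor_CT: "obj X \<Longrightarrow> coh_tensor A s i0 j0 (fst X) (snd X) = mk_module (CT X) (CS X)"
  by (rule tensor_pair.coh_tensor_eq[OF pairI])

end

theorem theorem7:
  fixes K :: "'k ring" and A :: "'a dg_ring" and s :: "'k \<Rightarrow> 'a" and i0 j0 :: int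
    and L :: "(('a, 'u) dg_module \<times> ('a, 'u) dg_module, ('a, 'u) der_mor \<times> ('a, 'u) der_mor,
               ('k, ('u, 'u) tensor_elem) dg_module, ('k, ('u, 'u) tensor_elem) der_mor) functr"
    and \<eta> :: "('a, 'u) dg_module \<times> ('a, 'u) dg_module \<Rightarrow> ('k, ('u, 'u) tensor_elem) der_mor"
  assumes "central_dg_ring K A s"
    and "concentrated_le 0 A"
    and "infinite (UNIV :: 'u set)"
    and "carrier K \<lesssim> (UNIV :: 'u set)"
    and "\<And>i. carrier (gr A i) \<lesssim> (UNIV :: 'u set)"
    and "left_derived_tensor K A s L \<eta>"
  shows "\<exists>!\<theta>.
    \<theta> \<in> (\<Pi>\<^sub>E (M, N) \<in> der_le (op_dg_ring A) i0 \<times> der_le A j0.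
            module_isos K (coh_tensor A s i0 j0 M N) (coh_module (fob L (M, N)) (i0 + j0))) \<and>
    (\<forall>M \<in> der_le (op_dg_ring A) i0. \<forall>M' \<in> der_le (op_dg_ring A) i0.
     \<forall>N \<in> der_le A j0. \<forall>N' \<in> der_le A j0.
     \<forall>\<phi> \<in> Mor (der_cat (op_dg_ring A)) M M'. \<forall>\<psi> \<in> Mor (der_cat A) N N'.
       compose (carrier (coh_tensor A s i0 j0 M N))
         (der_coh_map (i0 + j0) (fob L (M, N)) (fmor L (M, N) (M', N') (\<phi>, \<psi>))) (\<theta> (M, N)) =
       compose (carrier (coh_tensor A s i0 j0 M N))
         (\<theta> (M', N'))
         (coh_tensor_map A i0 j0 M N M' N' (der_coh_map i0 M \<phi>) (der_coh_map j0 N \<psi>))) \<and>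
    (\<forall>M \<in> strict_le (op_dg_ring A) i0. \<forall>N \<in> strict_le A j0.
       compose (carrier (coh_tensor A s i0 j0 M N))
         (der_coh_map (i0 + j0) (fob L (M, N)) (\<eta> (M, N))) (\<theta> (M, N)) =
       theta K A s i0 j0 M N)"
proof -
  interpret derived_tensor K A s i0 j0 L \<eta>
    by (intro derived_tensor.intro derived_tensor_axioms.intro) fact+
  let ?DL = "der_le (op_dg_ring A) i0 \<times> der_le A j0 :: (('a, 'u) dg_module \<times> ('a, 'u) dg_module) set"
  have DL: "X \<in> ?DL \<longleftrightarrow> obj X \<and> coh_concentrated_le i0 (fst X) \<and> coh_concentrated_le j0 (snd X)" for X
    by (cases X) (auto simp: der_le_def obj_def)
  have SL: "M \<in> strict_le (op_dg_ring A) i0 \<and> N \<in> strict_le A j0 \<longleftrightarrow> top_obj (M, N)" for M N :: "('a, 'u) dg_module"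
    by (auto simp: strict_le_def top_obj_def obj_def)
  have SD: "top_obj X \<Longrightarrow> X \<in> ?DL" for X using DL top_coh top_obj_obj by blast
  have ct: "carrier (coh_tensor A s i0 j0 M N) = carrier (CT (M, N))" if "obj (M, N)" for M N
    using coh_tensor_CT[OF that] by simp
  have isos: "f \<in> module_isos K (coh_tensor A s i0 j0 M N) (coh_module (fob L (M, N)) (i0 + j0)) \<longleftrightarrow>
      f \<in> extensional (carrier (CT (M, N))) \<and>
      klinear K (CT (M, N)) (CS (M, N)) (coh (fob L (M, N)) pp) (coh_op (fob L (M, N)) pp) f \<and>
      bij_betw f (carrier (CT (M, N))) (HL (M, N))" if "obj (M, N)" for f M N
    using coh_tensor_CT[OF that] by (simp add: coh_module_eq module_isos_iff)
  have HLm: "der_coh_map (i0 + j0) (fob L X) (fmor L X Y \<phi>) = HLm X Y \<phi>" for X Y \<phi> by (simp add: df.HLm_def)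
  have Heta: "der_coh_map (i0 + j0) (fob L X) (\<eta> X) = Heta X" for X by (simp add: df.Heta_def)
  have CTm: "coh_tensor_map A i0 j0 M N M' N' (der_coh_map i0 M \<phi>) (der_coh_map j0 N \<psi>) = CTm (M, N) (M', N') (\<phi>, \<psi>)"
    for M N M' N' \<phi> \<psi> by (simp add: CTm_def)
  \<comment> \<open>undefined outside the bounded pairs and outside the carriers, as extensionality demands\<close>
  define \<theta>0 where "\<theta>0 = (\<lambda>X\<in>?DL. restrict (theta_der X) (carrier (CT X)))"
  have \<theta>0: "\<theta>0 X t = theta_der X t" if "X \<in> ?DL" "t \<in> carrier (CT X)" for X t
    using that unfolding \<theta>0_def by simp
  show ?thesis
  proof (rule ex1I[of _ \<theta>0], intro conjI)
    show "\<theta>0 \<in> (\<Pi>\<^sub>E (M, N) \<in> ?DL. module_isos K (coh_tensor A s i0 j0 M N) (coh_module (fob L (M, N)) (i0 + j0)))"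
    proof (rule PiE_I)
      fix X assume X: "X \<in> ?DL"
      then have o: "obj X" "coh_concentrated_le i0 (fst X)" "coh_concentrated_le j0 (snd X)" using DL by auto
      interpret k: kmodule K "CT X" "CS X" by (rule CT_kmodule[OF o(1)])
      have "klinear K (CT X) (CS X) (coh (fob L X) pp) (coh_op (fob L X) pp) (restrict (theta_der X) (carrier (CT X)))"
        using klinearD[OF theta_der_linear[OF o(1)]] k.sc_closed by (auto simp: klinear_def hom_def)
      moreover have "bij_betw (restrict (theta_der X) (carrier (CT X))) (carrier (CT X)) (HL X)"
        using theta_der_bij[OF o] by (simp cong: bij_betw_cong)
      ultimately show "\<theta>0 X \<in> (case X of (M, N) \<Rightarrow> module_isos K (coh_tensor A s i0 j0 M N) (coh_module (fob L (M, N)) (i0 + j0)))"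
        using X o(1) isos[of "fst X" "snd X"] by (cases X) (simp add: \<theta>0_def)
    qed (simp add: \<theta>0_def)
  next
    show "\<forall>M \<in> der_le (op_dg_ring A) i0. \<forall>M' \<in> der_le (op_dg_ring A) i0. \<forall>N \<in> der_le A j0. \<forall>N' \<in> der_le A j0.
     \<forall>\<phi> \<in> Mor (der_cat (op_dg_ring A)) M M'. \<forall>\<psi> \<in> Mor (der_cat A) N N'.
       compose (carrier (coh_tensor A s i0 j0 M N))
         (der_coh_map (i0 + j0) (fob L (M, N)) (fmor L (M, N) (M', N') (\<phi>, \<psi>))) (\<theta>0 (M, N)) =
       compose (carrier (coh_tensor A s i0 j0 M N)) (\<theta>0 (M', N'))
         (coh_tensor_map A i0 j0 M N M' N' (der_coh_map i0 M \<phi>) (der_coh_map j0 N \<psi>))"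
    proof (intro ballI)
      fix M M' N N' :: "('a, 'u) dg_module" and \<phi> \<psi>
      assume a: "M \<in> der_le (op_dg_ring A) i0" "M' \<in> der_le (op_dg_ring A) i0" "N \<in> der_le A j0" "N' \<in> der_le A j0"
        "\<phi> \<in> Mor (der_cat (op_dg_ring A)) M M'" "\<psi> \<in> Mor (der_cat A) N N'"
      have X: "(M, N) \<in> ?DL" "(M', N') \<in> ?DL" and q: "(\<phi>, \<psi>) \<in> Mor DD (M, N) (M', N')" using a by auto
      have o: "obj (M, N)" using X DL by blast
      show "compose (carrier (coh_tensor A s i0 j0 M N))
         (der_coh_map (i0 + j0) (fob L (M, N)) (fmor L (M, N) (M', N') (\<phi>, \<psi>))) (\<theta>0 (M, N)) =
       compose (carrier (coh_tensor A s i0 j0 M N)) (\<theta>0 (M', N'))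
         (coh_tensor_map A i0 j0 M N M' N' (der_coh_map i0 M \<phi>) (der_coh_map j0 N \<psi>))"
        unfolding HLm CTm ct[OF o]
        by (rule extensionalityI[OF compose_extensional compose_extensional])
          (use theta_der_natural[OF q] CTm_closed[OF q] \<theta>0[OF X(1)] \<theta>0[OF X(2)] in \<open>simp add: compose_eq\<close>)
    qed
  next
    show "\<forall>M \<in> strict_le (op_dg_ring A) i0. \<forall>N \<in> strict_le A j0.
       compose (carrier (coh_tensor A s i0 j0 M N)) (der_coh_map (i0 + j0) (fob L (M, N)) (\<eta> (M, N))) (\<theta>0 (M, N)) =
       theta K A s i0 j0 M N"
    proof (intro ballI)
      fix M N :: "('a, 'u) dg_module"
      assume "M \<in> strict_le (op_dg_ring A) i0" "N \<in> strict_le A j0"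
      then have X: "top_obj (M, N)" using SL by blast
      show "compose (carrier (coh_tensor A s i0 j0 M N)) (der_coh_map (i0 + j0) (fob L (M, N)) (\<eta> (M, N))) (\<theta>0 (M, N)) =
       theta K A s i0 j0 M N"
        unfolding Heta ct[OF top_obj_obj[OF X]]
      proof (rule extensionalityI[OF compose_extensional])
        show "theta K A s i0 j0 M N \<in> extensional (carrier (CT (M, N)))"
          using Th_spec(1)[OF X] by simp
        fix t assume "t \<in> carrier (CT (M, N))"
        then show "compose (carrier (CT (M, N))) (Heta (M, N)) (\<theta>0 (M, N)) t = theta K A s i0 j0 M N t"
          using theta_der_theta[OF X] \<theta>0[OF SD[OF X]] by (simp add: compose_eq)
      qed
    qed
  next
    fix \<theta>
    assume H: "\<theta> \<in> (\<Pi>\<^sub>E (M, N) \<in> ?DL. module_isos K (coh_tensor A s i0 j0 M N) (coh_module (fob L (M, N)) (i0 + j0))) \<and>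
      (\<forall>M \<in> der_le (op_dg_ring A) i0. \<forall>M' \<in> der_le (op_dg_ring A) i0. \<forall>N \<in> der_le A j0. \<forall>N' \<in> der_le A j0.
       \<forall>\<phi> \<in> Mor (der_cat (op_dg_ring A)) M M'. \<forall>\<psi> \<in> Mor (der_cat A) N N'.
         compose (carrier (coh_tensor A s i0 j0 M N))
           (der_coh_map (i0 + j0) (fob L (M, N)) (fmor L (M, N) (M', N') (\<phi>, \<psi>))) (\<theta> (M, N)) =
         compose (carrier (coh_tensor A s i0 j0 M N)) (\<theta> (M', N'))
           (coh_tensor_map A i0 j0 M N M' N' (der_coh_map i0 M \<phi>) (der_coh_map j0 N \<psi>))) \<and>
      (\<forall>M \<in> strict_le (op_dg_ring A) i0. \<forall>N \<in> strict_le A j0.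
         compose (carrier (coh_tensor A s i0 j0 M N)) (der_coh_map (i0 + j0) (fob L (M, N)) (\<eta> (M, N))) (\<theta> (M, N)) =
         theta K A s i0 j0 M N)"
    note H1 = conjunct1[OF H] and H2 = conjunct1[OF conjunct2[OF H]] and H3 = conjunct2[OF conjunct2[OF H]]
    have iso: "\<theta> X \<in> extensional (carrier (CT X))" "t \<in> carrier (CT X) \<Longrightarrow> \<theta> X t \<in> HL X" if X: "X \<in> ?DL" for X t
    proof -
      have o: "obj (fst X, snd X)" using X DL by simp
      have "\<theta> (fst X, snd X) \<in> module_isos K (coh_tensor A s i0 j0 (fst X) (snd X)) (coh_module (fob L (fst X, snd X)) (i0 + j0))"
        using PiE_mem[OF H1 X] by (simp add: split_beta)
      then show "\<theta> X \<in> extensional (carrier (CT X))" "t \<in> carrier (CT X) \<Longrightarrow> \<theta> X t \<in> HL X"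
        unfolding isos[OF o] by (auto simp: bij_betw_def)
    qed
    have "\<theta> X t = theta_der X t" if X: "X \<in> ?DL" and t: "t \<in> carrier (CT X)" for X t
    proof (rule theta_der_unique)
      show "\<theta> Y t \<in> HL Y" if "obj Y" "coh_concentrated_le i0 (fst Y)" "coh_concentrated_le j0 (snd Y)" "t \<in> carrier (CT Y)" for Y t
        using iso(2)[of Y t] that DL by blast
      show "HLm Y Z \<phi> (\<theta> Y t) = \<theta> Z (CTm Y Z \<phi> t)"
        if "obj Y" "coh_concentrated_le i0 (fst Y)" "coh_concentrated_le j0 (snd Y)"
          "obj Z" "coh_concentrated_le i0 (fst Z)" "coh_concentrated_le j0 (snd Z)" and q: "\<phi> \<in> Mor DD Y Z" and t: "t \<in> carrier (CT Y)"
        for Y Z \<phi> t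
      proof -
        have YZ: "Y \<in> ?DL" "Z \<in> ?DL" using that DL by blast+
        obtain M N M' N' f g where e: "Y = (M, N)" "Z = (M', N')" "\<phi> = (f, g)" by (metis surj_pair)
        have "compose (carrier (CT Y)) (HLm Y Z \<phi>) (\<theta> Y) = compose (carrier (CT Y)) (\<theta> Z) (CTm Y Z \<phi>)"
          using H2[rule_format, of M M' N N' f g] YZ q ct[of M N] \<open>obj Y\<close> by (simp add: e HLm CTm)
        from fun_cong[OF this, of t] show ?thesis using t by (simp add: compose_eq)
      qed
      show "Heta Y (\<theta> Y t) = Th Y t" if Y: "top_obj Y" and t: "t \<in> carrier (CT Y)" for Y t
      proof -
        obtain M N where e: "Y = (M, N)" by (metis surj_pair)
        have "compose (carrier (CT Y)) (Heta Y) (\<theta> Y) = Th Y"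
          using H3[rule_format, of M N] SL[of M N] Y ct[of M N] top_obj_obj[OF Y] by (simp add: e Heta)
        from fun_cong[OF this, of t] show ?thesis using t by (simp add: compose_eq)
      qed
    qed (use X t DL in auto)
    then have pt: "\<theta> X = \<theta>0 X" if X: "X \<in> ?DL" for X
      by (intro extensionalityI[OF iso(1)[OF X]]) (use X in \<open>simp_all add: \<theta>0_def\<close>)
    show "\<theta> = \<theta>0"
      by (rule extensionalityI[of _ ?DL]) (use H1 pt in \<open>auto simp: PiE_def \<theta>0_def\<close>)
  qed
qed

end
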